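(* Every bounded polynomially integrable planar billiard $\Omega\subset\mathbb{R}^2$ with a $C^2$-smooth connected boundary is an ellipse (that is, $\partial\Omega$ is an ellipse).
   Context: The plane $\mathbb{R}^2$ carries the standard Euclidean metric. A billiard is a connected domain $\Omega\subset\mathbb{R}^2$. The billiard flow acts on $T\mathbb{R}^2|_\Omega$: a point $(Q,P)$, $Q\in\Omega$, $P\in T_Q\mathbb{R}^2$, moves along the straight line with constant velocity $P$ until $Q$ hits $\partial\Omega$; then $Q$ is unchanged and $P$ is replaced by its reflection $P^*$ from the tangent line to $\partial\Omega$ (angle of incidence equals angle of reflection, $|P^*|=|P|$); then the motion continues in the same way. The billiard $\Omega$ is polynomially integrable if its flow has a first integral on $T\mathbb{R}^2|_\Omega$ (invariant under the free motion in $\Omega$ and under the reflections from the boundary) that is a polynomial in the velocity $P$ and whose restriction to the hypersurface $\{|P|=1\}$ is non-constant. *)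

theory Defs
  imports "HOL-Analysis.Analysis"
begin

text \<open>A domain is a nonempty connected open set; the boundary is its topological frontier.\<close>

definition billiard :: "(real^2) set \<Rightarrow> bool" where
  "billiard \<Omega> \<longleftrightarrow> open \<Omega> \<and> connected \<Omega> \<and> \<Omega> \<noteq> {}"

text \<open>
  A \<open>C\<^sup>2\<close>-smooth curve, in the sense of an embedded one-dimensional submanifold without
  boundary: near each of its points it is homeomorphically parametrised by an open interval, with
  a \<open>C\<^sup>2\<close> parametrisation whose velocity \<open>D\<close> never vanishes. No injectivity or connectedness
  is imposed globally. Taking the interval to be \<open>(-1,1)\<close> is no restriction, by affine
  reparametrisation.
\<close>

definition C2_smooth_curve :: "(real^2) set \<Rightarrow> bool" where
  "C2_smooth_curve S \<longleftrightarrow>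
     (\<forall>p\<in>S. \<exists>U \<gamma> D g.
        open U \<and> p \<in> U \<and>
        homeomorphism {-1<..<1::real} (S \<inter> U) \<gamma> g \<and>
        (\<forall>t\<in>{-1<..<1}. (\<gamma> has_vector_derivative D t) (at t) \<and> D t \<noteq> 0) \<and>
        D C1_differentiable_on {-1<..<1})"

text \<open>
  Velocities at \<open>p\<close> of curves in \<open>S\<close> through \<open>p\<close>. For a \<open>C\<^sup>2\<close>-smooth curve \<open>S\<close> these form the
  (one-dimensional) tangent line of \<open>S\<close> at \<open>p\<close>, including the zero vector.
\<close>

definition tangent_vector :: "(real^2) set \<Rightarrow> real^2 \<Rightarrow> real^2 \<Rightarrow> bool" where
  "tangent_vector S p v \<longleftrightarrow>
     (\<exists>\<gamma>::real \<Rightarrow> real^2. \<gamma> 0 = p \<and> (\<forall>\<^sub>F t in nhds 0. \<gamma> t \<in> S) \<and>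
        (\<gamma> has_vector_derivative v) (at 0))"

text \<open>The orthogonal reflection in the line spanned by a nonzero vector \<open>\<tau>\<close>.\<close>

definition line_reflection :: "real^2 \<Rightarrow> real^2 \<Rightarrow> real^2" where
  "line_reflection \<tau> P = (2 * (P \<bullet> \<tau>) / (\<tau> \<bullet> \<tau>)) *\<^sub>R \<tau> - P"

text \<open>\<open>P'\<close> is the reflection of the velocity \<open>P\<close> from the tangent line to \<open>S\<close> at \<open>Q\<close>.\<close>

definition reflected_velocity :: "(real^2) set \<Rightarrow> real^2 \<Rightarrow> real^2 \<Rightarrow> real^2 \<Rightarrow> bool" where
  "reflected_velocity S Q P P' \<longleftrightarrow>
     (\<exists>\<tau>. tangent_vector S Q \<tau> \<and> \<tau> \<noteq> 0 \<and> P' = line_reflection \<tau> P)"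

text \<open>
  \<open>billiard_flow \<Omega> t x y\<close>: the billiard flow carries the phase point \<open>x = (Q, P)\<close> to \<open>y\<close> in time
  \<open>t\<close>. The flow is a partial one: a trajectory is followed as long as it can be continued by
  the rules. Both \<open>x\<close> and \<open>y\<close> lie over the open set \<open>\<Omega>\<close>; the boundary point \<open>Q'\<close>, where the
  velocity jumps from \<open>P\<close> to \<open>P'\<close>, is passed through inside the rule \<open>bounce\<close>. In this
  way a first integral is a function over \<open>\<Omega>\<close> only, and no extension of it to the boundary has
  to be chosen.
\<close>

inductive billiard_flow ::
    "(real^2) set \<Rightarrow> real \<Rightarrow> (real^2) \<times> (real^2) \<Rightarrow> (real^2) \<times> (real^2) \<Rightarrow> bool"
  for \<Omega> :: "(real^2) set"
where
  free:
    "\<lbrakk>0 \<le> t; \<forall>s\<in>{0..t}. Q + s *\<^sub>R P \<in> \<Omega>\<rbrakk>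
     \<Longrightarrow> billiard_flow \<Omega> t (Q, P) (Q + t *\<^sub>R P, P)"
| bounce:
    "\<lbrakk>0 < T; \<forall>s\<in>{0..<T}. Q + s *\<^sub>R P \<in> \<Omega>;
      Q' = Q + T *\<^sub>R P; Q' \<in> frontier \<Omega>; reflected_velocity (frontier \<Omega>) Q' P P';
      0 < t; \<forall>s\<in>{0<..t}. Q' + s *\<^sub>R P' \<in> \<Omega>\<rbrakk>
     \<Longrightarrow> billiard_flow \<Omega> (T + t) (Q, P) (Q' + t *\<^sub>R P', P')"
| trans:
    "\<lbrakk>billiard_flow \<Omega> t x y; billiard_flow \<Omega> t' y z\<rbrakk> \<Longrightarrow> billiard_flow \<Omega> (t + t') x z"

definition first_integral :: "(real^2) set \<Rightarrow> ((real^2) \<times> (real^2) \<Rightarrow> real) \<Rightarrow> bool" where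
  "first_integral \<Omega> \<Phi> \<longleftrightarrow> (\<forall>t x y. billiard_flow \<Omega> t x y \<longrightarrow> \<Phi> y = \<Phi> x)"

text \<open>
  A polynomial in the velocity of total degree at most some \<open>n\<close>, not necessarily homogeneous,
  whose coefficients are functions of the position. No regularity of the coefficients is required.
\<close>

definition polynomial_in_velocity ::
    "(real^2) set \<Rightarrow> ((real^2) \<times> (real^2) \<Rightarrow> real) \<Rightarrow> bool" where
  "polynomial_in_velocity \<Omega> \<Phi> \<longleftrightarrow>
     (\<exists>(n::nat) (a :: nat \<Rightarrow> nat \<Rightarrow> real^2 \<Rightarrow> real). \<forall>Q\<in>\<Omega>. \<forall>P.
        \<Phi> (Q, P) = (\<Sum>i\<le>n. \<Sum>j\<le>n - i. a i j Q * (P $ 1) ^ i * (P $ 2) ^ j))"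

definition polynomially_integrable :: "(real^2) set \<Rightarrow> bool" where
  "polynomially_integrable \<Omega> \<longleftrightarrow>
     (\<exists>\<Phi>. first_integral \<Omega> \<Phi> \<and> polynomial_in_velocity \<Omega> \<Phi> \<and>
        \<not> \<Phi> constant_on (\<Omega> \<times> sphere 0 1))"

text \<open>
  The canonical equation in an orthonormal frame \<open>u, v\<close> centred at \<open>c\<close>. Circles
  (\<open>a = b\<close>) are ellipses.
\<close>

definition is_ellipse :: "(real^2) set \<Rightarrow> bool" where
  "is_ellipse E \<longleftrightarrow>
     (\<exists>c u v a b. norm u = 1 \<and> norm v = 1 \<and> u \<bullet> v = 0 \<and> 0 < a \<and> 0 < b \<and>
        E = {Q. (((Q - c) \<bullet> u) / a)\<^sup>2 + (((Q - c) \<bullet> v) / b)\<^sup>2 = 1})"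

end

theory Submission
  imports Defs "HOL-Complex_Analysis.Complex_Analysis" "HOL-Computational_Algebra.Fundamental_Theorem_Algebra"
begin

text \<open>Identify the plane with the complex numbers. Along a line, a homogeneous component of degree \<open>n\<close>
  of the integral is a homogeneous polynomial in \<open>P\<close>, \<open>cnj P\<close> and the moment
  \<open>Q * cnj P - cnj Q * P\<close>; split off powers of \<open>P * cnj P\<close> until some terms are free of \<open>P\<close>. At a
  boundary point \<open>p\<close> with unit tangent \<open>T\<close>, invariance under reflection turns the lowest two
  coefficients into the real numbers \<open>R(p) / T^n\<close> and \<open>(R1(p) - cnj p * R'(p)) / T^(n-2)\<close> with
  complex polynomials \<open>R \<noteq> 0\<close> of degree at most \<open>n\<close> and \<open>R1\<close>.

  The boundary contains a simple closed curve. Comparing the argument of \<open>R\<close> along it with the turning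
  of its tangent shows that \<open>R\<close> has degree exactly \<open>n\<close> and all its roots lie inside. The equation
  \<open>A'^n = R(A)\<close> (with \<open>R\<close> made monic) has a solution \<open>A(x) ~ exp x\<close> of period \<open>2 * pi * i\<close> near
  \<open>Re x = \<infinity>\<close>, which extends to a maximal right half-plane \<open>h0 < Re x\<close>. By the first reality
  condition the boundary is a straight line in the coordinate \<open>x\<close>, hence the image of a line
  \<open>Re x = h\<close>.

  Unless \<open>R\<close> has only one root, in which case the boundary is a circle, \<open>A\<close> runs into a root of \<open>R\<close>
  on the line \<open>Re x = h0\<close>. The second reality condition, continued by Schwarz reflection, forces
  \<open>A\<close> to be single valued at this point and symmetric about it; so \<open>A\<close> is entire, \<open>A'' - A\<close> is
  bounded, and \<open>A(x) = c + \<alpha> exp x + \<beta> exp (-x)\<close>, which maps vertical lines to ellipses.\<close>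

subsection \<open>Analytic continuation of solutions of an autonomous equation\<close>

text \<open>Write the tangent as \<open>T = A' * W'\<close> for a curve \<open>W\<close> in the
  \<open>x\<close>-plane. That \<open>R(p) / T ^ n\<close> is real then says that
  \<open>W' ^ n\<close> has constant argument modulo pi, which leaves finitely many directions.
  Compactness of the boundary excludes every slanted line, since one of its rays runs to the right,
  where \<open>A\<close> is unbounded.

  The obstacle is that \<open>A\<close> is in general ramified where it meets a root. At a root of
  multiplicity \<open>k\<close> the equation makes \<open>A - z\<close> comparable to
  \<open>(x - w) ^ (n / (n - k))\<close>, which is single valued only if \<open>n - k\<close>
  divides \<open>n\<close>. The second condition contains the antiholomorphic term
  \<open>cnj p\<close>; reflection in the line \<open>Re x = h\<close> turns it into a holomorphic
  function with nonzero derivative at the branch point, and a comparison of exponents yields the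
  divisibility.

  The count of arguments comes first for two reasons: degree exactly \<open>n\<close> is what makes
  \<open>A\<close> asymptotic to \<open>exp x\<close>, and roots inside the curve guarantee that the
  image of \<open>A\<close> meets the boundary.\<close>

lemma fps_nth_compose_X_power:
  fixes f :: "complex fps"
  assumes "n > 0"
  shows "fps_nth (f oo fps_X ^ n) j = (if n dvd j then fps_nth f (j div n) else 0)"
proof -
  have "fps_nth (f oo fps_X ^ n) j = (\<Sum>i=0..j. fps_nth f i * (if n * i = j then 1 else 0))"
    unfolding fps_compose_nth
    by (intro sum.cong refl) (auto simp: power_mult [symmetric] fps_X_power_nth)
  also have "\<dots> = (if n dvd j then fps_nth f (j div n) else 0)"
  proof (cases "n dvd j")
    case True
    then obtain i where i: "j = n * i" by auto
    have "(\<Sum>l=0..j. fps_nth f l * (if n * l = j then 1 else 0)) = (\<Sum>l\<in>{i}. fps_nth f l)"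
      using assms by (intro sum.mono_neutral_cong_right) (auto simp: i)
    with True i assms show ?thesis by simp
  qed (auto intro!: sum.neutral)
  finally show ?thesis .
qed

lemma fps_power_support:
  fixes G :: "complex fps"
  assumes G: "\<And>j. fps_nth G j \<noteq> 0 \<Longrightarrow> \<exists>t. j = N + n * t"
  shows "fps_nth (G ^ i) j \<noteq> 0 \<Longrightarrow> \<exists>t. j = i * N + n * t"
proof (induction i arbitrary: j)
  case 0
  then show ?case by (auto split: if_splits)
next
  case (Suc i)
  then obtain l where l: "l \<le> j" "fps_nth G l \<noteq> 0" "fps_nth (G ^ i) (j - l) \<noteq> 0"
    by (auto simp: fps_mult_nth elim: sum.not_neutral_contains_not_neutral)
  from G [OF l(2)] Suc.IH [OF l(3)] obtain t u where "l = N + n * t" "j - l = i * N + n * u"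
    by auto
  with l(1) have "j = Suc i * N + n * (t + u)" by (simp add: algebra_simps)
  then show ?case by blast
qed

text \<open>Comparing the coefficients of \<open>X ^ (k * (n - 1))\<close>: on the left only \<open>\<beta>\<close> contributes, and on the
  right this exponent occurs only if \<open>n - k\<close> divides \<open>k\<close>.\<close>

lemma fps_exponent_dvd:
  fixes p \<rho> \<mu> \<beta> c d G :: "complex fps"
  assumes k: "0 < k" "k < n" and n: "n \<ge> 2" and N: "N = n - k"
    and \<beta>: "fps_nth \<beta> 0 = 0" "fps_nth \<beta> 1 \<noteq> 0" and \<rho>: "fps_nth \<rho> 0 \<noteq> 0"
    and G: "\<And>j. fps_nth G j \<noteq> 0 \<Longrightarrow> \<exists>t. j = N + n * t" and GN: "fps_nth G N \<noteq> 0"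
    and eq: "(p oo fps_X ^ n) - (\<beta> oo G) * fps_X ^ (n * (k - 1)) * (\<rho> oo fps_X ^ n) =
       fps_X ^ (k * (n - 2)) * (\<mu> oo fps_X ^ n) * ((c oo G) + fps_X ^ n * (d oo G))"
  shows "N dvd n"
proof (rule ccontr)
  assume nd: "\<not> N dvd n"
  note supp = fps_power_support [of G N n, OF G]
  have n0: "n > 0" and Nn: "N < n" "N > 0" using k N by auto
  define e where "e = k * (n - 1)"
  obtain k' n' where k': "k = Suc k'" and n': "n = Suc (Suc n')"
    using k n by (metis Suc_pred less_eqE nat_less_le numeral_2_eq_2 plus_nat.simps not_less_eq zero_less_iff_neq_zero Suc_diff_Suc add_Suc)
  \<comment> \<open>The exponent \<open>e\<close> in two ways: after the factor
    \<open>fps_X ^ (n * (k - 1))\<close> on the left there remains \<open>N\<close>, after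
    \<open>fps_X ^ (k * (n - 2))\<close> on the right there remains \<open>k\<close>.\<close>
  have e1: "e = n * (k - 1) + N" and e2: "e = k * (n - 2) + k"
    using k(2) N unfolding e_def k' n' by (auto simp: algebra_simps)
  \<comment> \<open>So \<open>p oo fps_X ^ n\<close> has no term of exponent
    \<open>e\<close>.\<close>
  have "\<not> n dvd e"
  proof
    assume "n dvd e"
    moreover have "coprime n (n - 1)" by (simp add: n' coprime_Suc_left_nat)
    ultimately have "n dvd k" unfolding e_def by (simp add: coprime_dvd_mult_left_iff)
    then show False using k by (auto dest: dvd_imp_le)
  qed
  then have c1: "fps_nth (p oo fps_X ^ n) e = 0"
    by (simp add: fps_nth_compose_X_power n0)
  \<comment> \<open>\<open>G\<close> starts at exponent \<open>N > 0\<close>, so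
    \<open>G ^ i\<close> with \<open>i \<ge> 2\<close> starts beyond \<open>N\<close>; only the
    linear term of \<beta> reaches exponent \<open>N\<close>.\<close>
  have "fps_nth (\<beta> oo G) N = (\<Sum>i\<in>{1}. fps_nth \<beta> i * fps_nth (G ^ i) N)"
    unfolding fps_compose_nth
  proof (intro sum.mono_neutral_right ballI)
    fix i assume i: "i \<in> {0..N} - {1}"
    show "fps_nth \<beta> i * fps_nth (G ^ i) N = 0"
    proof (rule ccontr)
      assume "\<not> ?thesis"
      then have "i \<noteq> 0" "fps_nth (G ^ i) N \<noteq> 0" using \<beta>(1) by (auto intro: ccontr)
      with supp obtain t where "N = i * N + n * t" by blast
      then have "i * N \<le> N" by linarith
      moreover have "2 * N \<le> i * N" using \<open>i \<noteq> 0\<close> i by (intro mult_right_mono) auto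
      ultimately show False using Nn by linarith
    qed
  qed (use Nn in auto)
  then have \<beta>N: "fps_nth (\<beta> oo G) N \<noteq> 0" using \<beta> GN by simp
  have "fps_nth ((\<beta> oo G) * (\<rho> oo fps_X ^ n)) N = (\<Sum>i\<in>{N}. fps_nth (\<beta> oo G) i * fps_nth (\<rho> oo fps_X ^ n) (N - i))"
    unfolding fps_mult_nth
    by (intro sum.mono_neutral_right) (use Nn in \<open>auto simp: fps_nth_compose_X_power dest: dvd_imp_le\<close>)
  then have "fps_nth ((\<beta> oo G) * (\<rho> oo fps_X ^ n)) N \<noteq> 0"
    using \<beta>N \<rho> n0 by (simp add: fps_nth_compose_X_power)
  moreover have "(\<beta> oo G) * fps_X ^ (n * (k - 1)) * (\<rho> oo fps_X ^ n) =
      fps_X ^ (n * (k - 1)) * ((\<beta> oo G) * (\<rho> oo fps_X ^ n))"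
    by (simp add: algebra_simps)
  ultimately have c2: "fps_nth ((\<beta> oo G) * fps_X ^ (n * (k - 1)) * (\<rho> oo fps_X ^ n)) e \<noteq> 0"
    by (simp only: e1 mult.assoc fps_X_power_mult_nth) simp
  \<comment> \<open>A term \<open>G ^ i\<close> has exponents \<open>i * N + n * t\<close>. Since
    \<open>k < n\<close>, exponent \<open>k\<close> forces \<open>t = 0\<close>, hence
    \<open>N dvd k\<close>, and then \<open>N\<close> divides \<open>k + N = n\<close>.\<close>
  have cG: "fps_nth (c oo G) k = 0"
    unfolding fps_compose_nth
  proof (intro sum.neutral ballI)
    fix i assume "i \<in> {0..k}"
    show "fps_nth c i * fps_nth (G ^ i) k = 0"
    proof (rule ccontr)
      assume "\<not> ?thesis"
      then have "fps_nth (G ^ i) k \<noteq> 0" by auto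
      with supp obtain t where t: "k = i * N + n * t" by blast
      with k(2) have "t = 0" by (cases t) auto
      with t have "N dvd k" by simp
      moreover have "n = k + N" using k N by simp
      ultimately show False using nd by simp
    qed
  qed
  have cd: "fps_nth ((c oo G) + fps_X ^ n * (d oo G)) k = 0"
    using cG k by (simp add: fps_X_power_mult_nth)
  have "fps_nth ((\<mu> oo fps_X ^ n) * ((c oo G) + fps_X ^ n * (d oo G))) k =
      (\<Sum>i\<in>{}. fps_nth (\<mu> oo fps_X ^ n) i * fps_nth ((c oo G) + fps_X ^ n * (d oo G)) (k - i))"
    unfolding fps_mult_nth
  proof (intro sum.mono_neutral_right ballI)
    fix i assume i: "i \<in> {0..k} - {}"
    show "fps_nth (\<mu> oo fps_X ^ n) i * fps_nth ((c oo G) + fps_X ^ n * (d oo G)) (k - i) = 0"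
      using i k cd by (cases "i = 0") (auto simp: fps_nth_compose_X_power dest: dvd_imp_le simp del: fps_add_nth)
  qed auto
  then have c3: "fps_nth (fps_X ^ (k * (n - 2)) * (\<mu> oo fps_X ^ n) * ((c oo G) + fps_X ^ n * (d oo G))) e = 0"
    by (simp add: e2 mult.assoc fps_X_power_mult_nth)
  from arg_cong [OF eq, of "\<lambda>f. fps_nth f e"] c1 c2 c3 show False
    by simp
qed

text \<open>The quotient maps a connected set continuously into the finite set of
  \<open>n\<close>-th roots of unity. This turns an equation between \<open>n\<close>-th powers into
  one between the functions themselves.\<close>

lemma power_eq_imp_const_multiple:
  fixes f g :: "'a::topological_space \<Rightarrow> complex"
  assumes "connected S" "continuous_on S f" "continuous_on S g" "n > 0"
    and "\<And>x. x \<in> S \<Longrightarrow> g x \<noteq> 0" "\<And>x. x \<in> S \<Longrightarrow> f x ^ n = g x ^ n"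
  obtains c where "c ^ n = 1" "\<And>x. x \<in> S \<Longrightarrow> f x = c * g x"
proof (cases "S = {}")
  case False
  have "(\<lambda>x. f x / g x) ` S \<subseteq> {z. z ^ n = 1}"
    using assms by (auto simp: power_divide)
  then have "finite ((\<lambda>x. f x / g x) ` S)"
    using finite_roots_unity [of n] assms(4) finite_subset by (metis Suc_leI One_nat_def)
  then have "(\<lambda>x. f x / g x) constant_on S"
    using assms by (intro continuous_finite_range_constant continuous_intros) auto
  then obtain c where c: "\<And>x. x \<in> S \<Longrightarrow> f x / g x = c"
    by (auto simp: constant_on_def)
  from False obtain x where "x \<in> S" by blast
  then have "c ^ n = 1" using c [of x] assms by (auto simp: power_divide)
  moreover have "f x = c * g x" if "x \<in> S" for x
    using c [OF that] assms(5) [OF that] by (auto simp: field_simps)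
  ultimately show ?thesis using that by blast
qed (use that [of 1] in auto)

lemma holomorphic_nth_root:
  assumes "convex S" "open S" "f holomorphic_on S" "\<And>x. x \<in> S \<Longrightarrow> f x \<noteq> 0" "n > 0"
  obtains g where "g holomorphic_on S" "\<And>x. x \<in> S \<Longrightarrow> g x ^ n = f x"
proof (cases "S = {}")
  case False
  then obtain z where "z \<in> S" by blast
  obtain h where h: "h holomorphic_on S" "\<And>x. x \<in> S \<Longrightarrow> exp (h x) = f x"
    using holomorphic_logarithm_exists [OF assms(1-3)] assms(4) \<open>z \<in> S\<close> by metis
  show ?thesis
  proof (rule that [of "\<lambda>x. exp (h x / of_nat n)"])
    show "(\<lambda>x. exp (h x / of_nat n)) holomorphic_on S"
      using h(1) \<open>n > 0\<close> by (intro holomorphic_intros) auto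
    show "exp (h x / of_nat n) ^ n = f x" if "x \<in> S" for x
      using h(2) [OF that] \<open>n > 0\<close> by (simp flip: exp_of_nat_mult)
  qed
qed (use that [of "\<lambda>_. 0"] in auto)

lemma holomorphic_local_inverse:
  assumes "f holomorphic_on S" "open S" "z \<in> S" "deriv f z \<noteq> 0"
  obtains r g where "r > 0" "ball z r \<subseteq> S" "open (f ` ball z r)"
    "g holomorphic_on f ` ball z r" "\<And>x. x \<in> ball z r \<Longrightarrow> g (f x) = x"
proof (rule has_complex_derivative_locally_invertible [OF assms(1,3,2,4)])
  fix r assume r: "0 < r" "ball z r \<subseteq> S" "open (f ` ball z r)" "inj_on f (ball z r)"
  then have "f holomorphic_on ball z r" using assms(1) holomorphic_on_subset by blast
  from holomorphic_has_inverse [OF this open_ball r(4)]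
  obtain g where "g holomorphic_on f ` ball z r" "\<And>x. x \<in> ball z r \<Longrightarrow> g (f x) = x"
    by metis
  with r show thesis using that by metis
qed

section \<open>One-sided neighbourhoods of a boundary point\<close>

definition half_ball :: "complex \<Rightarrow> real \<Rightarrow> complex set" where
  "half_ball w r = ball w r \<inter> {z. Re w < Re z}"

lemma open_half_ball [intro]: "open (half_ball w r)"
  unfolding half_ball_def by (intro open_Int open_ball open_halfspace_Re_gt)

lemma convex_half_ball [intro]: "convex (half_ball w r)"
  unfolding half_ball_def by (intro convex_Int convex_ball convex_halfspace_Re_gt)

lemma half_ball_subset: "r \<le> s \<Longrightarrow> half_ball w r \<subseteq> half_ball w s"
  unfolding half_ball_def by auto

lemma half_ball_nonempty: "r > 0 \<Longrightarrow> half_ball w r \<noteq> {}"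
proof -
  assume "r > 0"
  then have "w + of_real (r/2) \<in> half_ball w r"
    by (auto simp: half_ball_def dist_norm)
  then show ?thesis by blast
qed

lemma islimpt_half_ball: "r > 0 \<Longrightarrow> w islimpt half_ball w r"
  unfolding islimpt_approachable
proof (intro allI impI)
  fix e :: real assume "r > 0" "e > 0"
  then have "w + of_real (min (r/2) (e/2)) \<in> half_ball w r" 
    by (auto simp: half_ball_def dist_norm)
  moreover have "w + of_real (min (r/2) (e/2)) \<noteq> w" "dist (w + of_real (min (r/2) (e/2))) w < e"
    using \<open>r > 0\<close> \<open>e > 0\<close> by (auto simp: dist_norm)
  ultimately show "\<exists>x'\<in>half_ball w r. x' \<noteq> w \<and> dist x' w < e" by blast
qed

lemma at_within_half_ball: "r > 0 \<Longrightarrow> s > 0 \<Longrightarrow> at w within half_ball w r = at w within half_ball w s"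
  by (rule at_within_nhd [of w "ball w (min r s)"]) (auto simp: half_ball_def)

lemma at_within_half_ball_neq_bot: "r > 0 \<Longrightarrow> at w within half_ball w r \<noteq> bot"
  using islimpt_half_ball trivial_limit_within by blast

text \<open>Separation of variables: the primitive \<Phi> of \<open>q\<close> measures the time that
  the flow needs from position 0, since \<open>\<Phi> (y z) - z\<close> has derivative zero. The
  limit of \<open>y\<close> at \<open>w\<close> determines the constant.\<close>

lemma primitive_along_flow:
  assumes "r > 0" "\<rho> > 0" "y holomorphic_on half_ball w r"
    and lim: "(y \<longlongrightarrow> 0) (at w within half_ball w r)"
    and q: "q holomorphic_on ball 0 \<rho>"
    and y: "\<And>z. z \<in> half_ball w r \<Longrightarrow> y z \<in> ball 0 \<rho> \<and> deriv y z * q (y z) = 1"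
  obtains \<Phi> where "\<Phi> 0 = 0" "\<And>z. z \<in> ball 0 \<rho> \<Longrightarrow> (\<Phi> has_field_derivative q z) (at z)"
    "\<And>z. z \<in> half_ball w r \<Longrightarrow> \<Phi> (y z) = z - w"
proof -
  obtain \<Phi>0 where \<Phi>0: "\<And>z. z \<in> ball 0 \<rho> \<Longrightarrow> (\<Phi>0 has_field_derivative q z) (at z)"
    using holomorphic_convex_primitive' [OF convex_ball open_ball q] 
    by (metis at_within_open open_ball)
  define \<Phi> where "\<Phi> = (\<lambda>z. \<Phi>0 z - \<Phi>0 0)"
  have \<Phi>: "(\<Phi> has_field_derivative q z) (at z)" if "z \<in> ball 0 \<rho>" for z
    unfolding \<Phi>_def using \<Phi>0 [OF that] by (auto intro!: derivative_eq_intros)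
  have [simp]: "\<Phi> 0 = 0" by (simp add: \<Phi>_def)
  have "((\<lambda>z. \<Phi> (y z) - z) has_field_derivative 0) (at z within half_ball w r)" if "z \<in> half_ball w r" for z
  proof -
    have "(y has_field_derivative deriv y z) (at z within half_ball w r)"
      using assms(3) that by (meson DERIV_subset holomorphic_derivI open_half_ball subset_UNIV)
    then show ?thesis
      using y [OF that] by (auto intro!: derivative_eq_intros DERIV_chain2 [OF \<Phi>] simp: mult.commute)
  qed
  then have "\<exists>c. \<forall>z\<in>half_ball w r. \<Phi> (y z) - z = c"
    by (intro has_field_derivative_zero_constant convex_half_ball)
  then obtain c where c: "\<And>z. z \<in> half_ball w r \<Longrightarrow> \<Phi> (y z) - z = c"
    by blast
  have "isCont \<Phi> 0" using \<Phi> [of 0] \<open>\<rho> > 0\<close> by (auto intro: DERIV_isCont)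
  then have "((\<lambda>z. \<Phi> (y z)) \<longlongrightarrow> \<Phi> 0) (at w within half_ball w r)"
    using lim isCont_tendsto_compose by blast
  then have "((\<lambda>z. \<Phi> (y z) - z) \<longlongrightarrow> \<Phi> 0 - w) (at w within half_ball w r)"
    by (intro tendsto_intros)
  moreover have "((\<lambda>z. \<Phi> (y z) - z) \<longlongrightarrow> c) (at w within half_ball w r)"
    by (rule Lim_transform_eventually [OF tendsto_const]) (auto simp: eventually_at_filter c)
  ultimately have "c = - w"
    using tendsto_unique [OF at_within_half_ball_neq_bot [OF \<open>r > 0\<close>]] by force
  then have "\<Phi> (y z) = z - w" if "z \<in> half_ball w r" for z
    using c [OF that] by (simp add: algebra_simps add_eq_0_iff2)
  with \<Phi> show ?thesis by (intro that [of \<Phi>]) simp_all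
qed

text \<open>The time function \<Phi>, a primitive of \<open>1 / m\<close>, has nonzero derivative at
  0, and its local inverse continues \<open>y\<close> across \<open>w\<close>. If \<open>m\<close>
  is invariant under a rotation, then \<Phi> commutes with that rotation, and so does the continued
  solution in the variable \<open>s = x - w\<close>.\<close>

lemma flow_extension:
  assumes "r > 0" "\<rho> > 0" "y holomorphic_on half_ball w r"
    and lim: "(y \<longlongrightarrow> 0) (at w within half_ball w r)"
    and m: "m holomorphic_on ball 0 \<rho>" "\<And>z. z \<in> ball 0 \<rho> \<Longrightarrow> m z \<noteq> 0"
    and y: "\<And>z. z \<in> half_ball w r \<Longrightarrow> y z \<in> ball 0 \<rho> \<and> deriv y z = m (y z)"
  obtains \<delta> f where "\<delta> > 0" "f holomorphic_on ball w \<delta>" "\<And>z. z \<in> half_ball w r \<inter> ball w \<delta> \<Longrightarrow> f z = y z"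
    "\<And>\<omega> s. norm \<omega> = 1 \<Longrightarrow> (\<And>z. z \<in> ball 0 \<rho> \<Longrightarrow> m (\<omega> * z) = m z) \<Longrightarrow> norm s < \<delta> \<Longrightarrow> f (w + \<omega> * s) = \<omega> * f (w + s)"
proof -
  have q: "(\<lambda>z. 1 / m z) holomorphic_on ball 0 \<rho>"
    using m by (intro holomorphic_intros) auto
  obtain \<Phi> where \<Phi>: "\<Phi> 0 = 0" "\<And>z. z \<in> ball 0 \<rho> \<Longrightarrow> (\<Phi> has_field_derivative 1 / m z) (at z)"
    "\<And>z. z \<in> half_ball w r \<Longrightarrow> \<Phi> (y z) = z - w"
    by (rule primitive_along_flow [OF assms(1-4) q]) (use y m(2) that in auto)
  have hol: "\<Phi> holomorphic_on ball 0 \<rho>"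
    unfolding holomorphic_on_open [OF open_ball] using \<Phi>(2) by blast
  have "deriv \<Phi> 0 \<noteq> 0"
    using \<Phi>(2) [of 0] m(2) [of 0] \<open>\<rho> > 0\<close> by (auto simp: DERIV_imp_deriv)
  then obtain \<eta> g where \<eta>: "\<eta> > 0" "ball (0::complex) \<eta> \<subseteq> ball 0 \<rho>" "open (\<Phi> ` ball 0 \<eta>)"
    and g: "g holomorphic_on \<Phi> ` ball 0 \<eta>" "\<And>z. z \<in> ball 0 \<eta> \<Longrightarrow> g (\<Phi> z) = z"
    by (rule holomorphic_local_inverse [OF hol open_ball centre_in_ball [THEN iffD2, OF \<open>\<rho> > 0\<close>]]) (rule that)
  have "0 \<in> \<Phi> ` ball 0 \<eta>" using \<Phi>(1) \<open>\<eta> > 0\<close> by (metis centre_in_ball image_eqI)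
  then obtain \<delta>1 where \<delta>1: "\<delta>1 > 0" "ball 0 \<delta>1 \<subseteq> \<Phi> ` ball 0 \<eta>"
    using \<eta>(3) openE by blast
  have "eventually (\<lambda>z. dist (y z) 0 < \<eta>) (at w within half_ball w r)"
    using lim \<open>\<eta> > 0\<close> tendstoD by blast
  then obtain \<delta>2 where \<delta>2: "\<delta>2 > 0" "\<And>z. z \<in> half_ball w r \<Longrightarrow> dist z w < \<delta>2 \<Longrightarrow> y z \<in> ball 0 \<eta>"
    unfolding eventually_at by (force simp: half_ball_def)
  define f where "f = (\<lambda>z. g (z - w))"
  show ?thesis
  proof (rule that)
    show "min \<delta>1 \<delta>2 > 0" using \<delta>1 \<delta>2 by auto
    have "(\<lambda>z. z - w) ` ball w (min \<delta>1 \<delta>2) \<subseteq> \<Phi> ` ball 0 \<eta>"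
      using \<delta>1(2) by (auto simp: dist_norm norm_minus_commute subset_iff)
    then show "f holomorphic_on ball w (min \<delta>1 \<delta>2)"
      unfolding f_def by (intro holomorphic_on_compose_gen [OF _ g(1), unfolded o_def] holomorphic_intros) auto
    show "f z = y z" if "z \<in> half_ball w r \<inter> ball w (min \<delta>1 \<delta>2)" for z
      unfolding f_def using that \<Phi>(3) [of z] g(2) [of "y z"] \<delta>2(2) [of z] by (auto simp: dist_commute)
    show "f (w + \<omega> * s) = \<omega> * f (w + s)"
      if \<omega>: "norm \<omega> = 1" "\<And>z. z \<in> ball 0 \<rho> \<Longrightarrow> m (\<omega> * z) = m z" and s: "norm s < min \<delta>1 \<delta>2" for \<omega> s
    proof -
      have "((\<lambda>z. \<Phi> (\<omega> * z) - \<omega> * \<Phi> z) has_field_derivative 0) (at z within ball 0 \<rho>)" if "z \<in> ball 0 \<rho>" for z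
      proof -
        have "\<omega> * z \<in> ball 0 \<rho>" using \<omega>(1) that by (simp add: norm_mult)
        then have "((\<lambda>z. \<Phi> (\<omega> * z)) has_field_derivative 1 / m (\<omega> * z) * \<omega>) (at z)"
          by (intro DERIV_chain2 [OF \<Phi>(2)]) (auto intro!: derivative_eq_intros)
        then have "((\<lambda>z. \<Phi> (\<omega> * z) - \<omega> * \<Phi> z) has_field_derivative 0) (at z)"
          using \<Phi>(2) [OF that] \<omega>(2) [OF that] by (auto intro!: derivative_eq_intros)
        then show ?thesis using has_field_derivative_at_within by blast
      qed
      then have "\<exists>C. \<forall>z\<in>ball 0 \<rho>. \<Phi> (\<omega> * z) - \<omega> * \<Phi> z = C"
        by (intro has_field_derivative_zero_constant convex_ball)
      then obtain C where "\<And>z. z \<in> ball 0 \<rho> \<Longrightarrow> \<Phi> (\<omega> * z) - \<omega> * \<Phi> z = C"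
        by blast
      moreover from this [of 0] have "C = 0" using \<Phi>(1) \<open>\<rho> > 0\<close> by simp
      ultimately have rot: "\<And>z. z \<in> ball 0 \<rho> \<Longrightarrow> \<Phi> (\<omega> * z) = \<omega> * \<Phi> z" by simp
      from s \<delta>1(2) have "s \<in> \<Phi> ` ball 0 \<eta>" by auto
      then obtain u where u: "u \<in> ball 0 \<eta>" "s = \<Phi> u" by blast
      have "\<omega> * u \<in> ball 0 \<eta>" using u \<omega>(1) by (simp add: norm_mult)
      then have "g (\<Phi> (\<omega> * u)) = \<omega> * u" by (rule g(2))
      then show ?thesis
        unfolding f_def using u \<eta>(2) rot g(2) [of u] by (simp add: subset_iff)
    qed
  qed
qed

lemma poly_order_factor:
  fixes R :: "complex poly"
  assumes "R \<noteq> 0"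
  obtains R2 where "R = [:- z, 1:] ^ order z R * R2" "poly R2 z \<noteq> 0"
  using order_decomp [OF assms, of z] by (metis poly_eq_0_iff_dvd)

text \<open>With \<open>N = n - k\<close> and \<open>e = n div N\<close>, substitute
  \<open>A = z + y ^ e\<close>. Since \<open>e * k = n * (e - 1)\<close>, the powers of
  \<open>y\<close> cancel in \<open>A' ^ n = R(A)\<close> and leave
  \<open>(e * y') ^ n = R2 (z + y ^ e)\<close>, which is regular and nonzero at 0. The right side
  depends on \<open>y ^ e\<close> only, so \<open>e\<close>-th roots of unity act on
  \<open>y\<close> and disappear in \<open>A\<close>. The value \<open>e = 1\<close> is the regular
  case \<open>k = 0\<close>.\<close>

lemma flow_extension_at_root:
  assumes r: "r > 0" and holA: "A holomorphic_on half_ball w r"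
    and lim: "(A \<longlongrightarrow> z) (at w within half_ball w r)"
    and ode: "\<And>x. x \<in> half_ball w r \<Longrightarrow> deriv A x ^ n = poly R (A x) \<and> poly R (A x) \<noteq> 0"
    and kn: "order z R < n" and dv: "n - order z R dvd n"
  obtains \<delta> f where "\<delta> > 0" "f holomorphic_on ball w \<delta>" "\<And>x. x \<in> half_ball w r \<inter> ball w \<delta> \<Longrightarrow> f x = A x"
    "\<And>\<omega> s. \<omega> ^ (n div (n - order z R)) = 1 \<Longrightarrow> norm s < \<delta> \<Longrightarrow> f (w + \<omega> * s) = f (w + s)"
proof -
  define k where "k = order z R"
  define N where "N = n - k"
  define e where "e = n div N"
  have N: "N > 0" "n = N + k" and e: "n = e * N" and n: "n > 0"
    using kn dv by (auto simp: k_def N_def e_def)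
  have e0: "e > 0" using e n by (cases e) auto
  have kpos: "k > 0" if "e \<noteq> 1"
  proof (rule ccontr)
    assume "\<not> k > 0"
    then have "N = n" by (simp add: N_def)
    with n that show False unfolding e_def by simp
  qed
  have ek: "e * k = n * (e - 1)"
  proof -
    have "e * k + n = n * e" using e N(2) by (metis add_mult_distrib2 mult.commute add.commute)
    then show ?thesis using e0 by (simp add: algebra_simps)
  qed
  have "R \<noteq> 0" using ode half_ball_nonempty [OF r] by fastforce
  then obtain R2 where R2: "R = [:- z, 1:] ^ k * R2" "poly R2 z \<noteq> 0"
    unfolding k_def by (rule poly_order_factor)
  \<comment> \<open>For \<open>e = 1\<close> the function \<open>A - z\<close> may vanish, and no
    root is to be taken; for \<open>e > 1\<close> the point \<open>z\<close> is a root of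
    \<open>R\<close>, which \<open>A\<close> avoids.\<close>
  have "\<exists>y. y holomorphic_on half_ball w r \<and> (\<forall>x\<in>half_ball w r. y x ^ e = A x - z)"
  proof (cases "e = 1")
    case True
    then show ?thesis using holA by (intro exI [of _ "\<lambda>x. A x - z"]) (auto intro!: holomorphic_intros)
  next
    case False
    note kpos [OF False]
    then have nz: "\<And>x. x \<in> half_ball w r \<Longrightarrow> A x - z \<noteq> 0"
      using ode unfolding R2(1) by (auto simp: power_0_left)
    have "(\<lambda>x. A x - z) holomorphic_on half_ball w r" by (intro holomorphic_intros holA)
    then obtain g where "g holomorphic_on half_ball w r" "\<And>x. x \<in> half_ball w r \<Longrightarrow> g x ^ e = A x - z"
      by (rule holomorphic_nth_root [OF convex_half_ball open_half_ball]) (assumption | rule nz e0 that)+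
    then show ?thesis by blast
  qed
  then obtain y where y: "y holomorphic_on half_ball w r" "\<And>x. x \<in> half_ball w r \<Longrightarrow> y x ^ e = A x - z"
    by blast
  \<comment> \<open>The modulus of \<open>y\<close> is a function of \<open>A\<close>, whatever the
    branch; since the limit is 0, its convergence is enough.\<close>
  have "((\<lambda>x. root e (norm (A x - z))) \<longlongrightarrow> root e (norm (z - z))) (at w within half_ball w r)"
    by (intro tendsto_intros lim)
  moreover have "root e (norm (A x - z)) = norm (y x)" if "x \<in> half_ball w r" for x
    using y(2) [OF that] e0 by (metis norm_ge_zero norm_power real_root_power_cancel)
  ultimately have "((\<lambda>x. norm (y x)) \<longlongrightarrow> 0) (at w within half_ball w r)"
    using e0 Lim_transform_eventually [of _ "0::real"] by (force simp: eventually_at_filter)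
  then have ylim: "(y \<longlongrightarrow> 0) (at w within half_ball w r)"
    using tendsto_norm_zero_cancel by blast
  have "open ((\<lambda>u. poly R2 (z + u)) -` (- {0}))"
    by (intro continuous_open_vimage) (auto intro!: continuous_intros)
  then obtain \<rho>' where \<rho>': "\<rho>' > 0" "\<And>u. u \<in> ball 0 \<rho>' \<Longrightarrow> poly R2 (z + u) \<noteq> 0"
    using R2(2) openE [of "(\<lambda>u. poly R2 (z + u)) -` (- {0})" 0] by (auto simp: subset_iff)
  obtain m0 where m0: "m0 holomorphic_on ball 0 \<rho>'" "\<And>u. u \<in> ball 0 \<rho>' \<Longrightarrow> m0 u ^ n = poly R2 (z + u)"
  proof (rule holomorphic_nth_root [of "ball 0 \<rho>'" "\<lambda>u. poly R2 (z + u)" n])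
    show "(\<lambda>u. poly R2 (z + u)) holomorphic_on ball 0 \<rho>'"
      by (intro holomorphic_intros)
  qed (use \<rho>' n in auto)
  \<comment> \<open>The bound 1 makes \<open>norm (u ^ e) \<le> norm u\<close>, so
    \<open>u ^ e\<close> stays in the disc of radius \<open>\<rho>'\<close>.\<close>
  define \<rho> where "\<rho> = min \<rho>' 1"
  have \<rho>: "\<rho> > 0" "u ^ e \<in> ball 0 \<rho>'" if "u \<in> ball 0 \<rho>" for u :: complex
    using that \<rho>'(1) power_le_one_iff e0 self_le_power
     by (auto simp: \<rho>_def norm_power intro: le_less_trans [OF power_decreasing [of 1 e "norm u", simplified]])
  have \<rho>0: "\<rho> > 0" using \<rho>' by (simp add: \<rho>_def)
  have "eventually (\<lambda>x. dist (y x) 0 < \<rho>) (at w within half_ball w r)"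
    using ylim \<rho>0 tendstoD by blast
  then obtain r1 where r1: "r1 > 0" "\<And>x. x \<in> half_ball w r \<Longrightarrow> dist x w < r1 \<Longrightarrow> y x \<in> ball 0 \<rho>"
    unfolding eventually_at by (force simp: half_ball_def)
  define r2 where "r2 = min r r1"
  have r2: "r2 > 0" "r2 \<le> r" using r r1 by (auto simp: r2_def)
  note sub = half_ball_subset [OF r2(2), of w]
  have yb: "y x \<in> ball 0 \<rho>" if "x \<in> half_ball w r2" for x
    using r1(2) that sub by (auto simp: half_ball_def r2_def dist_commute)
  define m1 where "m1 = (\<lambda>u. m0 (u ^ e) / of_nat e)"
  have m1h: "m1 holomorphic_on ball 0 \<rho>"
    unfolding m1_def using \<rho>(2) e0
    by (intro holomorphic_intros holomorphic_on_compose_gen [OF _ m0(1), unfolded o_def]) auto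
  have m1: "m1 u \<noteq> 0" if "u \<in> ball 0 \<rho>" for u
    using m0(2) [OF \<rho>(2) [OF that]] \<rho>'(2) [OF \<rho>(2) [OF that]] n e0 by (auto simp: m1_def power_0_left)
  have yd: "deriv y x ^ n = m1 (y x) ^ n" if x: "x \<in> half_ball w r2" for x
  proof -
    from x sub have x': "x \<in> half_ball w r" by auto
    have "(y has_field_derivative deriv y x) (at x)"
      using y(1) x' by (meson holomorphic_derivI open_half_ball)
    then have "((\<lambda>x. y x ^ e + z) has_field_derivative of_nat e * y x ^ (e - 1) * deriv y x) (at x)"
      by (auto intro!: derivative_eq_intros)
    moreover have "eventually (\<lambda>x. y x ^ e + z = A x) (nhds x)"
      using eventually_nhds_in_open [OF open_half_ball x'] by eventually_elim (simp add: y(2))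
    ultimately have "deriv A x = of_nat e * y x ^ (e - 1) * deriv y x"
      using deriv_cong_ev [of "\<lambda>x. y x ^ e + z" A x x] by (simp add: DERIV_imp_deriv)
    then have "(of_nat e * y x ^ (e - 1) * deriv y x) ^ n = (y x ^ e) ^ k * poly R2 (z + y x ^ e)"
      using ode [OF x'] y(2) [OF x'] unfolding R2(1) by (simp add: diff_eq_eq add.commute)
    also have "poly R2 (z + y x ^ e) = m0 (y x ^ e) ^ n"
      using m0(2) [OF \<rho>(2) [OF yb [OF x]]] by simp
    also have "(y x ^ e) ^ k = (y x ^ (e - 1)) ^ n"
      by (simp flip: power_mult add: ek mult.commute)
    finally have *: "(y x ^ (e - 1)) ^ n * (of_nat e * deriv y x) ^ n = (y x ^ (e - 1)) ^ n * m0 (y x ^ e) ^ n"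
      by (simp add: power_mult_distrib mult_ac)
    have "y x ^ (e - 1) \<noteq> 0"
    proof (cases "e = 1")
      case False
      then have "k > 0" by (rule kpos)
      then have "A x - z \<noteq> 0" using ode [OF x'] unfolding R2(1) by (auto simp: power_0_left)
      then show ?thesis using y(2) [OF x'] e0 by (auto simp: power_0_left)
    qed auto
    then have "(y x ^ (e - 1)) ^ n \<noteq> 0" by (rule power_not_zero)
    with * have "(of_nat e * deriv y x) ^ n = m0 (y x ^ e) ^ n" by (metis mult_left_cancel)
    then show ?thesis using e0 by (simp add: m1_def power_divide power_mult_distrib field_simps)
  qed
  have cy: "continuous_on (half_ball w r2) y"
    using y(1) sub holomorphic_on_imp_continuous_on continuous_on_subset by blast
  obtain c where c: "c ^ n = 1" "\<And>x. x \<in> half_ball w r2 \<Longrightarrow> deriv y x = c * m1 (y x)"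
  proof (rule power_eq_imp_const_multiple [of "half_ball w r2" "deriv y" "\<lambda>x. m1 (y x)" n])
    show "connected (half_ball w r2)" using convex_connected by blast
    show "continuous_on (half_ball w r2) (deriv y)"
      using y(1) sub by (meson continuous_on_subset holomorphic_deriv holomorphic_on_imp_continuous_on open_half_ball)
    show "continuous_on (half_ball w r2) (\<lambda>x. m1 (y x))"
      using yb by (intro continuous_on_compose2 [OF holomorphic_on_imp_continuous_on [OF m1h] cy]) auto
  qed (use m1 yb yd n in auto)
  have cm: "(\<lambda>u. c * m1 u) holomorphic_on ball 0 \<rho>" "\<And>u. u \<in> ball 0 \<rho> \<Longrightarrow> c * m1 u \<noteq> 0"
    using m1h m1 c(1) n by (auto intro!: holomorphic_intros simp: power_0_left)
  have yh2: "y holomorphic_on half_ball w r2" using y(1) sub holomorphic_on_subset by blast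
  have yl2: "(y \<longlongrightarrow> 0) (at w within half_ball w r2)"
    using ylim at_within_half_ball [OF r r2(1)] by simp
  obtain \<delta> f where f: "\<delta> > 0" "f holomorphic_on ball w \<delta>" "\<And>x. x \<in> half_ball w r2 \<inter> ball w \<delta> \<Longrightarrow> f x = y x"
    "\<And>\<omega> s. norm \<omega> = 1 \<Longrightarrow> (\<And>u. u \<in> ball 0 \<rho> \<Longrightarrow> c * m1 (\<omega> * u) = c * m1 u) \<Longrightarrow> norm s < \<delta> \<Longrightarrow> f (w + \<omega> * s) = \<omega> * f (w + s)"
    using flow_extension [OF r2(1) \<rho>0 yh2 yl2 cm] yb c(2) by blast
  show ?thesis
  proof (rule that [of "min \<delta> r2" "\<lambda>x. z + f x ^ e"])
    show "min \<delta> r2 > 0" using f r2 by auto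
    show "(\<lambda>x. z + f x ^ e) holomorphic_on ball w (min \<delta> r2)"
      using f(2) by (intro holomorphic_intros) (auto elim: holomorphic_on_subset)
    show "z + f x ^ e = A x" if "x \<in> half_ball w r \<inter> ball w (min \<delta> r2)" for x
      using that f(3) [of x] y(2) [of x] by (auto simp: half_ball_def)
    fix \<omega> s :: complex assume \<omega>: "\<omega> ^ (n div (n - order z R)) = 1" and s: "norm s < min \<delta> r2"
    have \<omega>e: "\<omega> ^ e = 1" using \<omega> by (simp add: e_def N_def k_def)
    then have "norm \<omega> ^ e = 1" by (metis norm_one norm_power)
    then have "norm \<omega> = 1" using e0 power_eq_imp_eq_base [of "norm \<omega>" e 1] by simp
    moreover have "c * m1 (\<omega> * u) = c * m1 u" for u
      using \<omega>e by (simp add: m1_def power_mult_distrib)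
    ultimately have "f (w + \<omega> * s) = \<omega> * f (w + s)" using f(4) s by auto
    then show "z + f (w + \<omega> * s) ^ e = z + f (w + s) ^ e" using \<omega>e by (simp add: power_mult_distrib)
  qed
qed

section \<open>Ramification at a root\<close>

lemma poly_near_root:
  fixes R2 :: "complex poly"
  assumes "k > 0"
  shows "poly (pderiv ([:- z, 1:] ^ k * R2)) (z + u) =
    u ^ (k - 1) * (of_nat k * poly R2 (z + u) + u * poly (pderiv R2) (z + u))"
proof -
  obtain l where l: "k = Suc l" using assms by (cases k) auto
  show ?thesis unfolding l pderiv_mult pderiv_power_Suc
    by (simp add: pderiv_pCons algebra_simps)
qed

lemma has_fps_expansion_compose_X_power:
  assumes "f has_fps_expansion F" "n > 0"
  shows "(\<lambda>x::complex. f (x ^ n)) has_fps_expansion (F oo fps_X ^ n)"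
proof -
  have "(f \<circ> (\<lambda>x. x ^ n)) has_fps_expansion (F oo fps_X ^ n)"
    by (intro has_fps_expansion_compose assms has_fps_expansion_fps_X_power)
       (use assms in \<open>auto simp: fps_X_power_nth\<close>)
  then show ?thesis by (simp add: o_def)
qed

text \<open>In the uniformizer \<open>\<tau>\<close> with \<open>A = z + \<tau> ^ n\<close> and \<open>x = w + G \<tau>\<close>, the two sides of the identity
  have the exponents handled in \<open>fps_exponent_dvd\<close>.\<close>

lemma root_multiplicity_dvd:
  assumes r: "r > 0" and holA: "A holomorphic_on half_ball w r"
    and lim: "(A \<longlongrightarrow> z) (at w within half_ball w r)"
    and ode: "\<And>x. x \<in> half_ball w r \<Longrightarrow> deriv A x ^ n = poly R (A x) \<and> poly R (A x) \<noteq> 0"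
    and k0: "0 < order z R" and kn: "order z R < n"
    and b: "b holomorphic_on ball w r" "deriv b w \<noteq> 0"
    and V: "V holomorphic_on ball w r" and D: "D holomorphic_on ball w r"
    and eq: "\<And>x. x \<in> half_ball w r \<Longrightarrow>
       poly R1 (A x) - b x * poly (pderiv R) (A x) = deriv A x ^ (n - 2) * (V x - A x * D x)"
  shows "n - order z R dvd n"
proof -
  define k where "k = order z R"
  define N where "N = n - k"
  have N: "N > 0" "N < n" "n = N + k" and n: "n > 0" "n \<ge> 2" and k: "0 < k" "k < n"
    using k0 kn by (auto simp: k_def N_def)
  have "R \<noteq> 0" using ode half_ball_nonempty [OF r] by fastforce
  then obtain R2 where R2: "R = [:- z, 1:] ^ k * R2" "poly R2 z \<noteq> 0"
    unfolding k_def by (rule poly_order_factor)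
  have nz: "A x - z \<noteq> 0" if "x \<in> half_ball w r" for x
    using ode [OF that] k unfolding R2(1) by (auto simp: power_0_left)
  have "(\<lambda>x. A x - z) holomorphic_on half_ball w r" by (intro holomorphic_intros holA)
  \<comment> \<open>\<open>t\<close> is a branch of the uniformizer along the solution. Divisibility
    is what has to be proved here, so the full \<open>n\<close>-th root is taken, where
    \<open>flow_extension_at_root\<close> takes an \<open>e\<close>-th root.\<close>
  then obtain t where t: "t holomorphic_on half_ball w r" "\<And>x. x \<in> half_ball w r \<Longrightarrow> t x ^ n = A x - z"
    by (rule holomorphic_nth_root [OF convex_half_ball open_half_ball]) (assumption | rule nz n that)+
  have t0: "t x \<noteq> 0" if "x \<in> half_ball w r" for x
    using t(2) [OF that] nz [OF that] n by (auto simp: power_0_left)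
  have "((\<lambda>x. root n (norm (A x - z))) \<longlongrightarrow> root n (norm (z - z))) (at w within half_ball w r)"
    by (intro tendsto_intros lim)
  moreover have "root n (norm (A x - z)) = norm (t x)" if "x \<in> half_ball w r" for x
    using t(2) [OF that] n by (metis norm_ge_zero norm_power real_root_power_cancel)
  ultimately have "((\<lambda>x. norm (t x)) \<longlongrightarrow> 0) (at w within half_ball w r)"
    using n Lim_transform_eventually [of _ "0::real"] by (force simp: eventually_at_filter)
  then have tlim: "(t \<longlongrightarrow> 0) (at w within half_ball w r)"
    using tendsto_norm_zero_cancel by blast
  have "open ((\<lambda>u. poly R2 (z + u)) -` (- {0}))"
    by (intro continuous_open_vimage) (auto intro!: continuous_intros)
  then obtain \<rho>' where \<rho>': "\<rho>' > 0" "\<And>u. u \<in> ball 0 \<rho>' \<Longrightarrow> poly R2 (z + u) \<noteq> 0"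
    using R2(2) openE [of "(\<lambda>u. poly R2 (z + u)) -` (- {0})" 0] by (auto simp: subset_iff)
  obtain m0 where m0: "m0 holomorphic_on ball 0 \<rho>'" "\<And>u. u \<in> ball 0 \<rho>' \<Longrightarrow> m0 u ^ n = poly R2 (z + u)"
  proof (rule holomorphic_nth_root [of "ball 0 \<rho>'" "\<lambda>u. poly R2 (z + u)" n])
    show "(\<lambda>u. poly R2 (z + u)) holomorphic_on ball 0 \<rho>'"
      by (intro holomorphic_intros)
  qed (use \<rho>' n in auto)
  define \<rho> where "\<rho> = min \<rho>' 1"
  have \<rho>: "u ^ n \<in> ball 0 \<rho>'" if "u \<in> ball 0 \<rho>" for u :: complex
    using that \<rho>'(1) n
     by (auto simp: \<rho>_def norm_power intro: le_less_trans [OF power_decreasing [of 1 n "norm u", simplified]])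
  have \<rho>0: "\<rho> > 0" using \<rho>' by (simp add: \<rho>_def)
  have "eventually (\<lambda>x. dist (t x) 0 < \<rho>) (at w within half_ball w r)"
    using tlim \<rho>0 tendstoD by blast
  then obtain r1 where r1: "r1 > 0" "\<And>x. x \<in> half_ball w r \<Longrightarrow> dist x w < r1 \<Longrightarrow> t x \<in> ball 0 \<rho>"
    unfolding eventually_at by (force simp: half_ball_def)
  define r2 where "r2 = min r r1"
  have r2: "r2 > 0" "r2 \<le> r" using r r1 by (auto simp: r2_def)
  note sub = half_ball_subset [OF r2(2), of w]
  have tb: "t x \<in> ball 0 \<rho>" if "x \<in> half_ball w r2" for x
    using r1(2) that sub by (auto simp: half_ball_def r2_def dist_commute)
  have m0n: "m0 u \<noteq> 0" if "u \<in> ball 0 \<rho>'" for u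
    using m0(2) [OF that] \<rho>'(2) [OF that] n by (auto simp: power_0_left)
  have dA: "deriv A x = of_nat n * t x ^ (n - 1) * deriv t x" if x': "x \<in> half_ball w r" for x
  proof -
    have "(t has_field_derivative deriv t x) (at x)"
      using t(1) x' by (meson holomorphic_derivI open_half_ball)
    then have "((\<lambda>x. t x ^ n + z) has_field_derivative of_nat n * t x ^ (n - 1) * deriv t x) (at x)"
      by (auto intro!: derivative_eq_intros)
    moreover have "eventually (\<lambda>x. t x ^ n + z = A x) (nhds x)"
      using eventually_nhds_in_open [OF open_half_ball x'] by eventually_elim (simp add: t(2))
    ultimately show ?thesis
      using deriv_cong_ev [of "\<lambda>x. t x ^ n + z" A x x] by (simp add: DERIV_imp_deriv)
  qed
  have n1: "n - 1 = k + (N - 1)" using N by simp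
  have td: "(of_nat n * t x ^ (N - 1) * deriv t x) ^ n = m0 (t x ^ n) ^ n" if x: "x \<in> half_ball w r2" for x
  proof -
    from x sub have x': "x \<in> half_ball w r" by auto
    have "(t x ^ k * (of_nat n * t x ^ (N - 1) * deriv t x)) ^ n = deriv A x ^ n"
      unfolding dA [OF x'] n1 power_add by (simp add: mult_ac)
    also have "\<dots> = (t x ^ n) ^ k * poly R2 (z + t x ^ n)"
      using ode [OF x'] t(2) [OF x'] unfolding R2(1) by (simp add: diff_eq_eq add.commute)
    also have "poly R2 (z + t x ^ n) = m0 (t x ^ n) ^ n"
      using m0(2) [OF \<rho> [OF tb [OF x]]] by simp
    also have "(t x ^ n) ^ k = (t x ^ k) ^ n"
      by (simp flip: power_mult add: mult.commute)
    finally have "(t x ^ k) ^ n * (of_nat n * t x ^ (N - 1) * deriv t x) ^ n = (t x ^ k) ^ n * m0 (t x ^ n) ^ n"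
      by (simp add: power_mult_distrib)
    moreover have "(t x ^ k) ^ n \<noteq> 0" using t0 [OF x'] by simp
    ultimately show ?thesis by (metis mult_left_cancel)
  qed
  have th2: "t holomorphic_on half_ball w r2" using t(1) sub holomorphic_on_subset by blast
  have m0c: "(\<lambda>u. m0 (u ^ n)) holomorphic_on ball 0 \<rho>"
    using \<rho> by (intro holomorphic_on_compose_gen [OF _ m0(1), unfolded o_def] holomorphic_intros) auto
  \<comment> \<open>In the variable \<open>t\<close> the equation reads
    \<open>n * t ^ (N - 1) * t' = c * m0 (t ^ n)\<close>: of the factor \<open>t ^ (n - 1)\<close>
    in \<open>A'\<close>, the power \<open>t ^ k\<close> cancels against the zero of
    \<open>R\<close>.\<close>
  obtain c where c: "c ^ n = 1" "\<And>x. x \<in> half_ball w r2 \<Longrightarrow> of_nat n * t x ^ (N - 1) * deriv t x = c * m0 (t x ^ n)"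
  proof (rule power_eq_imp_const_multiple [of "half_ball w r2" "\<lambda>x. of_nat n * t x ^ (N - 1) * deriv t x" "\<lambda>x. m0 (t x ^ n)" n])
    show "connected (half_ball w r2)" using convex_connected by blast
    show "continuous_on (half_ball w r2) (\<lambda>x. of_nat n * t x ^ (N - 1) * deriv t x)"
      using th2 by (intro continuous_intros holomorphic_on_imp_continuous_on holomorphic_deriv open_half_ball)
    show "continuous_on (half_ball w r2) (\<lambda>x. m0 (t x ^ n))"
      using tb by (intro continuous_on_compose2 [OF holomorphic_on_imp_continuous_on [OF m0c] holomorphic_on_imp_continuous_on [OF th2]]) auto
  qed (use tb td n \<rho> m0n in auto)
  define M where "M = (\<lambda>u. c * m0 u)"
  have c0: "c \<noteq> 0" using c(1) n by (auto simp: power_0_left)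
  have M0: "M u \<noteq> 0" if "u \<in> ball 0 \<rho>'" for u
    using m0n [OF that] c0 by (simp add: M_def)
  have Mh: "M holomorphic_on ball 0 \<rho>'"
    unfolding M_def by (intro holomorphic_intros m0)
  have tM: "of_nat n * t x ^ (N - 1) * deriv t x = M (t x ^ n)" if "x \<in> half_ball w r2" for x
    using c(2) [OF that] by (simp add: M_def)
  \<comment> \<open>\<open>q\<close> is \<open>dx / dt\<close> as a function of \<open>t\<close>;
    its primitive \<open>G\<close> expresses \<open>x - w\<close> through \<open>t\<close>.\<close>
  define q where "q = (\<lambda>u. of_nat n * u ^ (N - 1) * inverse (M (u ^ n)))"
  have qh: "q holomorphic_on ball 0 \<rho>"
    unfolding q_def M_def using \<rho> m0n c0 by (intro holomorphic_intros m0c) auto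
  have tlim2: "(t \<longlongrightarrow> 0) (at w within half_ball w r2)"
    using tlim at_within_half_ball [OF r r2(1)] by simp
  obtain G where G: "G 0 = 0" "\<And>u. u \<in> ball 0 \<rho> \<Longrightarrow> (G has_field_derivative q u) (at u)"
    "\<And>x. x \<in> half_ball w r2 \<Longrightarrow> G (t x) = x - w"
  proof (rule primitive_along_flow [OF r2(1) \<rho>0 th2 tlim2 qh])
    fix x assume x: "x \<in> half_ball w r2"
    have "deriv t x * q (t x) = (of_nat n * t x ^ (N - 1) * deriv t x) * inverse (M (t x ^ n))"
      by (simp add: q_def mult_ac)
    also have "\<dots> = 1" unfolding tM [OF x] using M0 [OF \<rho> [OF tb [OF x]]] by (rule right_inverse)
    finally show "t x \<in> ball 0 \<rho> \<and> deriv t x * q (t x) = 1" using tb [OF x] by simp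
  qed (use that in auto)
  have Gh: "G holomorphic_on ball 0 \<rho>"
    unfolding holomorphic_on_open [OF open_ball] using G(2) by blast

  \<comment> \<open>The ingredients of the identity as functions of \<open>u = t ^ n = A - z\<close>
    (\<open>p\<close>, \<open>\<rho>f\<close>, \<open>\<mu>\<close>) or of \<open>s = x - w\<close>
    (\<open>\<beta>\<close>, \<open>cf\<close>, \<open>df\<close>). The constant \<open>b w\<close>
    is moved into \<open>p\<close>, so that \<beta> vanishes at 0.\<close>
  define p \<rho>f \<mu> \<beta> cf df where
    "p = (\<lambda>u. poly R1 (z + u) - b w * poly (pderiv R) (z + u))" and
    "\<rho>f = (\<lambda>u. of_nat k * poly R2 (z + u) + u * poly (pderiv R2) (z + u))" and
    "\<mu> = (\<lambda>u. M u ^ (n - 2))" and "\<beta> = (\<lambda>s. b (w + s) - b w)" and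
    "cf = (\<lambda>s. V (w + s) - z * D (w + s))" and "df = (\<lambda>s. - D (w + s))"
  have shift: "(\<lambda>s. f (w + s)) analytic_on {0}" if "f holomorphic_on ball w r" for f
  proof -
    have "(\<lambda>s. f (w + s)) holomorphic_on ball 0 r"
      by (intro holomorphic_on_compose_gen [OF _ that, unfolded o_def] holomorphic_intros) (auto simp: dist_norm)
    then show ?thesis using r by (meson analytic_at centre_in_ball open_ball)
  qed
  have an: "p analytic_on {0}" "\<rho>f analytic_on {0}" "\<mu> analytic_on {0}" "\<beta> analytic_on {0}" "cf analytic_on {0}" "df analytic_on {0}"
    "M analytic_on {0}" "G analytic_on {0}"
  proof -
    have P: "(\<lambda>u. poly P (z + u)) analytic_on {0}" for P
    proof -
      have "(\<lambda>u. poly P (z + u)) holomorphic_on UNIV" by (intro holomorphic_intros)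
      then show ?thesis by (meson analytic_at UNIV_I open_UNIV)
    qed
    show "p analytic_on {0}" "\<rho>f analytic_on {0}" unfolding p_def \<rho>f_def by (intro analytic_intros P)+
    show M: "M analytic_on {0}" using Mh \<rho>'(1) by (meson analytic_at centre_in_ball open_ball)
    then show "\<mu> analytic_on {0}" unfolding \<mu>_def by (intro analytic_intros)
    show "\<beta> analytic_on {0}" "cf analytic_on {0}" "df analytic_on {0}"
      unfolding \<beta>_def cf_def df_def by (intro analytic_intros shift b V D)+
    show "G analytic_on {0}" using Gh \<rho>0 by (meson analytic_at centre_in_ball open_ball)
  qed
  note ex = an [THEN analytic_at_imp_has_fps_expansion_0]
  define pF \<rho>F \<mu>F \<beta>F cF dF MF GF where "pF = fps_expansion p 0" and "\<rho>F = fps_expansion \<rho>f 0"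
    and "\<mu>F = fps_expansion \<mu> 0" and "\<beta>F = fps_expansion \<beta> 0" and "cF = fps_expansion cf 0"
    and "dF = fps_expansion df 0" and "MF = fps_expansion M 0" and "GF = fps_expansion G 0"
  note ex = ex [folded pF_def \<rho>F_def \<mu>F_def \<beta>F_def cF_def dF_def MF_def GF_def]
  have GF0: "fps_nth GF 0 = 0" using has_fps_expansion_imp_0_eq_fps_nth_0 [OF ex(8)] G(1) by simp
  have MF0: "fps_nth MF 0 \<noteq> 0" using has_fps_expansion_imp_0_eq_fps_nth_0 [OF ex(7)] M0 [of 0] \<rho>'(1) by simp
  have exX: "(\<lambda>u. u ^ i) has_fps_expansion (fps_X ^ i :: complex fps)" for i
    by (rule has_fps_expansion_fps_X_power)
  have exG: "(\<lambda>u. f (G u)) has_fps_expansion (F oo GF)" if "f has_fps_expansion F" for f F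
    using has_fps_expansion_compose [OF that ex(8) GF0] by (simp add: o_def)
  note exP = has_fps_expansion_compose_X_power [OF _ n(1)]
  define lhs where "lhs = (\<lambda>u. p (u ^ n) - \<beta> (G u) * u ^ (n * (k - 1)) * \<rho>f (u ^ n) -
      u ^ (k * (n - 2)) * \<mu> (u ^ n) * (cf (G u) + u ^ n * df (G u)))"
  have exl: "lhs has_fps_expansion ((pF oo fps_X ^ n) - (\<beta>F oo GF) * fps_X ^ (n * (k - 1)) * (\<rho>F oo fps_X ^ n) -
       fps_X ^ (k * (n - 2)) * (\<mu>F oo fps_X ^ n) * ((cF oo GF) + fps_X ^ n * (dF oo GF)))"
    unfolding lhs_def
    by (intro has_fps_expansion_diff has_fps_expansion_add has_fps_expansion_mult exX exG exP ex)
  then have "lhs analytic_on {0}" by (rule has_fps_expansion_imp_analytic_0)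
  then obtain \<epsilon> where \<epsilon>: "\<epsilon> > 0" "lhs holomorphic_on ball 0 \<epsilon>" unfolding analytic_on_def by auto
  have zero: "lhs (t x) = 0" if x: "x \<in> half_ball w r2" for x
  proof -
    from x sub have x': "x \<in> half_ball w r" by auto
    have A: "A x = z + t x ^ n" using t(2) [OF x'] by simp
    have "deriv A x = t x ^ k * M (t x ^ n)"
      using tM [OF x] unfolding dA [OF x'] n1 power_add by (simp add: mult_ac)
    then have "deriv A x ^ (n - 2) = t x ^ (k * (n - 2)) * \<mu> (t x ^ n)"
      by (simp add: power_mult_distrib power_mult \<mu>_def)
    moreover have "poly (pderiv R) (A x) = t x ^ (n * (k - 1)) * \<rho>f (t x ^ n)"
      unfolding A R2(1) poly_near_root [OF k(1)] \<rho>f_def by (simp add: power_mult)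
    moreover have "poly R1 (A x) = p (t x ^ n) + b w * poly (pderiv R) (A x)"
      unfolding A p_def by simp
    moreover have "b x = \<beta> (G (t x)) + b w" "V x - A x * D x = cf (G (t x)) + t x ^ n * df (G (t x))"
      unfolding \<beta>_def cf_def df_def G(3) [OF x] A by (auto simp: algebra_simps)
    ultimately show ?thesis using eq [OF x'] unfolding lhs_def by (simp add: algebra_simps)
  qed
  \<comment> \<open>The values \<open>t x\<close> accumulate at 0 without reaching it, so the
    identity theorem extends the vanishing of \<open>lhs\<close> to a full disc, where Taylor
    coefficients can be compared.\<close>
  have lhs0: "lhs u = 0" if u: "u \<in> ball 0 \<epsilon>" for u
  proof (rule analytic_continuation [OF \<epsilon>(2) open_ball connected_ball, of "t ` half_ball w r2 \<inter> ball 0 \<epsilon>" 0])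
    show "0 islimpt t ` half_ball w r2 \<inter> ball 0 \<epsilon>"
      unfolding islimpt_approachable
    proof (intro allI impI)
      fix e :: real assume e: "e > 0"
      have "eventually (\<lambda>x. dist (t x) 0 < min e \<epsilon>) (at w within half_ball w r2)"
        using tlim2 \<epsilon>(1) e tendstoD by (metis min_less_iff_conj)
      then have "eventually (\<lambda>x. dist (t x) 0 < min e \<epsilon> \<and> x \<in> half_ball w r2) (at w within half_ball w r2)"
        by (auto simp: eventually_at_filter elim: eventually_mono)
      then obtain x where x: "dist (t x) 0 < min e \<epsilon>" "x \<in> half_ball w r2"
        using eventually_happens at_within_half_ball_neq_bot [OF r2(1)] by blast
      then show "\<exists>x'\<in>t ` half_ball w r2 \<inter> ball 0 \<epsilon>. x' \<noteq> 0 \<and> dist x' 0 < e"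
        using t0 sub by (intro bexI [of _ "t x"]) (auto simp: dist_commute)
    qed
  qed (use \<epsilon>(1) u zero in auto)
  have "lhs has_fps_expansion 0"
  proof -
    have "eventually (\<lambda>u. u \<in> ball 0 \<epsilon>) (nhds (0::complex))"
      using \<epsilon>(1) by (intro eventually_nhds_in_open) auto
    then have "eventually (\<lambda>u. lhs u = 0) (nhds 0)" by eventually_elim (rule lhs0)
    then show ?thesis by (simp add: has_fps_expansion_0_iff)
  qed
  with exl have fps_eq: "(pF oo fps_X ^ n) - (\<beta>F oo GF) * fps_X ^ (n * (k - 1)) * (\<rho>F oo fps_X ^ n) -
       fps_X ^ (k * (n - 2)) * (\<mu>F oo fps_X ^ n) * ((cF oo GF) + fps_X ^ n * (dF oo GF)) = 0"
    by (rule fps_expansion_unique_complex)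
  \<comment> \<open>The derivative of \<open>G\<close> is \<open>X ^ (N - 1)\<close> times a series
    in \<open>X ^ n\<close> with nonzero constant term. Hence \<open>G\<close> has only exponents
    \<open>N + n * t\<close> and begins at \<open>N\<close>.\<close>
  have GD: "fps_deriv GF = fps_const (of_nat n) * fps_X ^ (N - 1) * (inverse MF oo fps_X ^ n)"
  proof (rule fps_expansion_unique_complex)
    show "deriv G has_fps_expansion fps_deriv GF" by (intro has_fps_expansion_deriv ex)
    have "q has_fps_expansion (fps_const (of_nat n) * fps_X ^ (N - 1) * (inverse MF oo fps_X ^ n))"
      unfolding q_def
      by (intro has_fps_expansion_mult has_fps_expansion_const exX exP [of "\<lambda>u. inverse (M u)"] has_fps_expansion_inverse ex MF0)
    moreover have "eventually (\<lambda>u. q u = deriv G u) (nhds 0)"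
    proof -
      have "eventually (\<lambda>u. u \<in> ball 0 \<rho>) (nhds (0::complex))"
        using \<rho>0 by (intro eventually_nhds_in_open) auto
      then show ?thesis by eventually_elim (rule DERIV_imp_deriv [OF G(2), symmetric])
    qed
    ultimately show "deriv G has_fps_expansion (fps_const (of_nat n) * fps_X ^ (N - 1) * (inverse MF oo fps_X ^ n))"
      using has_fps_expansion_cong by blast
  qed
  have GDn: "of_nat (Suc j) * fps_nth GF (Suc j) = (if j < N - 1 \<or> \<not> n dvd (j - (N - 1)) then 0 else
      of_nat n * fps_nth (inverse MF) ((j - (N - 1)) div n))" for j
  proof -
    have "of_nat (Suc j) * fps_nth GF (Suc j) = fps_nth (fps_deriv GF) j" by simp
    also have "\<dots> = of_nat n * fps_nth (fps_X ^ (N - 1) * (inverse MF oo fps_X ^ n)) j"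
      unfolding GD mult.assoc by (rule fps_mult_left_const_nth)
    finally show ?thesis by (simp add: fps_X_power_mult_nth fps_nth_compose_X_power [OF n(1)])
  qed
  have supp: "\<exists>t. j = N + n * t" if j: "fps_nth GF j \<noteq> 0" for j
  proof -
    obtain i where i: "j = Suc i" using GF0 j by (cases j) auto
    have "of_nat (Suc i) * fps_nth GF (Suc i) \<noteq> 0" using j i by (simp del: of_nat_Suc)
    then have "\<not> i < N - 1" "n dvd i - (N - 1)" unfolding GDn by (auto split: if_splits)
    then obtain l where "i - (N - 1) = n * l" by auto
    then have "j = N + n * l" using \<open>\<not> i < N - 1\<close> i N(1) by linarith
    then show ?thesis by blast
  qed
  have "of_nat (Suc (N - 1)) * fps_nth GF (Suc (N - 1)) = of_nat n * fps_nth (inverse MF) 0"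
    unfolding GDn by simp
  then have GN: "fps_nth GF N \<noteq> 0" using N(1) n MF0 by auto
  show ?thesis
  proof (fold k_def, fold N_def, rule fps_exponent_dvd [OF k n(2) N_def])
    have "\<beta> 0 = 0" by (simp add: \<beta>_def)
    then show "fps_nth \<beta>F 0 = 0" using has_fps_expansion_imp_0_eq_fps_nth_0 [OF ex(4)] by simp
    have "(b has_field_derivative deriv b w) (at w)"
      using b(1) r by (meson centre_in_ball holomorphic_derivI open_ball)
    then have "((\<lambda>s. b (w + s) - b w) has_field_derivative deriv b w) (at 0)"
      by (auto intro!: derivative_eq_intros DERIV_chain2 [where g="\<lambda>s. w + s" and f=b])
    then have "deriv \<beta> 0 = deriv b w" unfolding \<beta>_def by (rule DERIV_imp_deriv)
    moreover have "deriv \<beta> 0 = fps_nth (fps_deriv \<beta>F) 0"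
      using has_fps_expansion_imp_0_eq_fps_nth_0 [OF has_fps_expansion_deriv [OF ex(4)]] by simp
    ultimately show "fps_nth \<beta>F 1 \<noteq> 0" using b(2) by simp
    have "\<rho>f 0 \<noteq> 0" using k R2(2) by (simp add: \<rho>f_def)
    then show "fps_nth \<rho>F 0 \<noteq> 0" using has_fps_expansion_imp_0_eq_fps_nth_0 [OF ex(2)] by simp
    show "\<exists>t. j = N + n * t" if "fps_nth GF j \<noteq> 0" for j using supp that by blast
    show "fps_nth GF N \<noteq> 0" by (rule GN)
    show "(pF oo fps_X ^ n) - (\<beta>F oo GF) * fps_X ^ (n * (k - 1)) * (\<rho>F oo fps_X ^ n) =
       fps_X ^ (k * (n - 2)) * (\<mu>F oo fps_X ^ n) * ((cF oo GF) + fps_X ^ n * (dF oo GF))"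
      using fps_eq by simp
  qed
qed

subsection \<open>The equation on a right half-plane\<close>

lemma open_right_half_plane: "open {x. h < Re x}" by (rule open_halfspace_Re_gt)

lemma convex_right_half_plane: "convex {x. h < Re x}" by (rule convex_halfspace_Re_gt)

lemma connected_right_half_plane: "connected {x. h < Re x}"
  by (rule convex_connected [OF convex_right_half_plane])

lemma holomorphic_on_local:
  assumes "\<And>x. x \<in> S \<Longrightarrow> \<exists>U. open U \<and> x \<in> U \<and> f holomorphic_on U"
  shows "f holomorphic_on S"
  unfolding holomorphic_on_def
  using assms by (meson field_differentiable_at_within holomorphic_on_imp_differentiable_at)

lemma periodic_shift:
  assumes "\<And>x. h < Re x \<Longrightarrow> A (x + 2 * of_real pi * \<i>) = A x" "h < Re x"
  shows "A (x + 2 * of_real pi * \<i> * of_int k) = A x"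
proof -
  have *: "A (x + 2 * of_real pi * \<i> * of_nat m) = A x" if "h < Re x" for x m
    using that
  proof (induction m)
    case (Suc m)
    have "A ((x + 2 * of_real pi * \<i> * of_nat m) + 2 * of_real pi * \<i>) = A (x + 2 * of_real pi * \<i> * of_nat m)"
      using Suc by (intro assms) auto
    then show ?case using Suc by (simp add: algebra_simps)
  qed auto
  show ?thesis
  proof (cases "k \<ge> 0")
    case True
    then show ?thesis using * [OF assms(2), of "nat k"] by simp
  next
    case False
    then show ?thesis using * [of "x + 2 * of_real pi * \<i> * of_int k" "nat (- k)"] assms(2) by (simp add: algebra_simps)
  qed
qed

lemma periodic_representative:
  obtains k :: int where "0 \<le> Im (x - 2 * of_real pi * \<i> * of_int k)" "Im (x - 2 * of_real pi * \<i> * of_int k) \<le> 2 * pi"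
    "Re (x - 2 * of_real pi * \<i> * of_int k) = Re x"
proof (rule that [of "\<lfloor>Im x / (2 * pi)\<rfloor>"])
  have Im: "Im x = 2 * pi * (Im x / (2 * pi))" by simp
  have "2 * pi * of_int \<lfloor>Im x / (2 * pi)\<rfloor> \<le> Im x"
    by (subst (2) Im) (intro mult_left_mono, auto)
  moreover have "Im x \<le> 2 * pi * (of_int \<lfloor>Im x / (2 * pi)\<rfloor> + 1)"
    by (subst (1) Im) (intro mult_left_mono, linarith, auto)
  ultimately have "2 * pi * of_int \<lfloor>Im x / (2 * pi)\<rfloor> \<le> Im x" "Im x \<le> 2 * pi * of_int \<lfloor>Im x / (2 * pi)\<rfloor> + 2 * pi"
    by (simp_all add: algebra_simps)
  then show "0 \<le> Im (x - 2 * of_real pi * \<i> * of_int \<lfloor>Im x / (2 * pi)\<rfloor>)"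
    "Im (x - 2 * of_real pi * \<i> * of_int \<lfloor>Im x / (2 * pi)\<rfloor>) \<le> 2 * pi"
    by simp_all
qed simp

lemma compact_strip: "compact {x. a \<le> Re x \<and> Re x \<le> b \<and> c \<le> Im x \<and> Im x \<le> d}"
proof -
  have "{x. a \<le> Re x \<and> Re x \<le> b \<and> c \<le> Im x \<and> Im x \<le> d} = cbox (Complex a c) (Complex b d)"
    by (auto simp: in_cbox_complex_iff)
  then show ?thesis by (simp add: compact_cbox)
qed

text \<open>The radii of the local continuations vary from point to point. Periodicity reduces the
  line to a compact segment, and a Lebesgue number gives one radius for the whole line, so the
  continuations fill a strip; they agree on overlaps by the identity theorem. The set
  \<open>U\<close> keeps track of the new values.\<close>

lemma line_extension:
  assumes hol: "A holomorphic_on {x. h < Re x}"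
    and per: "\<And>x. h < Re x \<Longrightarrow> A (x + 2 * of_real pi * \<i>) = A x"
    and loc: "\<And>w. Re w = h \<Longrightarrow> \<exists>\<delta> f. \<delta> > 0 \<and> f holomorphic_on ball w \<delta> \<and> f ` ball w \<delta> \<subseteq> U \<and> (\<forall>x\<in>half_ball w \<delta>. f x = A x)"
  obtains \<delta> B where "\<delta> > 0" "B holomorphic_on {x. h - \<delta> < Re x}" "\<And>x. h < Re x \<Longrightarrow> B x = A x"
    "\<And>x. h - \<delta> < Re x \<Longrightarrow> Re x \<le> h \<Longrightarrow> B x \<in> U"
proof -
  define K where "K = {x. h \<le> Re x \<and> Re x \<le> h \<and> 0 \<le> Im x \<and> Im x \<le> 2 * pi}"
  have "compact K" unfolding K_def by (rule compact_strip)
  have "\<forall>w\<in>K. \<exists>\<delta>. \<delta> > 0 \<and> (\<exists>f. f holomorphic_on ball w \<delta> \<and> f ` ball w \<delta> \<subseteq> U \<and> (\<forall>x\<in>half_ball w \<delta>. f x = A x))"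
    using loc by (auto simp: K_def)
  then obtain r where r: "\<And>w. w \<in> K \<Longrightarrow> r w > 0"
    "\<And>w. w \<in> K \<Longrightarrow> \<exists>f. f holomorphic_on ball w (r w) \<and> f ` ball w (r w) \<subseteq> U \<and> (\<forall>x\<in>half_ball w (r w). f x = A x)"
    by metis
  have cover: "K \<subseteq> \<Union>((\<lambda>w. ball w (r w)) ` K)" using r(1) by force
  obtain e where e: "e > 0" "\<And>x. x \<in> K \<Longrightarrow> \<exists>G\<in>(\<lambda>w. ball w (r w)) ` K. ball x e \<subseteq> G"
  proof (rule Heine_Borel_lemma [OF \<open>compact K\<close> cover])
    show "open G" if "G \<in> (\<lambda>w. ball w (r w)) ` K" for G using that by auto
  qed (rule that)
  have loc': "\<exists>f. f holomorphic_on ball w e \<and> f ` ball w e \<subseteq> U \<and> (\<forall>x\<in>half_ball w e. f x = A x)" if w: "Re w = h" for w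
  proof -
    obtain k where k: "0 \<le> Im (w - 2 * of_real pi * \<i> * of_int k)" "Im (w - 2 * of_real pi * \<i> * of_int k) \<le> 2 * pi"
      "Re (w - 2 * of_real pi * \<i> * of_int k) = Re w"
      by (rule periodic_representative)
    define s where "s = 2 * of_real pi * \<i> * of_int k"
    have "w - s \<in> K" using k w by (auto simp: K_def s_def)
    then obtain w0 where w0: "w0 \<in> K" "ball (w - s) e \<subseteq> ball w0 (r w0)" using e(2) by blast
    obtain f where f: "f holomorphic_on ball w0 (r w0)" "f ` ball w0 (r w0) \<subseteq> U" "\<And>x. x \<in> half_ball w0 (r w0) \<Longrightarrow> f x = A x"
      using r(2) [OF w0(1)] by blast
    have mem: "x - s \<in> ball (w - s) e" if "x \<in> ball w e" for x
      using that by (simp add: dist_norm)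
    show ?thesis
    proof (intro exI [of _ "\<lambda>x. f (x - s)"] conjI ballI)
      show "(\<lambda>x. f (x - s)) holomorphic_on ball w e"
        using w0(2) mem by (intro holomorphic_on_compose_gen [OF _ f(1), unfolded o_def] holomorphic_intros) blast
      show "(\<lambda>x. f (x - s)) ` ball w e \<subseteq> U" using mem w0(2) f(2) by blast
      fix x assume x: "x \<in> half_ball w e"
      then have "x - s \<in> ball w0 (r w0)" using mem [of x] w0(2) unfolding half_ball_def by blast
      moreover have "Re w0 < Re (x - s)" using x w w0(1) by (auto simp: half_ball_def K_def s_def)
      ultimately have "f (x - s) = A (x - s)" by (intro f) (auto simp: half_ball_def)
      also have "\<dots> = A ((x - s) + s)" unfolding s_def
        by (rule periodic_shift [of h A, symmetric]) (use x w per in \<open>auto simp: half_ball_def\<close>)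
      finally show "f (x - s) = A x" by simp
    qed
  qed
  then obtain F where F: "\<And>w. Re w = h \<Longrightarrow> F w holomorphic_on ball w e" "\<And>w. Re w = h \<Longrightarrow> F w ` ball w e \<subseteq> U"
    "\<And>w x. Re w = h \<Longrightarrow> x \<in> half_ball w e \<Longrightarrow> F w x = A x"
    by metis
  have agree: "F w x = F w' x" if w: "Re w = h" "Re w' = h" and x: "x \<in> ball w e \<inter> ball w' e" "Re x \<le> h" for w w' x
  proof (rule analytic_continuation_open [of "ball w e \<inter> ball w' e \<inter> {x. h < Re x}" "ball w e \<inter> ball w' e" "F w" "F w'" x])
    show "open (ball w e \<inter> ball w' e \<inter> {x. h < Re x})" by (intro open_Int open_ball open_right_half_plane)
    show "open (ball w e \<inter> ball w' e)" by auto
    show "connected (ball w e \<inter> ball w' e)" by (intro convex_connected convex_Int convex_ball)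
    show "F w holomorphic_on ball w e \<inter> ball w' e" "F w' holomorphic_on ball w e \<inter> ball w' e"
      using F(1) w by (auto intro: holomorphic_on_subset)
    show "F w y = F w' y" if "y \<in> ball w e \<inter> ball w' e \<inter> {x. h < Re x}" for y
      using F(3) [of w y] F(3) [of w' y] that w by (auto simp: half_ball_def)
    show "ball w e \<inter> ball w' e \<inter> {x. h < Re x} \<noteq> {}"
    proof (cases "Re x = h")
      case False
      \<comment> \<open>The mirror image of \<open>x\<close> in the line: discs centred on the line
        are symmetric in it, so a common point on the left gives one on the right, where both
        continuations equal \<open>A\<close>.\<close>
      define y where "y = Complex (2 * h - Re x) (Im x)"
      have "norm (w - y) = norm (w - x)" if "Re w = h" for w
        using that by (simp add: cmod_def y_def power2_eq_square algebra_simps)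
      then have "y \<in> ball w e \<inter> ball w' e \<inter> {x. h < Re x}"
        using x w False by (auto simp: dist_norm y_def)
      then show ?thesis by blast
    next
      case True
      have "open (ball w e \<inter> ball w' e)" by auto
      then obtain d where d: "d > 0" "ball x d \<subseteq> ball w e \<inter> ball w' e" using x openE by blast
      then have "x + of_real (d/2) \<in> ball x d" by (simp add: dist_norm)
      then have "x + of_real (d/2) \<in> ball w e \<inter> ball w' e \<inter> {x. h < Re x}" using d True by auto
      then show ?thesis by blast
    qed
  qed (use x in auto)
  define B where "B = (\<lambda>x. if h < Re x then A x else F (Complex h (Im x)) x)"
  have near: "x \<in> ball (Complex h (Im x)) e" if "h - e < Re x" "Re x \<le> h" for x
  proof -
    have "Complex h (Im x) - x = of_real (h - Re x)" by (simp add: complex_eq_iff)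
    then have "norm (Complex h (Im x) - x) = h - Re x" using that by (simp add: norm_of_real del: of_real_diff)
    then show ?thesis using that by (simp add: dist_norm)
  qed
  have BF: "B x = F w x" if "Re w = h" "x \<in> ball w e" for w x
  proof (cases "h < Re x")
    case True
    then show ?thesis using F(3) [of w x] that by (simp add: B_def half_ball_def)
  next
    case False
    have "\<bar>Re (w - x)\<bar> < e" using that abs_Re_le_cmod [of "w - x"] by (simp add: dist_norm)
    then have "x \<in> ball (Complex h (Im x)) e" using that False by (intro near) auto
    then have "F (Complex h (Im x)) x = F w x" using False that by (intro agree) auto
    then show ?thesis using False by (simp add: B_def)
  qed
  show ?thesis
  proof (rule that [of e B])
    show "B holomorphic_on {x. h - e < Re x}"
    proof -
      have "\<exists>S. open S \<and> x \<in> S \<and> B holomorphic_on S" if x: "h - e < Re x" for x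
      proof (cases "h < Re x")
        case True
        have "B holomorphic_on {x. h < Re x}" using hol by (rule holomorphic_transform) (simp add: B_def)
        then show ?thesis using True open_right_half_plane by blast
      next
        case False
        have "B holomorphic_on ball (Complex h (Im x)) e"
          using F(1) [of "Complex h (Im x)"] by (rule holomorphic_transform) (auto intro: BF [symmetric])
        then show ?thesis using near [of x] x False by (intro exI [of _ "ball (Complex h (Im x)) e"]) auto
      qed
      then show ?thesis by (intro holomorphic_on_local) auto
    qed
    show "B x \<in> U" if "h - e < Re x" "Re x \<le> h" for x
      using F(2) [of "Complex h (Im x)"] near [OF that] that by (auto simp: B_def)
  qed (use e in \<open>auto simp: B_def\<close>)
qed

text \<open>In the coordinate \<open>1 / A\<close> the flow is a holomorphic perturbation of \<open>x' = - x\<close>, which is linearised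
  by \<open>u w = w * exp (H w)\<close>.\<close>

lemma solution_at_infinity:
  fixes R :: "complex poly"
  assumes deg: "degree R = n" "n > 0" and monic: "lead_coeff R = 1"
  obtains h A where "A holomorphic_on {x. h < Re x}"
    "\<And>x. h < Re x \<Longrightarrow> A (x + 2 * of_real pi * \<i>) = A x"
    "\<And>x. h < Re x \<Longrightarrow> deriv A x ^ n = poly R (A x) \<and> poly R (A x) \<noteq> 0"
    "\<And>C. \<exists>h'. \<forall>x. h' < Re x \<longrightarrow> C < norm (A x)"
    "\<exists>C. \<forall>x. h < Re x \<longrightarrow> norm (deriv (deriv A) x - A x) \<le> C"
proof -
  \<comment> \<open>In the coordinate \<open>w = 1 / A\<close> one has
    \<open>poly R (1 / w) = Q w / w ^ n\<close>, and the leading coefficient 1 becomes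
    \<open>Q 0 = 1\<close>.\<close>
  define Q where "Q = poly (reflect_poly R)"
  have Q0: "Q 0 = 1" using monic by (simp add: Q_def)
  have Qh: "Q holomorphic_on S" for S unfolding Q_def by (intro holomorphic_intros)
  have "open (Q -` (- {0}))"
    unfolding Q_def by (intro continuous_open_vimage) (auto intro!: continuous_intros)
  then obtain \<rho> where \<rho>: "\<rho> > 0" "\<And>u. u \<in> ball 0 \<rho> \<Longrightarrow> Q u \<noteq> 0"
    using Q0 openE [of "Q -` (- {0})" 0] by (auto simp: subset_iff)
  obtain g where g: "g holomorphic_on ball 0 \<rho>" "\<And>u. u \<in> ball 0 \<rho> \<Longrightarrow> g u ^ n = Q u"
    by (rule holomorphic_nth_root [of "ball 0 \<rho>" Q n]) (use \<rho> deg Qh that in auto)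
  have g0: "g 0 ^ n = 1" using g(2) [of 0] \<rho>(1) Q0 by simp
  then have g0': "g 0 \<noteq> 0" using deg by (auto simp: power_0_left)
  \<comment> \<open>Dividing by \<open>g 0\<close> selects the branch of the \<open>n\<close>-th
    root of \<open>Q\<close> with value 1 at 0; this gives the linear part of the flow the rate -1,
    and \<open>A\<close> the period \<open>2 * pi * \<i>\<close>.\<close>
  define B where "B = (\<lambda>u. g u / g 0)"
  have Bh: "B holomorphic_on ball 0 \<rho>" unfolding B_def by (intro holomorphic_intros g) (rule g0')
  have Bn: "B u ^ n = Q u" if "u \<in> ball 0 \<rho>" for u
    using g(2) [OF that] g0 by (simp add: B_def power_divide)
  have B0: "B 0 = 1" using g0' by (simp add: B_def)
  have Bnz: "B u \<noteq> 0" if "u \<in> ball 0 \<rho>" for u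
    using Bn [OF that] \<rho>(2) [OF that] deg by (auto simp: power_0_left)
  define f where "f = (\<lambda>u. 1 / B u)"
  have fh: "f holomorphic_on ball 0 \<rho>" unfolding f_def by (intro holomorphic_intros Bh Bnz)
  define \<kappa> where "\<kappa> = (\<lambda>z. if z = 0 then deriv f 0 else (f z - f 0) / (z - 0))"
  have \<kappa>h: "\<kappa> holomorphic_on ball 0 \<rho>" unfolding \<kappa>_def by (rule pole_lemma_open [OF fh open_ball])
  have f\<kappa>: "f z = 1 + z * \<kappa> z" for z
    using B0 by (auto simp: \<kappa>_def f_def)
  obtain H0 where H0: "\<And>x. x \<in> ball 0 \<rho> \<Longrightarrow> (H0 has_field_derivative \<kappa> x) (at x)"
    using holomorphic_convex_primitive' [OF convex_ball open_ball \<kappa>h] by (metis at_within_open open_ball)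
  \<comment> \<open>Since \<open>u' z = exp (H0 z - H0 0) / B z\<close>, a solution of
    \<open>Y' = - Y * B Y\<close> satisfies \<open>(u (Y x))' = - u (Y x)\<close>. The solution to
    take is therefore given by \<open>u (Y x) = exp (- x)\<close>.\<close>
  define u where "u = (\<lambda>z. z * exp (H0 z - H0 0))"
  have ud: "(u has_field_derivative exp (H0 z - H0 0) * f z) (at z)" if "z \<in> ball 0 \<rho>" for z
    unfolding u_def f\<kappa> using H0 [OF that] by (auto intro!: derivative_eq_intros simp: algebra_simps)
  have uh: "u holomorphic_on ball 0 \<rho>"
    unfolding holomorphic_on_open [OF open_ball] using ud by blast
  have "deriv u 0 \<noteq> 0" using DERIV_imp_deriv [OF ud [of 0]] \<rho>(1) B0 by (simp add: f_def)
  then obtain r \<Xi> where r: "r > 0" "ball (0::complex) r \<subseteq> ball 0 \<rho>" "open (u ` ball 0 r)"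
    and \<Xi>: "\<Xi> holomorphic_on u ` ball 0 r" "\<And>x. x \<in> ball 0 r \<Longrightarrow> \<Xi> (u x) = x"
    using holomorphic_local_inverse [OF uh open_ball centre_in_ball [THEN iffD2, OF \<rho>(1)]] by metis
  have [simp]: "u 0 = 0" by (simp add: u_def)
  have [simp]: "\<Xi> 0 = 0" using \<Xi>(2) [of 0] r(1) by simp
  have "0 \<in> u ` ball 0 r" using r(1) by (intro image_eqI [of _ _ 0]) auto
  then have \<Xi>cont: "isCont \<Xi> 0"
    using holomorphic_on_imp_continuous_on [OF \<Xi>(1)] r(3) continuous_on_eq_continuous_at by blast
  have small: "\<exists>\<epsilon>>0. \<forall>v. norm v < \<epsilon> \<longrightarrow> v \<in> u ` ball 0 r \<and> norm (\<Xi> v) < e" if "e > 0" for e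
  proof -
    obtain \<epsilon>1 where "\<epsilon>1 > 0" "ball 0 \<epsilon>1 \<subseteq> u ` ball 0 r" using \<open>0 \<in> u ` ball 0 r\<close> r(3) openE by blast
    moreover have "\<exists>\<delta>>0. \<forall>v. dist v 0 < \<delta> \<longrightarrow> dist (\<Xi> v) (\<Xi> 0) < e"
      using \<Xi>cont that unfolding continuous_at_eps_delta by blast
    then obtain \<epsilon>2 where "\<epsilon>2 > 0" "\<And>v. norm v < \<epsilon>2 \<Longrightarrow> norm (\<Xi> v) < e"
      by auto
    ultimately show ?thesis
      by (intro exI [of _ "min \<epsilon>1 \<epsilon>2"]) (auto simp: subset_iff)
  qed
  have expsmall: "norm (exp (- x)) < \<epsilon>" if "\<epsilon> > 0" "- ln \<epsilon> < Re x" for x :: complex and \<epsilon>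
  proof -
    have "- Re x < ln \<epsilon>" using that by linarith
    then have "exp (- Re x) < exp (ln \<epsilon>)" by simp
    then show ?thesis using that by simp
  qed
  \<comment> \<open>The bound \<open>r / 2\<close> keeps \<open>Y\<close> in a compact disc, on
    which the function \<open>F\<close> below is bounded.\<close>
  obtain \<epsilon> where \<epsilon>: "\<epsilon> > 0" "\<And>v. norm v < \<epsilon> \<Longrightarrow> v \<in> u ` ball 0 r \<and> norm (\<Xi> v) < r / 2"
    using small [of "r/2"] r(1) by auto
  define h where "h = - ln \<epsilon>"
  define Y where "Y = (\<lambda>x. \<Xi> (exp (- x)))"
  have key: "Y x \<in> ball 0 r \<and> norm (Y x) < r/2 \<and> Y x \<noteq> 0 \<and> (Y has_field_derivative - Y x * B (Y x)) (at x)"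
    if x: "h < Re x" for x
  proof -
    define v where "v = exp (- x)"
    have v: "v \<in> u ` ball 0 r" "norm (\<Xi> v) < r / 2"
      using \<epsilon>(2) [of v] expsmall [OF \<epsilon>(1), of x] x by (auto simp: v_def h_def)
    then obtain y where y: "y \<in> ball 0 r" "v = u y" by auto
    have Yx: "Y x = y" using \<Xi>(2) [OF y(1)] y(2) by (simp add: Y_def v_def)
    have y0: "y \<noteq> 0" using y(2) by (auto simp: v_def)
    have y\<rho>: "y \<in> ball 0 \<rho>" using y r by auto
    have "(\<Xi> has_field_derivative deriv \<Xi> v) (at v)"
      using \<Xi>(1) v(1) r(3) holomorphic_derivI by blast
    then have d\<Xi>: "(\<Xi> has_field_derivative deriv \<Xi> (u y)) (at (u y))" using y by simp
    have "((\<lambda>z. \<Xi> (u z)) has_field_derivative deriv \<Xi> (u y) * (exp (H0 y - H0 0) * f y)) (at y)"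
      by (rule DERIV_chain2 [OF d\<Xi> ud [OF y\<rho>]])
    moreover have "((\<lambda>z. \<Xi> (u z)) has_field_derivative 1) (at y)"
      by (rule has_field_derivative_transform_within_open [OF DERIV_ident open_ball y(1)]) (simp add: \<Xi>(2))
    ultimately have "deriv \<Xi> (u y) * (exp (H0 y - H0 0) * f y) = 1" by (rule DERIV_unique)
    then have "deriv \<Xi> v * exp (H0 y - H0 0) = B y" using Bnz [OF y\<rho>] y(2) by (simp add: f_def field_simps)
    then have dv: "deriv \<Xi> v * v = y * B y" by (simp add: y(2) u_def mult_ac)
    have "((\<lambda>x. \<Xi> (exp (- x))) has_field_derivative deriv \<Xi> v * (- v)) (at x)"
      using \<open>(\<Xi> has_field_derivative deriv \<Xi> v) (at v)\<close> unfolding v_def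
      by (intro DERIV_chain2 [where f=\<Xi>]) (auto intro!: derivative_eq_intros)
    then have "(Y has_field_derivative - y * B y) (at x)" using dv by (simp add: Y_def)
    then show ?thesis using Yx y y0 v(2) by (simp add: Y_def v_def)
  qed
  define A where "A = (\<lambda>x. 1 / Y x)"
  have dA: "(A has_field_derivative B (Y x) / Y x) (at x)" if "h < Re x" for x
    unfolding A_def using key [OF that] by (auto intro!: derivative_eq_intros simp: power2_eq_square)
  have mem: "Y x \<in> ball 0 \<rho>" if "h < Re x" for x using key [OF that] r(2) by blast
  \<comment> \<open>Differentiating twice gives
    \<open>A'' - A = (B(Y) ^ 2 - 1) / Y - B(Y) * B'(Y)\<close>. The relation
    \<open>1 = B(Y) * (1 + Y * \<kappa>(Y))\<close> removes the pole at \<open>Y = 0\<close>, and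
    \<open>F\<close> is the result.\<close>
  define F where "F = (\<lambda>w. - \<kappa> w * (2 + w * \<kappa> w) * (B w)\<^sup>2 - B w * deriv B w)"
  have d2A: "deriv (deriv A) x - A x = F (Y x)" if x: "h < Re x" for x
  proof -
    have "(B has_field_derivative deriv B (Y x)) (at (Y x))"
      using Bh mem [OF x] by (meson holomorphic_derivI open_ball)
    then have "((\<lambda>x. B (Y x) / Y x) has_field_derivative
        (deriv B (Y x) * (- Y x * B (Y x)) * Y x - B (Y x) * (- Y x * B (Y x))) / (Y x * Y x)) (at x)"
      using key [OF x] by (intro DERIV_divide DERIV_chain2 [where f=B]) auto
    moreover have "eventually (\<lambda>x. deriv A x = B (Y x) / Y x) (nhds x)"
      using eventually_nhds_in_open [OF open_right_half_plane, of x h] x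
      by (auto elim!: eventually_mono intro: DERIV_imp_deriv dA)
    ultimately have "deriv (deriv A) x = (deriv B (Y x) * (- Y x * B (Y x)) * Y x - B (Y x) * (- Y x * B (Y x))) / (Y x * Y x)"
      using deriv_cong_ev DERIV_imp_deriv by metis
    also have "\<dots> = ((B (Y x))\<^sup>2 / Y x - B (Y x) * deriv B (Y x))"
      using key [OF x] by (simp add: field_simps power2_eq_square)
    finally have *: "deriv (deriv A) x - A x = ((B (Y x))\<^sup>2 - 1) / Y x - B (Y x) * deriv B (Y x)"
      by (simp add: A_def diff_divide_distrib)
    have "1 = B (Y x) * (1 + Y x * \<kappa> (Y x))"
      using f\<kappa> [of "Y x"] Bnz [OF mem [OF x]] by (simp add: f_def field_simps)
    then have "1 = (B (Y x))\<^sup>2 * (1 + Y x * \<kappa> (Y x))\<^sup>2"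
      by (metis power_mult_distrib power_one)
    then have "((B (Y x))\<^sup>2 - 1) = - Y x * \<kappa> (Y x) * (2 + Y x * \<kappa> (Y x)) * (B (Y x))\<^sup>2"
      by (simp add: algebra_simps power2_eq_square)
    then show ?thesis using key [OF x] unfolding * F_def by (simp add: field_simps)
  qed
  have cb: "cball (0::complex) (r/2) \<subseteq> ball 0 \<rho>" using r by (force simp: subset_iff)
  have "F holomorphic_on ball 0 \<rho>"
    unfolding F_def by (intro holomorphic_intros \<kappa>h Bh holomorphic_deriv open_ball)
  then have "continuous_on (cball 0 (r/2)) F"
    using cb holomorphic_on_imp_continuous_on continuous_on_subset by blast
  then have "bounded (F ` cball 0 (r/2))"
    by (intro compact_imp_bounded compact_continuous_image) auto
  then obtain C where C: "\<And>w. w \<in> cball 0 (r/2) \<Longrightarrow> norm (F w) \<le> C"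
    unfolding bounded_iff by blast
  show ?thesis
  proof (rule that [where h=h and A=A])
    show "A holomorphic_on {x. h < Re x}"
      unfolding holomorphic_on_open [OF open_right_half_plane] using dA by blast
    show "A (x + 2 * of_real pi * \<i>) = A x" if "h < Re x" for x
    proof -
      have "exp (- (x + 2 * of_real pi * \<i>)) = exp (- x)"
        unfolding exp_minus exp_add by simp
      then show ?thesis by (simp add: A_def Y_def)
    qed
    show "deriv A x ^ n = poly R (A x) \<and> poly R (A x) \<noteq> 0" if x: "h < Re x" for x
    proof -
      have Y: "Y x \<noteq> 0" using key [OF x] by simp
      have Q: "Q (Y x) = Y x ^ n * poly R (A x)"
        using Y deg by (simp add: Q_def poly_reflect_poly_nz A_def inverse_eq_divide)
      have "deriv A x ^ n = B (Y x) ^ n / Y x ^ n"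
        by (simp add: DERIV_imp_deriv [OF dA [OF x]] power_divide)
      then show ?thesis using Bn [OF mem [OF x]] \<rho>(2) [OF mem [OF x]] Y Q by simp
    qed
    show "\<exists>h'. \<forall>x. h' < Re x \<longrightarrow> C < norm (A x)" for C
    proof -
      define C' where "C' = max C 1"
      have C': "C' > 0" "C \<le> C'" by (auto simp: C'_def)
      obtain \<epsilon>' where \<epsilon>': "\<epsilon>' > 0" "\<And>v. norm v < \<epsilon>' \<Longrightarrow> norm (\<Xi> v) < 1 / C'"
        using small [of "1/C'"] C' by auto
      have "C < norm (A x)" if "max h (- ln \<epsilon>') < Re x" for x
      proof -
        have "norm (Y x) < 1 / C'" unfolding Y_def using that by (intro \<epsilon>' expsmall) auto
        moreover have "Y x \<noteq> 0" using key [of x] that by simp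
        ultimately have "C' < norm (A x)" using C' by (simp add: A_def norm_divide field_simps)
        then show ?thesis using C' by simp
      qed
      then show ?thesis by blast
    qed
    show "\<exists>C. \<forall>x. h < Re x \<longrightarrow> norm (deriv (deriv A) x - A x) \<le> C"
    proof (intro exI allI impI)
      fix x assume "h < Re x"
      then show "norm (deriv (deriv A) x - A x) \<le> C"
        using C [of "Y x"] d2A [of x] key [of x] by simp
    qed
  qed
qed

section \<open>Maximal half-plane of the solution\<close>

lemma le_one_plus_square: "t \<le> 1 + t\<^sup>2" for t :: real
proof -
  have "0 \<le> (t - 1/2)\<^sup>2" by simp
  also have "(t - 1/2)\<^sup>2 = t\<^sup>2 - t + 1/4" by (simp add: power2_eq_square algebra_simps)
  finally have "0 \<le> t\<^sup>2 - t + 1/4" .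
  then show ?thesis by linarith
qed

lemma norm_poly_le:
  fixes p :: "complex poly"
  shows "norm (poly p a) \<le> (\<Sum>i\<le>degree p. norm (coeff p i)) * (1 + norm a) ^ degree p"
proof -
  have "norm (poly p a) \<le> (\<Sum>i\<le>degree p. norm (coeff p i * a ^ i))"
    unfolding poly_altdef by (rule norm_sum)
  also have "\<dots> \<le> (\<Sum>i\<le>degree p. norm (coeff p i) * (1 + norm a) ^ degree p)"
  proof (rule sum_mono)
    fix i assume "i \<in> {..degree p}"
    then have "norm a ^ i \<le> (1 + norm a) ^ degree p"
      by (intro order_trans [OF power_mono [of "norm a" "1 + norm a" i] power_increasing]) auto
    then show "norm (coeff p i * a ^ i) \<le> norm (coeff p i) * (1 + norm a) ^ degree p"
      by (simp add: norm_mult norm_power mult_left_mono)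
  qed
  finally show ?thesis by (simp add: sum_distrib_right)
qed

text \<open>A second root keeps each multiplicity below the degree. If \<open>z\<close> is the only
  root, the solution is \<open>z + exp x\<close> and approaches \<open>z\<close> only as
  \<open>Re x\<close> tends to minus infinity, which is why that case is treated apart.\<close>

lemma order_less_degree:
  fixes p :: "complex poly"
  assumes "poly p z1 = 0" "poly p z2 = 0" "z1 \<noteq> z2" "p \<noteq> 0"
  shows "order z p < degree p"
proof (rule ccontr)
  assume "\<not> ?thesis"
  then have o: "order z p = degree p" using order_degree [OF assms(4), of z] by simp
  obtain q where q: "p = [:- z, 1:] ^ order z p * q" "poly q z \<noteq> 0"
    by (rule poly_order_factor [OF assms(4)])
  have "q \<noteq> 0" using q(2) by auto
  then have "degree p = order z p + degree q"
    using arg_cong [OF q(1), of degree] by (simp add: degree_mult_eq degree_power_eq)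
  then have "degree q = 0" using o by simp
  then obtain c where "q = [:c:]" by (rule degree_eq_zeroE)
  then have "poly p x = 0 \<Longrightarrow> x = z" for x
    using arg_cong [OF q(1), of "\<lambda>p. poly p x"] q(2) by auto
  then show False using assms by metis
qed

text \<open>A Gronwall estimate: a derivative of at most linear growth in \<open>A\<close> bounds
  \<open>A\<close> near the line by its values one unit further right, which are taken on a compact
  set. Then \<open>A'\<close> is bounded too, and \<open>A\<close> is Lipschitz on the half
  disc.\<close>

lemma boundary_limit:
  assumes hol: "A holomorphic_on {x. h < Re x}" and K: "K \<ge> 0"
    and bd: "\<And>x. h < Re x \<Longrightarrow> norm (deriv A x) \<le> K * (1 + norm (A x))" and w: "Re w = h"
  obtains z where "(A \<longlongrightarrow> z) (at w within half_ball w 1)"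
proof -
  have dA: "(A has_field_derivative deriv A x) (at x)" if "h < Re x" for x
    using hol that open_right_half_plane holomorphic_derivI by blast
  have gron: "1 + (norm (A x))\<^sup>2 \<le> (1 + (norm (A (x + 1)))\<^sup>2) * exp (4 * K)" if x: "h < Re x" for x
  proof -
    define f where "f = (\<lambda>t. A (x + of_real t))"
    define f' where "f' = (\<lambda>t. deriv A (x + of_real t))"
    have f: "(f has_vector_derivative f' t) (at t)" if "0 \<le> t" for t
      unfolding f_def f'_def using x that
      by (intro field_vector_diff_chain_at [where f = "\<lambda>t. x + of_real t" and f' = 1 and g = A, unfolded o_def, simplified] dA)
        (auto intro!: derivative_eq_intros)
    \<comment> \<open>The derivative of \<open>norm (f t) ^ 2\<close> is in absolute value at most
      \<open>2 * K * norm (f t) * (1 + norm (f t))\<close>, hence at most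
      \<open>4 * K * (1 + norm (f t) ^ 2)\<close>; the exponential factor compensates for this, so
      \<phi> cannot decrease.\<close>
    define \<phi> where "\<phi> = (\<lambda>t. (1 + f t \<bullet> f t) * exp (4 * K * t))"
    have step: "\<exists>y. (\<phi> has_real_derivative y) (at t) \<and> y \<ge> 0" if t: "0 \<le> t" for t
    proof -
      have "(\<phi> has_real_derivative ((f t \<bullet> f' t + f' t \<bullet> f t) * exp (4 * K * t) + (1 + f t \<bullet> f t) * (exp (4 * K * t) * (4 * K)))) (at t)"
      proof -
        have "((\<lambda>t. f t \<bullet> f t) has_derivative (\<lambda>s. f t \<bullet> (s *\<^sub>R f' t) + (s *\<^sub>R f' t) \<bullet> f t)) (at t)"
          using f [OF t] unfolding has_vector_derivative_def by (intro has_derivative_inner)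
        then have "((\<lambda>t. f t \<bullet> f t) has_real_derivative f t \<bullet> f' t + f' t \<bullet> f t) (at t)"
          unfolding has_field_derivative_def by (rule has_derivative_eq_rhs) (auto simp: algebra_simps)
        then show ?thesis
          unfolding \<phi>_def by (auto intro!: derivative_eq_intros)
      qed
      moreover have "0 \<le> (f t \<bullet> f' t + f' t \<bullet> f t) * exp (4 * K * t) + (1 + f t \<bullet> f t) * (exp (4 * K * t) * (4 * K))"
      proof -
        have "\<bar>f t \<bullet> f' t\<bar> \<le> norm (f t) * norm (f' t)" by (rule Cauchy_Schwarz_ineq2)
        also have "\<dots> \<le> norm (f t) * (K * (1 + norm (f t)))"
          unfolding f_def f'_def using x t by (intro mult_left_mono bd) auto
        also have "\<dots> = K * (norm (f t) * (1 + norm (f t)))" by simp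
        also have "\<dots> \<le> K * (2 * (1 + (norm (f t))\<^sup>2))"
        proof (rule mult_left_mono [OF _ K])
          show "norm (f t) * (1 + norm (f t)) \<le> 2 * (1 + (norm (f t))\<^sup>2)"
          proof -
            have "norm (f t) * 2 \<le> 1 + (norm (f t))\<^sup>2"
              using sum_squares_bound [of 1 "norm (f t)"] by simp
            moreover have e: "norm (f t) * (1 + norm (f t)) = norm (f t) + (norm (f t))\<^sup>2"
              by (simp add: algebra_simps power2_eq_square)
            ultimately show ?thesis using zero_le_power2 [of "norm (f t)"] by (smt (verit))
          qed
        qed
        finally have *: "\<bar>f t \<bullet> f' t\<bar> \<le> K * (2 * (1 + f t \<bullet> f t))" by (simp add: power2_norm_eq_inner)
        have "(1 + f t \<bullet> f t) * (4 * K) = 2 * (K * (2 * (1 + f t \<bullet> f t)))" by simp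
        with * have "0 \<le> (f t \<bullet> f' t + f' t \<bullet> f t + (1 + f t \<bullet> f t) * (4 * K))"
          unfolding inner_commute [of "f' t" "f t"] by linarith
        then have "0 \<le> (f t \<bullet> f' t + f' t \<bullet> f t + (1 + f t \<bullet> f t) * (4 * K)) * exp (4 * K * t)" by simp
        then show ?thesis by (simp add: algebra_simps)
      qed
      ultimately show ?thesis by blast
    qed
    have "\<phi> 0 \<le> \<phi> 1"
      by (rule DERIV_nonneg_imp_nondecreasing [OF _ step]) simp_all
    then show ?thesis by (simp add: \<phi>_def f_def power2_norm_eq_inner)
  qed
  define S where "S = {x. h + 1 \<le> Re x \<and> Re x \<le> h + 2 \<and> Im w - 1 \<le> Im x \<and> Im x \<le> Im w + 1}"
  have "continuous_on S A"
    by (rule continuous_on_subset [OF holomorphic_on_imp_continuous_on [OF hol]]) (auto simp: S_def)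
  then have "bounded (A ` S)"
    by (intro compact_imp_bounded compact_continuous_image) (simp_all add: S_def compact_strip)
  then obtain C where C: "\<And>x. x \<in> S \<Longrightarrow> norm (A x) \<le> C" unfolding bounded_iff by blast
  define M where "M = (1 + C\<^sup>2) * exp (4 * K)"
  have AM: "norm (A x) \<le> M" if x: "x \<in> half_ball w 1" for x
  proof -
    have "\<bar>Re (x - w)\<bar> < 1" "\<bar>Im (x - w)\<bar> < 1"
      using x abs_Re_le_cmod [of "x - w"] abs_Im_le_cmod [of "x - w"] by (auto simp: half_ball_def dist_norm norm_minus_commute)
    then have "x + 1 \<in> S" "h < Re x" using x w by (auto simp: S_def half_ball_def)
    then have "1 + (norm (A x))\<^sup>2 \<le> (1 + (norm (A (x + 1)))\<^sup>2) * exp (4 * K)" "norm (A (x + 1)) \<le> C"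
      using gron C by auto
    moreover from this(2) have "(norm (A (x + 1)))\<^sup>2 \<le> C\<^sup>2" by (intro power_mono) auto
    ultimately have "1 + (norm (A x))\<^sup>2 \<le> M"
      unfolding M_def by (smt (verit) exp_gt_zero mult_right_mono)
    moreover have "norm (A x) \<le> 1 + (norm (A x))\<^sup>2"
      by (rule le_one_plus_square)
    ultimately show ?thesis by linarith
  qed
  have "norm (A x - A y) \<le> K * (1 + M) * norm (x - y)" if "x \<in> half_ball w 1" "y \<in> half_ball w 1" for x y
  proof (rule field_differentiable_bound [OF convex_half_ball, of w 1])
    fix z assume z: "z \<in> half_ball w 1"
    then have "h < Re z" using w by (simp add: half_ball_def)
    then show "(A has_field_derivative deriv A z) (at z within half_ball w 1)"
      using dA has_field_derivative_at_within by blast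
    show "norm (deriv A z) \<le> K * (1 + M)"
      using bd [OF \<open>h < Re z\<close>] AM [OF z] K by (smt (verit) mult_left_mono)
  qed (use that in auto)
  moreover have "0 \<le> K * (1 + M)" using K by (simp add: M_def)
  ultimately have "(K * (1 + M))-lipschitz_on (half_ball w 1) A"
    by (auto simp: lipschitz_on_def dist_norm)
  then have "uniformly_continuous_on (half_ball w 1) A" by (rule lipschitz_on_uniformly_continuous)
  moreover have "w \<in> closure (half_ball w 1)"
    using islimpt_half_ball [of 1 w] by (simp add: closure_def)
  ultimately show ?thesis using uniformly_continuous_on_extension_at_closure that by metis
qed

text \<open>\<open>X\<close> collects the left ends of half-planes to which the solution extends
  with \<open>R(A)\<close> zero-free. It is bounded below: otherwise \<open>A\<close> would be
  entire and omit two roots, hence be constant by little Picard, against its growth. At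
  \<open>h0 = Inf X\<close> some boundary limit is a root, for otherwise every boundary point is
  regular and \<open>A\<close> extends to a larger half-plane.\<close>

lemma exterior_solution:
  fixes R :: "complex poly"
  assumes deg: "degree R = n" "n > 0" and monic: "lead_coeff R = 1"
    and roots: "poly R z1 = 0" "poly R z2 = 0" "z1 \<noteq> z2"
  obtains h0 A where "A holomorphic_on {x. h0 < Re x}"
    "\<And>x. h0 < Re x \<Longrightarrow> A (x + 2 * of_real pi * \<i>) = A x"
    "\<And>x. h0 < Re x \<Longrightarrow> deriv A x ^ n = poly R (A x) \<and> poly R (A x) \<noteq> 0"
    "\<And>C. \<exists>h'. \<forall>x. h' < Re x \<longrightarrow> C < norm (A x)"
    "\<exists>h' C. \<forall>x. h' < Re x \<longrightarrow> norm (deriv (deriv A) x - A x) \<le> C"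
    "\<And>w. Re w = h0 \<Longrightarrow> \<exists>z. (A \<longlongrightarrow> z) (at w within half_ball w 1)"
    "\<exists>w z. Re w = h0 \<and> (A \<longlongrightarrow> z) (at w within half_ball w 1) \<and> poly R z = 0"
proof -
  obtain hb A0 where A0: "A0 holomorphic_on {x. hb < Re x}"
    "\<And>x. hb < Re x \<Longrightarrow> A0 (x + 2 * of_real pi * \<i>) = A0 x"
    "\<And>x. hb < Re x \<Longrightarrow> deriv A0 x ^ n = poly R (A0 x) \<and> poly R (A0 x) \<noteq> 0"
    "\<And>C. \<exists>h'. \<forall>x. h' < Re x \<longrightarrow> C < norm (A0 x)"
    "\<exists>C. \<forall>x. hb < Re x \<longrightarrow> norm (deriv (deriv A0) x - A0 x) \<le> C"
    by (rule solution_at_infinity [OF deg monic]) (rule that)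
  \<comment> \<open>The differential equation is inherited from \<open>A0\<close> by the identity
    theorem, so \<open>P\<close> records only holomorphy, the zero-free condition and agreement with
    \<open>A0\<close>.\<close>
  define P where "P = (\<lambda>h A. h \<le> hb \<and> A holomorphic_on {x. h < Re x} \<and> (\<forall>x. h < Re x \<longrightarrow> poly R (A x) \<noteq> 0)
      \<and> (\<forall>x. hb < Re x \<longrightarrow> A x = A0 x))"
  have uniq: "f x = g x" if "f holomorphic_on {x. h < Re x}" "g holomorphic_on {x. h < Re x}" "h \<le> h'"
    "\<And>x. h' < Re x \<Longrightarrow> f x = g x" "h < Re x" for f g h h' x
  proof (rule analytic_continuation_open [of "{x. h' < Re x}" "{x. h < Re x}" f g x])
    have "of_real (h' + 1) \<in> {x. h' < Re x}" by simp
    then show "{x. h' < Re x} \<noteq> {}" by blast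
  qed (use that in \<open>auto intro: open_right_half_plane connected_right_half_plane\<close>)
  define X where "X = {h. \<exists>A. P h A}"
  have hbX: "hb \<in> X" using A0 by (auto simp: X_def P_def)
  define G where "G = (\<lambda>h. SOME A. P h A)"
  have G: "P h (G h)" if "h \<in> X" for h
  proof -
    from that obtain A where "P h A" unfolding X_def by blast
    then show ?thesis unfolding G_def by (rule someI [of "P h"])
  qed
  define H where "H = {x. \<exists>h\<in>X. h < Re x}"
  \<comment> \<open>The chosen extensions agree where they overlap, so the value may be read off
    from any half-plane that contains \<open>x\<close>.\<close>
  define A where "A = (\<lambda>x. G (SOME h. h \<in> X \<and> h < Re x) x)"
  have AG: "A x = G h x" if h: "h \<in> X" "h < Re x" for h x
  proof -
    define h' where "h' = (SOME h. h \<in> X \<and> h < Re x)"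
    have h': "h' \<in> X \<and> h' < Re x" unfolding h'_def by (rule someI [of _ h]) (use h in auto)
    have "G h' x = G h x"
    proof (rule uniq [of "G h'" "max h h'" "G h" hb x])
      show "G h' holomorphic_on {x. max h h' < Re x}" "G h holomorphic_on {x. max h h' < Re x}"
        using G [of h] G [of h'] h h' unfolding P_def by (auto elim!: holomorphic_on_subset)
    qed (use G [of h] G [of h'] h h' in \<open>auto simp: P_def\<close>)
    then show ?thesis by (simp add: A_def h'_def)
  qed
  have Ah: "A holomorphic_on {x. h < Re x}" if "h \<in> X" for h
  proof -
    have "G h holomorphic_on {x. h < Re x}" using G [OF that] by (simp add: P_def)
    then show ?thesis by (rule holomorphic_transform) (use AG that in auto)
  qed
  have AA0: "A x = A0 x" if "hb < Re x" for x
    using AG [OF hbX that] G [OF hbX] that by (simp add: P_def)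
  have Anz: "poly R (A x) \<noteq> 0" if "h \<in> X" "h < Re x" for h x
    using AG [OF that] G [OF that(1)] that by (simp add: P_def)
  have Xhb: "h \<le> hb" if "h \<in> X" for h using G [OF that] by (simp add: P_def)
  have Aper: "A (x + 2 * of_real pi * \<i>) = A x" if h: "h \<in> X" "h < Re x" for h x
  proof (rule uniq [of "\<lambda>x. A (x + 2 * of_real pi * \<i>)" h A hb x])
    show "(\<lambda>x. A (x + 2 * of_real pi * \<i>)) holomorphic_on {x. h < Re x}"
      by (intro holomorphic_on_compose_gen [OF _ Ah [OF h(1)], unfolded o_def] holomorphic_intros) auto
  qed (use h Ah Xhb A0(2) AA0 in auto)
  have A0d: "deriv A x = deriv A0 x" if "hb < Re x" for x
  proof (rule deriv_cong_ev)
    show "eventually (\<lambda>x. A x = A0 x) (nhds x)"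
      using eventually_nhds_in_open [OF open_right_half_plane, of x hb] that by (auto elim!: eventually_mono intro: AA0)
  qed simp
  have A0dd: "deriv (deriv A) x = deriv (deriv A0) x" if "hb < Re x" for x
  proof (rule deriv_cong_ev)
    show "eventually (\<lambda>x. deriv A x = deriv A0 x) (nhds x)"
      using eventually_nhds_in_open [OF open_right_half_plane, of x hb] that by (auto elim!: eventually_mono intro: A0d)
  qed simp
  have Aode: "deriv A x ^ n = poly R (A x)" if h: "h \<in> X" "h < Re x" for h x
  proof (rule uniq [of "\<lambda>x. deriv A x ^ n" h "\<lambda>x. poly R (A x)" hb x])
    show "(\<lambda>x. deriv A x ^ n) holomorphic_on {x. h < Re x}" "(\<lambda>x. poly R (A x)) holomorphic_on {x. h < Re x}"
      by (intro holomorphic_intros holomorphic_deriv Ah h open_right_half_plane)+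
  qed (use h Xhb A0(3) AA0 A0d in auto)
  obtain C1 where "\<forall>x. hb < Re x \<longrightarrow> norm (deriv (deriv A0) x - A0 x) \<le> C1" using A0(5) by blast
  then have Abd: "\<forall>x. hb < Re x \<longrightarrow> norm (deriv (deriv A) x - A x) \<le> C1" using A0dd AA0 by simp
  have Ainf: "\<exists>h'. \<forall>x. h' < Re x \<longrightarrow> C < norm (A x)" for C
  proof -
    obtain h' where "\<forall>x. h' < Re x \<longrightarrow> C < norm (A0 x)" using A0(4) by blast
    then show ?thesis using AA0 by (intro exI [of _ "max h' hb"]) auto
  qed
  have below: "bdd_below X"
  proof (rule ccontr)
    assume nb: "\<not> bdd_below X"
    then have all: "\<exists>h\<in>X. h < c" for c unfolding bdd_below_def by (meson not_le)
    have "A holomorphic_on UNIV"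
    proof (rule holomorphic_on_local)
      fix x :: complex
      obtain h where "h \<in> X" "h < Re x" using all by blast
      then show "\<exists>U. open U \<and> x \<in> U \<and> A holomorphic_on U" using Ah open_right_half_plane by blast
    qed
    moreover have "range A \<inter> {z1, z2} = {}"
    proof -
      have "A x \<noteq> z1 \<and> A x \<noteq> z2" for x using all [of "Re x"] Anz roots by metis
      then show ?thesis by auto
    qed
    ultimately obtain c where "A = (\<lambda>x. c)" using little_Picard [OF _ roots(3)] by blast
    moreover obtain h' where "\<forall>x. h' < Re x \<longrightarrow> norm c < norm (A x)" using Ainf by blast
    ultimately show False by (metis Re_complex_of_real less_add_one less_irrefl)
  qed
  define h0 where "h0 = Inf X"
  have X_near: "\<exists>h\<in>X. h < c" if "h0 < c" for c
    using that hbX below unfolding h0_def by (metis cInf_lessD empty_iff)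
  have h0hb: "h0 \<le> hb" unfolding h0_def by (rule cInf_lower [OF hbX below])
  have hol: "A holomorphic_on {x. h0 < Re x}"
  proof (rule holomorphic_on_local)
    fix x assume "x \<in> {x. h0 < Re x}"
    then obtain h where "h \<in> X" "h < Re x" using X_near by auto
    then show "\<exists>U. open U \<and> x \<in> U \<and> A holomorphic_on U" using Ah open_right_half_plane by blast
  qed
  have per: "A (x + 2 * of_real pi * \<i>) = A x" if "h0 < Re x" for x
    using X_near [OF that] Aper by blast
  have ode: "deriv A x ^ n = poly R (A x) \<and> poly R (A x) \<noteq> 0" if "h0 < Re x" for x
    using X_near [OF that] Aode Anz by blast
  have R0: "R \<noteq> 0" using deg by auto
  \<comment> \<open>\<open>norm (A') ^ n = norm (R(A)) \<le> S * (1 + norm A) ^ n\<close>, so the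
    \<open>n\<close>-th root \<open>K\<close> of \<open>S\<close> is a growth constant for
    \<open>boundary_limit\<close>.\<close>
  define S where "S = (\<Sum>i\<le>n. norm (coeff R i))"
  have S0: "S \<ge> 0" unfolding S_def by (intro sum_nonneg) auto
  define K where "K = root n S"
  have K: "K \<ge> 0" "K ^ n = S" using S0 deg by (auto simp: K_def)
  have bd: "norm (deriv A x) \<le> K * (1 + norm (A x))" if "h0 < Re x" for x
  proof (rule power_le_imp_le_base)
    have "norm (deriv A x) ^ n \<le> (K * (1 + norm (A x))) ^ n"
      using norm_poly_le [of R "A x"] ode [OF that] by (simp add: power_mult_distrib K deg S_def flip: norm_power)
    then show "norm (deriv A x) ^ Suc (n - 1) \<le> (K * (1 + norm (A x))) ^ Suc (n - 1)" using deg by simp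
    show "0 \<le> K * (1 + norm (A x))" using K by simp
  qed
  have lims: "\<exists>z. (A \<longlongrightarrow> z) (at w within half_ball w 1)" if "Re w = h0" for w
    using boundary_limit [OF hol K(1) bd that] by blast
  have zero: "\<exists>w z. Re w = h0 \<and> (A \<longlongrightarrow> z) (at w within half_ball w 1) \<and> poly R z = 0"
  proof (rule ccontr)
    assume "\<not> ?thesis"
    then have nz: "poly R z \<noteq> 0" if "Re w = h0" "(A \<longlongrightarrow> z) (at w within half_ball w 1)" for w z
      using that by blast
    have loc: "\<exists>\<delta> f. \<delta> > 0 \<and> f holomorphic_on ball w \<delta> \<and> f ` ball w \<delta> \<subseteq> {a. poly R a \<noteq> 0} \<and> (\<forall>x\<in>half_ball w \<delta>. f x = A x)"
      if w: "Re w = h0" for w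
    proof -
      obtain z where z: "(A \<longlongrightarrow> z) (at w within half_ball w 1)" using lims w by blast
      \<comment> \<open>Multiplicity 0 is the regular case of \<open>flow_extension_at_root\<close>,
        where \<open>n - 0\<close> divides \<open>n\<close> trivially.\<close>
      have "order z R = 0" using nz [OF w z] by (simp add: order_root)
      moreover have "A holomorphic_on half_ball w 1"
        using hol by (rule holomorphic_on_subset) (auto simp: half_ball_def w)
      moreover have "deriv A x ^ n = poly R (A x) \<and> poly R (A x) \<noteq> 0" if "x \<in> half_ball w 1" for x
        using ode that w by (auto simp: half_ball_def)
      ultimately obtain \<delta> f where f: "\<delta> > 0" "f holomorphic_on ball w \<delta>" "\<And>x. x \<in> half_ball w 1 \<inter> ball w \<delta> \<Longrightarrow> f x = A x"
        using flow_extension_at_root [of 1 A w z n R] z deg by (metis diff_zero dvd_refl zero_less_one)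
      define \<delta>1 where "\<delta>1 = min 1 \<delta>"
      have \<delta>1: "\<delta>1 > 0" using f(1) by (simp add: \<delta>1_def)
      have fA: "f x = A x" if "x \<in> half_ball w \<delta>1" for x
        using that by (intro f) (auto simp: half_ball_def \<delta>1_def)
      have fc: "isCont f w"
        using f(1,2) by (meson centre_in_ball continuous_on_eq_continuous_at holomorphic_on_imp_continuous_on open_ball)
      have "(f \<longlongrightarrow> f w) (at w within half_ball w \<delta>1)"
        using fc isCont_def tendsto_within_subset by blast
      moreover have "(f \<longlongrightarrow> z) (at w within half_ball w \<delta>1)"
        using z unfolding at_within_half_ball [OF zero_less_one \<delta>1]
        by (rule Lim_transform_eventually) (auto simp: eventually_at_filter fA)
      ultimately have "f w = z" using tendsto_unique [OF at_within_half_ball_neq_bot [OF \<delta>1]] by blast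
      then have "poly R (f w) \<noteq> 0" using nz [OF w z] by simp
      moreover have "isCont (\<lambda>x. poly R (f x)) w"
        by (rule isCont_o2 [OF fc]) (rule poly_isCont)
      ultimately have "eventually (\<lambda>x. poly R (f x) \<noteq> 0) (nhds w)"
        unfolding eventually_nhds_metric
        using continuous_at_avoid [of w "\<lambda>x. poly R (f x)" 0] by (auto simp: dist_commute)
      then obtain \<delta>2 where \<delta>2: "\<delta>2 > 0" "\<And>x. dist x w < \<delta>2 \<Longrightarrow> poly R (f x) \<noteq> 0"
        unfolding eventually_nhds_metric by blast
      show ?thesis
      proof (intro exI [of _ "min \<delta>1 \<delta>2"] exI [of _ f] conjI ballI)
        show "f holomorphic_on ball w (min \<delta>1 \<delta>2)"
          using f(2) by (rule holomorphic_on_subset) (auto simp: \<delta>1_def)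
        show "f ` ball w (min \<delta>1 \<delta>2) \<subseteq> {a. poly R a \<noteq> 0}" using \<delta>2 by (auto simp: dist_commute)
        show "f x = A x" if "x \<in> half_ball w (min \<delta>1 \<delta>2)" for x
          using that by (intro fA) (auto simp: half_ball_def)
      qed (use \<delta>1 \<delta>2 in auto)
    qed
    obtain \<delta> B where B: "\<delta> > 0" "B holomorphic_on {x. h0 - \<delta> < Re x}" "\<And>x. h0 < Re x \<Longrightarrow> B x = A x"
      "\<And>x. h0 - \<delta> < Re x \<Longrightarrow> Re x \<le> h0 \<Longrightarrow> B x \<in> {a. poly R a \<noteq> 0}"
      by (rule line_extension [OF hol per loc]) (assumption | rule that)+
    have "P (h0 - \<delta>) B" unfolding P_def
    proof (intro conjI allI impI)
      show "poly R (B x) \<noteq> 0" if "h0 - \<delta> < Re x" for x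
        using B(3,4) [of x] ode [of x] that by (cases "h0 < Re x") auto
    qed (use B h0hb AA0 in auto)
    then have "h0 - \<delta> \<in> X" by (auto simp: X_def)
    then have "h0 \<le> h0 - \<delta>" unfolding h0_def by (rule cInf_lower [OF _ below])
    then show False using B(1) by simp
  qed
  show ?thesis
    by (rule that [of A h0]) (use hol per ode Ainf Abd lims zero in auto)
qed

subsection \<open>Symmetry about a branch point\<close>

lemma right_half_plane_unique:
  assumes "f holomorphic_on {x. h < Re x}" "g holomorphic_on {x. h < Re x}" "h \<le> h'"
    "\<And>x. h' < Re x \<Longrightarrow> f x = g x" "h < Re x"
  shows "f x = g x"
proof (rule analytic_continuation_open [of "{x. h' < Re x}" "{x. h < Re x}" f g x])
  have "of_real (h' + 1) \<in> {x. h' < Re x}" by simp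
  then show "{x. h' < Re x} \<noteq> {}" by blast
qed (use assms in \<open>auto intro: open_right_half_plane connected_right_half_plane\<close>)

lemma periodic_bounded_on_strip:
  fixes f :: "complex \<Rightarrow> complex"
  assumes "continuous_on {x. h < Re x} f" "\<And>x. h < Re x \<Longrightarrow> f (x + 2 * of_real pi * \<i>) = f x" "h < a"
  obtains C where "\<And>x. a \<le> Re x \<Longrightarrow> Re x \<le> b \<Longrightarrow> norm (f x) \<le> C"
proof -
  define S where "S = {x. a \<le> Re x \<and> Re x \<le> b \<and> 0 \<le> Im x \<and> Im x \<le> 2 * pi}"
  have "continuous_on S f"
    by (rule continuous_on_subset [OF assms(1)]) (use assms(3) in \<open>auto simp: S_def\<close>)
  then have "bounded (f ` S)"
    by (intro compact_imp_bounded compact_continuous_image) (simp_all add: S_def compact_strip)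
  then obtain C where C: "\<And>x. x \<in> S \<Longrightarrow> norm (f x) \<le> C" unfolding bounded_iff by blast
  show ?thesis
  proof (rule that [of C])
    fix x assume x: "a \<le> Re x" "Re x \<le> b"
    obtain k where k: "0 \<le> Im (x - 2 * of_real pi * \<i> * of_int k)" "Im (x - 2 * of_real pi * \<i> * of_int k) \<le> 2 * pi"
      "Re (x - 2 * of_real pi * \<i> * of_int k) = Re x"
      by (rule periodic_representative)
    have "f ((x - 2 * of_real pi * \<i> * of_int k) + 2 * of_real pi * \<i> * of_int k) = f (x - 2 * of_real pi * \<i> * of_int k)"
      by (rule periodic_shift [of h f, OF assms(2)]) (use k(3) x assms(3) in auto)
    then have "f x = f (x - 2 * of_real pi * \<i> * of_int k)" by simp
    moreover have "x - 2 * of_real pi * \<i> * of_int k \<in> S" using k x by (simp add: S_def)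
    ultimately show "norm (f x) \<le> C" using C by metis
  qed
qed

text \<open>The functions \<open>(f - c + f') * exp (- x)\<close> and
  \<open>(f - c - f') * exp x\<close> have derivative zero.\<close>

lemma second_order_linear_ode:
  assumes f: "f holomorphic_on UNIV" and ode: "\<And>x. deriv (deriv f) x = f x - c"
  obtains \<alpha> \<beta> where "\<And>x. f x = c + \<alpha> * exp x + \<beta> * exp (- x)"
proof -
  have d: "(f has_field_derivative deriv f x) (at x)" for x
    using f by (meson UNIV_I holomorphic_derivI open_UNIV)
  have "deriv f holomorphic_on UNIV" using f by (intro holomorphic_deriv) auto
  then have d2: "(deriv f has_field_derivative f x - c) (at x)" for x
    using ode by (metis UNIV_I holomorphic_derivI open_UNIV)
  have "((\<lambda>x. (f x - c + deriv f x) * exp (- x)) has_field_derivative 0) (at x)" for x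
    by (auto intro!: derivative_eq_intros d d2 simp: algebra_simps)
  then have "\<exists>p. \<forall>x\<in>UNIV. (f x - c + deriv f x) * exp (- x) = p"
    by (intro has_field_derivative_zero_constant) auto
  then obtain p where p: "(f x - c + deriv f x) * exp (- x) = p" for x by auto
  have "((\<lambda>x. (f x - c - deriv f x) * exp x) has_field_derivative 0) (at x)" for x
    by (auto intro!: derivative_eq_intros d d2 simp: algebra_simps)
  then have "\<exists>p. \<forall>x\<in>UNIV. (f x - c - deriv f x) * exp x = p"
    by (intro has_field_derivative_zero_constant) auto
  then obtain q where q: "(f x - c - deriv f x) * exp x = q" for x by auto
  have "f x = c + (p/2) * exp x + (q/2) * exp (- x)" for x
  proof -
    have "p * exp x = f x - c + deriv f x" using p [of x] by (auto simp: exp_minus field_simps)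
    moreover have "q * exp (- x) = f x - c - deriv f x" using q [of x] by (auto simp: exp_minus field_simps)
    ultimately have "f x - c = (p * exp x + q * exp (- x)) / 2" by simp
    then show ?thesis by (simp add: add_divide_distrib diff_eq_eq add_ac)
  qed
  then show ?thesis using that by blast
qed

lemma has_field_derivative_diff_arg:
  fixes f :: "complex \<Rightarrow> complex"
  assumes "(f has_field_derivative d) (at (c - x))"
  shows "((\<lambda>x. f (c - x)) has_field_derivative - d) (at x)"
proof -
  have "((\<lambda>x. f (c - x)) has_field_derivative d * (- 1)) (at x)"
    by (rule DERIV_chain2 [where f = f and g = "\<lambda>x. c - x"]) (auto intro!: derivative_eq_intros assms)
  then show ?thesis by simp
qed

lemma has_field_derivative_reflect:
  assumes "(f has_field_derivative d) (at (2 * of_real h - cnj x))"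
  shows "((\<lambda>x. cnj (f (2 * of_real h - cnj x))) has_field_derivative - cnj d) (at x)"
proof -
  define g where "g = (\<lambda>y. f (2 * of_real h - y))"
  have "(g has_field_derivative - d) (at (cnj x))"
    unfolding g_def by (rule has_field_derivative_diff_arg [OF assms])
  then have "(cnj \<circ> g \<circ> cnj has_field_derivative cnj (- d)) (at x)"
    using has_field_derivative_cnj_cnj by force
  then show ?thesis by (simp add: g_def o_def)
qed

text \<open>Schwarz reflection in the line \<open>Re x = h\<close>, where
  \<open>2 * of_real h - cnj x\<close> is the mirror image of \<open>x\<close>. For
  \<open>h0 < h\<close> a neighbourhood of the boundary \<open>Re x = h0\<close> receives values
  from the interior of the half-plane.\<close>

lemma holomorphic_on_reflect:
  assumes "f holomorphic_on {x. h0 < Re x}"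
  shows "(\<lambda>x. cnj (f (2 * of_real h - cnj x))) holomorphic_on {x. Re x < 2 * h - h0}"
proof -
  have "\<exists>d. ((\<lambda>x. cnj (f (2 * of_real h - cnj x))) has_field_derivative d) (at x)" if "Re x < 2 * h - h0" for x
  proof -
    have "(f has_field_derivative deriv f (2 * of_real h - cnj x)) (at (2 * of_real h - cnj x))"
      using that by (intro holomorphic_derivI [OF assms open_right_half_plane]) auto
    then show ?thesis by (blast intro: has_field_derivative_reflect)
  qed
  then show ?thesis by (simp add: holomorphic_on_open open_halfspace_Re_lt)
qed

text \<open>The reality condition says that the left side equals its Schwarz reflection in \<open>Re x = h\<close>,
  which is holomorphic near the singular line \<open>Re x = h0\<close>. At a root of multiplicity \<open>k\<close> this makes
  \<open>A\<close> invariant under rotation by \<open>2 * pi / e\<close> with \<open>e = n / (n - k)\<close>, and \<open>e \<ge> 3\<close> would map the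
  line \<open>Re x = h0\<close>, where \<open>A\<close> is bounded, to a ray along which it is not.\<close>

lemma exterior_solution_joukowski:
  fixes R R1 :: "complex poly"
  assumes deg: "degree R = n" "n > 0"
    and roots: "poly R z1 = 0" "poly R z2 = 0" "z1 \<noteq> z2"
    and hol: "A holomorphic_on {x. h0 < Re x}"
    and per: "\<And>x. h0 < Re x \<Longrightarrow> A (x + 2 * of_real pi * \<i>) = A x"
    and ode: "\<And>x. h0 < Re x \<Longrightarrow> deriv A x ^ n = poly R (A x) \<and> poly R (A x) \<noteq> 0"
    and inf: "\<And>C. \<exists>h'. \<forall>x. h' < Re x \<longrightarrow> C < norm (A x)"
    and asym: "\<exists>h' C. \<forall>x. h' < Re x \<longrightarrow> norm (deriv (deriv A) x - A x) \<le> C"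
    and lims: "\<And>w. Re w = h0 \<Longrightarrow> \<exists>z. (A \<longlongrightarrow> z) (at w within half_ball w 1)"
    and zero: "\<exists>w z. Re w = h0 \<and> (A \<longlongrightarrow> z) (at w within half_ball w 1) \<and> poly R z = 0"
    and h: "h0 < h"
    and real: "\<And>x. Re x = h \<Longrightarrow>
       (poly R1 (A x) - cnj (A x) * poly (pderiv R) (A x)) / deriv A x ^ (n - 2) \<in> \<real>"
  obtains c \<alpha> \<beta> where "\<And>x. h0 < Re x \<Longrightarrow> A x = c + \<alpha> * exp x + \<beta> * exp (- x)"
proof -
  have R0: "R \<noteq> 0" using deg by auto
  note ord = order_less_degree [OF roots R0, unfolded deg(1)]
  have dA: "(A has_field_derivative deriv A x) (at x)" if "h0 < Re x" for x
    using hol that open_right_half_plane holomorphic_derivI by blast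
  have dA0: "deriv A x \<noteq> 0" if "h0 < Re x" for x using ode [OF that] deg by (auto simp: power_0_left)
  have hA': "deriv A holomorphic_on {x. h0 < Re x}" by (intro holomorphic_deriv hol open_right_half_plane)
  define \<sigma> where "\<sigma> = (\<lambda>x. 2 * of_real h - cnj x)"
  \<comment> \<open>\<open>b\<close>, \<open>V\<close>, \<open>D\<close> are the reflections of
    \<open>A\<close>, \<open>R1(A) / A' ^ (n - 2)\<close> and \<open>R'(A) / A' ^ (n - 2)\<close>.
    On \<open>Re x = h\<close> the function \<open>b\<close> is \<open>cnj (A x)\<close>, and
    \<open>V - A * D\<close> is the conjugate of the quotient assumed to be real. Unlike
    \<open>A\<close>, all three are known to be holomorphic across \<open>Re x = h0\<close>.\<close>
  define b where "b = (\<lambda>x. cnj (A (\<sigma> x)))"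
  define V where "V = (\<lambda>x. cnj (poly R1 (A (\<sigma> x)) / deriv A (\<sigma> x) ^ (n - 2)))"
  define D where "D = (\<lambda>x. cnj (poly (pderiv R) (A (\<sigma> x)) / deriv A (\<sigma> x) ^ (n - 2)))"
  have bh: "b holomorphic_on {x. Re x < 2 * h - h0}"
    unfolding b_def \<sigma>_def by (intro holomorphic_on_reflect hol)
  have Vh: "V holomorphic_on {x. Re x < 2 * h - h0}"
    unfolding V_def \<sigma>_def
    by (intro holomorphic_on_reflect [where f="\<lambda>x. poly R1 (A x) / deriv A x ^ (n - 2)"] holomorphic_intros hol hA') (use dA0 in auto)
  have Dh: "D holomorphic_on {x. Re x < 2 * h - h0}"
    unfolding D_def \<sigma>_def
    by (intro holomorphic_on_reflect [where f="\<lambda>x. poly (pderiv R) (A x) / deriv A x ^ (n - 2)"] holomorphic_intros hol hA') (use dA0 in auto)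
  have db: "deriv b w \<noteq> 0" if "Re w < 2 * h - h0" for w
  proof -
    have "(b has_field_derivative - cnj (deriv A (\<sigma> w))) (at w)"
      unfolding b_def \<sigma>_def using that by (intro has_field_derivative_reflect dA) auto
    then show ?thesis using dA0 [of "\<sigma> w"] that by (simp add: DERIV_imp_deriv \<sigma>_def)
  qed
  define S where "S = {x. h0 < Re x} \<inter> {x. Re x < 2 * h - h0}"
  have S: "open S" "convex S" unfolding S_def
    by (auto intro: convex_halfspace_Re_gt convex_halfspace_Re_lt convex_Int open_Int open_halfspace_Re_gt open_halfspace_Re_lt)
  define F where "F = (\<lambda>x. (poly R1 (A x) - b x * poly (pderiv R) (A x)) / deriv A x ^ (n - 2) - (V x - A x * D x))"
  have sub: "A holomorphic_on S" "deriv A holomorphic_on S" "b holomorphic_on S" "V holomorphic_on S" "D holomorphic_on S"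
    using hol hA' bh Vh Dh by (auto simp: S_def intro: holomorphic_on_subset)
  have Fh: "F holomorphic_on S"
    unfolding F_def by (intro holomorphic_intros sub) (use dA0 in \<open>auto simp: S_def\<close>)
  \<comment> \<open>Reality makes \<open>F\<close> vanish on the line \<open>Re x = h\<close>, and
    the identity theorem carries this to the whole strip, whose left edge is the line
    \<open>Re x = h0\<close>.\<close>
  have F0: "F x = 0" if x: "x \<in> S" for x
  proof (rule analytic_continuation [OF Fh S(1) convex_connected [OF S(2)], of "{x. Re x = h}" "of_real h"])
    show "of_real h islimpt {x. Re x = h}"
      unfolding islimpt_approachable
    proof (intro allI impI)
      fix e :: real assume "e > 0"
      then show "\<exists>x'\<in>{x. Re x = h}. x' \<noteq> of_real h \<and> dist x' (of_real h) < e"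
        by (intro bexI [of _ "Complex h (e/2)"]) (auto simp: complex_eq_iff dist_norm cmod_def)
    qed
    fix y assume "y \<in> {x. Re x = h}"
    then have y: "Re y = h" by simp
    then have \<sigma>y: "\<sigma> y = y" by (simp add: \<sigma>_def complex_eq_iff)
    have "cnj ((poly R1 (A y) - cnj (A y) * poly (pderiv R) (A y)) / deriv A y ^ (n - 2)) =
        (poly R1 (A y) - cnj (A y) * poly (pderiv R) (A y)) / deriv A y ^ (n - 2)"
      using real [OF y] by (simp only: Reals_cnj_iff)
    then show "F y = 0"
      by (simp add: F_def b_def V_def D_def \<sigma>y diff_divide_distrib)
  qed (use h x in \<open>auto simp: S_def\<close>)
  have dvd: "n - order z R dvd n" if w: "Re w = h0" and z: "(A \<longlongrightarrow> z) (at w within half_ball w 1)" for w z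
  proof (cases "order z R = 0")
    case False
    \<comment> \<open>A half disc at \<open>Re x = h0\<close> of radius at most
      \<open>2 * (h - h0)\<close> stays in the strip that is symmetric about
      \<open>Re x = h\<close>.\<close>
    define r where "r = min 1 (2 * (h - h0))"
    have r: "r > 0" "r \<le> 1" "r \<le> 2 * (h - h0)" using h by (auto simp: r_def)
    have half: "half_ball w r \<subseteq> S" "ball w r \<subseteq> {x. Re x < 2 * h - h0}"
    proof -
      have "Re x < h0 + r" if "x \<in> ball w r" for x
        using that abs_Re_le_cmod [of "w - x"] w by (auto simp: dist_norm)
      then show "half_ball w r \<subseteq> S" "ball w r \<subseteq> {x. Re x < 2 * h - h0}"
        using r(3) w by (fastforce simp: half_ball_def S_def)+
    qed
    show ?thesis
    proof (rule root_multiplicity_dvd [OF r(1), of A w z n R b V D R1])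
      show "(A \<longlongrightarrow> z) (at w within half_ball w r)"
        using z at_within_half_ball [OF r(1) zero_less_one] by simp
      show "deriv A x ^ n = poly R (A x) \<and> poly R (A x) \<noteq> 0" if "x \<in> half_ball w r" for x
        using that half(1) by (intro ode) (auto simp: S_def)
      show "poly R1 (A x) - b x * poly (pderiv R) (A x) = deriv A x ^ (n - 2) * (V x - A x * D x)"
        if "x \<in> half_ball w r" for x
        using F0 [of x] dA0 [of x] that half(1) by (auto simp: F_def S_def field_simps)
      show "deriv b w \<noteq> 0" using w h by (intro db) auto
      show "A holomorphic_on half_ball w r" using sub(1) half(1) by (rule holomorphic_on_subset)
      show "b holomorphic_on ball w r" using bh half(2) by (rule holomorphic_on_subset)
      show "V holomorphic_on ball w r" using Vh half(2) by (rule holomorphic_on_subset)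
      show "D holomorphic_on ball w r" using Dh half(2) by (rule holomorphic_on_subset)
    qed (use False ord in auto)
  qed auto
  have ext: "\<exists>\<delta> f. \<delta> > 0 \<and> f holomorphic_on ball w \<delta> \<and> (\<forall>x\<in>half_ball w \<delta>. f x = A x) \<and>
      (\<forall>\<omega> s. \<omega> ^ (n div (n - order z R)) = 1 \<longrightarrow> norm s < \<delta> \<longrightarrow> f (w + \<omega> * s) = f (w + s))"
    if w: "Re w = h0" and z: "(A \<longlongrightarrow> z) (at w within half_ball w 1)" for w z
  proof -
    have "A holomorphic_on half_ball w 1"
      using hol by (rule holomorphic_on_subset) (auto simp: half_ball_def w)
    moreover have "deriv A x ^ n = poly R (A x) \<and> poly R (A x) \<noteq> 0" if "x \<in> half_ball w 1" for x
      using that w by (intro ode) (auto simp: half_ball_def)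
    ultimately obtain \<delta> f where f: "\<delta> > 0" "f holomorphic_on ball w \<delta>" "\<And>x. x \<in> half_ball w 1 \<inter> ball w \<delta> \<Longrightarrow> f x = A x"
      "\<And>\<omega> s. \<omega> ^ (n div (n - order z R)) = 1 \<Longrightarrow> norm s < \<delta> \<Longrightarrow> f (w + \<omega> * s) = f (w + s)"
      using flow_extension_at_root [OF zero_less_one _ z _ ord dvd [OF w z]] by metis
    show ?thesis
    proof (intro exI [of _ "min 1 \<delta>"] exI [of _ f] conjI ballI allI impI)
      show "f holomorphic_on ball w (min 1 \<delta>)" using f(2) by (rule holomorphic_on_subset) auto
      show "f x = A x" if "x \<in> half_ball w (min 1 \<delta>)" for x
        using that by (intro f(3)) (auto simp: half_ball_def)
    qed (use f in auto)
  qed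
  have loc: "\<exists>\<delta> f. \<delta> > 0 \<and> f holomorphic_on ball w \<delta> \<and> f ` ball w \<delta> \<subseteq> UNIV \<and> (\<forall>x\<in>half_ball w \<delta>. f x = A x)"
    if w: "Re w = h0" for w
    using lims [OF w] ext [OF w] by blast
  obtain \<delta> B where B: "\<delta> > 0" "B holomorphic_on {x. h0 - \<delta> < Re x}" "\<And>x. h0 < Re x \<Longrightarrow> B x = A x"
    by (rule line_extension [OF hol per loc]) (assumption | rule that)+
  have Bper: "B (x + 2 * of_real pi * \<i>) = B x" if "h0 - \<delta> < Re x" for x
  proof (rule right_half_plane_unique [of "\<lambda>x. B (x + 2 * of_real pi * \<i>)" "h0 - \<delta>" B h0 x])
    show "(\<lambda>x. B (x + 2 * of_real pi * \<i>)) holomorphic_on {x. h0 - \<delta> < Re x}"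
      by (intro holomorphic_on_compose_gen [OF _ B(2), unfolded o_def] holomorphic_intros) auto
  qed (use B per that in auto)
  obtain w0 z0 where w0: "Re w0 = h0" and z0: "(A \<longlongrightarrow> z0) (at w0 within half_ball w0 1)" and Rz0: "poly R z0 = 0"
    using zero by blast
  define k where "k = order z0 R"
  define e where "e = n div (n - k)"
  have k: "k > 0" "k < n" using Rz0 R0 ord by (auto simp: k_def order_root)
  have "n - k dvd n" unfolding k_def by (rule dvd [OF w0 z0])
  then have ne: "n = e * (n - k)" by (simp add: e_def)
  have e2: "e \<ge> 2"
  proof (rule ccontr)
    assume "\<not> e \<ge> 2"
    then have "e = 0 \<or> e = 1" by auto
    then show False using ne k by auto
  qed
  obtain \<delta>0 f where f: "\<delta>0 > 0" "f holomorphic_on ball w0 \<delta>0" "\<And>x. x \<in> half_ball w0 \<delta>0 \<Longrightarrow> f x = A x"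
     "\<And>\<omega> s. \<omega> ^ e = 1 \<Longrightarrow> norm s < \<delta>0 \<Longrightarrow> f (w0 + \<omega> * s) = f (w0 + s)"
    using ext [OF w0 z0] unfolding e_def k_def by blast
  define \<delta>1 where "\<delta>1 = min \<delta>0 \<delta>"
  have \<delta>1: "\<delta>1 > 0" "\<delta>1 \<le> \<delta>0" "\<delta>1 \<le> \<delta>" using f(1) B(1) by (auto simp: \<delta>1_def)
  have ball\<delta>: "ball w0 \<delta>1 \<subseteq> {x. h0 - \<delta> < Re x}"
  proof
    fix x assume "x \<in> ball w0 \<delta>1"
    then show "x \<in> {x. h0 - \<delta> < Re x}" using abs_Re_le_cmod [of "w0 - x"] w0 \<delta>1(3) by (auto simp: dist_norm)
  qed
  have fB: "f x = B x" if x: "x \<in> ball w0 \<delta>1" for x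
  proof (rule analytic_continuation_open [of "half_ball w0 \<delta>1" "ball w0 \<delta>1" f B x])
    show "f holomorphic_on ball w0 \<delta>1" using f(2) \<delta>1 by (auto elim: holomorphic_on_subset)
    show "B holomorphic_on ball w0 \<delta>1" using B(2) ball\<delta> holomorphic_on_subset by blast
    show "f x = B x" if "x \<in> half_ball w0 \<delta>1" for x
      using that f(3) [of x] B(3) [of x] \<delta>1 w0 by (auto simp: half_ball_def)
    show "half_ball w0 \<delta>1 \<subseteq> ball w0 \<delta>1" by (auto simp: half_ball_def)
  qed (use x half_ball_nonempty [OF \<delta>1(1)] in auto)
  have rot: "B (w0 + \<omega> * s) = B (w0 + s)" if "\<omega> ^ e = 1" "norm s < \<delta>1" for \<omega> s
  proof -
    have "norm \<omega> ^ e = 1" using that(1) by (metis norm_one norm_power)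
    then have "norm \<omega> = 1" using e2 power_eq_imp_eq_base [of "norm \<omega>" e 1] by simp
    then have "w0 + \<omega> * s \<in> ball w0 \<delta>1" "w0 + s \<in> ball w0 \<delta>1" using that(2) by (auto simp: dist_norm norm_mult)
    then show ?thesis using f(4) [of \<omega> s] that \<delta>1 by (simp add: fB [symmetric])
  qed
  \<comment> \<open>Both sides are defined on an intersection \<open>T\<close> of two half-planes,
    which is connected; so the local symmetry at \<open>w0\<close> spreads over all of it.\<close>
  have global_rot: "B (w0 + \<omega> * s) = B (w0 + s)"
    if \<omega>: "\<omega> ^ e = 1" and s: "- \<delta> < Re s" "- \<delta> < Re (\<omega> * s)" for \<omega> s
  proof -
    define T where "T = {s. - \<delta> < Re s} \<inter> {s. - \<delta> < Re (\<omega> * s)}"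
    have "{s. - \<delta> < Re (\<omega> * s)} = {s. (cnj \<omega>) \<bullet> s > - \<delta>}" by (auto simp: inner_complex_def)
    then have T: "open T" "convex T" unfolding T_def
      by (auto intro!: open_Int convex_Int open_halfspace_Re_gt convex_halfspace_Re_gt open_halfspace_gt convex_halfspace_gt)
    have "norm \<omega> ^ e = 1" using \<omega> by (metis norm_one norm_power)
    then have n1: "norm \<omega> = 1" using e2 power_eq_imp_eq_base [of "norm \<omega>" e 1] by simp
    have sub: "ball 0 \<delta>1 \<subseteq> T"
    proof
      fix x :: complex assume "x \<in> ball 0 \<delta>1"
      then show "x \<in> T" using abs_Re_le_cmod [of x] abs_Re_le_cmod [of "\<omega> * x"] n1 \<delta>1(3) by (auto simp: T_def norm_mult)
    qed
    show ?thesis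
    proof (rule analytic_continuation_open [of "ball 0 \<delta>1" T "\<lambda>s. B (w0 + \<omega> * s)" "\<lambda>s. B (w0 + s)" s])
      show "(\<lambda>s. B (w0 + \<omega> * s)) holomorphic_on T" "(\<lambda>s. B (w0 + s)) holomorphic_on T"
        by (intro holomorphic_on_compose_gen [OF _ B(2), unfolded o_def] holomorphic_intros; auto simp: T_def w0)+
      show "B (w0 + \<omega> * s) = B (w0 + s)" if "s \<in> ball 0 \<delta>1" for s using rot [OF \<omega>] that by simp
    qed (use s T sub \<delta>1 in \<open>auto simp: T_def convex_connected\<close>)
  qed
  have "e = 2"
  proof (rule ccontr)
    assume "e \<noteq> 2"
    with e2 have e3: "e \<ge> 3" by simp
    define \<theta> where "\<theta> = 2 * pi / real e"
    have "0 < \<theta>" "\<theta> < pi" using e3 by (auto simp: \<theta>_def field_simps)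
    then have sin: "sin \<theta> > 0" by (rule sin_gt_zero)
    have "real e * \<theta> = 2 * pi" using e3 by (simp add: \<theta>_def)
    then have \<omega>: "cis \<theta> ^ e = 1" using Complex.DeMoivre [of \<theta> e] by simp
    have "continuous_on {x. h0 - \<delta> < Re x} B" using B(2) by (rule holomorphic_on_imp_continuous_on)
    then obtain C where C: "\<And>x. h0 \<le> Re x \<Longrightarrow> Re x \<le> h0 \<Longrightarrow> norm (B x) \<le> C"
      using periodic_bounded_on_strip [of "h0 - \<delta>" B h0 h0] Bper B(1) by auto
    obtain h' where h': "\<And>x. h' < Re x \<Longrightarrow> C < norm (A x)" using inf by blast
    define t where "t = (max 0 (h' - h0) + 1) / sin \<theta>"
    have t: "t > 0" "h' < h0 + t * sin \<theta>" using sin by (auto simp: t_def add_pos_nonneg)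
    \<comment> \<open>\<open>w0 + s\<close> lies on the line below \<open>w0\<close>; rotation by
      \<theta>, an angle between 0 and pi, moves it to the right of the line by
      \<open>t * sin \<theta>\<close>, and \<open>t\<close> is chosen to make this large.\<close>
    define s where "s = - \<i> * of_real t"
    have s: "Re s = 0" "Re (cis \<theta> * s) = t * sin \<theta>" by (auto simp: s_def)
    have "B (w0 + cis \<theta> * s) = B (w0 + s)"
      using s sin t(1) B(1) by (intro global_rot \<omega>) (auto intro: less_trans [of _ 0])
    moreover have "norm (B (w0 + s)) \<le> C" using s w0 by (intro C) auto
    moreover have "h0 < Re (w0 + cis \<theta> * s)" using s w0 t sin by simp
    moreover have "C < norm (A (w0 + cis \<theta> * s))" using s w0 t by (intro h') simp
    ultimately show False using B(3) by simp
  qed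
  \<comment> \<open>\<open>e = 2\<close> admits the root of unity -1, that is, the point reflection
    about \<open>w0\<close>.\<close>
  then have sym: "B (2 * w0 - x) = B x" if "h0 - \<delta> < Re x" "Re x < h0 + \<delta>" for x
    using global_rot [of "-1" "x - w0"] that w0 by (simp add: algebra_simps)
  \<comment> \<open>The two formulas fit together because \<open>sym\<close> holds on the strip
    around \<open>Re x = h0\<close> where both apply.\<close>
  define E where "E = (\<lambda>x. if h0 < Re x then B x else B (2 * w0 - x))"
  have EB: "E x = B x" if "h0 - \<delta> < Re x" for x using sym [of x] that B(1) by (auto simp: E_def)
  have Eh: "E holomorphic_on UNIV"
  proof (rule holomorphic_on_local)
    fix x :: complex
    show "\<exists>U. open U \<and> x \<in> U \<and> E holomorphic_on U"
    proof (cases "h0 - \<delta> < Re x")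
      case True
      have "E holomorphic_on {x. h0 - \<delta> < Re x}" using B(2) by (rule holomorphic_transform) (simp add: EB)
      then show ?thesis using True open_right_half_plane by blast
    next
      case False
      have "(\<lambda>x. B (2 * w0 - x)) holomorphic_on {x. Re x < h0}"
        by (intro holomorphic_on_compose_gen [OF _ B(2), unfolded o_def] holomorphic_intros) (use B(1) in \<open>auto simp: w0\<close>)
      then have "E holomorphic_on {x. Re x < h0}" by (rule holomorphic_transform) (simp add: E_def)
      then show ?thesis using False B(1) open_halfspace_Re_lt by (intro exI [of _ "{x. Re x < h0}"]) auto
    qed
  qed
  have Esym: "E (2 * w0 - x) = E x" for x
    using sym [of x] w0 B(1) by (auto simp: E_def)
  have dE: "(E has_field_derivative deriv E x) (at x)" for x
    using Eh by (meson UNIV_I holomorphic_derivI open_UNIV)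
  have E'h: "deriv E holomorphic_on UNIV" using Eh by (intro holomorphic_deriv) auto
  have ddE: "(deriv E has_field_derivative deriv (deriv E) x) (at x)" for x
    using E'h by (meson UNIV_I holomorphic_derivI open_UNIV)
  have E'sym: "deriv E x = - deriv E (2 * w0 - x)" for x
  proof -
    have "((\<lambda>x. E (2 * w0 - x)) has_field_derivative - deriv E (2 * w0 - x)) (at x)"
      by (rule has_field_derivative_diff_arg [OF dE])
    then show ?thesis by (simp add: Esym DERIV_imp_deriv)
  qed
  have E''sym: "deriv (deriv E) x = deriv (deriv E) (2 * w0 - x)" for x
  proof -
    have "((\<lambda>x. - deriv E (2 * w0 - x)) has_field_derivative - (- deriv (deriv E) (2 * w0 - x))) (at x)"
      by (intro DERIV_minus has_field_derivative_diff_arg ddE)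
    then show ?thesis by (simp add: E'sym [symmetric] DERIV_imp_deriv)
  qed
  have Eper: "E (x + 2 * of_real pi * \<i>) = E x" for x
  proof (rule right_half_plane_unique [of "\<lambda>x. E (x + 2 * of_real pi * \<i>)" "Re x - 1" E "max h0 (Re x)" x])
    show "(\<lambda>x. E (x + 2 * of_real pi * \<i>)) holomorphic_on {y. Re x - 1 < Re y}"
      by (intro holomorphic_on_compose_gen [OF _ Eh, unfolded o_def] holomorphic_intros) auto
  qed (use Eh Bper B(1) in \<open>auto simp: EB elim: holomorphic_on_subset\<close>)
  have E'per: "deriv E (x + 2 * of_real pi * \<i>) = deriv E x" for x
  proof -
    have "((\<lambda>x. E (x + 2 * of_real pi * \<i>)) has_field_derivative deriv E (x + 2 * of_real pi * \<i>)) (at x)"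
      using dE DERIV_shift by blast
    then show ?thesis by (simp add: Eper DERIV_imp_deriv)
  qed
  have E''per: "deriv (deriv E) (x + 2 * of_real pi * \<i>) = deriv (deriv E) x" for x
  proof -
    have "((\<lambda>x. deriv E (x + 2 * of_real pi * \<i>)) has_field_derivative deriv (deriv E) (x + 2 * of_real pi * \<i>)) (at x)"
      using ddE DERIV_shift by blast
    then show ?thesis by (simp add: E'per DERIV_imp_deriv)
  qed
  \<comment> \<open>\<open>g\<close> is bounded far to the right by the asymptotics of
    \<open>A\<close>, on the intermediate strip by periodicity, and to the left by the symmetry
    about \<open>w0\<close>; Liouville makes it constant.\<close>
  define g where "g = (\<lambda>x. deriv (deriv E) x - E x)"
  have gh: "g holomorphic_on UNIV" unfolding g_def by (intro holomorphic_intros Eh holomorphic_deriv E'h) auto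
  obtain h' C where hC: "\<And>x. h' < Re x \<Longrightarrow> norm (deriv (deriv A) x - A x) \<le> C" using asym by blast
  have EA: "E x = A x" if "h0 < Re x" for x using that B(3) by (simp add: E_def)
  have E'A: "deriv E x = deriv A x" if "h0 < Re x" for x
  proof (rule deriv_cong_ev)
    show "eventually (\<lambda>x. E x = A x) (nhds x)"
      using eventually_nhds_in_open [OF open_right_half_plane, of x h0] that by (auto elim!: eventually_mono intro: EA)
  qed simp
  have E''A: "deriv (deriv E) x = deriv (deriv A) x" if "h0 < Re x" for x
  proof (rule deriv_cong_ev)
    show "eventually (\<lambda>x. deriv E x = deriv A x) (nhds x)"
      using eventually_nhds_in_open [OF open_right_half_plane, of x h0] that by (auto elim!: eventually_mono intro: E'A)
  qed simp
  have gC: "norm (g x) \<le> C" if "max h' h0 < Re x" for x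
    unfolding g_def using hC [of x] EA E''A that by simp
  have "continuous_on {x. h0 - 1 < Re x} g"
    using holomorphic_on_imp_continuous_on [OF gh] continuous_on_subset by blast
  then obtain C' where gC': "\<And>x. h0 \<le> Re x \<Longrightarrow> Re x \<le> max h' h0 \<Longrightarrow> norm (g x) \<le> C'"
    by (rule periodic_bounded_on_strip [of "h0 - 1" g h0 "max h' h0"]) (auto simp: g_def Eper E''per)
  have right: "norm (g x) \<le> max C C'" if "h0 \<le> Re x" for x
    using gC [of x] gC' [of x] that by (cases "max h' h0 < Re x") auto
  have all: "norm (g x) \<le> max C C'" for x
  proof (cases "h0 \<le> Re x")
    case False
    then have "norm (g (2 * w0 - x)) \<le> max C C'" using w0 by (intro right) auto
    then show ?thesis using E''sym [of x] Esym [of x] by (simp add: g_def)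
  qed (rule right)
  then have "bounded (range g)" unfolding bounded_iff by blast
  then have "g constant_on UNIV" by (rule Liouville_theorem [OF gh])
  then obtain c where c: "\<And>x. g x = - c" unfolding constant_on_def by (metis UNIV_I minus_minus)
  have "deriv (deriv E) x = E x - c" for x using c [of x] by (simp add: g_def algebra_simps)
  then obtain \<alpha> \<beta> where "\<And>x. E x = c + \<alpha> * exp x + \<beta> * exp (- x)"
    using second_order_linear_ode [OF Eh] by blast
  then show ?thesis using that [of c \<alpha> \<beta>] EA by simp
qed

subsection \<open>Arguments along a closed curve\<close>

lemma continuous_int_valued_const:
  fixes f :: "real \<Rightarrow> real"
  assumes "continuous_on {a..b} f" "\<And>t. t \<in> {a..b} \<Longrightarrow> f t \<in> \<int>" "s \<in> {a..b}" "t \<in> {a..b}"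
  shows "f s = f t"
proof -
  have "f constant_on {a..b}"
  proof (rule continuous_discrete_range_constant)
    fix x assume "x \<in> {a..b}"
    show "\<exists>e>0. \<forall>y. y \<in> {a..b} \<and> f y \<noteq> f x \<longrightarrow> e \<le> norm (f y - f x)"
    proof (intro exI [of _ 1] conjI allI impI)
      fix y assume y: "y \<in> {a..b} \<and> f y \<noteq> f x"
      then have "f y - f x \<in> \<int>" "f y - f x \<noteq> 0" using assms(2) \<open>x \<in> {a..b}\<close> by auto
      then have "1 \<le> \<bar>f y - f x\<bar>" by (rule Ints_nonzero_abs_ge1)
      then show "1 \<le> norm (f y - f x)" by simp
    qed auto
  qed (use assms in auto)
  then show ?thesis using assms unfolding constant_on_def by auto
qed

text \<open>Hopf's secant map. On the triangle \<open>0 \<le> s \<le> t \<le> L\<close> the chord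
  \<open>c t - c s\<close>, divided by \<open>(t - s) * (L - (t - s))\<close>, extends to a
  continuous function \<open>E\<close> without zeros: it is \<open>c' / L\<close> on the diagonal
  and \<open>- c' / L\<close> at the corner \<open>(0, L)\<close>. The triangle is contractible, so
  \<open>E\<close> has a logarithm \<open>q\<close>. On the two legs \<open>E\<close> differs by a
  sign, so the values of \<open>q\<close> differ by an odd multiple of \<open>pi * \<i>\<close>,
  which is constant by continuity.\<close>

lemma secant_log:
  fixes c :: "real \<Rightarrow> complex"
  assumes L: "L > 0" and der: "\<And>t. (c has_vector_derivative c' t) (at t)"
    and cont: "continuous_on UNIV c'" and c'0: "\<And>t. c' t \<noteq> 0"
    and per: "\<And>t. c (t + L) = c t" and inj: "inj_on c {0..<L}"
  obtains q m where "continuous_on {p. 0 \<le> fst p \<and> fst p \<le> snd p \<and> snd p \<le> L} q"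
    "\<And>s. 0 \<le> s \<Longrightarrow> s \<le> L \<Longrightarrow> c' s / of_real L = exp (q (s, s))"
    "\<And>s t. 0 \<le> s \<Longrightarrow> s < t \<Longrightarrow> t \<le> L \<Longrightarrow> t - s < L \<Longrightarrow>
       c t - c s = of_real ((t - s) * (L - (t - s))) * exp (q (s, t))"
    "\<And>s. 0 \<le> s \<Longrightarrow> s \<le> L \<Longrightarrow> q (s, L) - q (0, s) = of_real ((2 * of_int m + 1) * pi) * \<i>"
proof -
  define K where "K = {p :: real \<times> real. 0 \<le> fst p \<and> fst p \<le> snd p \<and> snd p \<le> L}"
  have c'per: "c' (t + L) = c' t" for t
  proof -
    have "((\<lambda>t. t + L) has_vector_derivative 1) (at t)" by (auto intro!: derivative_eq_intros)
    then have "((\<lambda>t. c (t + L)) has_vector_derivative c' (t + L)) (at t)"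
      using vector_diff_chain_at [of "\<lambda>t. t + L" 1 t c "c' (t + L)"] der [of "t + L"]
      by (simp add: o_def)
    then have "(c has_vector_derivative c' (t + L)) (at t)" by (simp add: per)
    then show ?thesis using der vector_derivative_unique_at by blast
  qed
  \<comment> \<open>The mean of \<open>c'\<close> between the two parameters is the difference
    quotient of \<open>c\<close>, continued continuously to the diagonal.\<close>
  define e where "e = (\<lambda>p. integral (cbox 0 1) (\<lambda>r. c' (fst p + r * (snd p - fst p))))"
  have econt: "continuous_on U e" for U
  proof -
    have "continuous_on (UNIV \<times> cbox 0 1) (\<lambda>(p, r). c' (fst p + r * (snd p - fst p)))"
      unfolding split_beta by (intro continuous_on_compose2 [OF cont] continuous_intros) auto
    then have "continuous_on UNIV e" unfolding e_def by (rule integral_continuous_on_param)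
    then show ?thesis using continuous_on_subset by blast
  qed
  have echord: "of_real (t - s) * e (s, t) = c t - c s" for s t
  proof -
    have "((\<lambda>r. of_real (t - s) * c' (s + r * (t - s))) has_integral c (s + 1 * (t - s)) - c (s + 0 * (t - s))) {0..1}"
    proof (rule fundamental_theorem_of_calculus)
      fix r :: real
      have "((c \<circ> (\<lambda>r. s + r * (t - s))) has_vector_derivative (t - s) *\<^sub>R c' (s + r * (t - s))) (at r)"
        by (rule vector_diff_chain_at) (auto intro!: derivative_eq_intros der)
      then show "((\<lambda>r. c (s + r * (t - s))) has_vector_derivative of_real (t - s) * c' (s + r * (t - s))) (at r within {0..1})"
        by (auto simp: o_def scaleR_conv_of_real intro: has_vector_derivative_at_within)
    qed simp
    then have 1: "((\<lambda>r. of_real (t - s) * c' (s + r * (t - s))) has_integral c t - c s) {0..1}" by simp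
    have "(\<lambda>r. c' (s + r * (t - s))) integrable_on {0..1}"
      by (intro integrable_continuous_real continuous_on_compose2 [OF cont] continuous_intros) auto
    then have "((\<lambda>r. c' (s + r * (t - s))) has_integral e (s, t)) {0..1}"
      by (simp add: e_def integrable_integral)
    then have "((\<lambda>r. of_real (t - s) * c' (s + r * (t - s))) has_integral of_real (t - s) * e (s, t)) {0..1}"
      by (rule has_integral_mult_right)
    then show ?thesis using 1 has_integral_unique by blast
  qed
  have ediag: "e (s, s) = c' s" for s by (simp add: e_def)
  have cneq: "c s \<noteq> c t" if "0 \<le> s" "s < t" "t \<le> L" "t - s < L" for s t
  proof (cases "t = L")
    case True
    then have "c t = c 0" using per [of 0] by simp
    moreover have "s > 0" using that True by simp
    moreover have "c s = c 0 \<longrightarrow> s = 0" using inj that True L by (intro impI inj_onD [OF inj]) auto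
    ultimately show ?thesis by auto
  next
    case False
    show ?thesis
    proof
      assume "c s = c t"
      then have "s = t" by (rule inj_onD [OF inj]) (use that False in auto)
      then show False using that by simp
    qed
  qed
  \<comment> \<open>For \<open>L / 2 \<le> t - s\<close> the chord is read as the one from
    \<open>t\<close> to \<open>s + L\<close>, with opposite sign; in this way each formula divides
    only by a length of at least \<open>L / 2\<close>.\<close>
  define E where "E = (\<lambda>p. if L / 2 \<le> snd p - fst p then - e (snd p, fst p + L) / of_real (snd p - fst p)
      else e p / of_real (L - (snd p - fst p)))"
  have Echord: "of_real ((t - s) * (L - (t - s))) * E (s, t) = c t - c s"
    if "0 \<le> s" "s < t" "t \<le> L" "t - s < L" for s t
  proof -
    have cancel: "of_real (a * b) * (x / of_real b) = of_real a * x" "of_real (a * b) * (x / of_real a) = of_real b * x"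
      if "a \<noteq> 0" "b \<noteq> 0" for a b and x :: complex
      using that by simp_all
    have ab: "t - s \<noteq> 0" "L - (t - s) \<noteq> 0" using that by auto
    show ?thesis
    proof (cases "L / 2 \<le> t - s")
      case True
      then have "E (s, t) = - e (t, s + L) / of_real (t - s)" by (simp add: E_def)
      then have "of_real ((t - s) * (L - (t - s))) * E (s, t) = of_real (L - (t - s)) * - e (t, s + L)"
        by (simp only: cancel [OF ab])
      also have "\<dots> = - (of_real ((s + L) - t) * e (t, s + L))" by simp
      also have "\<dots> = c t - c s" unfolding echord by (simp add: per)
      finally show ?thesis .
    next
      case False
      then have "E (s, t) = e (s, t) / of_real (L - (t - s))" by (simp add: E_def)
      then have "of_real ((t - s) * (L - (t - s))) * E (s, t) = of_real (t - s) * e (s, t)"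
        by (simp only: cancel [OF ab])
      then show ?thesis by (simp only: echord)
    qed
  qed
  have Econt: "continuous_on K E"
  proof -
    define K1 where "K1 = K \<inter> {p. snd p - fst p \<le> L / 2}"
    define K2 where "K2 = K \<inter> {p. L / 2 \<le> snd p - fst p}"
    have Kcl: "closed K" unfolding K_def
      by (intro closed_Collect_conj closed_Collect_le continuous_intros)
    have eq: "e p / of_real (L - (snd p - fst p)) = - e (snd p, fst p + L) / of_real (snd p - fst p)"
      if "p \<in> K1 \<inter> K2" for p
    proof -
      obtain s t where p: "p = (s, t)" by (cases p)
      have d: "t - s = L / 2" using that by (auto simp: K1_def K2_def p)
      have "of_real (L / 2) * e (s, t) = c t - c s" using echord [of t s] unfolding d .
      moreover have "of_real (L / 2) * e (t, s + L) = c s - c t"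
      proof -
        have h: "s + L - t = L / 2" using d by linarith
        show ?thesis using echord [of "s + L" t] unfolding h per .
      qed
      ultimately have "of_real (L / 2) * e (s, t) = of_real (L / 2) * (- e (t, s + L))"
        by (simp only: mult_minus_right minus_diff_eq)
      then have "e (s, t) = - e (t, s + L)" using L by (simp only: mult_cancel_left) auto
      moreover have "L - (t - s) = t - s" using d by linarith
      ultimately show ?thesis unfolding p fst_conv snd_conv by (simp only:)
    qed
    have "continuous_on (K2 \<union> K1) E"
      unfolding E_def
    proof (rule continuous_on_cases)
      show "closed K1" "closed K2" unfolding K1_def K2_def
        by (intro closed_Int Kcl closed_Collect_le continuous_intros)+
      show "continuous_on K1 (\<lambda>p. e p / of_real (L - (snd p - fst p)))"
      proof -
        have "of_real (L - (snd p - fst p)) \<noteq> (0::complex)" if "p \<in> K1" for p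
          using that L by (auto simp only: of_real_eq_0_iff K1_def)
        then show ?thesis by (intro continuous_intros econt ballI)
      qed
      show "continuous_on K2 (\<lambda>p. - e (snd p, fst p + L) / of_real (snd p - fst p))"
      proof -
        have "of_real (snd p - fst p) \<noteq> (0::complex)" if "p \<in> K2" for p
          using that L by (auto simp only: of_real_eq_0_iff K2_def)
        then show ?thesis by (intro continuous_intros continuous_on_compose2 [OF econt [of UNIV]] ballI) auto
      qed
      show "\<forall>p. p \<in> K2 \<and> \<not> L / 2 \<le> snd p - fst p \<or> p \<in> K1 \<and> L / 2 \<le> snd p - fst p \<longrightarrow>
          - e (snd p, fst p + L) / of_real (snd p - fst p) = e p / of_real (L - (snd p - fst p))"
        using eq by (force simp: K1_def K2_def)
    qed
    moreover have "K2 \<union> K1 = K" by (auto simp: K1_def K2_def)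
    ultimately show ?thesis by simp
  qed
  have Ediag: "E (s, s) = c' s / of_real L" for s using L by (simp add: E_def ediag)
  have Ecorner: "E (0, L) = - c' L / of_real L" using L by (simp add: E_def ediag)
  have E0: "E p \<noteq> 0" if "p \<in> K" for p
  proof -
    obtain s t where p: "p = (s, t)" by (cases p)
    have b: "0 \<le> s" "s \<le> t" "t \<le> L" using that by (auto simp: K_def p)
    then consider "s = t" | "s = 0" "t = L" | "s < t" "t - s < L" by linarith
    then show ?thesis
    proof cases
      case 3
      then have "of_real ((t - s) * (L - (t - s))) * E (s, t) \<noteq> 0"
        using Echord [of s t] cneq [of s t] b by (simp only: right_minus_eq) auto
      then show ?thesis by (auto simp: p)
    qed (use Ediag Ecorner c'0 L in \<open>auto simp: p\<close>)
  qed
  have "convex K"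
  proof -
    have "K = {p. 0 \<le> (1, 0) \<bullet> p} \<inter> {p. 0 \<le> (-1, 1) \<bullet> p} \<inter> {p. (0, 1) \<bullet> p \<le> L}"
      by (auto simp: K_def inner_prod_def)
    then show ?thesis by (simp add: convex_Int convex_halfspace_le convex_halfspace_ge)
  qed
  then have "contractible K" by (rule convex_imp_contractible)
  then obtain q where q: "continuous_on K q" "\<And>p. p \<in> K \<Longrightarrow> E p = exp (q p)"
    by (rule continuous_logarithm_on_contractible [OF Econt]) (assumption | rule notI that | erule (1) E0 [THEN notE])+
  have c'L: "c' L = c' 0" using c'per [of 0] by simp
  have cL: "c L = c 0" using per [of 0] by simp
  \<comment> \<open>The legs describe the chords between \<open>c s\<close> and the base point
    \<open>c 0 = c L\<close>, once as end point and once as starting point; hence the sign.\<close>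
  have leg: "exp (q (s, L)) = - exp (q (0, s))" if s: "0 \<le> s" "s \<le> L" for s
  proof -
    have "E (s, L) = - E (0, s)"
    proof -
      consider "s = 0" | "s = L" | "0 < s" "s < L" using s by linarith
      then show ?thesis
      proof cases
        case 3
        have "of_real ((L - s) * s) * E (s, L) = c L - c s" "of_real ((L - s) * s) * E (0, s) = c s - c 0"
          using Echord [of s L] Echord [of 0 s] 3 by (simp_all add: mult.commute)
        then have "of_real ((L - s) * s) * E (s, L) = of_real ((L - s) * s) * (- E (0, s))"
          by (simp only: mult_minus_right minus_diff_eq cL)
        moreover have "of_real ((L - s) * s) \<noteq> (0::complex)" using 3 by (simp only: of_real_eq_0_iff) auto
        ultimately show ?thesis by (metis mult_left_cancel)
      qed (use Ediag Ecorner c'L in auto)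
    qed
    then show ?thesis using q(2) [of "(s, L)"] q(2) [of "(0, s)"] s by (simp add: K_def)
  qed
  \<comment> \<open>\<open>d s\<close> is the integer \<open>m\<close> that belongs to
    \<open>s\<close>; its continuity shows that it does not depend on \<open>s\<close>.\<close>
  define d where "d = (\<lambda>s. (Im (q (s, L)) - Im (q (0, s)) - pi) / (2 * pi))"
  have dm: "\<exists>m::int. q (s, L) - q (0, s) = of_real ((2 * of_int m + 1) * pi) * \<i>" if s: "0 \<le> s" "s \<le> L" for s
  proof -
    have "exp (q (s, L)) = exp (q (0, s) + of_real pi * \<i>)"
      unfolding leg [OF s] by (simp add: exp_add exp_Euler)
    then obtain m :: int where "q (s, L) = q (0, s) + of_real pi * \<i> + (of_int (2 * m) * of_real pi) * \<i>"
      unfolding exp_eq by auto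
    then show ?thesis by (intro exI [of _ m]) (simp add: algebra_simps)
  qed
  have dint: "d s \<in> \<int>" if "s \<in> {0..L}" for s
  proof -
    from that have "0 \<le> s" "s \<le> L" by auto
    from dm [OF this] obtain m :: int where "q (s, L) - q (0, s) = of_real ((2 * of_int m + 1) * pi) * \<i>" by blast
    then have "Im (q (s, L) - q (0, s)) = (2 * of_int m + 1) * pi" by simp
    then have "d s = of_int m" by (simp add: d_def field_simps)
    then show ?thesis by simp
  qed
  have dcont: "continuous_on {0..L} d"
    unfolding d_def by (intro continuous_intros continuous_on_compose2 [OF q(1)]) (auto simp: K_def)
  obtain m :: int where m: "q (0, L) - q (0, 0) = of_real ((2 * of_int m + 1) * pi) * \<i>"
    using dm [OF order_refl less_imp_le [OF L]] by blast
  show ?thesis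
  proof (rule that [of q m])
    show "continuous_on {p. 0 \<le> fst p \<and> fst p \<le> snd p \<and> snd p \<le> L} q" using q(1) by (simp add: K_def)
    show "c' s / of_real L = exp (q (s, s))" if "0 \<le> s" "s \<le> L" for s
      using q(2) [of "(s, s)"] that by (simp add: K_def Ediag)
    show "c t - c s = of_real ((t - s) * (L - (t - s))) * exp (q (s, t))"
      if "0 \<le> s" "s < t" "t \<le> L" "t - s < L" for s t
      using q(2) [of "(s, t)"] Echord [OF that] that by (simp add: K_def)
    fix s assume s: "0 \<le> s" "s \<le> L"
    obtain m' :: int where m': "q (s, L) - q (0, s) = of_real ((2 * of_int m' + 1) * pi) * \<i>" using dm [OF s] by blast
    have "d s = d 0" using s L by (intro continuous_int_valued_const [OF dcont dint]) auto
    moreover have "d s = of_int m'" "d 0 = of_int m"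
      using arg_cong [OF m', of Im] arg_cong [OF m, of Im] by (auto simp: d_def field_simps)
    ultimately show "q (s, L) - q (0, s) = of_real ((2 * of_int m + 1) * pi) * \<i>" using m' by simp
  qed
qed

lemma degree_eq_sum_order:
  fixes p :: "complex poly"
  assumes "p \<noteq> 0"
  shows "degree p = (\<Sum>z | poly p z = 0. order z p)"
proof -
  have "degree p = degree (\<Prod>z | poly p z = 0. [:- z, 1:] ^ order z p)"
    using arg_cong [OF complex_poly_decompose [of p], of degree] assms by simp
  also have "\<dots> = (\<Sum>z | poly p z = 0. degree ([:- z, 1:] ^ order z p))"
    by (rule degree_prod_eq_sum_degree) simp
  also have "\<dots> = (\<Sum>z | poly p z = 0. order z p)" by (simp add: degree_power_eq)
  finally show ?thesis .
qed

text \<open>That \<theta> is an argument of \<open>x\<close> modulo pi is expressed below by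
  \<open>x * cis (- \<theta>) \<in> \<real>\<close>, which also makes sense for
  \<open>x = 0\<close>.\<close>

lemma Reals_exp_cis: "exp z * cis (- Im z) \<in> \<real>"
proof -
  have "exp z * cis (- Im z) = of_real (exp (Re z))"
    unfolding exp_eq_polar by (simp add: cis_mult)
  then show ?thesis by simp
qed

text \<open>Along the closed curve, the argument of the chord from a point of the curve changes by half as
  much as the argument of the tangent, and the argument seen from a point off the curve by a full
  turn at most. Since these changes match, all roots lie inside.\<close>

lemma roots_enclosed:
  fixes c :: "real \<Rightarrow> complex" and R :: "complex poly"
  assumes L: "L > 0" and der: "\<And>t. (c has_vector_derivative c' t) (at t)"
    and cont: "continuous_on UNIV c'" and c'0: "\<And>t. c' t \<noteq> 0"
    and per: "\<And>t. c (t + L) = c t" and inj: "inj_on c {0..<L}"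
    and R: "R \<noteq> 0" "degree R \<le> n" "n > 0" and real: "\<And>t. poly R (c t) / c' t ^ n \<in> \<real>"
  shows "degree R = n" "poly R z = 0 \<Longrightarrow> z \<in> inside (c ` {0..L})"
proof -
  obtain q m where q: "continuous_on {p. 0 \<le> fst p \<and> fst p \<le> snd p \<and> snd p \<le> L} q"
    "\<And>s. 0 \<le> s \<Longrightarrow> s \<le> L \<Longrightarrow> c' s / of_real L = exp (q (s, s))"
    "\<And>s t. 0 \<le> s \<Longrightarrow> s < t \<Longrightarrow> t \<le> L \<Longrightarrow> t - s < L \<Longrightarrow>
       c t - c s = of_real ((t - s) * (L - (t - s))) * exp (q (s, t))"
    "\<And>s. 0 \<le> s \<Longrightarrow> s \<le> L \<Longrightarrow> q (s, L) - q (0, s) = of_real ((2 * of_int m + 1) * pi) * \<i>"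
    by (rule secant_log [OF L der cont c'0 per inj]) (rule that)
  \<comment> \<open>The argument of the tangent changes by \<open>2 * \<omega> * pi\<close> along
    the curve. As an odd integer, \<omega> has absolute value at least 1.\<close>
  define \<omega> where "\<omega> = (2 * of_int m + 1 :: real)"
  have qIm: "Im (q (s, L)) - Im (q (0, s)) = \<omega> * pi" if "0 \<le> s" "s \<le> L" for s
    using arg_cong [OF q(4) [OF that], of Im] by (simp add: \<omega>_def)
  have cc: "continuous_on U c" for U
    using der by (meson continuous_at_imp_continuous_on has_vector_derivative_continuous)
  have cL: "c L = c 0" using per [of 0] by simp
  define p where "p = (\<lambda>x. c (L * x))"
  have p: "path p" unfolding p_def path_def by (intro continuous_on_compose2 [OF cc] continuous_intros) auto
  have pim: "path_image p = c ` {0..L}"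
  proof -
    have "(*) L ` {0..1} = {0..L}" using L by (subst image_mult_atLeastAtMost) auto
    then have "c ` {0..L} = c ` (*) L ` {0..1}" by simp
    then show ?thesis by (auto simp: path_image_def p_def)
  qed
  have pcl: "pathfinish p = pathstart p" by (simp add: pathfinish_def pathstart_def p_def cL)
  have sp: "simple_path p"
    unfolding simple_path_def loop_free_def
  proof (intro conjI p ballI impI)
    fix x y :: real assume xy: "x \<in> {0..1}" "y \<in> {0..1}" "p x = p y"
    have *: "x = y" if "x \<in> {0..<1}" "y \<in> {0..<1}" "p x = p y" for x y
      using inj_onD [OF inj, of "L * x" "L * y"] that L by (auto simp: p_def)
    have p1: "p 1 = p 0" using pcl by (simp add: pathfinish_def pathstart_def)
    show "x = y \<or> x = 0 \<and> y = 1 \<or> x = 1 \<and> y = 0"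
    proof (cases "x = 1")
      case True
      show ?thesis
      proof (cases "y = 1")
        case False
        then have "0 = y" using xy True p1 by (intro *) auto
        then show ?thesis using True by simp
      qed (use True in simp)
    next
      case x: False
      show ?thesis
      proof (cases "y = 1")
        case True
        then have "x = 0" using xy x p1 by (intro *) auto
        then show ?thesis using True by simp
      next
        case False
        then have "x = y" using xy x by (intro *) auto
        then show ?thesis by simp
      qed
    qed
  qed
  define J where "J = c ` {0..L}"
  \<comment> \<open>A continuous argument of \<open>c - z\<close> modulo pi, with its total change
    for the three positions of \<open>z\<close>: \<open>\<omega> * pi\<close> on the curve, at most
    one full turn inside, zero outside.\<close>
  have "\<exists>\<theta>. continuous_on {0..L} \<theta> \<and> (\<forall>t\<in>{0..L}. (c t - z) * cis (- \<theta> t) \<in> \<real>) \<and>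
      (if z \<in> J then \<theta> L - \<theta> 0 = \<omega> * pi else \<bar>\<theta> L - \<theta> 0\<bar> \<le> 2 * pi \<and> (z \<in> inside J \<or> \<theta> L = \<theta> 0))" for z
  proof (cases "z \<in> J")
    case True
    then obtain s1 where "s1 \<in> {0..L}" "z = c s1" by (auto simp: J_def)
    then obtain s where s: "0 \<le> s" "s < L" "z = c s" 
      using cL L by (cases "s1 = L") (auto intro: that [of s1] that [of 0])
    \<comment> \<open>Passing from \<open>q (t, s)\<close> to \<open>q (s, t)\<close> at
      \<open>t = s\<close> reverses the direction of the chord. This is invisible modulo pi, and the
      two pieces share the value at \<open>(s, s)\<close>.\<close>
    define \<theta> where "\<theta> = (\<lambda>t. if t \<le> s then Im (q (t, s)) else Im (q (s, t)))"
    have "continuous_on ({0..s} \<union> {s..L}) \<theta>" unfolding \<theta>_def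
      by (rule continuous_on_cases)
        (use s in \<open>auto intro!: continuous_intros continuous_on_compose2 [OF q(1)]\<close>)
    moreover have "{0..s} \<union> {s..L} = {0..L}" using s by auto
    moreover have "(c t - z) * cis (- \<theta> t) \<in> \<real>" if t: "t \<in> {0..L}" for t
    proof -
      consider "t < s" | "t = s" | "s < t" "t - s < L" | "s = 0" "t = L" using t s by fastforce
      then show ?thesis
      proof cases
        case 1
        then have "c t - z = of_real (- ((s - t) * (L - (s - t)))) * exp (q (t, s))"
          using q(3) [of t s] t s by (simp add: algebra_simps)
        then have "(c t - z) * cis (- \<theta> t) = of_real (- ((s - t) * (L - (s - t)))) * (exp (q (t, s)) * cis (- Im (q (t, s))))"
          using 1 by (simp add: \<theta>_def)
        then show ?thesis by (metis Reals_exp_cis Reals_mult Reals_of_real)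
      next
        case 3
        then have "c t - z = of_real ((t - s) * (L - (t - s))) * exp (q (s, t))"
          using q(3) [of s t] t s by simp
        then have "(c t - z) * cis (- \<theta> t) = of_real ((t - s) * (L - (t - s))) * (exp (q (s, t)) * cis (- Im (q (s, t))))"
          using 3 by (simp add: \<theta>_def)
        then show ?thesis by (metis Reals_exp_cis Reals_mult Reals_of_real)
      qed (use s cL in auto)
    qed
    moreover have "\<theta> L - \<theta> 0 = \<omega> * pi" using qIm [of s] s by (simp add: \<theta>_def)
    ultimately show ?thesis using True by metis
  next
    case False
    then have zp: "z \<notin> path_image p" by (simp add: pim J_def)
    obtain r where r: "path r" "pathfinish r - pathstart r = 2 * of_real pi * \<i> * winding_number p z"
      "\<And>t. t \<in> {0..1} \<Longrightarrow> p t = z + exp (r t)"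
      by (rule winding_number_as_continuous_log [OF p zp]) (rule that)
    define \<theta> where "\<theta> = (\<lambda>t. Im (r (t / L)))"
    have w: "winding_number p z \<in> {-1, 0, 1}" by (rule simple_closed_path_winding_number_cases [OF sp pcl zp])
    have \<theta>\<Delta>: "\<theta> L - \<theta> 0 = 2 * pi * Re (winding_number p z)"
      using arg_cong [OF r(2), of Im] L by (simp add: \<theta>_def pathfinish_def pathstart_def)
    show ?thesis
    proof (intro exI [of _ \<theta>] conjI ballI)
      have "continuous_on {0..L} (\<lambda>t. r (t / L))"
        by (rule continuous_on_compose2 [OF r(1) [unfolded path_def]]) (use L in \<open>auto intro!: continuous_intros\<close>)
      then show "continuous_on {0..L} \<theta>" unfolding \<theta>_def by (rule continuous_on_Im)
      show "(c t - z) * cis (- \<theta> t) \<in> \<real>" if "t \<in> {0..L}" for t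
      proof -
        have "c t = p (t / L)" using L by (simp add: p_def)
        then have "c t - z = exp (r (t / L))" using r(3) [of "t / L"] that L by simp
        then show ?thesis by (simp add: \<theta>_def Reals_exp_cis)
      qed
      have "z \<in> inside J \<or> \<theta> L = \<theta> 0"
      proof (cases "z \<in> outside J")
        case True
        then have "winding_number p z = 0"
          using winding_number_zero_in_outside [OF p pcl] by (simp add: pim J_def)
        then show ?thesis using \<theta>\<Delta> by simp
      next
        case out: False
        have "z \<in> inside J \<union> outside J" unfolding inside_Un_outside using False by blast
        then show ?thesis using out by blast
      qed
      moreover have "\<bar>\<theta> L - \<theta> 0\<bar> \<le> 2 * pi" using \<theta>\<Delta> w by auto
      ultimately show "if z \<in> J then \<theta> L - \<theta> 0 = \<omega> * pi else \<bar>\<theta> L - \<theta> 0\<bar> \<le> 2 * pi \<and> (z \<in> inside J \<or> \<theta> L = \<theta> 0)"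
        using False by simp
    qed
  qed
  then obtain \<theta> where \<theta>: "\<And>z. continuous_on {0..L} (\<theta> z)"
    "\<And>z t. t \<in> {0..L} \<Longrightarrow> (c t - z) * cis (- \<theta> z t) \<in> \<real>"
    "\<And>z. z \<in> J \<Longrightarrow> \<theta> z L - \<theta> z 0 = \<omega> * pi"
    "\<And>z. z \<notin> J \<Longrightarrow> \<bar>\<theta> z L - \<theta> z 0\<bar> \<le> 2 * pi \<and> (z \<in> inside J \<or> \<theta> z L = \<theta> z 0)"
    by metis
  define Z where "Z = {z. poly R z = 0}"
  have Z: "finite Z" unfolding Z_def by (rule poly_roots_finite [OF R(1)])
  define k where "k = (\<lambda>z. order z R)"
  have kpos: "k z > 0" if "z \<in> Z" for z using that R(1) by (simp add: Z_def k_def order_root)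
  \<comment> \<open>An argument of \<open>c' ^ n\<close> minus one of the product of the
    \<open>(c - z) ^ k z\<close>. The reality hypothesis says that it equals the argument of the
    leading coefficient modulo pi, so by continuity it is constant.\<close>
  define \<Theta> where "\<Theta> = (\<lambda>t. real n * Im (q (t, t)) - (\<Sum>z\<in>Z. real (k z) * \<theta> z t))"
  have \<Theta>cont: "continuous_on {0..L} \<Theta>"
    unfolding \<Theta>_def by (intro continuous_intros continuous_on_compose2 [OF q(1)] \<theta>) auto
  define a where "a = lead_coeff R"
  have a0: "a \<noteq> 0" using R(1) by (simp add: a_def)
  have Rprod: "poly R x = a * (\<Prod>z\<in>Z. (x - z) ^ k z)" for x
    using arg_cong [OF complex_poly_decompose [of R], of "\<lambda>p. poly p x"]
    by (simp add: poly_prod a_def Z_def k_def)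
  have ImR: "Im (a * cis (- \<Theta> t)) = 0" if t: "t \<in> {0..L}" "c t \<notin> Z" for t
  proof -
    define \<rho> where "\<rho> = (\<Prod>z\<in>Z. ((c t - z) * cis (- \<theta> z t)) ^ k z)"
    have "\<rho> \<in> \<real>" unfolding \<rho>_def by (intro prod_in_Reals Reals_power \<theta>(2) t)
    have "\<rho> \<noteq> 0" using t(2) Z by (auto simp: \<rho>_def cis_neq_zero)
    have e1: "\<rho> = (\<Prod>z\<in>Z. (c t - z) ^ k z) * cis (- (\<Sum>z\<in>Z. real (k z) * \<theta> z t))"
    proof -
      have "(\<Prod>z\<in>Z. cis (- \<theta> z t) ^ k z) = cis (- (\<Sum>z\<in>Z. real (k z) * \<theta> z t))"
        using Z by (induction rule: finite_induct) (auto simp: Complex.DeMoivre cis_mult)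
      then show ?thesis by (simp add: \<rho>_def power_mult_distrib prod.distrib)
    qed
    have c't: "c' t = of_real L * exp (q (t, t))" using q(2) [of t] t L by (simp add: field_simps)
    define e where "e = exp (Re (q (t, t)))"
    have "c' t ^ n = of_real ((L * e) ^ n) * cis (real n * Im (q (t, t)))"
      unfolding c't exp_eq_polar e_def by (simp add: power_mult_distrib Complex.DeMoivre)
    moreover have "cis (real n * Im (q (t, t))) * cis (- (real n * Im (q (t, t)))) = 1" by (simp add: cis_mult)
    ultimately have "poly R (c t) / c' t ^ n * of_real ((L * e) ^ n) = poly R (c t) * cis (- (real n * Im (q (t, t))))"
      using L by (simp add: e_def field_simps)
    moreover have "poly R (c t) / c' t ^ n * of_real ((L * e) ^ n) \<in> \<real>" using real by (intro Reals_mult) auto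
    ultimately have "poly R (c t) * cis (- (real n * Im (q (t, t)))) \<in> \<real>" by simp
    also have "poly R (c t) * cis (- (real n * Im (q (t, t)))) = a * cis (- \<Theta> t) * \<rho>"
      unfolding Rprod e1 \<Theta>_def
      by (simp add: algebra_simps cis_mult)
    finally have "a * cis (- \<Theta> t) * \<rho> / \<rho> \<in> \<real>" using \<open>\<rho> \<in> \<real>\<close> by (rule Reals_divide)
    then have "a * cis (- \<Theta> t) \<in> \<real>" using \<open>\<rho> \<noteq> 0\<close> by simp
    then show ?thesis by (simp add: complex_is_Real_iff)
  qed
  have fin: "finite {t\<in>{0..L}. c t \<in> Z}"
  proof -
    have "finite (c -` Z \<inter> {0..<L})" by (rule finite_vimage_IntI [OF Z inj])
    then have "finite (insert L (c -` Z \<inter> {0..<L}))" by simp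
    then show ?thesis by (rule finite_subset [rotated]) auto
  qed
  \<comment> \<open>The curve meets the roots at finitely many parameters, being injective on a
    period; continuity closes these gaps.\<close>
  have Im0: "Im (a * cis (- \<Theta> t)) = 0" if t: "t \<in> {0..L}" for t
  proof (rule ccontr)
    assume nz: "Im (a * cis (- \<Theta> t)) \<noteq> 0"
    have "continuous_on {0..L} (\<lambda>t. Im (a * cis (- \<Theta> t)))" by (intro continuous_intros \<Theta>cont)
    then obtain e where e: "e > 0" "\<And>s. s \<in> {0..L} \<Longrightarrow> dist t s < e \<Longrightarrow> Im (a * cis (- \<Theta> s)) \<noteq> 0"
      using continuous_on_avoid [of "{0..L}" "\<lambda>t. Im (a * cis (- \<Theta> t))" t 0] t nz by blast
    have "{max 0 (t - e)<..<min L (t + e)} \<subseteq> {t\<in>{0..L}. c t \<in> Z}"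
    proof
      fix s assume s: "s \<in> {max 0 (t - e)<..<min L (t + e)}"
      then have "s \<in> {0..L}" "dist t s < e" by (auto simp: dist_real_def)
      then show "s \<in> {t\<in>{0..L}. c t \<in> Z}" using e(2) ImR by blast
    qed
    moreover have "max 0 (t - e) < min L (t + e)" using t e(1) L by auto
    ultimately show False using fin infinite_Ioo finite_subset by metis
  qed
  define f where "f = (\<lambda>t. (Arg a - \<Theta> t) / pi)"
  have "f t \<in> \<int>" if t: "t \<in> {0..L}" for t
  proof -
    have "a = rcis (norm a) (Arg a)" by (simp add: rcis_cmod_Arg)
    then have "a * cis (- \<Theta> t) = of_real (norm a) * cis (Arg a - \<Theta> t)"
      by (metis cis_mult mult.assoc rcis_def uminus_add_conv_diff add.commute)
    then have "norm a * sin (Arg a - \<Theta> t) = 0" using Im0 [OF t] by simp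
    then have "sin (Arg a - \<Theta> t) = 0" using a0 by simp
    then obtain i :: int where "Arg a - \<Theta> t = of_int i * pi" by (auto simp: sin_zero_iff_int2)
    then have "f t = of_int i" by (simp add: f_def)
    then show ?thesis by simp
  qed
  then have "f 0 = f L" using L by (intro continuous_int_valued_const [of 0 L f]) (auto simp: f_def intro!: continuous_intros \<Theta>cont)
  then have "\<Theta> 0 = \<Theta> L" by (simp add: f_def)
  moreover have "Im (q (L, L)) - Im (q (0, 0)) = 2 * (\<omega> * pi)"
    using qIm [of L] qIm [of 0] L by simp
  \<comment> \<open>The balance: \<open>n\<close> times the turning of the tangent equals the
    changes of argument seen from the roots, weighted by multiplicity. None of these exceeds
    \<open>2 * \<bar>\<omega>\<bar> * pi\<close>, so at least \<open>n\<close> roots are required;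
    as the degree is at most \<open>n\<close>, each must attain the bound, which only points inside
    can do.\<close>
  ultimately have eq: "real n * (2 * (\<omega> * pi)) = (\<Sum>z\<in>Z. real (k z) * (\<theta> z L - \<theta> z 0))"
    by (simp add: \<Theta>_def algebra_simps sum_subtractf)
  have \<omega>1: "\<bar>\<omega>\<bar> \<ge> 1"
  proof -
    have "\<omega> = of_int (2 * m + 1)" by (simp add: \<omega>_def)
    moreover have "\<bar>2 * m + 1\<bar> \<ge> 1" by presburger
    ultimately show ?thesis by (metis of_int_1_le_iff of_int_abs)
  qed
  have bnd: "\<bar>\<theta> z L - \<theta> z 0\<bar> \<le> 2 * (\<bar>\<omega>\<bar> * pi)" "z \<notin> inside J \<Longrightarrow> \<bar>\<theta> z L - \<theta> z 0\<bar> < 2 * (\<bar>\<omega>\<bar> * pi)" for z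
  proof -
    have "\<bar>\<theta> z L - \<theta> z 0\<bar> \<le> 2 * (\<bar>\<omega>\<bar> * pi) \<and> (z \<notin> inside J \<longrightarrow> \<bar>\<theta> z L - \<theta> z 0\<bar> < 2 * (\<bar>\<omega>\<bar> * pi))"
    proof (cases "z \<in> J")
      case True
      have "0 < \<bar>\<omega>\<bar> * pi" using \<omega>1 by (intro mult_pos_pos) auto
      moreover have "\<bar>\<theta> z L - \<theta> z 0\<bar> = \<bar>\<omega>\<bar> * pi" by (simp add: \<theta>(3) [OF True] abs_mult)
      ultimately show ?thesis by linarith
    next
      case False
      have "1 * pi \<le> \<bar>\<omega>\<bar> * pi" using \<omega>1 by (intro mult_right_mono) auto
      then have "2 * pi \<le> 2 * (\<bar>\<omega>\<bar> * pi)" "0 < 2 * (\<bar>\<omega>\<bar> * pi)" using pi_gt_zero by linarith+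
      moreover have "\<bar>\<theta> z L - \<theta> z 0\<bar> \<le> 2 * pi" "z \<notin> inside J \<longrightarrow> \<bar>\<theta> z L - \<theta> z 0\<bar> = 0"
        using \<theta>(4) [OF False] by auto
      ultimately show ?thesis by linarith
    qed
    then show "\<bar>\<theta> z L - \<theta> z 0\<bar> \<le> 2 * (\<bar>\<omega>\<bar> * pi)" "z \<notin> inside J \<Longrightarrow> \<bar>\<theta> z L - \<theta> z 0\<bar> < 2 * (\<bar>\<omega>\<bar> * pi)" by auto
  qed
  have degk: "real (degree R) = (\<Sum>z\<in>Z. real (k z))"
    using degree_eq_sum_order [OF R(1)] by (simp add: Z_def k_def)
  have "real n * (2 * (\<bar>\<omega>\<bar> * pi)) = \<bar>real n * (2 * (\<omega> * pi))\<bar>" by (simp add: abs_mult)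
  also have "\<dots> \<le> (\<Sum>z\<in>Z. \<bar>real (k z) * (\<theta> z L - \<theta> z 0)\<bar>)" unfolding eq by (rule sum_abs)
  also have "\<dots> = (\<Sum>z\<in>Z. real (k z) * \<bar>\<theta> z L - \<theta> z 0\<bar>)" by (simp add: abs_mult)
  finally have le: "real n * (2 * (\<bar>\<omega>\<bar> * pi)) \<le> (\<Sum>z\<in>Z. real (k z) * \<bar>\<theta> z L - \<theta> z 0\<bar>)" .
  have \<omega>pi: "2 * (\<bar>\<omega>\<bar> * pi) > 0" using \<omega>1 by (intro mult_pos_pos) auto
  have "(\<Sum>z\<in>Z. real (k z) * \<bar>\<theta> z L - \<theta> z 0\<bar>) \<le> (\<Sum>z\<in>Z. real (k z) * (2 * (\<bar>\<omega>\<bar> * pi)))"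
    by (intro sum_mono mult_left_mono bnd) auto
  then have "real n * (2 * (\<bar>\<omega>\<bar> * pi)) \<le> real (degree R) * (2 * (\<bar>\<omega>\<bar> * pi))"
    using le by (simp add: degk sum_distrib_right)
  then have "n \<le> degree R" using \<omega>pi by (simp only: mult_le_cancel_right_pos of_nat_le_iff)
  with R(2) show deg: "degree R = n" by simp
  show "z \<in> inside (c ` {0..L})" if "poly R z = 0"
  proof (rule ccontr)
    assume nin: "z \<notin> inside (c ` {0..L})"
    have "(\<Sum>z\<in>Z. real (k z) * \<bar>\<theta> z L - \<theta> z 0\<bar>) < (\<Sum>z\<in>Z. real (k z) * (2 * (\<bar>\<omega>\<bar> * pi)))"
    proof (rule sum_strict_mono_ex1 [OF Z])
      show "\<forall>x\<in>Z. real (k x) * \<bar>\<theta> x L - \<theta> x 0\<bar> \<le> real (k x) * (2 * (\<bar>\<omega>\<bar> * pi))"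
        by (intro ballI mult_left_mono bnd) auto
      show "\<exists>a\<in>Z. real (k a) * \<bar>\<theta> a L - \<theta> a 0\<bar> < real (k a) * (2 * (\<bar>\<omega>\<bar> * pi))"
      proof (intro bexI [of _ z] mult_strict_left_mono bnd)
        show "z \<in> Z" using that by (simp add: Z_def)
        then show "0 < real (k z)" using kpos by simp
      qed (use nin in \<open>simp add: J_def\<close>)
    qed
    also have "\<dots> = real n * (2 * (\<bar>\<omega>\<bar> * pi))"
      using degk by (simp add: deg sum_distrib_right)
    finally show False using le by simp
  qed
qed

subsection \<open>The boundary in the flow coordinate\<close>

text \<open>The last clause says that near each point of the arc the set \<open>S\<close> consists
  of nothing but a short piece of the arc. This makes the arc open in \<open>S\<close> and excludes
  that other branches of \<open>S\<close> accumulate there.\<close>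

definition smooth_arc :: "complex set \<Rightarrow> (real \<Rightarrow> complex) \<Rightarrow> (real \<Rightarrow> complex) \<Rightarrow> real \<Rightarrow> bool" where
  "smooth_arc S \<sigma> \<sigma>' \<delta> \<longleftrightarrow> 0 < \<delta> \<and> continuous_on {-\<delta><..<\<delta>} \<sigma>' \<and>
     (\<forall>t\<in>{-\<delta><..<\<delta>}. (\<sigma> has_vector_derivative \<sigma>' t) (at t) \<and> norm (\<sigma>' t) = 1 \<and> \<sigma> t \<in> S \<and>
        (\<forall>\<epsilon>>0. \<exists>V. open V \<and> \<sigma> t \<in> V \<and> S \<inter> V \<subseteq> \<sigma> ` {u\<in>{-\<delta><..<\<delta>}. \<bar>u - t\<bar> < \<epsilon>}))"

definition C1_curve :: "complex set \<Rightarrow> bool" where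
  "C1_curve S \<longleftrightarrow> (\<forall>p\<in>S. \<exists>\<sigma> \<sigma>' \<delta>. smooth_arc S \<sigma> \<sigma>' \<delta> \<and> \<sigma> 0 = p)"

definition unit_tangent :: "complex set \<Rightarrow> complex \<Rightarrow> complex \<Rightarrow> bool" where
  "unit_tangent S p T \<longleftrightarrow> (\<exists>\<sigma> \<sigma>' \<delta> t. smooth_arc S \<sigma> \<sigma>' \<delta> \<and> t \<in> {-\<delta><..<\<delta>} \<and> \<sigma> t = p \<and> \<sigma>' t = T)"

lemma smooth_arcD:
  assumes "smooth_arc S \<sigma> \<sigma>' \<delta>"
  shows "0 < \<delta>" "continuous_on {-\<delta><..<\<delta>} \<sigma>'"
    "t \<in> {-\<delta><..<\<delta>} \<Longrightarrow> (\<sigma> has_vector_derivative \<sigma>' t) (at t)"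
    "t \<in> {-\<delta><..<\<delta>} \<Longrightarrow> norm (\<sigma>' t) = 1" "t \<in> {-\<delta><..<\<delta>} \<Longrightarrow> \<sigma> t \<in> S"
    "t \<in> {-\<delta><..<\<delta>} \<Longrightarrow> \<epsilon> > 0 \<Longrightarrow> \<exists>V. open V \<and> \<sigma> t \<in> V \<and> S \<inter> V \<subseteq> \<sigma> ` {u\<in>{-\<delta><..<\<delta>}. \<bar>u - t\<bar> < \<epsilon>}"
    "t \<in> {-\<delta><..<\<delta>} \<Longrightarrow> unit_tangent S (\<sigma> t) (\<sigma>' t)"
  using assms unfolding smooth_arc_def unit_tangent_def by blast+

lemma isCont_open_nbhd:
  fixes f :: "'a::metric_space \<Rightarrow> 'b::metric_space"
  assumes "isCont f a" "open U" "f a \<in> U"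
  obtains e where "e > 0" "\<And>x. dist x a < e \<Longrightarrow> f x \<in> U"
proof -
  obtain d where d: "d > 0" "ball (f a) d \<subseteq> U" using assms openE by blast
  then obtain e where "e > 0" "\<forall>x. dist x a < e \<longrightarrow> dist (f x) (f a) < d"
    using assms(1) unfolding continuous_at_eps_delta by blast
  then show ?thesis using d(2) by (intro that [of e]) (auto simp: dist_commute subset_iff)
qed

text \<open>Pulled back by \<open>A\<close>, the curve \<open>S\<close> is a straight line, because the \<open>n\<close>-th power of its velocity
  has a constant argument.\<close>

lemma curve_straightened:
  fixes A :: "complex \<Rightarrow> complex"
  assumes hol: "A holomorphic_on H" and "open H" and dA0: "\<And>x. x \<in> H \<Longrightarrow> deriv A x \<noteq> 0"
    and S: "C1_curve S" and n: "n > 0" and \<kappa>: "\<kappa> \<noteq> 0"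
    and tan: "\<And>x T. x \<in> H \<Longrightarrow> unit_tangent S (A x) T \<Longrightarrow> \<exists>r::real. T ^ n = of_real r * \<kappa> * deriv A x ^ n"
    and w: "w \<in> H" "A w \<in> S"
  obtains d \<rho> where "\<rho> > 0" "norm d = 1" "ball w \<rho> \<subseteq> H"
    "\<And>x. x \<in> ball w \<rho> \<Longrightarrow> A x \<in> S \<longleftrightarrow> (\<exists>s::real. x = w + of_real s * d)"
proof -
  obtain r g where r: "r > 0" "ball w r \<subseteq> H" "open (A ` ball w r)"
    and g: "g holomorphic_on A ` ball w r" "\<And>x. x \<in> ball w r \<Longrightarrow> g (A x) = x"
    using holomorphic_local_inverse [OF hol \<open>open H\<close> w(1) dA0 [OF w(1)]] by metis
  obtain \<sigma> \<sigma>' \<delta> where \<sigma>: "smooth_arc S \<sigma> \<sigma>' \<delta>" and \<sigma>0: "\<sigma> 0 = A w"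
    using S w(2) unfolding C1_curve_def by blast
  note sd = smooth_arcD [OF \<sigma>]
  have cont: "isCont \<sigma> 0" using sd(3) [of 0] sd(1) by (auto intro: has_vector_derivative_continuous)
  have "A w \<in> A ` ball w r" using r(1) by auto
  then obtain \<epsilon>0 where \<epsilon>0: "\<epsilon>0 > 0" "\<And>t. \<bar>t\<bar> < \<epsilon>0 \<Longrightarrow> \<sigma> t \<in> A ` ball w r"
    using isCont_open_nbhd [OF cont r(3)] \<sigma>0 by (auto simp: dist_norm)
  define \<epsilon> where "\<epsilon> = min \<epsilon>0 \<delta>"
  have \<epsilon>: "\<epsilon> > 0" "\<epsilon> \<le> \<epsilon>0" "\<epsilon> \<le> \<delta>" using \<epsilon>0 sd(1) by (auto simp: \<epsilon>_def)
  define I where "I = {-\<epsilon><..<\<epsilon>}"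
  have I: "t \<in> {-\<delta><..<\<delta>}" "\<sigma> t \<in> A ` ball w r" if "t \<in> I" for t
    using that \<epsilon> \<epsilon>0(2) [of t] by (auto simp: I_def)
  define W where "W = (\<lambda>t. g (\<sigma> t))"
  have Wb: "W t \<in> ball w r \<and> A (W t) = \<sigma> t" if "t \<in> I" for t
    using I(2) [OF that] g(2) by (auto simp: W_def)
  have W0: "W 0 = w" using g(2) [of w] r(1) by (simp add: W_def \<sigma>0)
  define W' where "W' = (\<lambda>t. \<sigma>' t / deriv A (W t))"
  have dW: "(W has_vector_derivative W' t) (at t)" if t: "t \<in> I" for t
  proof -
    have x: "W t \<in> ball w r" "A (W t) = \<sigma> t" using Wb [OF t] by auto
    have "(g has_field_derivative deriv g (\<sigma> t)) (at (\<sigma> t))"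
      using g(1) I(2) [OF t] r(3) holomorphic_derivI by blast
    then have "((g \<circ> \<sigma>) has_vector_derivative \<sigma>' t * deriv g (\<sigma> t)) (at t)"
      by (intro field_vector_diff_chain_at sd(3) I(1) t)
    moreover have "deriv g (\<sigma> t) = 1 / deriv A (W t)"
    proof -
      have dAx: "(A has_field_derivative deriv A (W t)) (at (W t))"
        using hol x(1) r(2) \<open>open H\<close> holomorphic_derivI by blast
      have "((\<lambda>x. g (A x)) has_field_derivative deriv g (\<sigma> t) * deriv A (W t)) (at (W t))"
        by (rule DERIV_chain2 [OF _ dAx]) (use x \<open>(g has_field_derivative deriv g (\<sigma> t)) (at (\<sigma> t))\<close> in simp)
      moreover have "((\<lambda>x. g (A x)) has_field_derivative 1) (at (W t))"
        by (rule has_field_derivative_transform_within_open [OF DERIV_ident open_ball x(1)]) (simp add: g(2))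
      ultimately have "deriv g (\<sigma> t) * deriv A (W t) = 1" by (rule DERIV_unique)
      then show ?thesis by (metis mult_cancel_right nonzero_eq_divide_eq mult_zero_right zero_neq_one)
    qed
    ultimately show ?thesis by (simp add: W_def W'_def o_def)
  qed
  have W'n0: "W' t \<noteq> 0" if "t \<in> I" for t
    using sd(4) [OF I(1) [OF that]] dA0 [of "W t"] Wb [OF that] r(2) by (auto simp: W'_def)
  have W'n: "\<exists>r::real. W' t ^ n = of_real r * \<kappa>" if t: "t \<in> I" for t
  proof -
    have x: "W t \<in> H" "A (W t) = \<sigma> t" using Wb [OF t] r(2) by auto
    have "unit_tangent S (A (W t)) (\<sigma>' t)" using sd(7) [OF I(1) [OF t]] x by simp
    then obtain r where "\<sigma>' t ^ n = of_real r * \<kappa> * deriv A (W t) ^ n" using tan x(1) by blast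
    then show ?thesis using dA0 [OF x(1)] by (auto simp: W'_def power_divide)
  qed
  have contW: "continuous_on I W"
    using dW by (meson continuous_at_imp_continuous_on has_vector_derivative_continuous)
  have contW': "continuous_on I W'"
    unfolding W'_def
  proof (intro continuous_intros)
    show "continuous_on I \<sigma>'" using sd(2) I(1) continuous_on_subset by blast
    have "continuous_on (ball w r) (deriv A)"
      using hol r(2) \<open>open H\<close> by (meson holomorphic_deriv holomorphic_on_imp_continuous_on holomorphic_on_subset)
    then show "continuous_on I (\<lambda>t. deriv A (W t))"
      using Wb by (intro continuous_on_compose2 [OF _ contW]) auto
    show "\<forall>t\<in>I. deriv A (W t) \<noteq> 0" using dA0 Wb r(2) by blast
  qed
  \<comment> \<open>The direction of \<open>W'\<close>. Since \<open>W' ^ n\<close> is a real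
    multiple of \<kappa>, the power \<open>u ^ (2 * n)\<close> is fixed, squaring having absorbed
    the sign; so \<open>u\<close> takes finitely many values and is constant.\<close>
  define u where "u = (\<lambda>t. W' t / of_real (norm (W' t)))"
  have "continuous_on I u" unfolding u_def using W'n0 by (intro continuous_intros contW') auto
  moreover have "u ` I \<subseteq> {z. z ^ (2 * n) = (\<kappa> / of_real (norm \<kappa>))\<^sup>2}"
  proof (clarsimp)
    fix t assume t: "t \<in> I"
    obtain r where r: "W' t ^ n = of_real r * \<kappa>" using W'n [OF t] by blast
    then have "norm (W' t) ^ n = \<bar>r\<bar> * norm \<kappa>" by (metis norm_mult norm_of_real norm_power)
    moreover have "r \<noteq> 0" using r W'n0 [OF t] by auto
    ultimately have "u t ^ n = of_real (r / \<bar>r\<bar>) * (\<kappa> / of_real (norm \<kappa>))"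
      using r by (simp add: u_def power_divide flip: of_real_power)
    then have "(u t ^ n)\<^sup>2 = (of_real (r / \<bar>r\<bar>))\<^sup>2 * (\<kappa> / of_real (norm \<kappa>))\<^sup>2"
      by (simp only: power_mult_distrib)
    moreover have "(of_real (r / \<bar>r\<bar>) :: complex)\<^sup>2 = 1"
      using \<open>r \<noteq> 0\<close> by (simp add: power_divide flip: of_real_power)
    ultimately show "u t ^ (2 * n) = (\<kappa> / of_real (norm \<kappa>))\<^sup>2" by (simp add: power_mult mult.commute)
  qed
  then have "finite (u ` I)" using finite_nth_roots [of "2 * n"] n finite_subset by (metis nat_0_less_mult_iff pos2)
  moreover have "connected I" by (simp add: I_def)
  ultimately have "u constant_on I" using continuous_finite_range_constant by blast
  then obtain d where d: "\<And>t. t \<in> I \<Longrightarrow> u t = d" unfolding constant_on_def by blast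
  have "0 \<in> I" using \<epsilon>(1) by (simp add: I_def)
  have nd: "norm d = 1" using d [OF \<open>0 \<in> I\<close>] W'n0 [OF \<open>0 \<in> I\<close>] by (auto simp: u_def norm_divide)
  then have d0: "d \<noteq> 0" by auto
  have W'd: "W' t = of_real (norm (W' t)) * d" if "t \<in> I" for t
    using d [OF that] W'n0 [OF that] by (auto simp: u_def field_simps)
  \<comment> \<open>The position measured in the direction \<open>d\<close>. Its derivative
    \<open>norm (W' t)\<close> is real and positive, so \<open>W\<close> moves along the line
    through \<open>w\<close> without turning back.\<close>
  define q where "q = (\<lambda>t. (W t - w) / d)"
  have dq: "(q has_vector_derivative of_real (norm (W' t))) (at t)" if "t \<in> I" for t
  proof -
    have "(q has_vector_derivative W' t / d) (at t)"
      unfolding q_def using dW [OF that] by (intro has_vector_derivative_divide) (auto intro!: derivative_eq_intros)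
    then show ?thesis using W'd [OF that] d0 by (metis nonzero_mult_div_cancel_right)
  qed
  define f where "f = (\<lambda>t. Re (q t))"
  have df: "(f has_real_derivative norm (W' t)) (at t)" if "t \<in> I" for t
    using has_field_derivative_Re [OF dq [OF that]] by (simp add: f_def)
  have dIm: "((\<lambda>t. Im (q t)) has_real_derivative 0) (at t)" if "t \<in> I" for t
    using has_field_derivative_Im [OF dq [OF that]] by simp
  have Im0: "Im (q t) = 0" if "t \<in> I" for t
  proof -
    have "\<exists>c. \<forall>t\<in>I. Im (q t) = c"
      using dIm by (intro has_field_derivative_zero_constant) (auto simp: I_def intro: has_field_derivative_at_within)
    then have "Im (q t) = Im (q 0)" using that \<open>0 \<in> I\<close> by metis
    then show ?thesis by (simp add: q_def W0)
  qed
  have Wf: "W t = w + of_real (f t) * d" if "t \<in> I" for t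
  proof -
    have "q t = of_real (f t)" using Im0 [OF that] by (simp add: complex_eq_iff f_def)
    then show ?thesis using d0 by (simp add: q_def field_simps)
  qed
  have f0: "f 0 = 0" using W0 by (simp add: f_def q_def)
  have mono: "f a < f b" if "a \<in> I" "b \<in> I" "a < b" for a b
  proof (rule DERIV_pos_imp_increasing [OF that(3)])
    fix x assume "a \<le> x" "x \<le> b"
    then have x: "x \<in> I" using that by (auto simp: I_def)
    show "\<exists>y. (f has_real_derivative y) (at x) \<and> 0 < y"
      using df [OF x] W'n0 [OF x] by (intro exI [of _ "norm (W' x)"]) auto
  qed
  define \<epsilon>1 where "\<epsilon>1 = \<epsilon> / 2"
  have \<epsilon>1: "\<epsilon>1 > 0" "\<epsilon>1 \<in> I" "-\<epsilon>1 \<in> I" using \<epsilon>(1) by (auto simp: \<epsilon>1_def I_def)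
  have fs: "f \<epsilon>1 > 0" "f (-\<epsilon>1) < 0" using mono [of 0 \<epsilon>1] mono [of "-\<epsilon>1" 0] \<epsilon>1 \<open>0 \<in> I\<close> f0 by auto
  have ivt: "\<exists>t\<in>I. f t = s" if s: "f (-\<epsilon>1) \<le> s" "s \<le> f \<epsilon>1" for s
  proof -
    have "continuous_on {-\<epsilon>1..\<epsilon>1} f"
    proof (intro continuous_at_imp_continuous_on ballI)
      fix t assume "t \<in> {-\<epsilon>1..\<epsilon>1}"
      then have "t \<in> I" using \<epsilon>1 by (auto simp: I_def)
      then show "isCont f t" using df DERIV_isCont by blast
    qed
    then obtain t where "-\<epsilon>1 \<le> t" "t \<le> \<epsilon>1" "f t = s" using IVT' [of f "-\<epsilon>1" s \<epsilon>1] s \<epsilon>1(1) by auto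
    then show ?thesis using \<epsilon>1 by (intro bexI [of _ t]) (auto simp: I_def)
  qed
  obtain V where V: "open V" "A w \<in> V" "S \<inter> V \<subseteq> \<sigma> ` {u\<in>{-\<delta><..<\<delta>}. \<bar>u - 0\<bar> < \<epsilon>}"
    using sd(6) [of 0 \<epsilon>] sd(1) \<epsilon>(1) \<sigma>0 by auto
  have "isCont A w"
    using hol w(1) \<open>open H\<close> by (meson continuous_on_eq_continuous_at holomorphic_on_imp_continuous_on)
  then obtain \<rho>0 where \<rho>0: "\<rho>0 > 0" "\<And>x. dist x w < \<rho>0 \<Longrightarrow> A x \<in> V"
    by (rule isCont_open_nbhd [where f = A and a = w and U = V]) (assumption | rule V that)+
  \<comment> \<open>The bounds ensure in turn that \<open>A\<close> is invertible, that
    \<open>S\<close> near \<open>A w\<close> is covered by the arc, and that \<open>W\<close>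
    reaches all points of the line up to distance \<rho> in both directions.\<close>
  define \<rho> where "\<rho> = min (min r \<rho>0) (min (f \<epsilon>1) (- f (-\<epsilon>1)))"
  have \<rho>: "\<rho> > 0" "\<rho> \<le> r" "\<rho> \<le> \<rho>0" "\<rho> \<le> f \<epsilon>1" "\<rho> \<le> - f (-\<epsilon>1)" using r \<rho>0 fs by (auto simp: \<rho>_def)
  show ?thesis
  proof (rule that [OF \<rho>(1) nd])
    show "ball w \<rho> \<subseteq> H" using \<rho>(2) r(2) by auto
    fix x assume x: "x \<in> ball w \<rho>"
    then have xr: "x \<in> ball w r" using \<rho> by auto
    show "A x \<in> S \<longleftrightarrow> (\<exists>s::real. x = w + of_real s * d)"
    proof
      assume "A x \<in> S"
      moreover have "A x \<in> V" using x \<rho> by (intro \<rho>0) (auto simp: dist_commute)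
      ultimately obtain t where t: "\<bar>t\<bar> < \<epsilon>" "A x = \<sigma> t" using V(3) by auto
      then have "t \<in> I" by (auto simp: I_def)
      moreover have "x = W t" using g(2) [OF xr] t(2) by (simp add: W_def)
      ultimately show "\<exists>s::real. x = w + of_real s * d" using Wf by blast
    next
      assume "\<exists>s::real. x = w + of_real s * d"
      then obtain s where s: "x = w + of_real s * d" by blast
      then have "\<bar>s\<bar> < \<rho>" using x nd by (simp add: dist_norm norm_mult)
      then obtain t where t: "t \<in> I" "f t = s" using ivt [of s] \<rho> by force
      then have "x = W t" using Wf s by simp
      then show "A x \<in> S" using Wb [OF t(1)] sd(5) [OF I(1) [OF t(1)]] by simp
    qed
  qed
qed

text \<open>Connectedness along the ray. Near a parameter whose image lies off the closed set
  \<open>S\<close>, nothing is mapped into \<open>S\<close>; near one whose image lies on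
  \<open>S\<close>, the preimage of \<open>S\<close> is a straight line, and this is the ray as soon
  as it contains a piece of it.\<close>

lemma curve_contains_line:
  fixes A :: "complex \<Rightarrow> complex"
  assumes hol: "A holomorphic_on {x. h0 < Re x}" and dA0: "\<And>x. h0 < Re x \<Longrightarrow> deriv A x \<noteq> 0"
    and S: "C1_curve S" "closed S" and n: "n > 0" and \<kappa>: "\<kappa> \<noteq> 0"
    and tan: "\<And>x T. h0 < Re x \<Longrightarrow> unit_tangent S (A x) T \<Longrightarrow> \<exists>r::real. T ^ n = of_real r * \<kappa> * deriv A x ^ n"
    and w: "h0 < Re w" and line: "\<rho> > 0" "\<And>s::real. \<bar>s\<bar> < \<rho> \<Longrightarrow> A (w + of_real s * d) \<in> S"
    and d: "norm d = 1" and t: "0 \<le> t" and re: "\<And>s. 0 \<le> s \<Longrightarrow> s \<le> t \<Longrightarrow> h0 < Re (w + of_real s * d)"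
  shows "A (w + of_real t * d) \<in> S"
proof -
  define P where "P = (\<lambda>s::real. \<exists>\<rho>>0. \<forall>\<tau>::real. \<bar>\<tau>\<bar> < \<rho> \<longrightarrow> A (w + of_real (s + \<tau>) * d) \<in> S)"
  have d0: "d \<noteq> 0" using d by auto
  have "P t"
  proof (rule connected_induction_simple [of "{0..t}" 0 t P])
    show "P 0" using line unfolding P_def by auto
    fix a assume a: "a \<in> {0..t}"
    define y where "y = w + of_real a * d"
    have yH: "h0 < Re y" using re [of a] a by (simp add: y_def)
    have "\<exists>r>0. \<forall>x x'. \<bar>x - a\<bar> < r \<longrightarrow> \<bar>x' - a\<bar> < r \<longrightarrow> P x \<longrightarrow> P x'"
    proof (cases "A y \<in> S")
      case False
      have "isCont A y"
        using hol yH open_right_half_plane by (metis (no_types, lifting) continuous_on_eq_continuous_at holomorphic_on_imp_continuous_on mem_Collect_eq)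
      then obtain r where r: "r > 0" "\<And>x. dist x y < r \<Longrightarrow> A x \<in> - S"
        by (rule isCont_open_nbhd [where f = A and a = y and U = "- S"]) (use False S(2) that in auto)
      have "\<not> P x" if "\<bar>x - a\<bar> < r" for x
      proof
        assume "P x"
        then have "A (w + of_real x * d) \<in> S" unfolding P_def by (metis abs_zero add.right_neutral)
        moreover have "dist (w + of_real x * d) y < r"
          using that d by (simp add: y_def dist_norm norm_mult flip: left_diff_distrib of_real_diff)
        ultimately show False using r(2) by blast
      qed
      then show ?thesis using r(1) by blast
    next
      case True
      have yH': "y \<in> {x. h0 < Re x}" using yH by simp
      obtain d1 r where r: "r > 0" "norm d1 = 1" "ball y r \<subseteq> {x. h0 < Re x}"
        "\<And>x. x \<in> ball y r \<Longrightarrow> A x \<in> S \<longleftrightarrow> (\<exists>s::real. x = y + of_real s * d1)"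
        by (rule curve_straightened [OF hol open_right_half_plane _ S(1) n \<kappa> _ yH' True]) (use dA0 tan that in auto)
      have mem: "w + of_real x * d \<in> ball y r" if "\<bar>x - a\<bar> < r" for x
        using that d by (simp add: y_def dist_norm norm_mult abs_minus_commute flip: left_diff_distrib of_real_diff)
      have "P x'" if x: "\<bar>x - a\<bar> < r" and x': "\<bar>x' - a\<bar> < r" and "P x" for x x'
      proof -
        obtain \<rho>1 where \<rho>1: "\<rho>1 > 0" "\<And>\<tau>::real. \<bar>\<tau>\<bar> < \<rho>1 \<Longrightarrow> A (w + of_real (x + \<tau>) * d) \<in> S"
          using \<open>P x\<close> unfolding P_def by blast
        define \<rho>2 where "\<rho>2 = min \<rho>1 (r - \<bar>x - a\<bar>)"
        have \<rho>2: "\<rho>2 > 0" "\<rho>2 \<le> \<rho>1" "\<rho>2 \<le> r - \<bar>x - a\<bar>" using \<rho>1(1) x by (auto simp: \<rho>2_def)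
        \<comment> \<open>The point with parameter \<open>z\<close> lies on both lines and differs
          from \<open>y\<close>, so \<open>d\<close> is a real multiple of
          \<open>d1\<close>.\<close>
        obtain z where z: "\<bar>z - x\<bar> < \<rho>2" "z \<noteq> a"
          using \<rho>2(1) by (cases "x = a") (auto intro: that [of "x + \<rho>2/2"] that [of x])
        have zr: "\<bar>z - a\<bar> < r" using z \<rho>2 by linarith
        have "A (w + of_real z * d) \<in> S" using \<rho>1(2) [of "z - x"] z \<rho>2 by simp
        then obtain s where s: "w + of_real z * d = y + of_real s * d1" using r(4) [OF mem [OF zr]] by blast
        then have e: "of_real (z - a) * d = of_real s * d1" by (simp add: y_def algebra_simps)
        then have "s \<noteq> 0" using z(2) d0 by auto
        then have dd: "d = of_real (s / (z - a)) * d1" using e z(2) by (simp add: field_simps)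
        show ?thesis unfolding P_def
        proof (intro exI [of _ "r - \<bar>x' - a\<bar>"] conjI allI impI)
          fix \<tau> :: real assume "\<bar>\<tau>\<bar> < r - \<bar>x' - a\<bar>"
          then have "\<bar>(x' + \<tau>) - a\<bar> < r" by linarith
          moreover have "w + of_real (x' + \<tau>) * d = y + of_real ((x' + \<tau> - a) * (s / (z - a))) * d1"
          proof -
            have "w + of_real (x' + \<tau>) * d = y + of_real (x' + \<tau> - a) * d" by (simp add: y_def algebra_simps)
            also have "of_real (x' + \<tau> - a) * d = of_real ((x' + \<tau> - a) * (s / (z - a))) * d1"
              by (subst dd) (simp only: of_real_mult mult.assoc)
            finally show ?thesis .
          qed
          ultimately show "A (w + of_real (x' + \<tau>) * d) \<in> S" using r(4) [OF mem] by blast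
        qed (use x' in auto)
      qed
      then show ?thesis using r(1) by blast
    qed
    then obtain r where r: "r > 0" "\<And>x x'. \<bar>x - a\<bar> < r \<Longrightarrow> \<bar>x' - a\<bar> < r \<Longrightarrow> P x \<Longrightarrow> P x'" by blast
    show "\<exists>T. openin (top_of_set {0..t}) T \<and> a \<in> T \<and> (\<forall>x\<in>T. \<forall>y\<in>T. P x \<longrightarrow> P y)"
      using r a by (intro exI [of _ "{0..t} \<inter> ball a r"]) (auto simp: dist_norm abs_minus_commute)
  qed (use t in auto)
  then show ?thesis unfolding P_def by (metis abs_zero add.right_neutral)
qed

text \<open>By \<open>curve_straightened\<close> the preimage of \<open>S\<close> is locally a line.
  If it were not vertical, one of its rays would run to the right and \<open>A\<close> would be
  unbounded on it, against compactness of \<open>S\<close>. So the whole vertical line through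
  \<open>w\<close> is mapped into \<open>S\<close>; its image is compact by periodicity and open in
  \<open>S\<close>, hence equals the connected set \<open>S\<close>.\<close>

lemma curve_eq_level_line:
  fixes A :: "complex \<Rightarrow> complex"
  assumes hol: "A holomorphic_on {x. h0 < Re x}" and dA0: "\<And>x. h0 < Re x \<Longrightarrow> deriv A x \<noteq> 0"
    and per: "\<And>x. h0 < Re x \<Longrightarrow> A (x + 2 * of_real pi * \<i>) = A x"
    and inf: "\<And>C. \<exists>h'. \<forall>x. h' < Re x \<longrightarrow> C < norm (A x)"
    and S: "C1_curve S" "compact S" "connected S" and n: "n > 0" and \<kappa>: "\<kappa> \<noteq> 0"
    and tan: "\<And>x T. h0 < Re x \<Longrightarrow> unit_tangent S (A x) T \<Longrightarrow> \<exists>r::real. T ^ n = of_real r * \<kappa> * deriv A x ^ n"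
    and w: "h0 < Re w" "A w \<in> S"
  shows "S = A ` {x. Re x = Re w}"
proof -
  have clS: "closed S" using S(2) by (rule compact_imp_closed)
  obtain C where C: "\<And>z. z \<in> S \<Longrightarrow> norm z \<le> C" using compact_imp_bounded [OF S(2)] unfolding bounded_iff by blast
  obtain h' where h': "\<And>x. h' < Re x \<Longrightarrow> C < norm (A x)" using inf by blast
  have line: "A (w + of_real t * d) \<in> S"
    if "h0 < Re w" "\<rho> > 0" "\<And>s::real. \<bar>s\<bar> < \<rho> \<Longrightarrow> A (w + of_real s * d) \<in> S" "norm d = 1" "0 \<le> t"
      "\<And>s. 0 \<le> s \<Longrightarrow> s \<le> t \<Longrightarrow> h0 < Re (w + of_real s * d)" for w d \<rho> t
    by (rule curve_contains_line [OF hol _ S(1) clS n \<kappa> _ that]) (use dA0 tan in auto)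
  have vert: "\<exists>\<rho>>0. ball x \<rho> \<subseteq> {x. h0 < Re x} \<and> (\<forall>y\<in>ball x \<rho>. A y \<in> S \<longleftrightarrow> Re y = Re x)"
    if x: "h0 < Re x" "A x \<in> S" for x
  proof -
    have x': "x \<in> {x. h0 < Re x}" using x by simp
    obtain d \<rho> where d: "\<rho> > 0" "norm d = 1" "ball x \<rho> \<subseteq> {x. h0 < Re x}"
      "\<And>y. y \<in> ball x \<rho> \<Longrightarrow> A y \<in> S \<longleftrightarrow> (\<exists>s::real. y = x + of_real s * d)"
      by (rule curve_straightened [OF hol open_right_half_plane _ S(1) n \<kappa> _ x' x(2)]) (use dA0 tan that in auto)
    have seg: "A (x + of_real s * d) \<in> S" "A (x + of_real s * (- d)) \<in> S" if "\<bar>s\<bar> < \<rho>" for s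
    proof -
      have "x + of_real s * d \<in> ball x \<rho>" using that d(2) by (simp add: dist_norm norm_mult)
      then show "A (x + of_real s * d) \<in> S" using d(4) by blast
      have "x + of_real (- s) * d \<in> ball x \<rho>" using that d(2) by (simp add: dist_norm norm_mult)
      then have "A (x + of_real (- s) * d) \<in> S" using d(4) by blast
      then show "A (x + of_real s * (- d)) \<in> S" by simp
    qed
    have no: "\<not> Re d' > 0" if d': "norm d' = 1" "\<And>s. \<bar>s\<bar> < \<rho> \<Longrightarrow> A (x + of_real s * d') \<in> S" for d'
    proof
      assume pos: "Re d' > 0"
      \<comment> \<open>Far enough along \<open>d'\<close> to reach the region where
        \<open>norm (A x)\<close> exceeds the bound \<open>C\<close> of \<open>S\<close>.\<close>
      define s where "s = (max 0 (h' - Re x) + 1) / Re d'"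
      have s: "s > 0" "h' < Re x + s * Re d'" using pos by (auto simp: s_def add_pos_nonneg)
      have "A (x + of_real s * d') \<in> S"
      proof (rule line [OF x(1) d(1) d'(2) d'(1)])
        fix u :: real assume "0 \<le> u"
        then have "0 \<le> u * Re d'" using pos by simp
        then show "h0 < Re (x + of_real u * d')" using x(1) by simp
      qed (use s in auto)
      moreover have "C < norm (A (x + of_real s * d'))" using s by (intro h') simp
      ultimately show False using C by force
    qed
    have "Re d = 0" using no [of d] no [of "-d"] seg d(2) by force
    then have dI: "d = \<i> \<or> d = - \<i>" using d(2) by (auto simp: complex_eq_iff cmod_def)
    show ?thesis
    proof (intro exI [of _ \<rho>] conjI ballI)
      fix y assume y: "y \<in> ball x \<rho>"
      show "A y \<in> S \<longleftrightarrow> Re y = Re x"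
      proof
        assume "A y \<in> S"
        then show "Re y = Re x" using d(4) [OF y] \<open>Re d = 0\<close> by auto
      next
        assume "Re y = Re x"
        then have "y = x + of_real (Im (y - x)) * \<i>" "y = x + of_real (- Im (y - x)) * (- \<i>)" by (auto simp: complex_eq_iff)
        then have "\<exists>s::real. y = x + of_real s * d" using dI by blast
        then show "A y \<in> S" using d(4) [OF y] by blast
      qed
    qed (use d in auto)
  qed
  define K where "K = A ` {x. Re x = Re w}"
  have KS: "K \<subseteq> S"
  proof
    fix z assume "z \<in> K"
    then obtain y where y: "Re y = Re w" "z = A y" by (auto simp: K_def)
    obtain \<rho> where \<rho>: "\<rho> > 0" "\<And>y. y \<in> ball w \<rho> \<Longrightarrow> A y \<in> S \<longleftrightarrow> Re y = Re w" using vert [OF w] by blast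
    have "A (w + of_real \<bar>Im (y - w)\<bar> * d) \<in> S" if "d = \<i> \<or> d = - \<i>" for d
    proof (rule line [OF w(1) \<rho>(1)])
      show "A (w + of_real s * d) \<in> S" if "\<bar>s\<bar> < \<rho>" for s
        using \<rho>(2) [of "w + of_real s * d"] that \<open>d = \<i> \<or> d = - \<i>\<close> by (auto simp: dist_norm norm_mult)
    qed (use that w in auto)
    moreover have "y = w + of_real \<bar>Im (y - w)\<bar> * (if Im (y - w) \<ge> 0 then \<i> else - \<i>)"
      using y by (auto simp: complex_eq_iff)
    ultimately show "z \<in> S" using y(2) by metis
  qed
  have Kcomp: "compact K"
  proof -
    define K0 where "K0 = {x. Re w \<le> Re x \<and> Re x \<le> Re w \<and> 0 \<le> Im x \<and> Im x \<le> 2 * pi}"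
    have "K = A ` K0"
    proof
      show "A ` K0 \<subseteq> K" by (auto simp: K_def K0_def)
      show "K \<subseteq> A ` K0"
      proof
        fix z assume "z \<in> K"
        then obtain x where x: "Re x = Re w" "z = A x" by (auto simp: K_def)
        obtain k where k: "0 \<le> Im (x - 2 * of_real pi * \<i> * of_int k)" "Im (x - 2 * of_real pi * \<i> * of_int k) \<le> 2 * pi"
          "Re (x - 2 * of_real pi * \<i> * of_int k) = Re x"
          by (rule periodic_representative)
        have "A ((x - 2 * of_real pi * \<i> * of_int k) + 2 * of_real pi * \<i> * of_int k) = A (x - 2 * of_real pi * \<i> * of_int k)"
          by (rule periodic_shift [of h0 A, OF per]) (use k(3) x w in auto)
        then have "z = A (x - 2 * of_real pi * \<i> * of_int k)" using x by simp
        moreover have "x - 2 * of_real pi * \<i> * of_int k \<in> K0" using k x by (simp add: K0_def)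
        ultimately show "z \<in> A ` K0" by blast
      qed
    qed
    moreover have "continuous_on K0 A"
      by (rule continuous_on_subset [OF holomorphic_on_imp_continuous_on [OF hol]]) (use w in \<open>auto simp: K0_def\<close>)
    moreover have "compact K0" unfolding K0_def by (rule compact_strip)
    ultimately show ?thesis using compact_continuous_image by metis
  qed
  \<comment> \<open>\<open>A\<close> maps a small disc at \<open>x\<close> onto a neighbourhood of
    \<open>z\<close> in which \<open>S\<close> is the image of the vertical diameter.\<close>
  have "\<exists>T. open T \<and> z \<in> T \<and> S \<inter> T \<subseteq> K" if "z \<in> K" for z
  proof -
    obtain x where x: "Re x = Re w" "z = A x" using \<open>z \<in> K\<close> by (auto simp: K_def)
    obtain \<rho> where \<rho>: "\<rho> > 0" "ball x \<rho> \<subseteq> {x. h0 < Re x}" "\<And>y. y \<in> ball x \<rho> \<Longrightarrow> A y \<in> S \<longleftrightarrow> Re y = Re x"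
    proof -
      have "A x \<in> S" "h0 < Re x" using x w KS \<open>z \<in> K\<close> by auto
      from vert [OF this(2,1)] show ?thesis using that by blast
    qed
    have xH: "x \<in> {x. h0 < Re x}" using x w by simp
    then have "deriv A x \<noteq> 0" using dA0 by simp
    then obtain r where r: "r > 0" "ball x r \<subseteq> {x. h0 < Re x}" "inj_on A (ball x r)"
      using has_complex_derivative_locally_injective [OF hol xH open_right_half_plane] by metis
    define r' where "r' = min r \<rho>"
    have "open (A ` ball x r')"
    proof (rule open_mapping_thm3)
      show "A holomorphic_on ball x r'" using hol r(2) by (rule holomorphic_on_subset [OF holomorphic_on_subset]) (auto simp: r'_def)
      show "inj_on A (ball x r')" using r(3) by (rule inj_on_subset) (auto simp: r'_def)
    qed auto
    moreover have "z \<in> A ` ball x r'" using x r \<rho> by (auto simp: r'_def)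
    moreover have "S \<inter> A ` ball x r' \<subseteq> K" using \<rho>(3) x by (auto simp: r'_def K_def)
    ultimately show ?thesis by blast
  qed
  then obtain T where T: "\<And>z. z \<in> K \<Longrightarrow> open (T z) \<and> z \<in> T z \<and> S \<inter> T z \<subseteq> K"
    by metis
  then have "open (\<Union>(T ` K))" "K = S \<inter> \<Union>(T ` K)" using KS by auto
  then have "openin (top_of_set S) K" unfolding openin_open by blast
  moreover have "closedin (top_of_set S) K"
    using Kcomp KS by (simp add: closed_subset compact_imp_closed)
  moreover have "K \<noteq> {}" by (auto simp: K_def)
  ultimately show ?thesis using S(3) unfolding connected_clopen K_def by blast
qed

subsection \<open>Closed curves in a compact one-dimensional manifold\<close>

definition unit_speed :: "complex set \<Rightarrow> real set \<Rightarrow> (real \<Rightarrow> complex) \<Rightarrow> (real \<Rightarrow> complex) \<Rightarrow> bool" where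
  "unit_speed S J c c' \<longleftrightarrow> open J \<and> continuous_on J c' \<and>
     (\<forall>t\<in>J. (c has_vector_derivative c' t) (at t) \<and> norm (c' t) = 1 \<and> c t \<in> S)"

lemma unit_speedD:
  assumes "unit_speed S J c c'"
  shows "open J" "continuous_on J c'" "t \<in> J \<Longrightarrow> (c has_vector_derivative c' t) (at t)"
    "t \<in> J \<Longrightarrow> norm (c' t) = 1" "t \<in> J \<Longrightarrow> c t \<in> S" "t \<in> J \<Longrightarrow> isCont c t" "t \<in> J \<Longrightarrow> isCont c' t"
  using assms unfolding unit_speed_def
  by (auto intro: has_vector_derivative_continuous simp: continuous_on_eq_continuous_at)

lemma unit_speed_subset: "unit_speed S J c c' \<Longrightarrow> open J' \<Longrightarrow> J' \<subseteq> J \<Longrightarrow> unit_speed S J' c c'"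
  unfolding unit_speed_def by (auto intro: continuous_on_subset)

lemma smooth_arc_unit_speed: "smooth_arc S \<sigma> \<sigma>' \<delta> \<Longrightarrow> unit_speed S {-\<delta><..<\<delta>} \<sigma> \<sigma>'"
  unfolding smooth_arc_def unit_speed_def by auto

lemma unit_speed_affine:
  assumes "unit_speed S J c c'" "e = 1 \<or> e = (-1::real)"
  shows "unit_speed S {s. a + e * s \<in> J} (\<lambda>s. c (a + e * s)) (\<lambda>s. of_real e * c' (a + e * s))"
  unfolding unit_speed_def
proof (intro conjI ballI)
  have oJ: "open J" using unit_speedD(1) [OF assms(1)] .
  then have "open ((\<lambda>s. a + e * s) -` J)" by (intro continuous_open_vimage continuous_intros)
  then show "open {s. a + e * s \<in> J}" by (simp add: vimage_def)
  show "continuous_on {s. a + e * s \<in> J} (\<lambda>s. of_real e * c' (a + e * s))"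
    by (intro continuous_intros continuous_on_compose2 [OF unit_speedD(2) [OF assms(1)]]) auto
  fix s assume s: "s \<in> {s. a + e * s \<in> J}"
  have "((c \<circ> (\<lambda>s. a + e * s)) has_vector_derivative e *\<^sub>R c' (a + e * s)) (at s)"
    by (rule vector_diff_chain_at) (use s unit_speedD(3) [OF assms(1)] in \<open>auto intro!: derivative_eq_intros\<close>)
  then show "((\<lambda>s. c (a + e * s)) has_vector_derivative of_real e * c' (a + e * s)) (at s)"
    by (simp add: o_def scaleR_conv_of_real)
  show "norm (of_real e * c' (a + e * s)) = 1" "c (a + e * s) \<in> S"
    using s unit_speedD(4,5) [OF assms(1)] assms(2) by (auto simp: norm_mult)
qed

lemma strict_mono_local_inverse:
  fixes X X' :: "real \<Rightarrow> real"
  assumes "r > 0" "\<And>t. \<bar>t - a\<bar> \<le> r \<Longrightarrow> (X has_real_derivative X' t) (at t)" "\<And>t. \<bar>t - a\<bar> \<le> r \<Longrightarrow> 0 < X' t"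
  obtains Y where "\<And>t. \<bar>t - a\<bar> \<le> r \<Longrightarrow> Y (X t) = t"
    "\<And>t. \<bar>t - a\<bar> < r \<Longrightarrow> (Y has_real_derivative inverse (X' t)) (at (X t))"
proof -
  define I where "I = {a - r..a + r}"
  have I: "t \<in> I \<longleftrightarrow> \<bar>t - a\<bar> \<le> r" for t by (auto simp: I_def)
  have mono: "X s < X t" if "s \<in> I" "t \<in> I" "s < t" for s t
  proof (rule DERIV_pos_imp_increasing [OF that(3)])
    fix x assume "s \<le> x" "x \<le> t"
    then have "\<bar>x - a\<bar> \<le> r" using that by (auto simp: I_def)
    then show "\<exists>y. (X has_real_derivative y) (at x) \<and> 0 < y" using assms(2,3) by blast
  qed
  have inj: "inj_on X I" using mono by (intro linorder_inj_onI') (metis less_irrefl)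
  define Y where "Y = inv_into I X"
  have Y: "Y (X t) = t" if "t \<in> I" for t unfolding Y_def using inj that by (rule inv_into_f_f)
  have Xc: "continuous_on I X"
    using assms(2) by (intro continuous_at_imp_continuous_on ballI) (auto simp: I intro: DERIV_isCont)
  have aI: "a - r \<in> I" "a + r \<in> I" using assms(1) by (auto simp: I_def)
  have surj: "\<exists>t\<in>I. X t = y" if "X (a - r) \<le> y" "y \<le> X (a + r)" for y
    using IVT' [of X "a - r" y "a + r"] that Xc assms(1) by (auto simp: I_def)
  have Xim: "X ` I = {X (a - r)..X (a + r)}"
  proof
    show "X ` I \<subseteq> {X (a - r)..X (a + r)}"
    proof
      fix y assume "y \<in> X ` I"
      then obtain t where t: "t \<in> I" "y = X t" by blast
      then have "a - r \<le> t" "t \<le> a + r" by (auto simp: I_def)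
      then have "X (a - r) \<le> X t" "X t \<le> X (a + r)"
        using mono [of "a - r" t] mono [of t "a + r"] aI t(1) by (auto simp: le_less)
      then show "y \<in> {X (a - r)..X (a + r)}" using t by simp
    qed
    show "{X (a - r)..X (a + r)} \<subseteq> X ` I" using surj by fastforce
  qed
  have "compact I" by (simp add: I_def)
  then have Yc: "continuous_on (X ` I) Y" by (rule continuous_on_inv [OF Xc]) (simp add: Y)
  show ?thesis
  proof (rule that [of Y])
    show "Y (X t) = t" if "\<bar>t - a\<bar> \<le> r" for t using that by (intro Y) (simp add: I)
    show "(Y has_real_derivative inverse (X' t)) (at (X t))" if t: "\<bar>t - a\<bar> < r" for t
    proof (rule DERIV_inverse_function [where f = X and a = "X (a - r)" and b = "X (a + r)"])
      have tI: "t \<in> I" using t by (simp add: I)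
      have s: "a - r < t" "t < a + r" using t by auto
      show lt: "X (a - r) < X t" "X t < X (a + r)" using mono aI tI s by auto
      show "(X has_real_derivative X' t) (at (Y (X t)))" using assms(2) [of t] t Y [OF tI] by simp
      show "X' t \<noteq> 0" using assms(3) [of t] t by simp
      show "X (Y y) = y" if "X (a - r) < y" "y < X (a + r)" for y
        using surj [of y] that Y by auto
      have "continuous_on {X (a - r)<..<X (a + r)} Y"
        by (rule continuous_on_subset [OF Yc]) (auto simp: Xim)
      then show "isCont Y (X t)" using lt by (simp add: continuous_on_eq_continuous_at)
    qed
  qed
qed

text \<open>Unit speed determines the parameter up to direction and shift: \<open>c\<close> is the
  arc taken at the parameter \<phi>, whose derivative is continuous with values 1 and -1 only, hence
  constant.\<close>

lemma unit_speed_in_arc: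
  assumes arc: "smooth_arc S \<sigma> \<sigma>' \<delta>" and u0: "u0 \<in> {-\<delta><..<\<delta>}"
    and c: "unit_speed S J c c'" and t0: "t0 \<in> J" "c t0 = \<sigma> u0"
  obtains r e where "r > 0" "e = 1 \<or> e = (-1::real)"
    "\<And>t. \<bar>t - t0\<bar> < r \<Longrightarrow> t \<in> J \<and> u0 + e * (t - t0) \<in> {-\<delta><..<\<delta>} \<and> c t = \<sigma> (u0 + e * (t - t0)) \<and>
        c' t = of_real e * \<sigma>' (u0 + e * (t - t0))"
proof -
  note sd = smooth_arcD [OF arc] and cd = unit_speedD [OF c]
  define T where "T = \<sigma>' u0"
  have nT: "T \<bullet> T = 1" using sd(4) [OF u0] by (simp add: T_def dot_square_norm)
  have "isCont (\<lambda>u. \<sigma>' u \<bullet> T) u0"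
    using sd(2) u0 by (intro continuous_intros) (auto simp: continuous_on_eq_continuous_at)
  then obtain r1 where r1: "r1 > 0" "\<And>u. dist u u0 < r1 \<Longrightarrow> \<sigma>' u \<bullet> T \<in> {0<..}"
    by (rule isCont_open_nbhd [where U = "{0<..}"]) (use nT in \<open>auto simp: T_def intro: that\<close>)
  define \<epsilon> where "\<epsilon> = min (r1 / 2) (min ((\<delta> - u0) / 2) ((\<delta> + u0) / 2))"
  have \<epsilon>: "\<epsilon> > 0" "\<epsilon> < r1" "\<epsilon> < \<delta> - u0" "\<epsilon> < \<delta> + u0" using r1 u0 by (auto simp: \<epsilon>_def min_def)
  have \<epsilon>I: "u \<in> {-\<delta><..<\<delta>} \<and> \<sigma>' u \<bullet> T > 0" if "\<bar>u - u0\<bar> \<le> \<epsilon>" for u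
    using that \<epsilon> r1(2) [of u] by (auto simp: dist_real_def)
  define X where "X = (\<lambda>u. \<sigma> u \<bullet> T)"
  have dinner: "((\<lambda>t. f t \<bullet> T) has_real_derivative f' \<bullet> T) (at t)" if "(f has_vector_derivative f') (at t)"
    for f :: "real \<Rightarrow> complex" and f' t
  proof -
    have "((\<lambda>t. f t \<bullet> T) has_derivative (\<lambda>s. (s *\<^sub>R f') \<bullet> T)) (at t)"
      using that unfolding has_vector_derivative_def by (rule has_derivative_inner_left)
    then show ?thesis unfolding has_field_derivative_def by (rule has_derivative_eq_rhs) auto
  qed
  obtain Y where Y: "\<And>u. \<bar>u - u0\<bar> \<le> \<epsilon> \<Longrightarrow> Y (X u) = u"
    "\<And>u. \<bar>u - u0\<bar> < \<epsilon> \<Longrightarrow> (Y has_real_derivative inverse (\<sigma>' u \<bullet> T)) (at (X u))"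
    by (rule strict_mono_local_inverse [OF \<epsilon>(1), of u0 X "\<lambda>u. \<sigma>' u \<bullet> T"])
      (use \<epsilon>I sd(3) dinner in \<open>auto simp: X_def intro: that\<close>)
  obtain V where V: "open V" "\<sigma> u0 \<in> V" "S \<inter> V \<subseteq> \<sigma> ` {u\<in>{-\<delta><..<\<delta>}. \<bar>u - u0\<bar> < \<epsilon>}"
    using sd(6) [OF u0 \<epsilon>(1)] by blast
  obtain r2 where r2: "r2 > 0" "\<And>t. dist t t0 < r2 \<Longrightarrow> c t \<in> V"
    by (rule isCont_open_nbhd [OF cd(6) [OF t0(1)] V(1)]) (use V t0 that in auto)
  obtain r3 where r3: "r3 > 0" "ball t0 r3 \<subseteq> J" using cd(1) t0(1) openE by blast
  define r where "r = min r2 r3"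
  have r: "r > 0" using r2 r3 by (simp add: r_def)
  \<comment> \<open>The projection to the tangent \<open>T\<close> at \<open>u0\<close> is strictly
    increasing along the arc near \<open>u0\<close>, so its inverse \<open>Y\<close> recovers the
    arc parameter of a point.\<close>
  define \<phi> where "\<phi> = (\<lambda>t. Y (c t \<bullet> T))"
  have \<phi>: "t \<in> J \<and> \<bar>\<phi> t - u0\<bar> < \<epsilon> \<and> c t = \<sigma> (\<phi> t)" if t: "\<bar>t - t0\<bar> < r" for t
  proof -
    have tJ: "t \<in> J" using r3(2) t by (auto simp: r_def dist_real_def)
    moreover have "c t \<in> V" using r2(2) [of t] t by (simp add: r_def dist_real_def)
    ultimately obtain u where u: "\<bar>u - u0\<bar> < \<epsilon>" "c t = \<sigma> u" using V(3) cd(5) [OF tJ] by auto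
    then have "\<phi> t = u" using Y(1) [of u] by (simp add: \<phi>_def X_def)
    then show ?thesis using u tJ by simp
  qed
  define \<phi>' where "\<phi>' = (\<lambda>t. (c' t \<bullet> T) / (\<sigma>' (\<phi> t) \<bullet> T))"
  have d\<phi>: "(\<phi> has_real_derivative \<phi>' t) (at t)" if t: "\<bar>t - t0\<bar> < r" for t
  proof -
    have "(Y has_real_derivative inverse (\<sigma>' (\<phi> t) \<bullet> T)) (at (c t \<bullet> T))"
      using Y(2) [of "\<phi> t"] \<phi> [OF t] by (simp add: X_def)
    moreover have "((\<lambda>t. c t \<bullet> T) has_real_derivative c' t \<bullet> T) (at t)"
      using cd(3) \<phi> [OF t] by (intro dinner) auto
    ultimately have "((\<lambda>t. Y (c t \<bullet> T)) has_real_derivative inverse (\<sigma>' (\<phi> t) \<bullet> T) * (c' t \<bullet> T)) (at t)"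
      by (rule DERIV_chain2)
    then show ?thesis by (simp add: \<phi>_def \<phi>'_def divide_inverse mult.commute)
  qed
  have c': "c' t = of_real (\<phi>' t) * \<sigma>' (\<phi> t)" if t: "\<bar>t - t0\<bar> < r" for t
  proof -
    have "((\<sigma> \<circ> \<phi>) has_vector_derivative \<phi>' t *\<^sub>R \<sigma>' (\<phi> t)) (at t)"
      by (rule vector_diff_chain_at)
        (use d\<phi> [OF t] sd(3) \<epsilon>I [of "\<phi> t"] \<phi> [OF t] in \<open>auto simp: has_real_derivative_iff_has_vector_derivative\<close>)
    moreover have "(c has_vector_derivative \<phi>' t *\<^sub>R \<sigma>' (\<phi> t)) (at t) = ((\<sigma> \<circ> \<phi>) has_vector_derivative \<phi>' t *\<^sub>R \<sigma>' (\<phi> t)) (at t)"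
    proof (rule has_vector_derivative_cong_ev)
      have "eventually (\<lambda>x. x \<in> ball t0 r) (nhds t)"
        using t by (intro eventually_nhds_in_open) (auto simp: dist_real_def)
      then show "\<forall>\<^sub>F x in nhds t. x \<in> UNIV \<longrightarrow> c x = (\<sigma> \<circ> \<phi>) x"
        by eventually_elim (use \<phi> in \<open>auto simp: dist_real_def abs_minus_commute\<close>)
      show "c t = (\<sigma> \<circ> \<phi>) t" using \<phi> [OF t] by simp
    qed
    ultimately have "(c has_vector_derivative \<phi>' t *\<^sub>R \<sigma>' (\<phi> t)) (at t)" by simp
    then show ?thesis
      using vector_derivative_unique_at cd(3) \<phi> [OF t] by (metis scaleR_conv_of_real)
  qed
  have abs1: "\<bar>\<phi>' t\<bar> = 1" if t: "\<bar>t - t0\<bar> < r" for t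
  proof -
    have "norm (\<sigma>' (\<phi> t)) = 1" "norm (c' t) = 1" using sd(4) cd(4) \<epsilon>I [of "\<phi> t"] \<phi> [OF t] by auto
    then show ?thesis using c' [OF t] by (simp add: norm_mult)
  qed
  have It0: "t \<in> ball t0 r \<longleftrightarrow> \<bar>t - t0\<bar> < r" for t by (auto simp: dist_real_def)
  have cont\<phi>: "continuous_on (ball t0 r) \<phi>"
    using d\<phi> by (intro continuous_at_imp_continuous_on ballI) (auto simp only: It0 intro: DERIV_isCont)
  have "continuous_on (ball t0 r) \<phi>'"
    unfolding \<phi>'_def
  proof (intro continuous_intros ballI)
    show "continuous_on (ball t0 r) c'" using cd(2) by (rule continuous_on_subset) (use \<phi> It0 in blast)
    show "continuous_on (ball t0 r) (\<lambda>t. \<sigma>' (\<phi> t))"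
      by (rule continuous_on_compose2 [OF sd(2) cont\<phi>]) (use \<phi> \<epsilon>I It0 in force)
    show "\<sigma>' (\<phi> t) \<bullet> T \<noteq> 0" if "t \<in> ball t0 r" for t
      using \<epsilon>I [of "\<phi> t"] \<phi> [of t] that unfolding It0 by force
  qed
  moreover have "finite (\<phi>' ` ball t0 r)"
  proof (rule finite_subset)
    show "\<phi>' ` ball t0 r \<subseteq> {1, -1}"
    proof (rule image_subsetI)
      fix t assume "t \<in> ball t0 r"
      then have "\<phi>' t = 1 \<or> \<phi>' t = -1" using abs1 [of t] unfolding It0 by linarith
      then show "\<phi>' t \<in> {1, -1}" by simp
    qed
  qed simp
  ultimately have "\<phi>' constant_on ball t0 r" by (intro continuous_finite_range_constant) auto
  then obtain e where e: "\<And>t. \<bar>t - t0\<bar> < r \<Longrightarrow> \<phi>' t = e" unfolding constant_on_def It0 [symmetric] by blast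
  have e1: "e = 1 \<or> e = -1" using abs1 [of t0] e [of t0] r by auto
  have \<phi>0: "\<phi> t0 = u0" using Y(1) [of u0] \<epsilon>(1) by (simp add: \<phi>_def X_def t0)
  have \<phi>lin: "\<phi> t = u0 + e * (t - t0)" if t: "\<bar>t - t0\<bar> < r" for t
  proof -
    have "\<exists>k. \<forall>t\<in>ball t0 r. \<phi> t - e * t = k"
    proof (rule has_field_derivative_zero_constant)
      fix x assume "x \<in> ball t0 r"
      then have "(\<phi> has_real_derivative e) (at x)" using d\<phi> e unfolding It0 by metis
      then have "((\<lambda>t. \<phi> t - e * t) has_real_derivative 0) (at x)"
        by (auto intro!: derivative_eq_intros)
      then show "((\<lambda>t. \<phi> t - e * t) has_field_derivative 0) (at x within ball t0 r)"
        by (rule has_field_derivative_at_within)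
    qed auto
    then have "\<phi> t - e * t = \<phi> t0 - e * t0" using t r unfolding It0 [symmetric] by (metis centre_in_ball)
    then show ?thesis by (simp add: \<phi>0 algebra_simps)
  qed
  show ?thesis
  proof (rule that [OF r e1])
    fix t assume t: "\<bar>t - t0\<bar> < r"
    show "t \<in> J \<and> u0 + e * (t - t0) \<in> {-\<delta><..<\<delta>} \<and> c t = \<sigma> (u0 + e * (t - t0)) \<and>
        c' t = of_real e * \<sigma>' (u0 + e * (t - t0))"
      using \<phi> [OF t] \<epsilon>I [of "\<phi> t"] c' [OF t] e [OF t] \<phi>lin [OF t] by auto
  qed
qed

text \<open>The set where position and velocity agree is open and closed. At a common point both
  curves run along the same arc: in the same direction, and then they agree nearby, or in opposite
  directions, and then their velocities differ nearby.\<close>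

lemma unit_speed_unique:
  assumes S: "C1_curve S" and c: "unit_speed S J c c'" and d: "unit_speed S J d d'" and J: "connected J"
    and t0: "t0 \<in> J" "c t0 = d t0" "c' t0 = d' t0" and t: "t \<in> J"
  shows "c t = d t \<and> c' t = d' t"
proof -
  define P where "P = (\<lambda>t. c t = d t \<and> c' t = d' t)"
  have "P t"
  proof (rule connected_induction_simple [OF J t0(1) t, of P])
    show "P t0" using t0 by (simp add: P_def)
    fix a assume a: "a \<in> J"
    have "\<exists>r>0. \<forall>x y. \<bar>x - a\<bar> < r \<longrightarrow> \<bar>y - a\<bar> < r \<longrightarrow> x \<in> J \<longrightarrow> y \<in> J \<longrightarrow> P x \<longrightarrow> P y"
    proof (cases "c a = d a")
      case False
      have "isCont (\<lambda>t. c t - d t) a" using unit_speedD(6) [OF c a] unit_speedD(6) [OF d a] by (intro continuous_intros)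
      then obtain r where "r > 0" "\<And>x. dist x a < r \<Longrightarrow> c x - d x \<in> - {0}"
        by (rule isCont_open_nbhd [where U = "- {0}"]) (use False that in auto)
      then show ?thesis by (intro exI [of _ r]) (auto simp: P_def dist_real_def)
    next
      case True
      obtain \<sigma> \<sigma>' \<delta> where \<sigma>: "smooth_arc S \<sigma> \<sigma>' \<delta>" "\<sigma> 0 = c a"
        using S unit_speedD(5) [OF c a] unfolding C1_curve_def by blast
      note n1 = smooth_arcD(4) [OF \<sigma>(1)]
      have z: "0 \<in> {-\<delta><..<\<delta>}" using smooth_arcD(1) [OF \<sigma>(1)] by simp
      obtain r1 e1 where r1: "r1 > 0" "e1 = 1 \<or> e1 = (-1::real)"
        "\<And>t. \<bar>t - a\<bar> < r1 \<Longrightarrow> t \<in> J \<and> 0 + e1 * (t - a) \<in> {-\<delta><..<\<delta>} \<and> c t = \<sigma> (0 + e1 * (t - a)) \<and>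
          c' t = of_real e1 * \<sigma>' (0 + e1 * (t - a))"
        by (rule unit_speed_in_arc [OF \<sigma>(1) z c a \<sigma>(2) [symmetric]]) (rule that)
      obtain r2 e2 where r2: "r2 > 0" "e2 = 1 \<or> e2 = (-1::real)"
        "\<And>t. \<bar>t - a\<bar> < r2 \<Longrightarrow> t \<in> J \<and> 0 + e2 * (t - a) \<in> {-\<delta><..<\<delta>} \<and> d t = \<sigma> (0 + e2 * (t - a)) \<and>
          d' t = of_real e2 * \<sigma>' (0 + e2 * (t - a))"
        by (rule unit_speed_in_arc [OF \<sigma>(1) z d a]) (use True \<sigma>(2) that in auto)
      show ?thesis
      proof (cases "e1 = e2")
        case True
        then have "P y" if "\<bar>y - a\<bar> < min r1 r2" for y using r1(3) [of y] r2(3) [of y] that by (simp add: P_def)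
        then show ?thesis using r1(1) r2(1) by (intro exI [of _ "min r1 r2"]) auto
      next
        case False
        have "isCont (\<lambda>t. c' t - d' t) a" using unit_speedD(7) [OF c a] unit_speedD(7) [OF d a] by (intro continuous_intros)
        moreover have "c' a - d' a \<noteq> 0"
        proof
          assume "c' a - d' a = 0"
          then have "of_real e1 * \<sigma>' 0 = of_real e2 * \<sigma>' 0" using r1(3) [of a] r2(3) [of a] r1(1) r2(1) by simp
          moreover have "\<sigma>' 0 \<noteq> 0" using n1 [OF z] by auto
          ultimately show False using False by simp
        qed
        ultimately obtain r where "r > 0" "\<And>x. dist x a < r \<Longrightarrow> c' x - d' x \<in> - {0}"
          by (rule_tac isCont_open_nbhd [where f = "\<lambda>t. c' t - d' t" and a = a and U = "- {0}"]) (use that in auto)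
        then show ?thesis by (intro exI [of _ r]) (auto simp: P_def dist_real_def)
      qed
    qed
    then obtain r where r: "r > 0" "\<And>x y. \<bar>x - a\<bar> < r \<Longrightarrow> \<bar>y - a\<bar> < r \<Longrightarrow> x \<in> J \<Longrightarrow> y \<in> J \<Longrightarrow> P x \<Longrightarrow> P y"
      by blast
    show "\<exists>T. openin (top_of_set J) T \<and> a \<in> T \<and> (\<forall>x\<in>T. \<forall>y\<in>T. P x \<longrightarrow> P y)"
      using r a by (intro exI [of _ "J \<inter> ball a r"]) (auto simp: dist_real_def abs_minus_commute)
  qed
  then show ?thesis by (simp add: P_def)
qed

text \<open>The inner halves of finitely many arcs cover \<open>S\<close>, and from a point of such
  a half the full arc continues for at least \<open>\<delta> / 2\<close> in both directions. The
  least of these lengths serves for every curve.\<close>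

lemma uniform_continuation:
  assumes S: "C1_curve S" "compact S" "S \<noteq> {}"
  obtains \<epsilon> where "\<epsilon> > 0"
    "\<And>J c c' t. unit_speed S J c c' \<Longrightarrow> t \<in> J \<Longrightarrow>
       \<exists>d d'. unit_speed S {-\<epsilon><..<\<epsilon>} d d' \<and> d 0 = c t \<and> d' 0 = c' t"
proof -
  define G where "G = (\<lambda>V \<delta>. open V \<and> (\<delta>::real) > 0 \<and> (\<exists>\<sigma> \<sigma>'. smooth_arc S \<sigma> \<sigma>' \<delta> \<and>
    S \<inter> V \<subseteq> \<sigma> ` {u\<in>{-\<delta><..<\<delta>}. \<bar>u\<bar> < \<delta> / 2}))"
  define \<V> where "\<V> = {V. \<exists>\<delta>. G V \<delta>}"
  have cover: "S \<subseteq> \<Union>\<V>"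
  proof
    fix p assume "p \<in> S"
    then obtain \<sigma> \<sigma>' \<delta> where \<sigma>: "smooth_arc S \<sigma> \<sigma>' \<delta>" "\<sigma> 0 = p" using S(1) unfolding C1_curve_def by blast
    have \<delta>: "\<delta> > 0" by (rule smooth_arcD(1) [OF \<sigma>(1)])
    then obtain V where V: "open V" "\<sigma> 0 \<in> V" "S \<inter> V \<subseteq> \<sigma> ` {u\<in>{-\<delta><..<\<delta>}. \<bar>u - 0\<bar> < \<delta> / 2}"
      using smooth_arcD(6) [OF \<sigma>(1), of 0 "\<delta> / 2"] by auto
    then have "G V \<delta>" unfolding G_def using \<sigma> \<delta> by (intro conjI exI [of _ \<sigma>] exI [of _ \<sigma>']) auto
    then have "V \<in> \<V>" by (auto simp: \<V>_def)
    then show "p \<in> \<Union>\<V>" using V(2) \<sigma>(2) by blast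
  qed
  have "\<forall>V\<in>\<V>. open V" by (auto simp: \<V>_def G_def)
  then obtain F where F: "F \<subseteq> \<V>" "finite F" "S \<subseteq> \<Union>F"
    using S(2) cover unfolding compact_eq_Heine_Borel by metis
  have "F \<noteq> {}" using F(3) S(3) by auto
  have "\<exists>\<delta>. G V \<delta>" if "V \<in> F" for V using F(1) that by (auto simp: \<V>_def)
  then obtain \<delta> where \<delta>: "\<And>V. V \<in> F \<Longrightarrow> G V (\<delta> V)" by metis
  define \<epsilon> where "\<epsilon> = Min ((\<lambda>V. \<delta> V / 2) ` F)"
  have \<epsilon>: "\<epsilon> \<le> \<delta> V / 2" if "V \<in> F" for V unfolding \<epsilon>_def using F(2) that by (intro Min_le) auto
  have \<epsilon>0: "\<epsilon> > 0" unfolding \<epsilon>_def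
  proof (subst Min_gr_iff)
    show "\<forall>a\<in>(\<lambda>V. \<delta> V / 2) ` F. 0 < a" using \<delta> by (auto simp: G_def)
  qed (use F \<open>F \<noteq> {}\<close> in auto)
  show ?thesis
  proof (rule that [OF \<epsilon>0])
    fix J c c' t assume c: "unit_speed S J c c'" and t: "t \<in> J"
    obtain V where V: "V \<in> F" "c t \<in> V" using F(3) unit_speedD(5) [OF c t] by blast
    define d where "d = \<delta> V"
    obtain \<sigma> \<sigma>' where arc: "smooth_arc S \<sigma> \<sigma>' d" "S \<inter> V \<subseteq> \<sigma> ` {u\<in>{-d<..<d}. \<bar>u\<bar> < d / 2}"
      using \<delta> [OF V(1)] unfolding G_def d_def by blast
    obtain u where u: "u \<in> {-d<..<d}" "\<bar>u\<bar> < d / 2" "c t = \<sigma> u"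
      using arc(2) V(2) unit_speedD(5) [OF c t] by blast
    obtain r e where r: "r > 0" "e = 1 \<or> e = (-1::real)"
      "\<And>x. \<bar>x - t\<bar> < r \<Longrightarrow> x \<in> J \<and> u + e * (x - t) \<in> {-d<..<d} \<and> c x = \<sigma> (u + e * (x - t)) \<and>
        c' x = of_real e * \<sigma>' (u + e * (x - t))"
      by (rule unit_speed_in_arc [OF arc(1) u(1) c t u(3)]) (rule that)
    have "unit_speed S {s. u + e * s \<in> {-d<..<d}} (\<lambda>s. \<sigma> (u + e * s)) (\<lambda>s. of_real e * \<sigma>' (u + e * s))"
      by (rule unit_speed_affine [OF smooth_arc_unit_speed [OF arc(1)] r(2)])
    then have "unit_speed S {-\<epsilon><..<\<epsilon>} (\<lambda>s. \<sigma> (u + e * s)) (\<lambda>s. of_real e * \<sigma>' (u + e * s))"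
      by (rule unit_speed_subset) (use \<epsilon> [OF V(1)] u(2) r(2) in \<open>auto simp: d_def\<close>)
    moreover have "\<sigma> (u + e * 0) = c t" "of_real e * \<sigma>' (u + e * 0) = c' t" using r(3) [of t] r(1) by auto
    ultimately show "\<exists>d d'. unit_speed S {-\<epsilon><..<\<epsilon>} d d' \<and> d 0 = c t \<and> d' 0 = c' t" by blast
  qed
qed

text \<open>Pieces on intervals of radius \<epsilon> are attached at steps of length
  \<open>\<eta> = \<epsilon> / 2\<close>, each taking over position and velocity of its predecessor;
  by uniqueness they agree on the overlaps. The domain starts before 0 so that 0 is an interior
  point.\<close>

lemma unit_speed_half_line:
  assumes S: "C1_curve S" "compact S" "S \<noteq> {}"
  obtains \<eta> c c' where "\<eta> > 0" "unit_speed S {-\<eta><..} c c'"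
proof -
  obtain \<epsilon> where \<epsilon>: "\<epsilon> > 0" and cont: "\<And>J c c' t. unit_speed S J c c' \<Longrightarrow> t \<in> J \<Longrightarrow>
       \<exists>d d'. unit_speed S {-\<epsilon><..<\<epsilon>} d d' \<and> d 0 = c t \<and> d' 0 = c' t"
    by (rule uniform_continuation [OF S]) (rule that)
  define \<eta> where "\<eta> = \<epsilon> / 2"
  have \<eta>: "\<eta> > 0" "\<epsilon> = 2 * \<eta>" using \<epsilon> by (auto simp: \<eta>_def)
  define Q where "Q = (\<lambda>x. unit_speed S {-\<epsilon><..<\<epsilon>} (fst x) (snd x))"
  have "\<exists>f. \<forall>k. Q (f k) \<and> (fst (f (Suc k)) 0 = fst (f k) \<eta> \<and> snd (f (Suc k)) 0 = snd (f k) \<eta>)"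
  proof (rule dependent_nat_choice)
    obtain p where "p \<in> S" using S(3) by blast
    then obtain \<sigma> \<sigma>' \<delta> where \<sigma>: "smooth_arc S \<sigma> \<sigma>' \<delta>" using S(1) unfolding C1_curve_def by blast
    have "0 \<in> {-\<delta><..<\<delta>}" using smooth_arcD(1) [OF \<sigma>] by simp
    then show "\<exists>x. Q x" using cont [OF smooth_arc_unit_speed [OF \<sigma>]] by (force simp: Q_def)
  next
    fix x k assume "Q x"
    then show "\<exists>y. Q y \<and> (fst y 0 = fst x \<eta> \<and> snd y 0 = snd x \<eta>)"
      using cont [of "{-\<epsilon><..<\<epsilon>}" "fst x" "snd x" \<eta>] \<eta> by (force simp: Q_def)
  qed
  then obtain f where f: "\<And>k::nat. Q (f k)" "\<And>k. fst (f (Suc k)) 0 = fst (f k) \<eta> \<and> snd (f (Suc k)) 0 = snd (f k) \<eta>"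
    by blast
  define g where "g = (\<lambda>k. fst (f k))"
  define g' where "g' = (\<lambda>k. snd (f k))"
  have us: "unit_speed S {-\<epsilon><..<\<epsilon>} (g k) (g' k)" for k using f(1) [of k] by (simp add: Q_def g_def g'_def)
  have link: "g (Suc k) 0 = g k \<eta>" "g' (Suc k) 0 = g' k \<eta>" for k using f(2) [of k] by (auto simp: g_def g'_def)
  have overlap: "g k (s + \<eta>) = g (Suc k) s \<and> g' k (s + \<eta>) = g' (Suc k) s" if s: "-\<epsilon> < s" "s < \<eta>" for k s
  proof (rule unit_speed_unique [OF S(1), of "{-\<epsilon><..<\<eta>}" "\<lambda>s. g k (s + \<eta>)" "\<lambda>s. g' k (s + \<eta>)" "g (Suc k)" "g' (Suc k)" 0])
    show "unit_speed S {-\<epsilon><..<\<eta>} (g (Suc k)) (g' (Suc k))" by (rule unit_speed_subset [OF us]) (use \<eta> in auto)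
    have "unit_speed S {s. \<eta> + 1 * s \<in> {-\<epsilon><..<\<epsilon>}} (\<lambda>s. g k (\<eta> + 1 * s)) (\<lambda>s. of_real 1 * g' k (\<eta> + 1 * s))"
      by (rule unit_speed_affine [OF us]) simp
    then have "unit_speed S {-\<epsilon><..<\<eta>} (\<lambda>s. g k (\<eta> + 1 * s)) (\<lambda>s. of_real 1 * g' k (\<eta> + 1 * s))"
      by (rule unit_speed_subset) (use \<eta> in auto)
    then show "unit_speed S {-\<epsilon><..<\<eta>} (\<lambda>s. g k (s + \<eta>)) (\<lambda>s. g' k (s + \<eta>))" by (simp add: add.commute)
  qed (use \<eta> link s in auto)
  \<comment> \<open>\<open>nat\<close> sends the negative floor to 0, so the first piece is also
    used for \<open>-\<eta> < t < 0\<close>.\<close>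
  define N where "N = (\<lambda>t. nat \<lfloor>t / \<eta>\<rfloor>)"
  define c where "c = (\<lambda>t. g (N t) (t - real (N t) * \<eta>))"
  define c' where "c' = (\<lambda>t. g' (N t) (t - real (N t) * \<eta>))"
  \<comment> \<open>Around each joint \<open>k * \<eta>\<close> the glued curve is the single piece
    \<open>k\<close>, which makes it differentiable there.\<close>
  have loc: "c t = g k (t - real k * \<eta>) \<and> c' t = g' k (t - real k * \<eta>)"
    if t: "real k * \<eta> - \<eta> < t" "t < real k * \<eta> + \<eta>" for k t
  proof -
    have lo: "real k - 1 < t / \<eta>" "t / \<eta> < real k + 1" using t \<eta>(1) by (auto simp: field_simps)
    consider "N t = k" | k' where "k = Suc k'" "N t = k'" 
    proof (cases "real k \<le> t / \<eta>")
      case True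
      then have "\<lfloor>t / \<eta>\<rfloor> = int k" using lo by (simp add: floor_eq_iff)
      then show ?thesis using that(1) by (simp add: N_def)
    next
      case False
      then have fl: "\<lfloor>t / \<eta>\<rfloor> = int k - 1" using lo by (simp add: floor_eq_iff)
      show ?thesis
      proof (cases k)
        case 0
        then show ?thesis using that(1) fl by (simp add: N_def)
      next
        case (Suc k')
        then show ?thesis using that(2) [of k'] fl by (simp add: N_def)
      qed
    qed
    then show ?thesis
    proof cases
      case 1
      then show ?thesis by (simp add: c_def c'_def)
    next
      case (2 k')
      have e: "(t - real k * \<eta>) + \<eta> = t - real k' * \<eta>" using 2 by (simp add: algebra_simps)
      have "g k' (t - real k' * \<eta>) = g k (t - real k * \<eta>) \<and> g' k' (t - real k' * \<eta>) = g' k (t - real k * \<eta>)"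
      proof -
        have "-\<epsilon> < t - real k * \<eta>" "t - real k * \<eta> < \<eta>" using t \<eta> by linarith+
        from overlap [OF this, of k'] show ?thesis unfolding e 2(1) [symmetric] .
      qed
      then show ?thesis using 2(2) by (simp add: c_def c'_def)
    qed
  qed
  have "unit_speed S {-\<eta><..} c c'"
    unfolding unit_speed_def
  proof -
    have key: "(c has_vector_derivative c' t) (at t) \<and> norm (c' t) = 1 \<and> c t \<in> S \<and> isCont c' t" if t: "t \<in> {-\<eta><..}" for t
    proof -
      define k where "k = nat \<lceil>t / \<eta>\<rceil>"
      have "of_int \<lceil>t / \<eta>\<rceil> - 1 < t / \<eta>" "t / \<eta> \<le> of_int \<lceil>t / \<eta>\<rceil>" by linarith+
      moreover have "- 1 < t / \<eta>" using t \<eta>(1) by (simp add: field_simps)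
      ultimately have "real k - 1 < t / \<eta>" "t / \<eta> < real k + 1"
        by (cases "\<lceil>t / \<eta>\<rceil> \<ge> 0"; simp add: k_def; linarith)+
      then have tk: "real k * \<eta> - \<eta> < t" "t < real k * \<eta> + \<eta>" using \<eta>(1) by (auto simp: field_simps)
      define W where "W = {real k * \<eta> - \<eta><..<real k * \<eta> + \<eta>}"
      have us': "unit_speed S {s. (- (real k * \<eta>)) + 1 * s \<in> {-\<epsilon><..<\<epsilon>}} (\<lambda>s. g k (- (real k * \<eta>) + 1 * s)) (\<lambda>s. of_real 1 * g' k (- (real k * \<eta>) + 1 * s))"
        by (rule unit_speed_affine [OF us]) simp
      have tm: "t \<in> {s. (- (real k * \<eta>)) + 1 * s \<in> {-\<epsilon><..<\<epsilon>}}" using tk \<eta> by auto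
      have ev: "eventually (\<lambda>x. c x = g k (- (real k * \<eta>) + 1 * x) \<and> c' x = of_real 1 * g' k (- (real k * \<eta>) + 1 * x)) (nhds t)"
      proof -
        have "eventually (\<lambda>x. x \<in> W) (nhds t)" unfolding W_def using tk by (intro eventually_nhds_in_open) auto
        then show ?thesis by eventually_elim (use loc in \<open>auto simp: W_def\<close>)
      qed
      have "((\<lambda>s. g k (- (real k * \<eta>) + 1 * s)) has_vector_derivative c' t) (at t)"
        using unit_speedD(3) [OF us' tm] eventually_nhds_x_imp_x [OF ev] by simp
      then have d: "(c has_vector_derivative c' t) (at t)"
        by (rule has_vector_derivative_transform_within_open [of _ _ t W])
          (use tk loc in \<open>auto simp: W_def algebra_simps\<close>)
      have "isCont c' t"
        using unit_speedD(7) [OF us' tm] ev by (subst isCont_cong [where g = "\<lambda>s. of_real 1 * g' k (- (real k * \<eta>) + 1 * s)"]) (auto elim: eventually_mono)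
      then show ?thesis
        using d unit_speedD(4,5) [OF us' tm] eventually_nhds_x_imp_x [OF ev] by simp
    qed
    then have "continuous_on {-\<eta><..} c'" by (intro continuous_at_imp_continuous_on) auto
    then show "open {-\<eta><..} \<and> continuous_on {-\<eta><..} c' \<and>
      (\<forall>t\<in>{-\<eta><..}. (c has_vector_derivative c' t) (at t) \<and> norm (c' t) = 1 \<and> c t \<in> S)"
      using key by auto
  qed
  then show ?thesis using that \<eta>(1) by blast
qed

text \<open>The velocities at the two visits agree up to sign. With opposite signs the curve would
  run back over itself, \<open>c (t1 + s) = c (t2 - s)\<close> for all admissible \<open>s\<close>,
  and at the midpoint the unit vector \<open>c'\<close> would equal its own negative. With equal
  signs uniqueness gives the period \<open>t2 - t1\<close>.\<close>

lemma unit_speed_return: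
  assumes S: "C1_curve S" and \<eta>: "\<eta> > 0" and c: "unit_speed S {-\<eta><..} c c'"
    and t: "0 \<le> t1" "t1 < t2" "c t1 = c t2" and s: "-\<eta> < s"
  shows "c (s + (t2 - t1)) = c s \<and> c' (s + (t2 - t1)) = c' s"
proof -
  note cd = unit_speedD [OF c]
  have tm: "t1 \<in> {-\<eta><..}" "t2 \<in> {-\<eta><..}" using t \<eta> by auto
  obtain \<sigma> \<sigma>' \<delta> where \<sigma>: "smooth_arc S \<sigma> \<sigma>' \<delta>" "\<sigma> 0 = c t1"
    using S cd(5) [OF tm(1)] unfolding C1_curve_def by blast
  have z: "0 \<in> {-\<delta><..<\<delta>}" using smooth_arcD(1) [OF \<sigma>(1)] by simp
  obtain r1 e1 where r1: "r1 > 0" "e1 = 1 \<or> e1 = (-1::real)"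
    "\<And>t. \<bar>t - t1\<bar> < r1 \<Longrightarrow> t \<in> {-\<eta><..} \<and> 0 + e1 * (t - t1) \<in> {-\<delta><..<\<delta>} \<and> c t = \<sigma> (0 + e1 * (t - t1)) \<and>
      c' t = of_real e1 * \<sigma>' (0 + e1 * (t - t1))"
    by (rule unit_speed_in_arc [OF \<sigma>(1) z c tm(1) \<sigma>(2) [symmetric]]) (rule that)
  have \<sigma>2: "c t2 = \<sigma> 0" using \<sigma>(2) t(3) by simp
  obtain r2 e2 where r2: "r2 > 0" "e2 = 1 \<or> e2 = (-1::real)"
    "\<And>t. \<bar>t - t2\<bar> < r2 \<Longrightarrow> t \<in> {-\<eta><..} \<and> 0 + e2 * (t - t2) \<in> {-\<delta><..<\<delta>} \<and> c t = \<sigma> (0 + e2 * (t - t2)) \<and>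
      c' t = of_real e2 * \<sigma>' (0 + e2 * (t - t2))"
    by (rule unit_speed_in_arc [OF \<sigma>(1) z c tm(2) \<sigma>2]) (rule that)
  have c't: "c' t1 = of_real e1 * \<sigma>' 0" "c' t2 = of_real e2 * \<sigma>' 0"
    using r1(3) [of t1] r2(3) [of t2] r1(1) r2(1) by auto
  have same: "c' t1 = c' t2"
  proof (rule ccontr)
    assume ne: "c' t1 \<noteq> c' t2"
    then have opp: "c' t1 = - c' t2" using c't r1(2) r2(2) by auto
    define J where "J = {-(\<eta> + t1)<..<t2 + \<eta>}"
    have 1: "unit_speed S J (\<lambda>s. c (t1 + 1 * s)) (\<lambda>s. of_real 1 * c' (t1 + 1 * s))"
      by (rule unit_speed_subset [OF unit_speed_affine [OF c]]) (auto simp: J_def)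
    have 2: "unit_speed S J (\<lambda>s. c (t2 + (- 1) * s)) (\<lambda>s. of_real (- 1) * c' (t2 + (- 1) * s))"
      by (rule unit_speed_subset [OF unit_speed_affine [OF c]]) (auto simp: J_def)
    define m where "m = (t2 - t1) / 2"
    have "(\<lambda>s. c (t1 + 1 * s)) m = (\<lambda>s. c (t2 + (- 1) * s)) m \<and>
        (\<lambda>s. of_real 1 * c' (t1 + 1 * s)) m = (\<lambda>s. of_real (- 1) * c' (t2 + (- 1) * s)) m"
      by (rule unit_speed_unique [OF S 1 2, of 0]) (use t \<eta> opp in \<open>auto simp: J_def m_def field_simps\<close>)
    then have "c' (t1 + m) = - c' (t2 - m)" by simp
    moreover have "t2 - m = t1 + m" by (simp add: m_def field_simps)
    moreover have "norm (c' (t1 + m)) = 1"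
    proof (rule cd(4))
      have "0 \<le> m" using t by (simp add: m_def)
      then show "t1 + m \<in> {-\<eta><..}" using t \<eta> by simp
    qed
    ultimately show False by simp
  qed
  define J where "J = {-(\<eta> + t1)<..}"
  have 1: "unit_speed S J (\<lambda>s. c (t1 + 1 * s)) (\<lambda>s. of_real 1 * c' (t1 + 1 * s))"
    by (rule unit_speed_subset [OF unit_speed_affine [OF c]]) (auto simp: J_def)
  have 2: "unit_speed S J (\<lambda>s. c (t2 + 1 * s)) (\<lambda>s. of_real 1 * c' (t2 + 1 * s))"
    by (rule unit_speed_subset [OF unit_speed_affine [OF c]]) (use t in \<open>auto simp: J_def\<close>)
  have "(\<lambda>s. c (t1 + 1 * s)) (s - t1) = (\<lambda>s. c (t2 + 1 * s)) (s - t1) \<and>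
      (\<lambda>s. of_real 1 * c' (t1 + 1 * s)) (s - t1) = (\<lambda>s. of_real 1 * c' (t2 + 1 * s)) (s - t1)"
    by (rule unit_speed_unique [OF S 1 2, of 0]) (use t \<eta> s same in \<open>auto simp: J_def\<close>)
  then show ?thesis by (simp add: algebra_simps)
qed

lemma has_vector_derivative_locally_injective:
  fixes c :: "real \<Rightarrow> complex"
  assumes "(c has_vector_derivative v) (at t)" "v \<noteq> 0"
  obtains r where "r > 0" "\<And>s. \<bar>s - t\<bar> < r \<Longrightarrow> s \<noteq> t \<Longrightarrow> c s \<noteq> c t"
proof -
  have "(c has_derivative (\<lambda>x. x *\<^sub>R v)) (at t)" using assms(1) by (simp add: has_vector_derivative_def)
  then obtain r where r: "r > 0" "\<And>s. norm (s - t) < r \<Longrightarrow> norm (c s - c t - (s - t) *\<^sub>R v) \<le> (norm v / 2) * norm (s - t)"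
    using assms(2) unfolding has_derivative_at_alt by (metis half_gt_zero zero_less_norm_iff)
  show ?thesis
  proof (rule that [OF r(1)])
    fix s assume s: "\<bar>s - t\<bar> < r" "s \<noteq> t"
    show "c s \<noteq> c t"
    proof
      assume "c s = c t"
      then have "\<bar>s - t\<bar> * norm v \<le> (norm v / 2) * \<bar>s - t\<bar>" using r(2) [of s] s by simp
      moreover have "\<bar>s - t\<bar> * norm v > 0" using s assms(2) by simp
      ultimately show False by (simp add: mult.commute)
    qed
  qed
qed

text \<open>On a compact set the points \<open>c k\<close> at integer times \<open>k\<close>
  accumulate, and two of them on a common short arc force a return. Returns to \<open>c 0\<close>
  cannot come arbitrarily early, as \<open>c'\<close> is nonzero at 0; so there is a least return
  time \<open>L\<close>, and by \<open>unit_speed_return\<close> a coincidence within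
  \<open>{0..<L}\<close> would be a return before \<open>L\<close>.\<close>

lemma closed_unit_speed_curve:
  assumes S: "C1_curve S" "compact S" "S \<noteq> {}"
  obtains c c' L where "L > 0" "unit_speed S UNIV c c'" "\<And>t. c (t + L) = c t" "inj_on c {0..<L}"
proof -
  obtain \<eta> c c' where \<eta>: "\<eta> > 0" and c: "unit_speed S {-\<eta><..} c c'"
    by (rule unit_speed_half_line [OF S]) (rule that)
  note cd = unit_speedD [OF c]
  note ret = unit_speed_return [OF S(1) \<eta> c]
  have "\<exists>t1 t2. 0 \<le> t1 \<and> t1 < t2 \<and> c t1 = c t2"
  proof -
    have "\<forall>k::nat. c (real k) \<in> S" using cd(5) \<eta> by auto
    then obtain p \<rho> where p: "p \<in> S" "strict_mono (\<rho> :: nat \<Rightarrow> nat)" "((\<lambda>k. c (real k)) \<circ> \<rho>) \<longlonglongrightarrow> p"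
      using S(2) unfolding compact_def by metis
    obtain \<sigma> \<sigma>' \<delta> where \<sigma>: "smooth_arc S \<sigma> \<sigma>' \<delta>" "\<sigma> 0 = p" using S(1) p(1) unfolding C1_curve_def by blast
    note sd = smooth_arcD [OF \<sigma>(1)]
    \<comment> \<open>The arc parameters of two points near \<open>p\<close> differ by less than
      \<open>2 * e \<le> 1 / 2\<close>, too little to bridge the integers \<open>i < j\<close>; so
      \<open>i + s\<close> and \<open>j\<close> are different times with the same position. The
      bound \<open>\<delta> / 4\<close> keeps the motion inside the arc.\<close>
    define e where "e = min (\<delta> / 4) (1 / 4)"
    have e: "e > 0" "e \<le> \<delta> / 4" "e \<le> 1 / 4" using sd(1) by (auto simp: e_def)
    have z: "0 \<in> {-\<delta><..<\<delta>}" using sd(1) by simp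
    obtain V where V: "open V" "\<sigma> 0 \<in> V" "S \<inter> V \<subseteq> \<sigma> ` {u\<in>{-\<delta><..<\<delta>}. \<bar>u - 0\<bar> < e}"
      using sd(6) [OF z e(1)] by blast
    have "eventually (\<lambda>k. ((\<lambda>k. c (real k)) \<circ> \<rho>) k \<in> V) sequentially"
      by (rule topological_tendstoD [OF p(3) V(1)]) (use V(2) \<sigma>(2) in simp)
    then obtain K where K: "\<And>k. k \<ge> K \<Longrightarrow> c (real (\<rho> k)) \<in> V" by (auto simp: eventually_sequentially)
    define i where "i = \<rho> (Suc K)"
    define j where "j = \<rho> (Suc (Suc K))"
    have ij: "1 \<le> i" "i < j"
      using p(2) strict_mono_less [OF p(2), of "Suc K" "Suc (Suc K)"] strict_mono_less [OF p(2), of K "Suc K"] by (auto simp: i_def j_def)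
    have near: "\<exists>u\<in>{-\<delta><..<\<delta>}. \<bar>u\<bar> < e \<and> q = \<sigma> u" if "q \<in> S \<inter> V" for q
      using subsetD [OF V(3) that] unfolding image_iff by auto
    have "c (real i) \<in> S \<inter> V" "c (real j) \<in> S \<inter> V" using K cd(5) \<eta> by (auto simp: i_def j_def)
    from near [OF this(1)] near [OF this(2)]
    obtain u v where u: "u \<in> {-\<delta><..<\<delta>}" "\<bar>u\<bar> < e" "c (real i) = \<sigma> u"
      and v: "v \<in> {-\<delta><..<\<delta>}" "\<bar>v\<bar> < e" "c (real j) = \<sigma> v" by blast
    have iJ: "real i \<in> {-\<eta><..}" using \<eta> by simp
    obtain r f where r: "r > 0" "f = 1 \<or> f = (-1::real)"
      "\<And>x. \<bar>x - real i\<bar> < r \<Longrightarrow> x \<in> {-\<eta><..} \<and> u + f * (x - real i) \<in> {-\<delta><..<\<delta>} \<and> c x = \<sigma> (u + f * (x - real i)) \<and>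
        c' x = of_real f * \<sigma>' (u + f * (x - real i))"
      by (rule unit_speed_in_arc [OF \<sigma>(1) u(1) c iJ u(3)]) (rule that)
    define J where "J = {- (2 * e)<..<2 * e}"
    have 1: "unit_speed S J (\<lambda>s. c (real i + 1 * s)) (\<lambda>s. of_real 1 * c' (real i + 1 * s))"
      by (rule unit_speed_subset [OF unit_speed_affine [OF c]]) (use e ij \<eta> in \<open>auto simp: J_def\<close>)
    have 2: "unit_speed S J (\<lambda>s. \<sigma> (u + f * s)) (\<lambda>s. of_real f * \<sigma>' (u + f * s))"
      by (rule unit_speed_subset [OF unit_speed_affine [OF smooth_arc_unit_speed [OF \<sigma>(1)] r(2)]])
        (use e u(2) r(2) in \<open>auto simp: J_def\<close>)
    define s where "s = f * (v - u)"
    have sJ: "s \<in> J" using u(2) v(2) r(2) by (auto simp: J_def s_def)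
    have "(\<lambda>s. c (real i + 1 * s)) s = (\<lambda>s. \<sigma> (u + f * s)) s \<and>
      (\<lambda>s. of_real 1 * c' (real i + 1 * s)) s = (\<lambda>s. of_real f * \<sigma>' (u + f * s)) s"
      by (rule unit_speed_unique [OF S(1) 1 2, of 0]) (use r(1) r(3) [of "real i"] e sJ in \<open>auto simp: J_def\<close>)
    moreover have "f * s = v - u" using r(2) by (auto simp: s_def)
    ultimately have "c (real i + s) = c (real j)" using v(3) by simp
    moreover have "0 \<le> real i + s" "real i + s < real j" using sJ e ij by (auto simp: J_def)
    ultimately show ?thesis by blast
  qed
  then obtain t1 t2 where t: "0 \<le> t1" "t1 < t2" "c t1 = c t2" by blast
  have c0: "(c has_vector_derivative c' 0) (at 0)" "c' 0 \<noteq> 0" using cd(3) [of 0] cd(4) [of 0] \<eta> by auto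
  obtain r where r: "r > 0" "\<And>s. \<bar>s - 0\<bar> < r \<Longrightarrow> s \<noteq> 0 \<Longrightarrow> c s \<noteq> c 0"
    by (rule has_vector_derivative_locally_injective [OF c0]) (rule that)
  \<comment> \<open>Every positive return time is at least \<open>r\<close>; the cut at
    \<open>r\<close> makes the set closed with positive infimum.\<close>
  define \<T> where "\<T> = {T\<in>{r..}. c T = c 0}"
  have mem: "T \<in> \<T>" if "T > 0" "c T = c 0" for T using r(2) [of T] that by (force simp: \<T>_def)
  have "c (0 + (t2 - t1)) = c 0" using ret [OF t, of 0] \<eta> by simp
  then have ne: "\<T> \<noteq> {}" using mem [of "t2 - t1"] t by auto
  have below: "bdd_below \<T>" by (intro bdd_belowI [of _ r]) (auto simp: \<T>_def)
  have "closed \<T>" unfolding \<T>_def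
  proof (rule continuous_closed_preimage_constant)
    show "continuous_on {r..} c" using cd(6) r(1) \<eta> by (intro continuous_at_imp_continuous_on) auto
  qed simp
  then have L\<T>: "Inf \<T> \<in> \<T>" using ne below by (rule closed_contains_Inf [rotated 2])
  define L where "L = Inf \<T>"
  have L: "L > 0" "c L = c 0" using L\<T> r(1) by (auto simp: L_def \<T>_def)
  have Lmin: "L \<le> T" if "T > 0" "c T = c 0" for T unfolding L_def using mem [OF that] below by (rule cInf_lower)
  have per: "c (s + L) = c s \<and> c' (s + L) = c' s" if "-\<eta> < s" for s
    using ret [of 0 L s] L that by simp
  have inj: "inj_on c {0..<L}"
  proof (rule linorder_inj_onI')
    fix s1 s2 assume s: "s1 \<in> {0..<L}" "s2 \<in> {0..<L}" "s1 < s2"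
    show "c s1 \<noteq> c s2"
    proof
      assume "c s1 = c s2"
      then have "c (0 + (s2 - s1)) = c 0" using ret [of s1 s2 0] s \<eta> by simp
      then have "L \<le> s2 - s1" using s by (intro Lmin) auto
      then show False using s by simp
    qed
  qed
  \<comment> \<open>Reduction modulo \<open>L\<close> extends the curve from the half-line to the
    whole line. The stretch of the half-line before 0 covers a neighbourhood of the multiples of
    \<open>L\<close>.\<close>
  define q where "q = (\<lambda>t. t - L * of_int \<lfloor>t / L\<rfloor>)"
  have q: "0 \<le> q t" "q t < L" for t
  proof -
    have "of_int \<lfloor>t / L\<rfloor> \<le> t / L" "t / L < of_int \<lfloor>t / L\<rfloor> + 1" by linarith+
    then have "of_int \<lfloor>t / L\<rfloor> * L \<le> t" "t < (of_int \<lfloor>t / L\<rfloor> + 1) * L"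
      using pos_le_divide_eq [OF L(1)] pos_divide_less_eq [OF L(1)] by blast+
    then show "0 \<le> q t" "q t < L" by (simp_all add: q_def algebra_simps)
  qed
  define C where "C = (\<lambda>t. c (q t))"
  define C' where "C' = (\<lambda>t. c' (q t))"
  have loc: "C x = c (0 + (x - L * of_int k)) \<and> C' x = c' (x - L * of_int k)"
    if x: "-\<eta> < x - L * of_int k" "-L < x - L * of_int k" "x - L * of_int k < L" for x k
  proof (cases "0 \<le> x - L * of_int k")
    case True
    then have "of_int k \<le> x / L" "x / L < of_int k + 1" using x L(1) by (auto simp: field_simps)
    then have "\<lfloor>x / L\<rfloor> = k" by (simp add: floor_eq_iff)
    then show ?thesis by (simp add: C_def C'_def q_def)
  next
    case False
    then have "of_int (k - 1) \<le> x / L" "x / L < of_int (k - 1) + 1" using x L(1) by (auto simp: field_simps)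
    then have "\<lfloor>x / L\<rfloor> = k - 1" by (simp add: floor_eq_iff)
    then have "q x = x - L * of_int (k - 1)" by (simp only: q_def)
    then have "q x = (x - L * of_int k) + L" by (simp add: algebra_simps)
    then show ?thesis using per [OF x(1)] by (simp add: C_def C'_def)
  qed
  have "unit_speed S UNIV C C'"
  proof -
    have key: "(C has_vector_derivative C' t) (at t) \<and> norm (C' t) = 1 \<and> C t \<in> S \<and> isCont C' t" for t
    proof -
      define k where "k = \<lfloor>t / L\<rfloor>"
      define W where "W = {L * of_int k - min \<eta> L<..<L * of_int k + L}"
      have W: "open W" "t \<in> W" using q [of t] L(1) \<eta> by (auto simp: W_def q_def k_def)
      have lW: "C x = c (- (L * of_int k) + 1 * x) \<and> C' x = of_real 1 * c' (- (L * of_int k) + 1 * x)" if "x \<in> W" for x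
        using loc [where x = x and k = k] that by (auto simp: W_def algebra_simps)
      have us: "unit_speed S {s. (- (L * of_int k)) + 1 * s \<in> {-\<eta><..}} (\<lambda>s. c (- (L * of_int k) + 1 * s)) (\<lambda>s. of_real 1 * c' (- (L * of_int k) + 1 * s))"
        by (rule unit_speed_affine [OF c]) simp
      have tm: "t \<in> {s. (- (L * of_int k)) + 1 * s \<in> {-\<eta><..}}" using q [of t] \<eta> by (auto simp: q_def k_def)
      have "((\<lambda>s. c (- (L * of_int k) + 1 * s)) has_vector_derivative C' t) (at t)"
        using unit_speedD(3) [OF us tm] lW [OF W(2)] by simp
      then have d: "(C has_vector_derivative C' t) (at t)"
        by (rule has_vector_derivative_transform_within_open [OF _ W]) (use lW in auto)
      have "eventually (\<lambda>x. x \<in> W) (nhds t)" using W by (rule eventually_nhds_in_open)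
      then have "isCont C' t"
        using unit_speedD(7) [OF us tm]
        by (subst isCont_cong [where g = "\<lambda>s. of_real 1 * c' (- (L * of_int k) + 1 * s)"]) (auto elim: eventually_mono simp: lW)
      then show ?thesis using d unit_speedD(4,5) [OF us tm] lW [OF W(2)] by simp
    qed
    then have "continuous_on UNIV C'" by (intro continuous_at_imp_continuous_on) auto
    then show ?thesis unfolding unit_speed_def using key by auto
  qed
  moreover have "C (t + L) = C t" for t
  proof -
    have "(t + L) / L = t / L + 1" using L(1) by (simp add: field_simps)
    then have "\<lfloor>(t + L) / L\<rfloor> = \<lfloor>t / L\<rfloor> + 1" by simp
    then show ?thesis by (simp add: C_def q_def algebra_simps)
  qed
  moreover have "inj_on C {0..<L}"
  proof (rule inj_onI)
    have "C x = c x" if "x \<in> {0..<L}" for x using loc [of x 0] that \<eta> L(1) by simp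
    then show "x = y" if "x \<in> {0..<L}" "y \<in> {0..<L}" "C x = C y" for x y
      using inj_onD [OF inj] that by metis
  qed
  ultimately show ?thesis using that L(1) by blast
qed

lemma unit_speed_tangent:
  assumes S: "C1_curve S" and c: "unit_speed S J c c'" and t: "t \<in> J"
  shows "unit_tangent S (c t) (c' t) \<or> unit_tangent S (c t) (- c' t)"
proof -
  obtain \<sigma> \<sigma>' \<delta> where \<sigma>: "smooth_arc S \<sigma> \<sigma>' \<delta>" "\<sigma> 0 = c t"
    using S unit_speedD(5) [OF c t] unfolding C1_curve_def by blast
  have z: "0 \<in> {-\<delta><..<\<delta>}" using smooth_arcD(1) [OF \<sigma>(1)] by simp
  obtain r e where r: "r > 0" "e = 1 \<or> e = (-1::real)"
    "\<And>x. \<bar>x - t\<bar> < r \<Longrightarrow> x \<in> J \<and> 0 + e * (x - t) \<in> {-\<delta><..<\<delta>} \<and> c x = \<sigma> (0 + e * (x - t)) \<and>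
      c' x = of_real e * \<sigma>' (0 + e * (x - t))"
    by (rule unit_speed_in_arc [OF \<sigma>(1) z c t \<sigma>(2) [symmetric]]) (rule that)
  have "c' t = of_real e * \<sigma>' 0" using r(3) [of t] r(1) by simp
  moreover have "unit_tangent S (c t) (\<sigma>' 0)" using smooth_arcD(7) [OF \<sigma>(1) z] \<sigma>(2) by simp
  ultimately show ?thesis using r(2) by auto
qed

subsection \<open>Integrals of the free motion\<close>

lemma lagrange_interpolation:
  fixes x :: "nat \<Rightarrow> 'a::field"
  assumes "inj_on x {..n}"
  obtains l :: "nat \<Rightarrow> 'a poly" where
    "\<And>p. degree p \<le> n \<Longrightarrow> p = (\<Sum>k\<le>n. smult (poly p (x k)) (l k))"
proof
  define m where "m k = (\<Prod>j\<in>{..n} - {k}. [:- x j, 1:])" for k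
  define l where "l k = smult (1 / poly (m k) (x k)) (m k)" for k
  have mk: "poly (m k) (x k) \<noteq> 0" if "k \<le> n" for k
    using assms that by (auto simp: m_def poly_prod dest: inj_onD)
  have lj: "poly (l k) (x j) = (if j = k then 1 else 0)" if "k \<le> n" "j \<le> n" for j k
    using mk [OF that(1)] that by (auto simp: l_def) (auto simp: m_def poly_prod intro!: bexI [of _ j])
  have deg: "degree (l k) \<le> n" if "k \<le> n" for k
  proof -
    have "degree (m k) \<le> (\<Sum>j\<in>{..n} - {k}. degree [:- x j, 1:])"
      using degree_prod_sum_le [of "{..n} - {k}" "\<lambda>j. [:- x j, 1:]"] by (simp add: m_def o_def)
    also have "\<dots> = n" using that by simp
    finally show ?thesis by (simp add: l_def)
  qed
  show "p = (\<Sum>k\<le>n. smult (poly p (x k)) (l k))" if p: "degree p \<le> n" for p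
  proof (rule poly_eqI_degree)
    fix y assume "y \<in> x ` {..n}"
    then obtain j where j: "j \<le> n" "y = x j" by auto
    have "poly (\<Sum>k\<le>n. smult (poly p (x k)) (l k)) y = (\<Sum>k\<le>n. poly p (x k) * (if j = k then 1 else 0))"
      using j lj by (simp add: poly_sum)
    then show "poly p y = poly (\<Sum>k\<le>n. smult (poly p (x k)) (l k)) y" using j by (simp add: if_distrib cong: if_cong)
  next
    have c: "card (x ` {..n}) = Suc n" using assms by (simp add: card_image)
    show "degree p < card (x ` {..n})" using p c by simp
    have "degree (\<Sum>k\<le>n. smult (poly p (x k)) (l k)) \<le> n"
      by (rule degree_sum_le) (auto intro: order.trans [OF degree_smult_le] deg)
    then show "degree (\<Sum>k\<le>n. smult (poly p (x k)) (l k)) < card (x ` {..n})" using c by simp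
  qed
qed

lemma poly_eqI_infinite:
  fixes p q :: "'a::idom poly"
  assumes "infinite A" "\<And>x. x \<in> A \<Longrightarrow> poly p x = poly q x"
  shows "p = q"
proof (rule ccontr)
  assume "p \<noteq> q"
  then have "finite {x. poly (p - q) x = 0}" by (intro poly_roots_finite) simp
  moreover have "A \<subseteq> {x. poly (p - q) x = 0}" using assms(2) by auto
  ultimately show False using assms(1) finite_subset by blast
qed

lemma degree_linear_power_le: "degree ([:a, b:] ^ i) \<le> i"
  by (rule order.trans [OF degree_power_le]) simp

text \<open>For fixed \<open>c\<close> and \<open>y\<close> the right side of the invariance is a polynomial in \<open>1 / x\<close>, for fixed
  \<open>x\<close> and \<open>y\<close> the left side is a polynomial in \<open>c\<close>; interpolation in \<open>1 / x\<close> recovers the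
  coefficients.\<close>

lemma line_integral_coeff_poly_aux:
  fixes a :: "nat \<Rightarrow> real \<Rightarrow> real \<Rightarrow> real"
  assumes inv: "\<And>x y c. 0 < x \<Longrightarrow> x < r \<Longrightarrow> \<bar>y\<bar> < r \<Longrightarrow> \<bar>c\<bar> < r \<Longrightarrow>
      (\<Sum>i\<le>n. a i x y * ((y - c) / x) ^ i) = (\<Sum>i\<le>n. a i 0 c * ((y - c) / x) ^ i)"
    and y: "\<bar>y\<bar> < r" and i: "i \<le> n"
  obtains q where "degree q \<le> n" "\<And>c. \<bar>c\<bar> < r \<Longrightarrow> a i 0 c * (y - c) ^ i = poly q c"
proof -
  have r: "r > 0" using y by linarith
  \<comment> \<open>Interpolation nodes for the variable \<open>1 / x\<close>; the shift by 2 gives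
    \<open>1 / u k \<le> r / 2\<close>, an admissible value of \<open>x\<close>.\<close>
  define u where "u k = (real k + 2) / r" for k :: nat
  have "inj_on u {..n}" using r by (auto simp: u_def inj_on_def)
  then obtain l where l: "\<And>p. degree p \<le> n \<Longrightarrow> p = (\<Sum>k\<le>n. smult (poly p (u k)) (l k))"
    by (rule lagrange_interpolation) (rule that)
  have u: "0 < 1 / u k" "1 / u k < r" for k using r by (auto simp: u_def field_simps intro: add_pos_nonneg)
  define Q where "Q k = (\<Sum>i\<le>n. smult (a i (1 / u k) y * u k ^ i) ([:y, -1:] ^ i))" for k
  have dQ: "degree (Q k) \<le> n" for k
    unfolding Q_def
    by (rule degree_sum_le) (auto intro!: order.trans [OF degree_smult_le] order.trans [OF degree_linear_power_le])
  show ?thesis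
  proof (rule that [of "\<Sum>k\<le>n. smult (coeff (l k) i) (Q k)"])
    show "degree (\<Sum>k\<le>n. smult (coeff (l k) i) (Q k)) \<le> n"
      by (rule degree_sum_le) (auto intro: order.trans [OF degree_smult_le] dQ)
    fix c assume c: "\<bar>c\<bar> < r"
    define p where "p = (\<Sum>j\<le>n. monom (a j 0 c * (y - c) ^ j) j)"
    have "degree p \<le> n" unfolding p_def by (rule degree_sum_le) (auto intro: order.trans [OF degree_monom_le])
    have pu: "poly p (u k) = poly (Q k) c" for k
    proof -
      have uy: "(y - c) / (1 / u k) = (y - c) * u k" by simp
      have "poly p (u k) = (\<Sum>j\<le>n. a j 0 c * ((y - c) / (1 / u k)) ^ j)"
        unfolding uy by (simp add: p_def poly_sum poly_monom power_mult_distrib mult.assoc)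
      also have "\<dots> = (\<Sum>j\<le>n. a j (1 / u k) y * ((y - c) / (1 / u k)) ^ j)"
        by (rule inv [OF u y c, symmetric])
      also have "\<dots> = poly (Q k) c"
        unfolding uy by (simp add: Q_def poly_sum power_mult_distrib mult_ac)
      finally show ?thesis .
    qed
    have "a i 0 c * (y - c) ^ i = coeff p i" using i by (simp add: p_def coeff_sum)
    also have "\<dots> = coeff (\<Sum>k\<le>n. smult (poly p (u k)) (l k)) i" using l [OF \<open>degree p \<le> n\<close>] by simp
    also have "\<dots> = poly (\<Sum>k\<le>n. smult (coeff (l k) i) (Q k)) c"
      by (simp add: coeff_sum poly_sum pu mult.commute)
    finally show "a i 0 c * (y - c) ^ i = poly (\<Sum>k\<le>n. smult (coeff (l k) i) (Q k)) c" .
  qed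
qed

text \<open>The auxiliary lemma is applied with \<open>y = 0\<close> and \<open>y = r / 2\<close>.
  The two resulting polynomials contain powers of the coprime factors \<open>- c\<close> and
  \<open>r / 2 - c\<close>; their common cofactor \<alpha> is the coefficient, and splitting off the
  power lowers the degree bound by \<open>i\<close>.\<close>

lemma line_integral_coeff_poly:
  fixes a :: "nat \<Rightarrow> real \<Rightarrow> real \<Rightarrow> real"
  assumes inv: "\<And>x y c. 0 < x \<Longrightarrow> x < r \<Longrightarrow> \<bar>y\<bar> < r \<Longrightarrow> \<bar>c\<bar> < r \<Longrightarrow>
      (\<Sum>i\<le>n. a i x y * ((y - c) / x) ^ i) = (\<Sum>i\<le>n. a i 0 c * ((y - c) / x) ^ i)"
    and r: "r > 0" and i: "i \<le> n"
  obtains \<alpha> where "degree \<alpha> \<le> n - i" "\<And>c. \<bar>c\<bar> < r \<Longrightarrow> a i 0 c = poly \<alpha> c"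
proof -
  have y: "\<bar>0\<bar> < r" "\<bar>r / 2\<bar> < r" using r by auto
  obtain q0 where q0: "degree q0 \<le> n" "\<And>c. \<bar>c\<bar> < r \<Longrightarrow> a i 0 c * (0 - c) ^ i = poly q0 c"
    by (rule line_integral_coeff_poly_aux [OF inv y(1) i]) (assumption | rule that)+
  obtain q1 where q1: "degree q1 \<le> n" "\<And>c. \<bar>c\<bar> < r \<Longrightarrow> a i 0 c * (r / 2 - c) ^ i = poly q1 c"
    by (rule line_integral_coeff_poly_aux [OF inv y(2) i]) (assumption | rule that)+
  define L0 L1 where "L0 = [:0::real, -1:]" and "L1 = [:r / 2, -1:]"
  have eq: "q0 * L1 ^ i = q1 * L0 ^ i"
  proof (rule poly_eqI_infinite [of "{-r<..<r}"])
    fix c assume "c \<in> {-r<..<r}"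
    then have c: "\<bar>c\<bar> < r" by auto
    have "poly (q0 * L1 ^ i) c = a i 0 c * (0 - c) ^ i * (r / 2 - c) ^ i" by (simp add: q0(2) [OF c, symmetric] L1_def)
    also have "\<dots> = poly (q1 * L0 ^ i) c" using q1(2) [OF c, symmetric] by (simp add: L0_def)
    finally show "poly (q0 * L1 ^ i) c = poly (q1 * L0 ^ i) c" .
  qed (use r in auto)
  have "L0 ^ i dvd q0"
  proof (cases "q0 = 0")
    case False
    have L: "L0 = smult (-1) [:- 0, 1:]" "L1 \<noteq> 0" "poly (L1 ^ i) 0 \<noteq> 0" using r by (auto simp: L0_def L1_def)
    have "[:- 0, 1:] ^ i dvd L0 ^ i" unfolding L(1) by (intro dvd_power_same dvd_smult dvd_refl)
    then have "[:- 0, 1:] ^ i dvd q0 * L1 ^ i" unfolding eq by (rule dvd_mult)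
    then have "i \<le> order 0 (q0 * L1 ^ i)" using False L(2) by (subst (asm) order_divides) auto
    also have "\<dots> = order 0 q0" using False L(2,3) by (simp add: order_mult order_0I)
    finally have "[:- 0, 1:] ^ i dvd q0" by (subst order_divides) simp
    moreover have "L0 ^ i = smult ((-1) ^ i) ([:- 0, 1:] ^ i)" unfolding L(1) by (rule smult_power)
    ultimately show ?thesis by (simp only: smult_dvd_iff) auto
  qed simp
  then obtain \<alpha> where \<alpha>: "q0 = L0 ^ i * \<alpha>" by (rule dvdE)
  have L0: "L0 \<noteq> 0" by (simp add: L0_def)
  have q1': "q1 = L1 ^ i * \<alpha>"
  proof -
    have "L0 ^ i * q1 = L0 ^ i * (L1 ^ i * \<alpha>)"
      using eq unfolding \<alpha> by (metis mult.assoc mult.commute)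
    then show ?thesis using L0 by (metis mult_cancel_left power_not_zero)
  qed
  show ?thesis
  proof (rule that [of \<alpha>])
    show "degree \<alpha> \<le> n - i"
    proof (cases "\<alpha> = 0")
      case False
      have "degree q0 = i + degree \<alpha>" unfolding \<alpha> using False L0 by (simp add: degree_mult_eq degree_power_eq) (simp add: L0_def)
      then show ?thesis using q0(1) by simp
    qed simp
    fix c assume c: "\<bar>c\<bar> < r"
    show "a i 0 c = poly \<alpha> c"
    \<comment> \<open>At \<open>c = 0\<close> the factor \<open>L0\<close> vanishes, and the
      representation by \<open>q1\<close> is used instead.\<close>
    proof (cases "c = 0")
      case True
      then show ?thesis using q1(2) [OF c] r by (simp add: q1' L1_def)
    next
      case False
      then show ?thesis using q0(2) [OF c] by (simp add: \<alpha> L0_def)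
    qed
  qed
qed

lemma poly_eq_sum_le: "degree p \<le> d \<Longrightarrow> poly p x = (\<Sum>i\<le>d. coeff p i * x ^ i)" for x :: "'a::comm_semiring_1"
  unfolding poly_altdef by (rule sum.mono_neutral_left) (auto simp: coeff_eq_0)

text \<open>The line of slope \<open>p\<close> through \<open>(x, y)\<close> meets the axis
  \<open>x = 0\<close> at \<open>y - p * x\<close>, where the coefficients are polynomials. For
  \<open>p = P2 / P1\<close> their degree bound \<open>n - i\<close> lets \<open>P1 ^ n\<close>
  clear all denominators, and \<open>y - p * x\<close> becomes the moment
  \<open>y * P1 - x * P2\<close>.\<close>

lemma line_integral_coeffs:
  fixes a :: "nat \<Rightarrow> real \<Rightarrow> real \<Rightarrow> real"
  assumes inv: "\<And>x y c. x \<noteq> 0 \<Longrightarrow> \<bar>x\<bar> < r \<Longrightarrow> \<bar>y\<bar> < r \<Longrightarrow> \<bar>c\<bar> < r \<Longrightarrow>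
      (\<Sum>i\<le>n. a i x y * ((y - c) / x) ^ i) = (\<Sum>i\<le>n. a i 0 c * ((y - c) / x) ^ i)"
    and r: "r > 0"
  obtains C where "\<And>x y P1 P2. \<bar>x\<bar> < r \<Longrightarrow> \<bar>y\<bar> < r \<Longrightarrow>
    (\<Sum>i\<le>n. a i x y * P1 ^ (n - i) * P2 ^ i) =
    (\<Sum>i\<le>n. \<Sum>j\<le>n - i. C i j * (y * P1 - x * P2) ^ j * P2 ^ i * P1 ^ (n - i - j))"
proof -
  have "\<exists>\<alpha>. degree \<alpha> \<le> n - i \<and> (\<forall>c. \<bar>c\<bar> < r \<longrightarrow> a i 0 c = poly \<alpha> c)" if i: "i \<le> n" for i
  proof -
    have inv': "(\<Sum>i\<le>n. a i x y * ((y - c) / x) ^ i) = (\<Sum>i\<le>n. a i 0 c * ((y - c) / x) ^ i)"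
      if "0 < x" "x < r" "\<bar>y\<bar> < r" "\<bar>c\<bar> < r" for x y c using inv [of x y c] that by auto
    show ?thesis by (rule line_integral_coeff_poly [OF inv' r i]) auto
  qed
  then obtain \<alpha> where \<alpha>: "\<And>i. i \<le> n \<Longrightarrow> degree (\<alpha> i) \<le> n - i"
    "\<And>i c. i \<le> n \<Longrightarrow> \<bar>c\<bar> < r \<Longrightarrow> a i 0 c = poly (\<alpha> i) c" by metis
  have slope: "(\<Sum>i\<le>n. a i x y * p ^ i) = (\<Sum>i\<le>n. poly (\<alpha> i) (y - p * x) * p ^ i)"
    if x: "\<bar>x\<bar> < r" and y: "\<bar>y\<bar> < r" for x y p
  proof (cases "x = 0")
    case True
    then show ?thesis using \<alpha>(2) y by simp
  next
    case False
    define p1 where "p1 = (\<Sum>i\<le>n. monom (a i x y) i)"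
    define p2 where "p2 = (\<Sum>i\<le>n. pcompose (\<alpha> i) [:y, - x:] * monom 1 i)"
    have p2: "poly p2 p = (\<Sum>i\<le>n. poly (\<alpha> i) (y - p * x) * p ^ i)" for p
      by (simp add: p2_def poly_sum poly_pcompose poly_monom)
    have p1: "poly p1 p = (\<Sum>i\<le>n. a i x y * p ^ i)" for p by (simp add: p1_def poly_sum poly_monom)
    \<comment> \<open>The invariance covers the slopes of segments that reach the axis within the
      range; these are infinitely many.\<close>
    have "p1 = p2"
    proof (rule poly_eqI_infinite)
      show "infinite ((\<lambda>c. (y - c) / x) ` {-r<..<r})"
        using False r by (subst finite_image_iff) (auto simp: inj_on_def)
      fix p assume "p \<in> (\<lambda>c. (y - c) / x) ` {-r<..<r}"
      then obtain c where "c \<in> {-r<..<r}" and c2: "p = (y - c) / x" by blast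
      then have c: "\<bar>c\<bar> < r" "p = (y - c) / x" by auto
      then have "y - p * x = c" using False by simp
      then show "poly p1 p = poly p2 p"
        using inv [OF False x y c(1)] \<alpha>(2) c unfolding p1 p2 by simp
    qed
    then show ?thesis using p1 p2 by metis
  qed
  define C where "C i j = coeff (\<alpha> i) j" for i j
  show ?thesis
  proof (rule that [of C])
    fix x y P1 P2 :: real assume x: "\<bar>x\<bar> < r" and y: "\<bar>y\<bar> < r"
    define f where "f P1 = (\<Sum>i\<le>n. a i x y * P1 ^ (n - i) * P2 ^ i)" for P1
    define g where "g P1 = (\<Sum>i\<le>n. \<Sum>j\<le>n - i. C i j * (y * P1 - x * P2) ^ j * P2 ^ i * P1 ^ (n - i - j))" for P1
    have ne: "f P1 = g P1" if P1: "P1 \<in> - {0}" for P1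
    proof -
      have P1': "P1 \<noteq> 0" using P1 by simp
      have "f P1 = P1 ^ n * (\<Sum>i\<le>n. a i x y * (P2 / P1) ^ i)"
        unfolding f_def sum_distrib_left
        by (rule sum.cong) (use P1' in \<open>auto simp: power_diff power_divide\<close>)
      also have "\<dots> = P1 ^ n * (\<Sum>i\<le>n. poly (\<alpha> i) (y - P2 / P1 * x) * (P2 / P1) ^ i)"
        using slope [OF x y] by simp
      also have "\<dots> = g P1"
        unfolding g_def sum_distrib_left
      proof (rule sum.cong)
        fix i assume i: "i \<in> {..n}"
        have "poly (\<alpha> i) (y - P2 / P1 * x) = (\<Sum>j\<le>n - i. C i j * (y - P2 / P1 * x) ^ j)"
          using poly_eq_sum_le [OF \<alpha>(1)] i by (simp add: C_def)
        then have "P1 ^ n * (poly (\<alpha> i) (y - P2 / P1 * x) * (P2 / P1) ^ i) =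
            (\<Sum>j\<le>n - i. P1 ^ n * (C i j * (y - P2 / P1 * x) ^ j * (P2 / P1) ^ i))"
          by (simp only: sum_distrib_left sum_distrib_right)
        moreover have "P1 ^ n * (C i j * (y - P2 / P1 * x) ^ j * (P2 / P1) ^ i) =
            C i j * (y * P1 - x * P2) ^ j * P2 ^ i * P1 ^ (n - i - j)" if "j \<le> n - i" for j
        proof -
          have n: "n = (n - i - j) + j + i" using that i by simp
          have e: "y - P2 / P1 * x = (y * P1 - x * P2) / P1" using P1' by (simp add: field_simps)
          have "P1 ^ n = P1 ^ (n - i - j) * P1 ^ j * P1 ^ i" by (subst n) (simp only: power_add)
          then show ?thesis using P1' unfolding e by (simp add: power_divide)
        qed
        ultimately show "P1 ^ n * (poly (\<alpha> i) (y - P2 / P1 * x) * (P2 / P1) ^ i) =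
          (\<Sum>j\<le>n - i. C i j * (y * P1 - x * P2) ^ j * P2 ^ i * P1 ^ (n - i - j))"
          by (simp only:) (intro sum.cong, auto)
      qed simp
      finally show ?thesis .
    qed
    \<comment> \<open>Velocities with \<open>P1 = 0\<close> have no slope and are reached by
      continuity.\<close>
    have "continuous_on UNIV f" "continuous_on UNIV g" unfolding f_def g_def by (intro continuous_intros)+
    then have "continuous_on (closure (- {0})) (\<lambda>t. f t - g t)"
      by (intro continuous_on_diff) (auto intro: continuous_on_subset)
    then have "f t - g t = 0" for t
      by (rule continuous_constant_on_closure [where a = 0]) (use ne in \<open>auto simp: closure_complement\<close>)
    then show "(\<Sum>i\<le>n. a i x y * P1 ^ (n - i) * P2 ^ i) =
      (\<Sum>i\<le>n. \<Sum>j\<le>n - i. C i j * (y * P1 - x * P2) ^ j * P2 ^ i * P1 ^ (n - i - j))"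
      by (simp add: f_def g_def)
  qed
qed

text \<open>The three arguments stand for \<open>P\<close>, \<open>cnj P\<close> and the moment
  \<open>Q * cnj P - cnj Q * P\<close>, each of degree one in the velocity.\<close>

inductive homogeneous :: "nat \<Rightarrow> (complex \<Rightarrow> complex \<Rightarrow> complex \<Rightarrow> complex) \<Rightarrow> bool" where
  monomial: "homogeneous (i + j + k) (\<lambda>u v w. c * u ^ i * v ^ j * w ^ k)"
| add: "homogeneous n g \<Longrightarrow> homogeneous n h \<Longrightarrow> homogeneous n (\<lambda>u v w. g u v w + h u v w)"

lemma homogeneous_mult:
  assumes "homogeneous m g" "homogeneous n h"
  shows "homogeneous (m + n) (\<lambda>u v w. g u v w * h u v w)"
  using assms(1)
proof induction
  case (monomial i j k c)
  show ?case using assms(2)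
  proof induction
    case (monomial i' j' k' c')
    have "homogeneous ((i + i') + (j + j') + (k + k')) (\<lambda>u v w. (c * c') * u ^ (i + i') * v ^ (j + j') * w ^ (k + k'))"
      by (rule homogeneous.monomial)
    moreover have "(i + i') + (j + j') + (k + k') = i + j + k + (i' + j' + k')" by simp
    ultimately show ?case by (simp add: power_add mult_ac)
  next
    case (add n g h)
    then show ?case by (simp add: distrib_left homogeneous.add)
  qed
next
  case (add m g h)
  then show ?case by (simp add: distrib_right homogeneous.add)
qed

lemma homogeneous_const: "homogeneous 0 (\<lambda>u v w. c)"
  using homogeneous.monomial [of 0 0 0 c] by simp

lemma homogeneous_power:
  assumes "homogeneous m g"
  shows "homogeneous (m * k) (\<lambda>u v w. g u v w ^ k)"
proof (induction k)
  case 0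
  then show ?case using homogeneous_const [of 1] by simp
next
  case (Suc k)
  then show ?case using homogeneous_mult [OF assms Suc] by (simp add: add.commute)
qed

lemma homogeneous_zero: "homogeneous n (\<lambda>u v w. 0)"
  using homogeneous.monomial [of n 0 0 0] by simp

lemma homogeneous_sum:
  assumes "\<And>i. i \<in> I \<Longrightarrow> homogeneous n (g i)"
  shows "homogeneous n (\<lambda>u v w. \<Sum>i\<in>I. g i u v w)"
  using assms
proof (induction I rule: infinite_finite_induct)
  case (insert i I)
  then show ?case by (simp add: homogeneous.add)
qed (simp_all add: homogeneous_zero)

lemma homogeneous_linear: "homogeneous 1 (\<lambda>u v w. a * u + b * v + c * w)"
  using homogeneous.monomial [of 1 0 0 a] homogeneous.monomial [of 0 1 0 b] homogeneous.monomial [of 0 0 1 c]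
  by (auto intro!: homogeneous.add)

lemma homogeneous_poly:
  assumes "homogeneous n g"
  obtains p where "\<And>w. g u v w = poly p w"
proof -
  have "\<exists>p. \<forall>w. g u v w = poly p w" using assms
  proof induction
    case (monomial i j k c)
    show ?case by (rule exI [of _ "monom (c * u ^ i * v ^ j) k"]) (simp add: poly_monom)
  next
    case (add n g h)
    then obtain p q where "\<forall>w. g u v w = poly p w" "\<forall>w. h u v w = poly q w" by blast
    then show ?case by (intro exI [of _ "p + q"]) simp
  qed
  then show ?thesis using that by blast
qed

lemma homogeneous_coefficients:
  assumes "homogeneous n g"
  obtains B where "\<And>u v w. g u v w = (\<Sum>i\<le>n. \<Sum>j\<le>n - i. B i j * u ^ i * v ^ (n - i - j) * w ^ j)"
proof -
  have "\<exists>B. \<forall>u v w. g u v w = (\<Sum>i\<le>n. \<Sum>j\<le>n - i. B i j * u ^ i * v ^ (n - i - j) * w ^ j)" using assms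
  proof induction
    case (monomial i j k c)
    define B where "B a b = (if a = i then if b = k then c else 0 else 0)" for a b
    have "(\<Sum>a\<le>i + j + k. \<Sum>b\<le>i + j + k - a. B a b * u ^ a * v ^ (i + j + k - a - b) * w ^ b) =
      c * u ^ i * v ^ j * w ^ k" for u v w
    proof -
      have "(\<Sum>b\<le>i + j + k - a. B a b * u ^ a * v ^ (i + j + k - a - b) * w ^ b) =
         (if a = i then c * u ^ i * v ^ j * w ^ k else 0)" for a
      proof (cases "a = i")
        case True
        then have "(\<Sum>b\<le>i + j + k - a. B a b * u ^ a * v ^ (i + j + k - a - b) * w ^ b) =
          (\<Sum>b\<le>j + k. if b = k then c * u ^ i * v ^ (j + k - b) * w ^ b else 0)"
          by (intro sum.cong) (auto simp: B_def)
        then show ?thesis using True by simp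
      qed (simp add: B_def)
      then show ?thesis by simp
    qed
    then show ?case by (intro exI [of _ B]) simp
  next
    case (add n g h)
    then obtain B C where "\<forall>u v w. g u v w = (\<Sum>i\<le>n. \<Sum>j\<le>n - i. B i j * u ^ i * v ^ (n - i - j) * w ^ j)"
      "\<forall>u v w. h u v w = (\<Sum>i\<le>n. \<Sum>j\<le>n - i. C i j * u ^ i * v ^ (n - i - j) * w ^ j)" by blast
    then show ?case by (intro exI [of _ "\<lambda>i j. B i j + C i j"]) (simp add: distrib_right sum.distrib)
  qed
  then show ?thesis using that by blast
qed

text \<open>For fixed \<open>P\<close> only the moment depends on \<open>Q\<close>. Moving
  \<open>Q\<close> orthogonally to \<open>P\<close> changes it by
  \<open>2 * \<i> * t * norm P\<close>, so an open set of positions already yields infinitely many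
  moments, at which two polynomials in the third argument agree.\<close>

lemma homogeneous_unique:
  assumes g: "homogeneous n g" and h: "homogeneous n h" and U: "open U" "U \<noteq> {}"
    and eq: "\<And>Q P. Q \<in> U \<Longrightarrow> g P (cnj P) (Q * cnj P - cnj Q * P) = h P (cnj P) (Q * cnj P - cnj Q * P)"
  shows "g P (cnj P) (Q * cnj P - cnj Q * P) = h P (cnj P) (Q * cnj P - cnj Q * P)"
proof (cases "P = 0")
  case True
  then show ?thesis using eq [of _ P] U(2) by auto
next
  case False
  obtain p where p: "\<And>w. g P (cnj P) w = poly p w" by (rule homogeneous_poly [OF g]) (rule that)
  obtain q where q: "\<And>w. h P (cnj P) w = poly q w" by (rule homogeneous_poly [OF h]) (rule that)
  obtain Q0 where "Q0 \<in> U" using U(2) by blast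
  then obtain r where r: "r > 0" "ball Q0 r \<subseteq> U" using U(1) openE by blast
  define N where "N Q = Q * cnj P - cnj Q * P" for Q
  define \<phi> where "\<phi> t = Q0 + of_real t * \<i> * sgn P" for t
  have \<phi>: "N (\<phi> t) = N Q0 + 2 * \<i> * of_real (t * norm P)" for t
  proof -
    have 1: "sgn P * cnj P = of_real (norm P)"
      using False by (simp add: sgn_eq complex_norm_square [symmetric] power2_eq_square)
    then have "cnj (sgn P * cnj P) = of_real (norm P)" by simp
    then have 2: "cnj (sgn P) * P = of_real (norm P)" by simp
    have "N (\<phi> t) = N Q0 + of_real t * \<i> * (sgn P * cnj P) + of_real t * \<i> * (cnj (sgn P) * P)"
      by (simp add: N_def \<phi>_def algebra_simps)
    then show ?thesis unfolding 1 2 by simp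
  qed
  have "p = q"
  proof (rule poly_eqI_infinite)
    show "infinite ((\<lambda>t. N (\<phi> t)) ` {0<..<r})"
      using False r(1) by (subst finite_image_iff) (auto simp: inj_on_def \<phi>)
    fix w assume "w \<in> (\<lambda>t. N (\<phi> t)) ` {0<..<r}"
    then obtain t where t: "0 < t" "t < r" "w = N (\<phi> t)" by auto
    have "dist Q0 (\<phi> t) < r" using t False by (simp add: \<phi>_def dist_norm norm_mult norm_sgn)
    then have "\<phi> t \<in> U" using r(2) by auto
    then show "poly p w = poly q w" using eq [of "\<phi> t" P] t(3) by (simp add: p [symmetric] q [symmetric] N_def)
  qed
  then show ?thesis using p q by metis
qed

text \<open>The vertical line through \<open>Q0\<close> serves as the axis from which the free
  motion carries the coefficients to nearby points.\<close>

lemma polynomial_integral_local: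
  fixes f :: "complex \<Rightarrow> complex \<Rightarrow> real"
  assumes coef: "\<And>Q P. Q \<in> \<Omega> \<Longrightarrow> f Q P = (\<Sum>i\<le>n. a i Q * Re P ^ (n - i) * Im P ^ i)"
    and free: "\<And>Q P. closed_segment Q (Q + P) \<subseteq> \<Omega> \<Longrightarrow> f (Q + P) P = f Q P"
    and \<Omega>: "open \<Omega>" "Q0 \<in> \<Omega>"
  obtains g r where "homogeneous n g" "r > 0" "ball Q0 r \<subseteq> \<Omega>"
    "\<And>Q P. Q \<in> ball Q0 r \<Longrightarrow> of_real (f Q P) = g P (cnj P) (Q * cnj P - cnj Q * P)"
proof -
  obtain R where R: "R > 0" "ball Q0 R \<subseteq> \<Omega>" using \<Omega> openE by blast
  \<comment> \<open>A square with half side \<open>R / 2\<close> fits into the disc of radius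
    \<open>R\<close>.\<close>
  define r where "r = R / 2"
  have r: "r > 0" using R by (simp add: r_def)
  define b where "b i x y = a i (Q0 + Complex x y)" for i x y
  have inR: "Q0 + Complex x y \<in> ball Q0 R" if "\<bar>x\<bar> < r" "\<bar>y\<bar> < r" for x y
    using that cmod_le [of "Complex x y"] by (simp add: dist_norm r_def)
  have "(\<Sum>i\<le>n. b i x y * ((y - c) / x) ^ i) = (\<Sum>i\<le>n. b i 0 c * ((y - c) / x) ^ i)"
    if x: "x \<noteq> 0" "\<bar>x\<bar> < r" and y: "\<bar>y\<bar> < r" and c: "\<bar>c\<bar> < r" for x y c
  proof -
    define Q where "Q = Q0 + Complex 0 c"
    define P where "P = Complex x (y - c)"
    have QP: "Q + P = Q0 + Complex x y" by (simp add: Q_def P_def complex_eq_iff)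
    have m: "Q \<in> ball Q0 R" "Q + P \<in> ball Q0 R" unfolding QP unfolding Q_def using inR x y c r by auto
    then have "closed_segment Q (Q + P) \<subseteq> \<Omega>" using R(2) closed_segment_subset [OF _ _ convex_ball] by blast
    then have eq: "f (Q + P) P = f Q P" by (rule free)
    have fx: "f Q' P = x ^ n * (\<Sum>i\<le>n. a i Q' * ((y - c) / x) ^ i)" if "Q' \<in> \<Omega>" for Q'
      unfolding coef [OF that] sum_distrib_left using x(1)
      by (intro sum.cong) (auto simp: P_def power_diff power_divide)
    have "x ^ n * (\<Sum>i\<le>n. a i (Q + P) * ((y - c) / x) ^ i) = x ^ n * (\<Sum>i\<le>n. a i Q * ((y - c) / x) ^ i)"
      using eq m R(2) fx by (metis subsetD)
    then show ?thesis using x(1) unfolding QP by (simp add: b_def Q_def)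
  qed
  then obtain C where C: "\<And>x y P1 P2. \<bar>x\<bar> < r \<Longrightarrow> \<bar>y\<bar> < r \<Longrightarrow>
    (\<Sum>i\<le>n. b i x y * P1 ^ (n - i) * P2 ^ i) =
    (\<Sum>i\<le>n. \<Sum>j\<le>n - i. C i j * (y * P1 - x * P2) ^ j * P2 ^ i * P1 ^ (n - i - j))"
    by (rule line_integral_coeffs [where a = b and n = n, OF _ r]) (assumption | rule that)+
  \<comment> \<open>Linear forms in \<open>P\<close>, \<open>cnj P\<close> and the moment that
    return the real part and the imaginary part of \<open>P\<close> and the moment
    \<open>Im ((Q - Q0) * cnj P)\<close> about \<open>Q0\<close>.\<close>
  define lx where "lx = (\<lambda>u v w :: complex. (1 / 2) * u + (1 / 2) * v + 0 * w)"
  define ly where "ly = (\<lambda>u v w :: complex. (- \<i> / 2) * u + (\<i> / 2) * v + 0 * w)"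
  define lm where "lm = (\<lambda>u v w. (- \<i> / 2 * cnj Q0) * u + (\<i> / 2 * Q0) * v + (- \<i> / 2) * w)"
  define g where "g = (\<lambda>u v w. \<Sum>i\<le>n. \<Sum>j\<le>n - i. of_real (C i j) * lm u v w ^ j * ly u v w ^ i * lx u v w ^ (n - i - j))"
  have "homogeneous n g"
    unfolding g_def
  proof (intro homogeneous_sum)
    fix i j assume i: "i \<in> {..n}" "j \<in> {..n - i}"
    have "homogeneous (0 + 1 * j + 1 * i + 1 * (n - i - j))
      (\<lambda>u v w. of_real (C i j) * lm u v w ^ j * ly u v w ^ i * lx u v w ^ (n - i - j))"
      unfolding lm_def lx_def ly_def
      by (intro homogeneous_mult homogeneous_power homogeneous_linear homogeneous_const)
    moreover have "0 + 1 * j + 1 * i + 1 * (n - i - j) = n" using i by simp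
    ultimately show "homogeneous n (\<lambda>u v w. of_real (C i j) * lm u v w ^ j * ly u v w ^ i * lx u v w ^ (n - i - j))" by simp
  qed
  then show ?thesis
  proof (rule that [OF _ r])
    show "ball Q0 r \<subseteq> \<Omega>" using R by (auto simp: r_def)
    fix Q P assume Q: "Q \<in> ball Q0 r"
    define x where "x = Re (Q - Q0)"
    define y where "y = Im (Q - Q0)"
    have xy: "\<bar>x\<bar> < r" "\<bar>y\<bar> < r" "Q = Q0 + Complex x y"
      using Q abs_Re_le_cmod [of "Q - Q0"] abs_Im_le_cmod [of "Q - Q0"]
      by (auto simp: x_def y_def dist_norm norm_minus_commute complex_eq_iff)
    have "Q \<in> \<Omega>" using xy inR R(2) by auto
    then have "f Q P = (\<Sum>i\<le>n. b i x y * Re P ^ (n - i) * Im P ^ i)" using coef xy(3) by (simp add: b_def)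
    also have "\<dots> = (\<Sum>i\<le>n. \<Sum>j\<le>n - i. C i j * (y * Re P - x * Im P) ^ j * Im P ^ i * Re P ^ (n - i - j))"
      using C xy(1,2) by simp
    finally have "of_real (f Q P) = (\<Sum>i\<le>n. \<Sum>j\<le>n - i. of_real (C i j) * of_real (y * Re P - x * Im P) ^ j * of_real (Im P) ^ i * (of_real (Re P) :: complex) ^ (n - i - j))"
      by simp
    moreover have "lx P (cnj P) w = of_real (Re P)" "ly P (cnj P) w = of_real (Im P)" for w
      by (simp_all add: lx_def ly_def complex_eq_iff)
    moreover have "lm P (cnj P) (Q * cnj P - cnj Q * P) = of_real (y * Re P - x * Im P)"
      unfolding xy(3) by (simp add: lm_def complex_eq_iff field_simps)
    ultimately show "of_real (f Q P) = g P (cnj P) (Q * cnj P - cnj Q * P)" unfolding g_def by simp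
  qed
qed

text \<open>Local expansions that share an open set of positions define the same function by
  \<open>homogeneous_unique\<close>, so the expansion at one point propagates through the connected
  domain.\<close>

lemma polynomial_integral_global:
  fixes f :: "complex \<Rightarrow> complex \<Rightarrow> real"
  assumes coef: "\<And>Q P. Q \<in> \<Omega> \<Longrightarrow> f Q P = (\<Sum>i\<le>n. a i Q * Re P ^ (n - i) * Im P ^ i)"
    and free: "\<And>Q P. closed_segment Q (Q + P) \<subseteq> \<Omega> \<Longrightarrow> f (Q + P) P = f Q P"
    and \<Omega>: "open \<Omega>" "connected \<Omega>" "\<Omega> \<noteq> {}"
  obtains g where "homogeneous n g"
    "\<And>Q P. Q \<in> \<Omega> \<Longrightarrow> of_real (f Q P) = g P (cnj P) (Q * cnj P - cnj Q * P)"
proof -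
  obtain Q0 where Q0: "Q0 \<in> \<Omega>" using \<Omega>(3) by blast
  define G where "G g Q r \<longleftrightarrow> r > 0 \<and> ball Q r \<subseteq> \<Omega> \<and>
    (\<forall>Q'\<in>ball Q r. \<forall>P. complex_of_real (f Q' P) = g P (cnj P) (Q' * cnj P - cnj Q' * P))" for g :: "complex \<Rightarrow> complex \<Rightarrow> complex \<Rightarrow> complex" and Q r
  have loc: "\<exists>g r. homogeneous n g \<and> G g Q r" if "Q \<in> \<Omega>" for Q
  proof (rule polynomial_integral_local [OF coef free \<Omega>(1) that])
    fix g r
    assume g: "homogeneous n g" "r > 0" "ball Q r \<subseteq> \<Omega>"
      "\<And>Q' P. Q' \<in> ball Q r \<Longrightarrow> complex_of_real (f Q' P) = g P (cnj P) (Q' * cnj P - cnj Q' * P)"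
    then show ?thesis unfolding G_def by (intro exI [of _ g] exI [of _ r]) blast
  qed
  obtain g r0 where g: "homogeneous n g" "G g Q0 r0" using loc [OF Q0] by blast
  have near: "\<exists>s. G g' y s" if G: "G g' x t" and y: "y \<in> ball x t" for g' x y t
  proof -
    obtain s where s: "s > 0" "ball y s \<subseteq> ball x t" using y openE [OF open_ball] by metis
    then show ?thesis using G by (intro exI [of _ s]) (auto simp: G_def)
  qed
  have "\<exists>s. G g Q s" if Q: "Q \<in> \<Omega>" for Q
  proof (rule connected_induction_simple [OF \<Omega>(2) Q0 Q, where P = "\<lambda>Q. \<exists>s. G g Q s"])
    show "\<exists>s. G g Q0 s" using g(2) by blast
    fix x assume x: "x \<in> \<Omega>"
    obtain h t where h: "homogeneous n h" "G h x t" using loc [OF x] by blast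
    show "\<exists>T. openin (top_of_set \<Omega>) T \<and> x \<in> T \<and> (\<forall>y\<in>T. \<forall>z\<in>T. (\<exists>s. G g y s) \<longrightarrow> (\<exists>s. G g z s))"
    proof (intro exI [of _ "ball x t"] conjI ballI impI)
      show "openin (top_of_set \<Omega>) (ball x t)" using h(2) \<Omega>(1) by (auto simp: G_def openin_open_eq)
      show "x \<in> ball x t" using h(2) by (simp add: G_def)
      fix y z assume yz: "y \<in> ball x t" "z \<in> ball x t" and "\<exists>s. G g y s"
      then obtain s where s: "G g y s" by blast
      obtain s' where s': "G h y s'" using near [OF h(2) yz(1)] by blast
      have gh: "g P (cnj P) (Q * cnj P - cnj Q * P) = h P (cnj P) (Q * cnj P - cnj Q * P)" for P Q
      proof (rule homogeneous_unique [OF g(1) h(1)])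
        show "open (ball y (min s s'))" by simp
        have "0 < min s s'" using s s' unfolding G_def by linarith
        then show "ball y (min s s') \<noteq> {}" by (simp only: ball_eq_empty not_le not_False_eq_True)
        show "g P (cnj P) (Q * cnj P - cnj Q * P) = h P (cnj P) (Q * cnj P - cnj Q * P)"
          if "Q \<in> ball y (min s s')" for Q P
          using s s' that unfolding G_def by (metis dist_commute mem_ball min_less_iff_conj)
      qed
      obtain s'' where "G h z s''" using near [OF h(2) yz(2)] by blast
      then show "\<exists>s. G g z s" unfolding G_def gh by blast
    qed
  qed
  then show ?thesis by (intro that [OF g(1)]) (force simp: G_def)
qed

text \<open>Real values make the coefficients symmetric under complex conjugation; in an expansion of least
  degree the coefficients free of \<open>P\<close> therefore cannot all vanish, or else the factor
  \<open>P * cnj P = 1\<close> could be split off.\<close>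

lemma reduced_representation:
  fixes f :: "complex \<Rightarrow> complex \<Rightarrow> real"
  assumes g: "homogeneous n g"
    and f: "\<And>Q P. Q \<in> \<Omega> \<Longrightarrow> of_real (f Q P) = g P (cnj P) (Q * cnj P - cnj Q * P)"
    and nc: "\<And>c. \<exists>Q\<in>\<Omega>. \<exists>P. norm P = 1 \<and> f Q P \<noteq> c"
  obtains m B where "m > 0" "\<exists>j\<le>m. B 0 j \<noteq> 0"
    "\<And>Q P. Q \<in> \<Omega> \<Longrightarrow> norm P = 1 \<Longrightarrow>
      of_real (f Q P) = (\<Sum>i\<le>m. \<Sum>j\<le>m - i. B i j * P ^ i * cnj P ^ (m - i - j) * (Q * cnj P - cnj Q * P) ^ j)"
proof -
  define D where "D m = Sigma {..m} (\<lambda>i. {..m - i})" for m :: nat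
  have D: "(i, j) \<in> D m \<longleftrightarrow> i + j \<le> m" for i j m by (auto simp: D_def)
  have finD: "finite (D m)" for m by (simp add: D_def)
  define F where "F m B Q P = (\<Sum>(i, j)\<in>D m. B i j * P ^ i * cnj P ^ (m - i - j) * (Q * cnj P - cnj Q * P) ^ j)"
    for m and B :: "nat \<Rightarrow> nat \<Rightarrow> complex" and Q P
  have F: "F m B Q P = (\<Sum>i\<le>m. \<Sum>j\<le>m - i. B i j * P ^ i * cnj P ^ (m - i - j) * (Q * cnj P - cnj Q * P) ^ j)"
    for m B Q P unfolding F_def D_def by (subst sum.Sigma) auto
  define R where "R m B \<longleftrightarrow> (\<forall>Q\<in>\<Omega>. \<forall>P. norm P = 1 \<longrightarrow> of_real (f Q P) = F m B Q P)" for m B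
  obtain B0 where "\<And>u v w. g u v w = (\<Sum>i\<le>n. \<Sum>j\<le>n - i. B0 i j * u ^ i * v ^ (n - i - j) * w ^ j)"
    by (rule homogeneous_coefficients [OF g]) (rule that)
  then have "R n B0" unfolding R_def F using f by simp
  then have "\<exists>m. \<exists>B. R m B" by blast
  then obtain m where "\<exists>B. R m B" and least: "\<And>k. k < m \<Longrightarrow> \<not> (\<exists>B. R k B)"
    using exists_least_iff [of "\<lambda>m. \<exists>B. R m B"] by blast
  then obtain B where B: "R m B" by blast
  \<comment> \<open>The mean of the expansion and its conjugate. Conjugation exchanges
    \<open>P\<close> and \<open>cnj P\<close> and changes the sign of the moment; as
    \<open>f\<close> is real, the mean represents it as well.\<close>
  define C where "C i j = (B i j + (-1) ^ j * cnj (B (m - i - j) j)) / 2" for i j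
  have sym: "F m (\<lambda>i j. (-1) ^ j * cnj (B (m - i - j) j)) Q P = cnj (F m B Q P)" for Q P
  proof -
    have N: "cnj (Q * cnj P - cnj Q * P) = - (Q * cnj P - cnj Q * P)" by simp
    have "cnj (F m B Q P) = (\<Sum>(i, j)\<in>D m. cnj (B i j) * cnj P ^ i * P ^ (m - i - j) * (- (Q * cnj P - cnj Q * P)) ^ j)"
      unfolding F_def cnj_sum by (intro sum.cong) (auto simp del: minus_diff_eq complex_cnj_diff simp add: N)
    also have "\<dots> = (\<Sum>(i, j)\<in>D m. cnj (B i j) * cnj P ^ i * P ^ (m - i - j) * ((-1) ^ j * (Q * cnj P - cnj Q * P) ^ j))"
      by (simp only: power_minus [of "Q * cnj P - cnj Q * P"])
    also have "\<dots> = F m (\<lambda>i j. (-1) ^ j * cnj (B (m - i - j) j)) Q P"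
      unfolding F_def
      by (rule sum.reindex_bij_witness [where i = "\<lambda>(i, j). (m - i - j, j)" and j = "\<lambda>(i, j). (m - i - j, j)"])
        (auto simp: D mult_ac)
    finally show ?thesis by simp
  qed
  have RC: "R m C"
    unfolding R_def
  proof (intro ballI allI impI)
    fix Q P assume "Q \<in> \<Omega>" "norm (P :: complex) = 1"
    then have e: "of_real (f Q P) = F m B Q P" using B by (simp add: R_def)
    then have "cnj (F m B Q P) = F m B Q P" by (metis complex_cnj_complex_of_real)
    moreover have "F m C Q P = (F m B Q P + F m (\<lambda>i j. (-1) ^ j * cnj (B (m - i - j) j)) Q P) / 2"
      by (simp add: F_def C_def sum.distrib [symmetric] sum_divide_distrib split_def algebra_simps add_divide_distrib)
    ultimately show "of_real (f Q P) = F m C Q P" using e sym by simp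
  qed
  have "\<exists>j\<le>m. C 0 j \<noteq> 0"
  proof (rule ccontr)
    assume "\<not> ?thesis"
    then have z0: "C 0 j = 0" if "j \<le> m" for j using that by blast
    \<comment> \<open>By symmetry the terms free of \<open>cnj P\<close> vanish with those free of
      \<open>P\<close>, so every remaining term contains \<open>P * cnj P\<close>.\<close>
    have z1: "C (m - j) j = 0" if "j \<le> m" for j
    proof -
      have "C (m - j) j = (-1) ^ j * cnj (C 0 j)" using that by (simp add: C_def mult_ac distrib_left power_mult_distrib [symmetric] flip: power_add)
      then show ?thesis using z0 [OF that] by simp
    qed
    define E where "E = {(i, j). 1 \<le> i \<and> i + j + 1 \<le> m}"
    have FE: "F m C Q P = (\<Sum>(i, j)\<in>E. C i j * P ^ i * cnj P ^ (m - i - j) * (Q * cnj P - cnj Q * P) ^ j)" for Q P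
      unfolding F_def
    proof (rule sum.mono_neutral_right)
      show "E \<subseteq> D m" by (auto simp: E_def D)
      have "C i j = 0" if "(i, j) \<in> D m - E" for i j
      proof (cases "i = 0")
        case False
        then have "i = m - j" "j \<le> m" using that by (auto simp: D E_def)
        then show ?thesis using z1 by blast
      qed (use z0 that in \<open>auto simp: D\<close>)
      then show "\<forall>x\<in>D m - E. (case x of (i, j) \<Rightarrow> C i j * P ^ i * cnj P ^ (m - i - j) * (Q * cnj P - cnj Q * P) ^ j) = 0"
        by auto
    qed (rule finD)
    show False
    proof (cases "m < 2")
      case True
      then have "E = {}" by (auto simp: E_def)
      then have "f Q P = 0" if "Q \<in> \<Omega>" "norm P = 1" for Q P using RC that by (simp add: R_def FE)
      then show False using nc [of 0] by blast
    next
      case False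
      \<comment> \<open>Cancelling one factor \<open>P * cnj P = 1\<close> lowers the degree by 2,
        against the minimality of \<open>m\<close>.\<close>
      define k where "k = m - 2"
      have m: "m = k + 2" using False by (simp add: k_def)
      have "R k (\<lambda>i j. C (Suc i) j)"
        unfolding R_def
      proof (intro ballI allI impI)
        fix Q P assume Q: "Q \<in> \<Omega>" "norm (P :: complex) = 1"
        have P: "P * cnj P = 1" using Q(2) by (simp add: complex_norm_square [symmetric])
        have "of_real (f Q P) = (\<Sum>(i, j)\<in>E. C i j * P ^ i * cnj P ^ (m - i - j) * (Q * cnj P - cnj Q * P) ^ j)"
          using RC Q by (simp add: R_def FE)
        also have "\<dots> = F k (\<lambda>i j. C (Suc i) j) Q P"
          unfolding F_def
        proof (rule sum.reindex_bij_witness [where i = "\<lambda>(i, j). (Suc i, j)" and j = "\<lambda>(i, j). (i - 1, j)"])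
          fix x assume x: "x \<in> E"
          obtain i j where ij: "x = (i, j)" by (cases x)
          obtain i' where i': "i = Suc i'" "i' + j \<le> k" using x by (cases i) (auto simp: E_def ij m)
          have "m - i - j = Suc (k - i' - j)" using i' by (simp add: m)
          then have "C i j * P ^ i * cnj P ^ (m - i - j) = C (Suc i') j * P ^ i' * cnj P ^ (k - i' - j) * (P * cnj P)"
            using i' by (simp add: mult_ac)
          note e = this [unfolded P mult_1_right]
          show "(case case x of (i, j) \<Rightarrow> (i - 1, j) of (i, j) \<Rightarrow> C (Suc i) j * P ^ i * cnj P ^ (k - i - j) * (Q * cnj P - cnj Q * P) ^ j) =
            (case x of (i, j) \<Rightarrow> C i j * P ^ i * cnj P ^ (m - i - j) * (Q * cnj P - cnj Q * P) ^ j)"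
            unfolding ij prod.case i'(1) diff_Suc_1 e [unfolded i'(1)] by (rule refl)
        qed (auto simp: E_def D m)
        finally show "of_real (f Q P) = F k (\<lambda>i j. C (Suc i) j) Q P" .
      qed
      then show False using least [of k] m by auto
    qed
  qed
  moreover have "m > 0"
  proof (rule ccontr)
    assume "\<not> m > 0"
    then have "f Q P = Re (C 0 0)" if "Q \<in> \<Omega>" "norm P = 1" for Q P
      using RC that unfolding R_def F by (metis (no_types, lifting) Re_complex_of_real add_0 atMost_0 diff_is_0_eq' finite.emptyI insert_absorb insert_not_empty le_zero_eq mult.right_neutral not_gr_zero power_0 sum.empty sum.insert zero_diff add.right_neutral)
    then show False using nc [of "Re (C 0 0)"] by blast
  qed
  ultimately show ?thesis using RC unfolding R_def F by (intro that [of m C]) auto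
qed

subsection \<open>Reflection at the boundary\<close>

text \<open>Near \<open>\<sigma> 0\<close> the frontier is a graph over its tangent and misses both vertical cones, so each cone
  lies in \<open>\<Omega>\<close> or in its complement. Both cannot lie in the complement: the vertical line through a
  nearby point of \<open>\<Omega>\<close> meets the frontier at most once.\<close>

lemma frontier_one_sided_cone:
  fixes \<Omega> :: "complex set"
  assumes \<Omega>: "open \<Omega>" and \<sigma>: "smooth_arc (frontier \<Omega>) \<sigma> \<sigma>' \<delta>"
  obtains e r where "e = 1 \<or> e = (-1 :: complex)" "r > 0"
    "\<And>w. norm w < r \<Longrightarrow> \<bar>Re w\<bar> < Im w \<Longrightarrow> \<sigma> 0 - e * \<sigma>' 0 * w \<in> \<Omega>"
proof -
  note sd = smooth_arcD [OF \<sigma>]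
  define S where "S = frontier \<Omega>"
  define T where "T = \<sigma>' 0"
  \<comment> \<open>Coordinates with origin \<open>\<sigma> 0\<close> in which the tangent is the
    real axis.\<close>
  define W where "W z = (z - \<sigma> 0) * cnj T" for z
  have z0: "0 \<in> {-\<delta><..<\<delta>}" using sd(1) by simp
  have T1: "T * cnj T = 1" using sd(4) [OF z0] by (simp add: T_def complex_norm_square [symmetric])
  have nW: "norm (W z) = norm (z - \<sigma> 0)" for z using sd(4) [OF z0] by (simp add: W_def norm_mult T_def)
  have WT: "W (\<sigma> 0 + T * w) = w" for w using T1 by (simp add: W_def mult_ac)
  have TW: "\<sigma> 0 + T * W z = z" for z
  proof -
    have "T * W z = (z - \<sigma> 0) * (T * cnj T)" by (simp add: W_def mult_ac)
    then show ?thesis using T1 by simp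
  qed
  have dW: "((\<lambda>u. W (\<sigma> u)) has_vector_derivative \<sigma>' u * cnj T) (at u)" if "u \<in> {-\<delta><..<\<delta>}" for u
    unfolding W_def using sd(3) [OF that] by (auto intro!: derivative_eq_intros)
  have dRe: "((\<lambda>u. Re (W (\<sigma> u))) has_real_derivative Re (\<sigma>' u * cnj T)) (at u)" if "u \<in> {-\<delta><..<\<delta>}" for u
    using bounded_linear.has_vector_derivative [OF bounded_linear_Re dW [OF that]] by (simp add: has_real_derivative_iff_has_vector_derivative)
  have c0: "isCont (\<lambda>u. Re (\<sigma>' u * cnj T)) 0"
  proof -
    have "isCont \<sigma>' 0" using sd(2) z0 by (auto simp: continuous_on_eq_continuous_at)
    then show ?thesis unfolding isCont_def by (intro tendsto_intros)
  qed
  have p0: "Re (\<sigma>' 0 * cnj T) \<in> {0<..}" using T1 by (simp add: T_def)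
  obtain e1 where e1: "e1 > 0" "\<And>u. dist u 0 < e1 \<Longrightarrow> Re (\<sigma>' u * cnj T) \<in> {0<..}"
    using isCont_open_nbhd [OF c0 open_greaterThan p0] by metis
  have "((\<lambda>u. W (\<sigma> u)) has_derivative (\<lambda>x. x *\<^sub>R 1)) (at 0)"
    using dW [OF z0] T1 by (simp add: has_vector_derivative_def T_def)
  \<comment> \<open>With tolerance \<open>1 / 4\<close>, the real part of
    \<open>W (\<sigma> u)\<close> is at least \<open>3 / 4 * \<bar>u\<bar>\<close> in modulus and
    the imaginary part at most \<open>1 / 4 * \<bar>u\<bar>\<close>; this keeps the arc out of both
    cones.\<close>
  then obtain e2 where e2: "e2 > 0" "\<And>u. norm (u - 0) < e2 \<Longrightarrow> norm (W (\<sigma> u) - W (\<sigma> 0) - (u - 0) *\<^sub>R 1) \<le> (1 / 4) * norm (u - 0)"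
    unfolding has_derivative_at_alt by (metis zero_less_divide_1_iff zero_less_numeral)
  define \<epsilon> where "\<epsilon> = min \<delta> (min e1 e2)"
  have \<epsilon>: "\<epsilon> > 0" "\<epsilon> \<le> \<delta>" "\<epsilon> \<le> e1" "\<epsilon> \<le> e2" using sd(1) e1 e2 by (auto simp: \<epsilon>_def)
  obtain V where V: "open V" "\<sigma> 0 \<in> V" "S \<inter> V \<subseteq> \<sigma> ` {u\<in>{-\<delta><..<\<delta>}. \<bar>u - 0\<bar> < \<epsilon>}"
    using sd(6) [OF z0 \<epsilon>(1)] unfolding S_def by blast
  obtain \<rho> where \<rho>: "\<rho> > 0" "ball (\<sigma> 0) \<rho> \<subseteq> V" using V openE by blast
  have near: "\<exists>u. \<bar>u\<bar> < \<epsilon> \<and> z = \<sigma> u" if "z \<in> S" "norm (z - \<sigma> 0) < \<rho>" for z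
  proof -
    have "z \<in> S \<inter> V" using that \<rho>(2) by (auto simp: dist_norm norm_minus_commute)
    then show ?thesis using V(3) by auto
  qed
  have slope: "\<bar>Im (W z)\<bar> \<le> \<bar>Re (W z)\<bar>" if z: "z \<in> S" "norm (z - \<sigma> 0) < \<rho>" for z
  proof -
    obtain u where u: "\<bar>u\<bar> < \<epsilon>" "z = \<sigma> u" using near [OF z] by blast
    have "norm (W z - of_real u) \<le> 1 / 4 * \<bar>u\<bar>" using e2(2) [of u] u \<epsilon> by (simp add: W_def scaleR_conv_of_real)
    moreover have "\<bar>Re (W z - of_real u)\<bar> \<le> norm (W z - of_real u)" "\<bar>Im (W z - of_real u)\<bar> \<le> norm (W z - of_real u)"
      by (rule abs_Re_le_cmod abs_Im_le_cmod)+
    ultimately have "\<bar>Re (W z) - u\<bar> \<le> 1 / 4 * \<bar>u\<bar>" "\<bar>Im (W z)\<bar> \<le> 1 / 4 * \<bar>u\<bar>" by simp_all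
    then show ?thesis by linarith
  qed
  have mono: "Re (W (\<sigma> u)) < Re (W (\<sigma> v))" if "\<bar>u\<bar> < \<epsilon>" "\<bar>v\<bar> < \<epsilon>" "u < v" for u v
  proof (rule DERIV_pos_imp_increasing [OF that(3)])
    fix x assume "u \<le> x" "x \<le> v"
    then have "\<bar>x\<bar> < \<epsilon>" using that by linarith
    then have "x \<in> {-\<delta><..<\<delta>}" "Re (\<sigma>' x * cnj T) > 0" using \<epsilon> e1(2) [of x] by auto
    then show "\<exists>y. ((\<lambda>u. Re (W (\<sigma> u))) has_real_derivative y) (at x) \<and> 0 < y" using dRe by blast
  qed
  have graph: "z = z'" if z: "z \<in> S" "norm (z - \<sigma> 0) < \<rho>" "z' \<in> S" "norm (z' - \<sigma> 0) < \<rho>" "Re (W z) = Re (W z')" for z z'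
  proof -
    obtain u v where uv: "\<bar>u\<bar> < \<epsilon>" "z = \<sigma> u" "\<bar>v\<bar> < \<epsilon>" "z' = \<sigma> v" using near z by metis
    then have "u = v" using mono [of u v] mono [of v u] z(5) by (metis less_irrefl linorder_less_linear)
    then show ?thesis using uv by simp
  qed
  have alt: "X \<subseteq> \<Omega> \<or> X \<inter> \<Omega> = {}" if "connected X" "X \<inter> S = {}" for X
    using connected_Int_frontier [of X \<Omega>] that unfolding S_def by blast
  \<comment> \<open>The upper cone for \<open>s = 1\<close>, the lower one for
    \<open>s = -1\<close>.\<close>
  define K where "K s = (\<lambda>w. \<sigma> 0 + T * w) ` (ball 0 \<rho> \<inter> {w. \<bar>Re w\<bar> < s * Im w})" for s :: real
  have K: "K s \<subseteq> \<Omega> \<or> K s \<inter> \<Omega> = {}" if "s = 1 \<or> s = -1" for s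
  proof (rule alt)
    have "{w. \<bar>Re w\<bar> < s * Im w} = {w. Re w - s * Im w < 0} \<inter> {w. - Re w - s * Im w < 0}" by auto
    also have "convex \<dots>"
    proof (rule convex_Int)
      have "{w. Re w - s * Im w < 0} = {w. inner (Complex 1 (- s)) w < 0}"
        "{w. - Re w - s * Im w < 0} = {w. inner (Complex (- 1) (- s)) w < 0}" by (auto simp: inner_complex_def)
      then show "convex {w. Re w - s * Im w < 0}" "convex {w. - Re w - s * Im w < 0}" by (simp_all add: convex_halfspace_lt)
    qed
    finally have "convex (ball 0 \<rho> \<inter> {w. \<bar>Re w\<bar> < s * Im w})" by (intro convex_Int convex_ball)
    then show "connected (K s)" unfolding K_def
      by (intro connected_continuous_image continuous_intros convex_connected)
    show "K s \<inter> S = {}"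
    proof -
      have False if w: "norm w < \<rho>" "\<bar>Re w\<bar> < s * Im w" "\<sigma> 0 + T * w \<in> S" for w
      proof -
        have "norm (\<sigma> 0 + T * w - \<sigma> 0) < \<rho>" using w(1) sd(4) [OF z0] by (simp add: norm_mult T_def)
        then have "\<bar>Im w\<bar> \<le> \<bar>Re w\<bar>" using slope [OF w(3)] by (simp add: WT)
        then show False using w(2) \<open>s = 1 \<or> s = -1\<close> by auto
      qed
      then show ?thesis by (auto simp: K_def)
    qed
  qed
  have "K 1 \<subseteq> \<Omega> \<or> K (-1) \<subseteq> \<Omega>"
  proof (rule ccontr)
    assume "\<not> ?thesis"
    then have out: "K 1 \<inter> \<Omega> = {}" "K (-1) \<inter> \<Omega> = {}" using K by blast+
    have "\<sigma> 0 \<in> closure \<Omega>" using sd(5) [OF z0] by (simp add: frontier_def)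
    then obtain Q where Q: "Q \<in> \<Omega>" "dist Q (\<sigma> 0) < \<rho> / 4" using \<rho>(1) unfolding closure_approachable by (meson zero_less_divide_iff zero_less_numeral)
    define x y where "x = Re (W Q)" and "y = Im (W Q)"
    have "norm (W Q) < \<rho> / 4" using Q(2) nW by (simp add: dist_norm)
    then have xy: "\<bar>x\<bar> < \<rho> / 4" "\<bar>y\<bar> < \<rho> / 4" using abs_Re_le_cmod [of "W Q"] abs_Im_le_cmod [of "W Q"] by (auto simp: x_def y_def)
    have Qxy: "Q = \<sigma> 0 + T * Complex x y" using TW [of Q] by (simp add: x_def y_def)
    \<comment> \<open>A vertical segment from \<open>Q\<close> into either cone leaves \<Omega> and
      so crosses the frontier. The crossings above and below have the same real part, hence coincide
      by \<open>graph\<close>, and then both are \<open>Q\<close>, which is impossible in an open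
      set.\<close>
    have hit: "\<exists>t\<in>closed_segment y (s * (\<rho> / 2)). \<sigma> 0 + T * Complex x t \<in> S" if s: "s = 1 \<or> s = -1" for s
    proof -
      define X where "X = (\<lambda>t. \<sigma> 0 + T * Complex x t) ` closed_segment y (s * (\<rho> / 2))"
      have "continuous_on (closed_segment y (s * (\<rho> / 2))) (\<lambda>t. \<sigma> 0 + T * Complex x t)"
        unfolding Complex_eq by (intro continuous_intros)
      then have "connected X" unfolding X_def by (rule connected_continuous_image) simp
      moreover have "Q \<in> X" unfolding X_def Qxy by auto
      then have "X \<inter> \<Omega> \<noteq> {}" using Q by blast
      moreover have "X - \<Omega> \<noteq> {}"
      proof -
        have "norm (Complex x (s * (\<rho> / 2))) \<le> \<bar>x\<bar> + \<bar>s * (\<rho> / 2)\<bar>" using cmod_le [of "Complex x (s * (\<rho> / 2))"] by simp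
        also have "\<dots> < \<rho>" using xy s \<rho>(1) by auto
        finally have "\<sigma> 0 + T * Complex x (s * (\<rho> / 2)) \<in> K s" using xy s \<rho>(1) by (auto simp: K_def)
        then have "\<sigma> 0 + T * Complex x (s * (\<rho> / 2)) \<notin> \<Omega>" using out s by blast
        moreover have "\<sigma> 0 + T * Complex x (s * (\<rho> / 2)) \<in> X" unfolding X_def by auto
        ultimately show ?thesis by blast
      qed
      ultimately have "X \<inter> S \<noteq> {}" unfolding S_def by (rule connected_Int_frontier)
      then show ?thesis by (auto simp: X_def)
    qed
    obtain t1 where t1: "t1 \<in> closed_segment y (1 * (\<rho> / 2))" "\<sigma> 0 + T * Complex x t1 \<in> S" using hit [of 1] by blast
    obtain t2 where t2: "t2 \<in> closed_segment y (- 1 * (\<rho> / 2))" "\<sigma> 0 + T * Complex x t2 \<in> S" using hit [of "-1"] by blast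
    have o: "y \<le> t1" "t1 \<le> \<rho> / 2" "- \<rho> / 2 \<le> t2" "t2 \<le> y" using t1(1) t2(1) xy by (auto simp: closed_segment_eq_real_ivl split: if_splits)
    have n: "norm (\<sigma> 0 + T * Complex x t - \<sigma> 0) < \<rho>" if "\<bar>t\<bar> \<le> \<rho> / 2" for t
    proof -
      have "norm (Complex x t) \<le> \<bar>x\<bar> + \<bar>t\<bar>" using cmod_le [of "Complex x t"] by simp
      then show ?thesis using that xy sd(4) [OF z0] \<rho>(1) by (simp add: norm_mult T_def)
    qed
    have "\<sigma> 0 + T * Complex x t1 = \<sigma> 0 + T * Complex x t2"
      by (rule graph [OF t1(2) n t2(2) n]) (use o xy in \<open>auto simp: WT\<close>)
    then have "Complex x t1 = Complex x t2" by (metis WT)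
    then have "t1 = y" using o by simp
    then have "Q \<in> S" using t1(2) Qxy by simp
    then show False using Q(1) \<Omega> by (simp add: S_def frontier_def interior_open)
  qed
  then show ?thesis
  proof
    assume k: "K 1 \<subseteq> \<Omega>"
    show ?thesis
    proof (rule that [of "-1", OF _ \<rho>(1)])
      fix w assume "norm w < \<rho>" "\<bar>Re w\<bar> < Im w"
      then have "\<sigma> 0 + T * w \<in> K 1" by (auto simp: K_def)
      then show "\<sigma> 0 - (- 1) * \<sigma>' 0 * w \<in> \<Omega>" using k by (auto simp: T_def)
    qed simp
  next
    assume k: "K (-1) \<subseteq> \<Omega>"
    show ?thesis
    proof (rule that [of 1, OF _ \<rho>(1)])
      fix w assume "norm w < \<rho>" "\<bar>Re w\<bar> < Im w"
      then have "\<sigma> 0 + T * (- w) \<in> K (-1)" unfolding K_def by (intro imageI) auto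
      then show "\<sigma> 0 - 1 * \<sigma>' 0 * w \<in> \<Omega>" using k by (auto simp: T_def)
    qed simp
  qed
qed

lemma coeff_linear_power:
  fixes a b :: "'a::comm_ring_1"
  shows "coeff ([:a, b:] ^ j) 0 = a ^ j" "coeff ([:a, b:] ^ j) 1 = of_nat j * a ^ (j - 1) * b"
proof -
  show 0: "coeff ([:a, b:] ^ j) 0 = a ^ j" for j by (simp add: coeff_0_power)
  show "coeff ([:a, b:] ^ j) 1 = of_nat j * a ^ (j - 1) * b"
  proof (induction j)
    case (Suc j)
    have "coeff ([:a, b:] ^ Suc j) 1 = a * coeff ([:a, b:] ^ j) 1 + b * coeff ([:a, b:] ^ j) 0" by simp
    also have "\<dots> = of_nat (Suc j) * a ^ (Suc j - 1) * b"
      unfolding Suc 0 by (cases j) (simp_all add: algebra_simps)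
    finally show ?case .
  qed simp
qed

text \<open>On the velocities \<open>P = U * z\<close> with \<open>norm z = 1\<close> the expansion is \<open>z powi (-m)\<close> times a
  polynomial in \<open>z\<^sup>2\<close>; being real and invariant under \<open>z \<mapsto> cnj z\<close>, this polynomial has real
  coefficients, of which the two lowest are evaluated.\<close>

lemma reflection_real_coefficients:
  fixes B :: "nat \<Rightarrow> nat \<Rightarrow> complex" and a U :: complex and h :: "complex \<Rightarrow> real" and m :: nat
  defines "F \<equiv> \<lambda>P. \<Sum>i\<le>m. \<Sum>j\<le>m - i. B i j * P ^ i * cnj P ^ (m - i - j) * (a * cnj P - cnj a * P) ^ j"
  assumes m: "m > 0" and U: "norm U = 1"
    and real: "\<And>z. norm z = 1 \<Longrightarrow> \<bar>Re z\<bar> < Im z \<Longrightarrow> F (U * z) = of_real (h z) \<and> F (U * cnj z) = of_real (h z)"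
  shows "(\<Sum>j\<le>m. B 0 j * a ^ j) / U ^ m \<in> \<real>"
    "U\<^sup>2 * ((\<Sum>j\<le>m - 1. B 1 j * a ^ j) - cnj a * (\<Sum>j\<le>m. of_nat j * B 0 j * a ^ (j - 1))) / U ^ m \<in> \<real>"
proof -
  \<comment> \<open>Multiplying \<open>F P\<close> by \<open>P ^ m\<close> and using
    \<open>cnj P * P = 1\<close> leaves a polynomial in \<open>P ^ 2\<close>, since
    \<open>(a * cnj P - cnj a * P) * P = a - cnj a * P ^ 2\<close>. The rescaled \<open>q\<close>
    satisfies \<open>poly q (z ^ 2) = F (U * z) * z ^ m\<close>.\<close>
  define p where "p = (\<Sum>i\<le>m. \<Sum>j\<le>m - i. smult (B i j) (monom 1 i * [:a, - cnj a:] ^ j))"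
  define q where "q = smult (1 / U ^ m) (pcompose p [:0, U\<^sup>2:])"
  have F: "F P * P ^ m = poly p (P\<^sup>2)" if P: "norm P = 1" for P
  proof -
    have PP: "cnj P * P = 1" using P by (simp add: complex_norm_square [symmetric] mult.commute)
    have "B i j * P ^ i * cnj P ^ (m - i - j) * (a * cnj P - cnj a * P) ^ j * P ^ m =
      B i j * ((P\<^sup>2) ^ i * (a + - cnj a * P\<^sup>2) ^ j)" if ij: "i \<le> m" "j \<le> m - i" for i j
    proof -
      have mm: "P ^ m = P ^ i * P ^ (m - i - j) * P ^ j" using ij by (simp flip: power_add)
      have "(a * cnj P - cnj a * P) * P = a + - cnj a * P\<^sup>2"
      proof -
        have "(a * cnj P - cnj a * P) * P = a * (cnj P * P) - cnj a * P\<^sup>2" by (simp add: algebra_simps power2_eq_square)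
        then show ?thesis unfolding PP by simp
      qed
      moreover have "B i j * P ^ i * cnj P ^ (m - i - j) * (a * cnj P - cnj a * P) ^ j * P ^ m =
        B i j * ((P * P) ^ i * (cnj P * P) ^ (m - i - j) * ((a * cnj P - cnj a * P) * P) ^ j)"
        unfolding mm power_mult_distrib by (simp only: mult_ac)
      ultimately show ?thesis unfolding PP by (simp add: power2_eq_square)
    qed
    then have "F P * P ^ m = (\<Sum>i\<le>m. \<Sum>j\<le>m - i. B i j * ((P\<^sup>2) ^ i * (a + - cnj a * P\<^sup>2) ^ j))"
      unfolding F_def sum_distrib_right by (intro sum.cong) auto
    also have "\<dots> = poly p (P\<^sup>2)" by (simp add: p_def poly_sum poly_monom mult.commute)
    finally show ?thesis .
  qed
  have U0: "U \<noteq> 0" using U by auto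
  have q: "poly q (z\<^sup>2) = F (U * z) * z ^ m" if "norm z = 1" for z
  proof -
    have "poly q (z\<^sup>2) = poly p ((U * z)\<^sup>2) / U ^ m"
      by (simp add: q_def poly_pcompose power_mult_distrib mult.commute)
    also have "\<dots> = F (U * z) * (U * z) ^ m / U ^ m" using F [of "U * z"] that U by (simp add: norm_mult)
    finally show ?thesis using U0 by (simp add: power_mult_distrib)
  qed
  have "q = map_poly cnj q"
  proof (rule poly_eqI_infinite)
    \<comment> \<open>Directions in the cone of the hypothesis; their squares have angles between
      \<open>pi / 2\<close> and \<open>pi\<close> and are infinitely many.\<close>
    define Z where "Z = cis ` {pi / 4<..<pi / 2}"
    have Z: "norm z = 1" "\<bar>Re z\<bar> < Im z" if zZ: "z \<in> Z" for z
    proof -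
      obtain t where t: "pi / 4 < t" "t < pi / 2" "z = cis t" using zZ by (auto simp: Z_def)
      have "cos t < cos (pi / 4)" using t pi_gt_zero by (intro cos_monotone_0_pi) auto
      moreover have "sin (pi / 4) < sin t" using t pi_gt_zero by (intro sin_monotone_2pi) auto
      moreover have "cos t > 0" using t pi_gt_zero by (intro cos_gt_zero) auto
      ultimately show "norm z = 1" "\<bar>Re z\<bar> < Im z" using t(3) by (auto simp: sin_45 cos_45)
    qed
    have "inj_on (\<lambda>t. (cis t)\<^sup>2) {pi / 4<..<pi / 2}"
    proof (rule inj_onI)
      fix s t assume st: "s \<in> {pi / 4<..<pi / 2}" "t \<in> {pi / 4<..<pi / 2}" "(cis s)\<^sup>2 = (cis t)\<^sup>2"
      have "(cis x)\<^sup>2 = cis (2 * x)" for x by (simp add: power2_eq_square cis_mult)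
      then have "cis (2 * s) = cis (2 * t)" using st(3) by metis
      then have "cos (2 * s) = cos (2 * t)" by (metis cis.sel(1))
      then have "2 * s = 2 * t" by (rule cos_inj_pi [rotated 4]) (use st pi_gt_zero in auto)
      then show "s = t" by simp
    qed
    then show "infinite ((\<lambda>z. z\<^sup>2) ` Z)" unfolding Z_def image_image
      by (subst finite_image_iff) (use pi_gt_zero in auto)
    fix x assume "x \<in> (\<lambda>z. z\<^sup>2) ` Z"
    then obtain z where z: "z \<in> Z" "x = z\<^sup>2" by auto
    have "poly (map_poly cnj q) (z\<^sup>2) = cnj (poly q ((cnj z)\<^sup>2))"
      using poly_cnj [of q "(cnj z)\<^sup>2"] by simp
    also have "poly q ((cnj z)\<^sup>2) = of_real (h z) * cnj z ^ m"
      using q [of "cnj z"] real Z [OF z(1)] by simp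
    also have "cnj \<dots> = of_real (h z) * z ^ m" by simp
    also have "\<dots> = poly q (z\<^sup>2)" using q [of z] real Z [OF z(1)] by simp
    finally show "poly q x = poly (map_poly cnj q) x" using z by simp
  qed
  then have "cnj (coeff q k) = coeff q k" for k by (metis coeff_map_poly complex_cnj_zero)
  then have qR: "coeff q k \<in> \<real>" for k by (simp add: Reals_cnj_iff)
  have cq: "coeff q k = coeff p k * U ^ (2 * k) / U ^ m" for k
    unfolding power_mult by (simp add: q_def coeff_pcompose_linear mult.commute)
  have cm: "coeff (monom 1 i * s) k = (if i \<le> k then coeff s (k - i) else 0)" for i k and s :: "complex poly"
    by (simp add: coeff_monom_mult)
  have p0: "coeff p 0 = (\<Sum>j\<le>m. B 0 j * a ^ j)"
  proof -
    have "coeff p 0 = (\<Sum>i\<le>m. \<Sum>j\<le>m - i. B i j * (if i \<le> 0 then coeff ([:a, - cnj a:] ^ j) (0 - i) else 0))"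
      by (simp add: p_def coeff_sum cm)
    also have "\<dots> = (\<Sum>i\<in>{0}. \<Sum>j\<le>m - i. B i j * (if i \<le> 0 then coeff ([:a, - cnj a:] ^ j) (0 - i) else 0))"
      by (rule sum.mono_neutral_right) auto
    finally show ?thesis by (simp add: coeff_linear_power)
  qed
  have p1: "coeff p 1 = (\<Sum>j\<le>m - 1. B 1 j * a ^ j) - cnj a * (\<Sum>j\<le>m. of_nat j * B 0 j * a ^ (j - 1))"
  proof -
    have "coeff p 1 = (\<Sum>i\<le>m. \<Sum>j\<le>m - i. B i j * (if i \<le> 1 then coeff ([:a, - cnj a:] ^ j) (1 - i) else 0))"
      by (simp add: p_def coeff_sum cm cong: if_cong)
    also have "\<dots> = (\<Sum>i\<in>{0, 1}. \<Sum>j\<le>m - i. B i j * (if i \<le> 1 then coeff ([:a, - cnj a:] ^ j) (1 - i) else 0))"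
      by (rule sum.mono_neutral_right) (use m in auto)
    also have "\<dots> = (\<Sum>j\<le>m. B 0 j * coeff ([:a, - cnj a:] ^ j) 1) + (\<Sum>j\<le>m - 1. B 1 j * coeff ([:a, - cnj a:] ^ j) 0)" by simp
    finally show ?thesis unfolding coeff_linear_power by (simp add: sum_distrib_left sum_negf mult_ac)
  qed
  show "(\<Sum>j\<le>m. B 0 j * a ^ j) / U ^ m \<in> \<real>" using qR [of 0] cq [of 0] p0 by simp
  show "U\<^sup>2 * ((\<Sum>j\<le>m - 1. B 1 j * a ^ j) - cnj a * (\<Sum>j\<le>m. of_nat j * B 0 j * a ^ (j - 1))) / U ^ m \<in> \<real>"
    using qR [of 1] cq [of 1] p1 by (simp add: mult.commute)
qed

subsection \<open>Arc length charts\<close>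

lemma arc_length_parameter:
  fixes D :: "real \<Rightarrow> 'a::real_normed_vector"
  assumes ab: "t0 \<in> {a<..<b}" and D: "continuous_on {a<..<b} D" "\<And>t. t \<in> {a<..<b} \<Longrightarrow> D t \<noteq> 0"
  obtains r \<delta> X Y where "r > 0" "ball t0 r \<subseteq> {a<..<b}" "\<delta> > 0" "X t0 = 0" "continuous_on (ball t0 r) X"
    "\<And>t. t \<in> ball t0 r \<Longrightarrow> Y (X t) = t"
    "\<And>s. \<bar>s\<bar> < \<delta> \<Longrightarrow> Y s \<in> ball t0 r \<and> X (Y s) = s \<and> (Y has_real_derivative inverse (norm (D (Y s)))) (at s)"
proof -
  \<comment> \<open>A third of the distance to the ends: the antiderivative is taken on an interval
    of radius \<open>2 * r\<close>, so its derivative is two-sided on the one of radius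
    \<open>r\<close>.\<close>
  define r where "r = min (t0 - a) (b - t0) / 3"
  have r3: "r > 0" "3 * r \<le> t0 - a" "3 * r \<le> b - t0" using ab by (auto simp: r_def)
  then have r: "r > 0" "{t0 - 2 * r..t0 + 2 * r} \<subseteq> {a<..<b}" by auto
  have "continuous_on {t0 - 2 * r..t0 + 2 * r} (\<lambda>t. norm (D t))"
    by (intro continuous_intros continuous_on_subset [OF D(1)] r)
  then obtain G where G: "\<And>t. t \<in> {t0 - 2 * r..t0 + 2 * r} \<Longrightarrow> (G has_vector_derivative norm (D t)) (at t within {t0 - 2 * r..t0 + 2 * r})"
    by (rule antiderivative_continuous) (rule that)
  define X where "X t = G t - G t0" for t
  have dX: "(X has_real_derivative norm (D t)) (at t)" "0 < norm (D t)" if t: "\<bar>t - t0\<bar> \<le> r" for t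
  proof -
    have i: "t \<in> interior {t0 - 2 * r..t0 + 2 * r}" using t r(1) by auto
    then have "(G has_real_derivative norm (D t)) (at t)"
      using G [of t] interior_subset at_within_interior [OF i] by (auto simp: has_real_derivative_iff_has_vector_derivative)
    then show "(X has_real_derivative norm (D t)) (at t)" unfolding X_def by (auto intro!: derivative_eq_intros)
    have "t \<in> {a<..<b}" using r(2) i interior_subset by blast
    then show "0 < norm (D t)" using D(2) by simp
  qed
  obtain Y where Y: "\<And>t. \<bar>t - t0\<bar> \<le> r \<Longrightarrow> Y (X t) = t"
    "\<And>t. \<bar>t - t0\<bar> < r \<Longrightarrow> (Y has_real_derivative inverse (norm (D t))) (at (X t))"
    by (rule strict_mono_local_inverse [OF r(1), of t0 X "\<lambda>t. norm (D t)"]) (use dX in \<open>auto intro: that\<close>)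
  have ball: "t \<in> ball t0 r \<longleftrightarrow> \<bar>t - t0\<bar> < r" for t by (auto simp: dist_real_def)
  have X0: "X t0 = 0" by (simp add: X_def)
  have inc: "X s < X t" if "t0 - r \<le> s" "s < t" "t \<le> t0 + r" for s t
  proof (rule DERIV_pos_imp_increasing [OF that(2)])
    fix x assume "s \<le> x" "x \<le> t"
    then have "\<bar>x - t0\<bar> \<le> r" using that by auto
    then show "\<exists>y. (X has_real_derivative y) (at x) \<and> 0 < y" using dX by blast
  qed
  have contX: "continuous_on {t0 - r..t0 + r} X"
  proof (intro continuous_at_imp_continuous_on ballI)
    fix x assume "x \<in> {t0 - r..t0 + r}"
    then have "\<bar>x - t0\<bar> \<le> r" by auto
    then show "isCont X x" by (rule DERIV_isCont [OF dX(1)])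
  qed
  define \<delta> where "\<delta> = min (X (t0 + r)) (- X (t0 - r))"
  have \<delta>: "\<delta> > 0" using inc [of t0 "t0 + r"] inc [of "t0 - r" t0] r(1) X0 by (auto simp: \<delta>_def)
  show ?thesis
  proof (rule that [of r \<delta> X Y])
    show "ball t0 r \<subseteq> {a<..<b}" using r3 by (auto simp: dist_real_def subset_iff)
    show "continuous_on (ball t0 r) X" by (rule continuous_on_subset [OF contX]) (auto simp: dist_real_def)
    show "Y (X t) = t" if "t \<in> ball t0 r" for t using that Y(1) [of t] by (simp add: dist_real_def)
    show "Y s \<in> ball t0 r \<and> X (Y s) = s \<and> (Y has_real_derivative inverse (norm (D (Y s)))) (at s)" if s: "\<bar>s\<bar> < \<delta>" for s
    proof -
      have b: "X (t0 - r) < s" "s < X (t0 + r)" using s by (auto simp: \<delta>_def)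
      then obtain t where t: "t0 - r \<le> t" "t \<le> t0 + r" "X t = s"
        using IVT' [of X "t0 - r" s "t0 + r"] contX r(1) by auto
      have "t \<noteq> t0 - r" "t \<noteq> t0 + r" using b t(3) by auto
      then have t': "\<bar>t - t0\<bar> < r" using t by auto
      then have "Y s = t" using Y(1) [of t] t(3) by simp
      then show ?thesis using Y(2) [OF t'] t t' by (simp add: dist_real_def abs_minus_commute)
    qed
  qed (use r \<delta> X0 in auto)
qed

lemma arc_length_unit_speed:
  assumes ab: "t0 \<in> {a<..<b}" and D: "continuous_on {a<..<b} D" "\<And>t. t \<in> {a<..<b} \<Longrightarrow> D t \<noteq> 0"
    and \<gamma>: "\<And>t. t \<in> {a<..<b} \<Longrightarrow> (\<gamma> has_vector_derivative D t) (at t)" "\<And>t. t \<in> {a<..<b} \<Longrightarrow> \<gamma> t \<in> S"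
  obtains r \<delta> X Y where "r > 0" "ball t0 r \<subseteq> {a<..<b}" "\<delta> > 0" "X t0 = 0" "continuous_on (ball t0 r) X"
    "\<And>t. t \<in> ball t0 r \<Longrightarrow> Y (X t) = t" "Y 0 = t0"
    "\<And>s. \<bar>s\<bar> < \<delta> \<Longrightarrow> Y s \<in> ball t0 r \<and> X (Y s) = s"
    "unit_speed S {-\<delta><..<\<delta>} (\<lambda>s. \<gamma> (Y s)) (\<lambda>s. sgn (D (Y s)))"
proof -
  obtain r \<delta> X Y where r: "r > 0" "ball t0 r \<subseteq> {a<..<b}" "\<delta> > 0" "X t0 = 0" "continuous_on (ball t0 r) X"
    "\<And>t. t \<in> ball t0 r \<Longrightarrow> Y (X t) = t" and
    Y: "\<And>s. \<bar>s\<bar> < \<delta> \<Longrightarrow> Y s \<in> ball t0 r \<and> X (Y s) = s \<and> (Y has_real_derivative inverse (norm (D (Y s)))) (at s)"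
    by (rule arc_length_parameter [OF ab D]) (assumption | rule that)+
  have Yab: "Y s \<in> {a<..<b}" if "\<bar>s\<bar> < \<delta>" for s using Y [OF that] r(2) by blast
  have I: "s \<in> {-\<delta><..<\<delta>} \<longleftrightarrow> \<bar>s\<bar> < \<delta>" for s by auto
  have "unit_speed S {-\<delta><..<\<delta>} (\<lambda>s. \<gamma> (Y s)) (\<lambda>s. sgn (D (Y s)))"
    unfolding unit_speed_def
  proof (intro conjI ballI)
    have "continuous_on {-\<delta><..<\<delta>} Y"
      using Y by (intro continuous_at_imp_continuous_on ballI) (meson DERIV_isCont I)
    then have "continuous_on {-\<delta><..<\<delta>} (\<lambda>s. D (Y s))"
      by (rule continuous_on_compose2 [OF D(1)]) (use Yab I in blast)
    then show "continuous_on {-\<delta><..<\<delta>} (\<lambda>s. sgn (D (Y s)))"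
      by (intro continuous_on_sgn) (use D(2) Yab I in blast)+
    fix s assume s: "s \<in> {-\<delta><..<\<delta>}"
    have "((\<gamma> \<circ> Y) has_vector_derivative inverse (norm (D (Y s))) *\<^sub>R D (Y s)) (at s)"
      by (rule vector_diff_chain_at)
        (use Y s \<gamma>(1) Yab in \<open>auto simp only: I has_real_derivative_iff_has_vector_derivative\<close>)
    then show "((\<lambda>s. \<gamma> (Y s)) has_vector_derivative sgn (D (Y s))) (at s)" by (simp add: o_def sgn_div_norm divide_inverse)
    show "norm (sgn (D (Y s))) = 1" "\<gamma> (Y s) \<in> S" using D(2) \<gamma>(2) Yab s by (auto simp only: I norm_sgn if_False)
  qed simp
  moreover have "Y 0 = t0" using r(1,4) r(6) [of t0] by simp
  ultimately show ?thesis using r Y by (intro that [of r \<delta> X Y]) auto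
qed

lemma regular_chart_smooth_arc:
  assumes U: "open U" "p \<in> S" "p \<in> U" and hom: "homeomorphism {a<..<b} (S \<inter> U) \<gamma> g"
    and D: "continuous_on {a<..<b} D" "\<And>t. t \<in> {a<..<b} \<Longrightarrow> D t \<noteq> 0"
      "\<And>t. t \<in> {a<..<b} \<Longrightarrow> (\<gamma> has_vector_derivative D t) (at t)"
  shows "\<exists>\<sigma> \<sigma>' \<delta>. smooth_arc S \<sigma> \<sigma>' \<delta> \<and> \<sigma> 0 = p"
proof -
  define t0 where "t0 = g p"
  have pSU: "p \<in> S \<inter> U" using U by blast
  have t0: "t0 \<in> {a<..<b}" "\<gamma> t0 = p" using pSU hom by (auto simp: t0_def homeomorphism_def)
  have \<gamma>S: "\<gamma> t \<in> S" if "t \<in> {a<..<b}" for t using hom that by (auto simp: homeomorphism_def)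
  obtain r \<delta> X Y where r: "r > 0" "ball t0 r \<subseteq> {a<..<b}" "\<delta> > 0" "X t0 = 0" "continuous_on (ball t0 r) X"
    "\<And>t. t \<in> ball t0 r \<Longrightarrow> Y (X t) = t" "Y 0 = t0"
    "\<And>s. \<bar>s\<bar> < \<delta> \<Longrightarrow> Y s \<in> ball t0 r \<and> X (Y s) = s"
    "unit_speed S {-\<delta><..<\<delta>} (\<lambda>s. \<gamma> (Y s)) (\<lambda>s. sgn (D (Y s)))"
    by (rule arc_length_unit_speed [OF t0(1) D(1,2,3) \<gamma>S]) (assumption | rule that)+
  have arcs: "\<exists>V. open V \<and> \<gamma> (Y s) \<in> V \<and> S \<inter> V \<subseteq> (\<lambda>s. \<gamma> (Y s)) ` {u\<in>{-\<delta><..<\<delta>}. \<bar>u - s\<bar> < \<epsilon>}"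
    if s: "s \<in> {-\<delta><..<\<delta>}" and \<epsilon>: "\<epsilon> > 0" for s \<epsilon>
  proof -
    \<comment> \<open>The chart parameters whose arc length is close to \<open>s\<close>. Continuity
      of the chart inverse \<open>g\<close> makes the corresponding piece open in
      \<open>S\<close>.\<close>
    define N where "N = ball t0 r \<inter> X -` {y. \<bar>y - s\<bar> < \<epsilon> \<and> \<bar>y\<bar> < \<delta>}"
    have "{y. \<bar>y - s\<bar> < \<epsilon> \<and> \<bar>y\<bar> < \<delta>} = ball s \<epsilon> \<inter> ball 0 \<delta>" by (auto simp: dist_real_def)
    then have "open N" unfolding N_def by (metis continuous_open_preimage r(5) open_ball open_Int)
    then have "openin (top_of_set (S \<inter> U)) ((S \<inter> U) \<inter> g -` N)"
      using hom by (intro continuous_openin_preimage_gen) (auto simp: homeomorphism_def)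
    then obtain V where V: "open V" "(S \<inter> U) \<inter> g -` N = (S \<inter> U) \<inter> V" unfolding openin_open by blast
    show ?thesis
    proof (intro exI [of _ "U \<inter> V"] conjI subsetI)
      show "open (U \<inter> V)" using U(1) V(1) by blast
      have Ys: "Y s \<in> ball t0 r" "X (Y s) = s" using r(8) [of s] s by auto
      have "Y s \<in> {a<..<b}" using Ys r(2) by blast
      then have "g (\<gamma> (Y s)) = Y s" "\<gamma> (Y s) \<in> S \<inter> U" using hom unfolding homeomorphism_def by blast+
      moreover have "Y s \<in> N" using Ys s \<epsilon> by (auto simp: N_def)
      ultimately show "\<gamma> (Y s) \<in> U \<inter> V" using V(2) by auto
      fix z assume z: "z \<in> S \<inter> (U \<inter> V)"
      then have "g z \<in> N" "\<gamma> (g z) = z" using V(2) hom by (auto simp: homeomorphism_def)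
      then have "z = \<gamma> (Y (X (g z)))" "\<bar>X (g z)\<bar> < \<delta>" "\<bar>X (g z) - s\<bar> < \<epsilon>" using r(6) by (auto simp: N_def)
      then show "z \<in> (\<lambda>s. \<gamma> (Y s)) ` {u \<in> {-\<delta><..<\<delta>}. \<bar>u - s\<bar> < \<epsilon>}" by (intro image_eqI [of _ _ "X (g z)"]) auto
    qed
  qed
  have "smooth_arc S (\<lambda>s. \<gamma> (Y s)) (\<lambda>s. sgn (D (Y s))) \<delta>"
    using arcs r(3) unit_speedD [OF r(9)] unfolding smooth_arc_def by blast
  then show ?thesis using r(7) t0(2) by blast
qed

subsection \<open>Boundary conditions and their solution\<close>

lemma smooth_arc_shift:
  assumes \<sigma>: "smooth_arc S \<sigma> \<sigma>' \<delta>" and t: "t \<in> {-\<delta><..<\<delta>}"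
  shows "smooth_arc S (\<lambda>u. \<sigma> (t + u)) (\<lambda>u. \<sigma>' (t + u)) (\<delta> - \<bar>t\<bar>)"
proof -
  note sd = smooth_arcD [OF \<sigma>]
  define e where "e = \<delta> - \<bar>t\<bar>"
  have e: "e > 0" using t by (auto simp: e_def)
  have I: "t + u \<in> {-\<delta><..<\<delta>}" if "u \<in> {-e<..<e}" for u using that by (auto simp: e_def)
  have us: "unit_speed S {s. t + 1 * s \<in> {-\<delta><..<\<delta>}} (\<lambda>s. \<sigma> (t + 1 * s)) (\<lambda>s. of_real 1 * \<sigma>' (t + 1 * s))"
    by (rule unit_speed_affine [OF smooth_arc_unit_speed [OF \<sigma>]]) simp
  have "unit_speed S {-e<..<e} (\<lambda>u. \<sigma> (t + u)) (\<lambda>u. \<sigma>' (t + u))"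
  proof -
    have "{-e<..<e} \<subseteq> {s. t + 1 * s \<in> {-\<delta><..<\<delta>}}" using I by auto
    from unit_speed_subset [OF us open_greaterThanLessThan this] show ?thesis by simp
  qed
  note ud = unit_speedD [OF this]
  have "\<exists>V. open V \<and> \<sigma> (t + u) \<in> V \<and> S \<inter> V \<subseteq> (\<lambda>u. \<sigma> (t + u)) ` {v\<in>{-e<..<e}. \<bar>v - u\<bar> < \<epsilon>}"
    if u: "u \<in> {-e<..<e}" and \<epsilon>: "\<epsilon> > 0" for u \<epsilon>
  proof -
    define \<epsilon>' where "\<epsilon>' = min \<epsilon> (e - \<bar>u\<bar>)"
    have "\<epsilon>' > 0" using u \<epsilon> by (auto simp: \<epsilon>'_def)
    then obtain V where V: "open V" "\<sigma> (t + u) \<in> V" "S \<inter> V \<subseteq> \<sigma> ` {v\<in>{-\<delta><..<\<delta>}. \<bar>v - (t + u)\<bar> < \<epsilon>'}"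
      using sd(6) [OF I [OF u]] by blast
    have "\<sigma> ` {v\<in>{-\<delta><..<\<delta>}. \<bar>v - (t + u)\<bar> < \<epsilon>'} \<subseteq> (\<lambda>u. \<sigma> (t + u)) ` {v\<in>{-e<..<e}. \<bar>v - u\<bar> < \<epsilon>}"
    proof (rule image_subsetI)
      fix v assume "v \<in> {v\<in>{-\<delta><..<\<delta>}. \<bar>v - (t + u)\<bar> < \<epsilon>'}"
      then show "\<sigma> v \<in> (\<lambda>u. \<sigma> (t + u)) ` {v\<in>{-e<..<e}. \<bar>v - u\<bar> < \<epsilon>}"
        by (intro image_eqI [of _ _ "v - t"]) (auto simp: \<epsilon>'_def)
    qed
    with V(3) have "S \<inter> V \<subseteq> (\<lambda>u. \<sigma> (t + u)) ` {v\<in>{-e<..<e}. \<bar>v - u\<bar> < \<epsilon>}" by (rule subset_trans)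
    with V(1,2) show ?thesis by (intro exI [of _ V] conjI)
  qed
  then show ?thesis using e ud(2-5) unfolding smooth_arc_def e_def [symmetric] by (intro conjI ballI allI impI) auto
qed

lemma pderiv_sum: "pderiv (sum f A) = (\<Sum>x\<in>A. pderiv (f x))"
  by (induction A rule: infinite_finite_induct) (simp_all add: pderiv_add)

text \<open>The moment is constant along the line through \<open>p\<close> with direction
  \<open>P\<close>, so the values of \<open>f\<close> shortly before and after a bounce are values
  of one expression \<open>F\<close> at \<open>p\<close>. The one-sided cone supplies the directions
  \<open>z\<close> for which the incoming and the outgoing segment both lie in \<Omega>; the
  reflection law then reads \<open>F (U * z) = F (U * cnj z)\<close>.\<close>

lemma integrable_billiard_boundary:
  fixes f :: "complex \<Rightarrow> complex \<Rightarrow> real"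
  assumes \<Omega>: "open \<Omega>" "connected \<Omega>" "\<Omega> \<noteq> {}"
    and coef: "\<And>Q P. Q \<in> \<Omega> \<Longrightarrow> f Q P = (\<Sum>i\<le>n. a i Q * Re P ^ (n - i) * Im P ^ i)"
    and free: "\<And>Q P. closed_segment Q (Q + P) \<subseteq> \<Omega> \<Longrightarrow> f (Q + P) P = f Q P"
    and bounce: "\<And>p T P \<tau>. unit_tangent (frontier \<Omega>) p T \<Longrightarrow> \<tau> > 0 \<Longrightarrow>
      (\<And>s. 0 < s \<Longrightarrow> s \<le> \<tau> \<Longrightarrow> p - of_real s * P \<in> \<Omega>) \<Longrightarrow>
      (\<And>s. 0 < s \<Longrightarrow> s \<le> \<tau> \<Longrightarrow> p + of_real s * (T\<^sup>2 * cnj P) \<in> \<Omega>) \<Longrightarrow>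
      f (p + of_real \<tau> * (T\<^sup>2 * cnj P)) (T\<^sup>2 * cnj P) = f (p - of_real \<tau> * P) P"
    and nc: "\<And>c. \<exists>Q\<in>\<Omega>. \<exists>P. norm P = 1 \<and> f Q P \<noteq> c"
  obtains m R R1 where "m > 0" "R \<noteq> 0" "degree R \<le> m"
    "\<And>p T. unit_tangent (frontier \<Omega>) p T \<Longrightarrow> poly R p / T ^ m \<in> \<real>"
    "\<And>p T. unit_tangent (frontier \<Omega>) p T \<Longrightarrow> T\<^sup>2 * (poly R1 p - cnj p * poly (pderiv R) p) / T ^ m \<in> \<real>"
proof -
  obtain g where g: "homogeneous n g"
    "\<And>Q P. Q \<in> \<Omega> \<Longrightarrow> complex_of_real (f Q P) = g P (cnj P) (Q * cnj P - cnj Q * P)"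
    by (rule polynomial_integral_global [OF coef free \<Omega>]) (assumption | rule that)+
  obtain m B where m: "m > 0" "\<exists>j\<le>m. B 0 j \<noteq> 0" and B: "\<And>Q P. Q \<in> \<Omega> \<Longrightarrow> norm P = 1 \<Longrightarrow>
      of_real (f Q P) = (\<Sum>i\<le>m. \<Sum>j\<le>m - i. B i j * P ^ i * cnj P ^ (m - i - j) * (Q * cnj P - cnj Q * P) ^ j)"
    by (rule reduced_representation [OF g nc]) (assumption | rule that)+
  define R where "R = (\<Sum>j\<le>m. monom (B 0 j) j)"
  define R1 where "R1 = (\<Sum>j\<le>m - 1. monom (B 1 j) j)"
  have R: "poly R p = (\<Sum>j\<le>m. B 0 j * p ^ j)" "poly R1 p = (\<Sum>j\<le>m - 1. B 1 j * p ^ j)"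
    "poly (pderiv R) p = (\<Sum>j\<le>m. of_nat j * B 0 j * p ^ (j - 1))" for p
    by (simp_all add: R_def R1_def poly_sum poly_monom pderiv_sum pderiv_monom)
  have key: "poly R p / T ^ m \<in> \<real> \<and> T\<^sup>2 * (poly R1 p - cnj p * poly (pderiv R) p) / T ^ m \<in> \<real>"
    if T: "unit_tangent (frontier \<Omega>) p T" for p T
  proof -
    obtain \<sigma>0 \<sigma>0' \<delta>0 t0 where \<sigma>0: "smooth_arc (frontier \<Omega>) \<sigma>0 \<sigma>0' \<delta>0" "t0 \<in> {-\<delta>0<..<\<delta>0}" "\<sigma>0 t0 = p" "\<sigma>0' t0 = T"
      using T unfolding unit_tangent_def by blast
    obtain e r where e: "e = 1 \<or> e = (-1 :: complex)" and r: "r > 0"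
      and cone: "\<And>w. norm w < r \<Longrightarrow> \<bar>Re w\<bar> < Im w \<Longrightarrow> p - e * T * w \<in> \<Omega>"
      by (rule frontier_one_sided_cone [OF \<Omega>(1) smooth_arc_shift [OF \<sigma>0(1,2)]]) (use \<sigma>0(3,4) that in auto)
    \<comment> \<open>The sign \<open>e\<close> puts the paths \<open>p - s * U * z\<close> and
      \<open>p + s * U * cnj z\<close> into \<Omega> for small \<open>s > 0\<close> and
      \<open>z\<close> in the upper cone. It leaves \<open>T ^ 2\<close> unchanged and
      \<open>T ^ m\<close> unchanged up to sign.\<close>
    define U where "U = e * T"
    have nT: "norm T = 1" using smooth_arcD(4) [OF \<sigma>0(1,2)] \<sigma>0(4) by simp
    have U: "norm U = 1" "U\<^sup>2 = T\<^sup>2" using e nT by (auto simp: U_def norm_mult)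
    have UU: "U * cnj U = 1" using U(1) by (simp add: complex_norm_square [symmetric])
    define F where "F = (\<lambda>P. \<Sum>i\<le>m. \<Sum>j\<le>m - i. B i j * P ^ i * cnj P ^ (m - i - j) * (p * cnj P - cnj p * P) ^ j)"
    have F: "of_real (f (p + of_real s * P) P) = F P" if "p + of_real s * P \<in> \<Omega>" "norm P = 1" for P and s :: real
    proof -
      have "(p + of_real s * P) * cnj P - cnj (p + of_real s * P) * P = p * cnj P - cnj p * P" by (simp add: algebra_simps)
      then show ?thesis using B [OF that] unfolding F_def by simp
    qed
    define \<tau> where "\<tau> = r / 2"
    define h where "h z = f (p + of_real (- \<tau>) * (U * z)) (U * z)" for z
    have Fh: "F (U * z) = of_real (h z) \<and> F (U * cnj z) = of_real (h z)" if z: "norm z = 1" "\<bar>Re z\<bar> < Im z" for z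
    proof -
      have in1: "p - of_real s * (U * z) \<in> \<Omega>" if "0 < s" "s \<le> \<tau>" for s
      proof -
        have "p - e * T * (of_real s * z) \<in> \<Omega>" by (rule cone) (use that z r in \<open>auto simp: norm_mult \<tau>_def abs_mult\<close>)
        then show ?thesis by (simp add: U_def mult_ac)
      qed
      have Tz: "T\<^sup>2 * cnj (U * z) = U * cnj z"
      proof -
        have "T\<^sup>2 * cnj (U * z) = U * (U * cnj U) * cnj z" unfolding U(2) [symmetric] by (simp add: power2_eq_square)
        then show ?thesis unfolding UU by simp
      qed
      have in2: "p + of_real s * (U * cnj z) \<in> \<Omega>" if "0 < s" "s \<le> \<tau>" for s
      proof -
        have "p - e * T * (- of_real s * cnj z) \<in> \<Omega>" by (rule cone) (use that z r in \<open>auto simp: norm_mult \<tau>_def abs_mult\<close>)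
        then show ?thesis by (simp add: U_def mult_ac)
      qed
      have \<tau>: "\<tau> > 0" using r by (simp add: \<tau>_def)
      have b: "f (p + of_real \<tau> * (U * cnj z)) (U * cnj z) = h z"
        using bounce [OF T \<tau>, of "U * z"] in1 in2 unfolding Tz h_def by simp
      have "F (U * z) = of_real (h z)"
        using F [of "-\<tau>" "U * z"] in1 [of \<tau>] \<tau> U(1) z(1) by (simp add: h_def norm_mult)
      moreover have "F (U * cnj z) = of_real (h z)"
        using F [of \<tau> "U * cnj z"] in2 [of \<tau>] \<tau> U(1) z(1) b by (simp add: norm_mult)
      ultimately show ?thesis ..
    qed
    note coeffs = reflection_real_coefficients [OF m(1) U(1) Fh [unfolded F_def], folded R]
    have Um: "U ^ m = T ^ m \<or> U ^ m = - (T ^ m)"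
      using e by (cases "even m") (auto simp: U_def power_mult_distrib)
    have 1: "poly R p / T ^ m \<in> \<real>" using coeffs(1) Um by auto
    have 2: "T\<^sup>2 * (poly R1 p - cnj p * poly (pderiv R) p) / T ^ m \<in> \<real>"
      using coeffs(2) Um unfolding U(2) by auto
    show ?thesis using 1 2 ..
  qed
  show ?thesis
  proof (rule that [of m R R1])
    show "R \<noteq> 0"
    proof
      assume "R = 0"
      have "coeff R j = B 0 j" if "j \<le> m" for j using that by (simp add: R_def coeff_sum)
      then show False using m(2) \<open>R = 0\<close> by auto
    qed
    show "degree R \<le> m" unfolding R_def by (rule degree_sum_le) (auto intro: order.trans [OF degree_monom_le])
  qed (use m key in auto)
qed

lemma regular_curve_unit_tangent:
  assumes S: "C1_curve S" and D: "continuous_on UNIV D" "\<And>t. D t \<noteq> 0" "\<And>t. (\<gamma> has_vector_derivative D t) (at t)"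
    and \<gamma>: "\<And>t. \<gamma> t \<in> S"
  shows "\<exists>s::real. s \<noteq> 0 \<and> unit_tangent S (\<gamma> t) (of_real s * D t)"
proof -
  have t: "t \<in> {t - 1<..<t + 1}" by simp
  obtain Y :: "real \<Rightarrow> real" and \<delta> where Y: "\<delta> > 0" "Y 0 = t" "unit_speed S {-\<delta><..<\<delta>} (\<lambda>s. \<gamma> (Y s)) (\<lambda>s. sgn (D (Y s)))"
    by (rule arc_length_unit_speed [OF t continuous_on_subset [OF D(1)] D(2,3) \<gamma>]) (use that in auto)
  have "unit_tangent S (\<gamma> t) (sgn (D t)) \<or> unit_tangent S (\<gamma> t) (- sgn (D t))"
    using unit_speed_tangent [OF S Y(3), of 0] Y(1,2) by simp
  moreover have "sgn (D t) = of_real (inverse (norm (D t))) * D t" "- sgn (D t) = of_real (- inverse (norm (D t))) * D t"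
    by (simp_all add: sgn_div_norm scaleR_conv_of_real)
  moreover have "inverse (norm (D t)) \<noteq> 0" using D(2) by simp
  ultimately show ?thesis by (metis neg_equal_0_iff_equal)
qed

text \<open>If \<open>norm p = norm q\<close>, then \<open>p * cis t = q * cis (- t)\<close> for
  some \<open>t\<close>, which would be a zero of \<open>A'\<close> on the line. This excludes
  ellipses that degenerate to a segment.\<close>

lemma joukowski_image_of_line:
  assumes A: "\<And>x. h0 < Re x \<Longrightarrow> A x = c + \<alpha> * exp x + \<beta> * exp (- x)" and dA: "\<And>x. h0 < Re x \<Longrightarrow> deriv A x \<noteq> 0"
    and h: "h0 < h"
  obtains p q where "norm p \<noteq> norm q" "A ` {x. Re x = h} = range (\<lambda>t::real. c + p * cis t + q * cis (- t))"
proof -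
  define p where "p = \<alpha> * exp (of_real h)"
  define q where "q = \<beta> * exp (- of_real h)"
  have pq: "\<alpha> * exp (Complex h t) = p * cis t" "\<beta> * exp (- Complex h t) = q * cis (- t)" for t
  proof -
    have e: "Complex h t = of_real h + \<i> * of_real t" "- Complex h t = - of_real h + \<i> * of_real (- t)"
      by (simp_all add: complex_eq_iff)
    have "exp (Complex h t) = exp (of_real h) * cis t" unfolding e(1) exp_add cis_conv_exp by (rule refl)
    moreover have "exp (- Complex h t) = exp (- of_real h) * cis (- t)" unfolding e(2) exp_add cis_conv_exp by (rule refl)
    ultimately
    show "\<alpha> * exp (Complex h t) = p * cis t" "\<beta> * exp (- Complex h t) = q * cis (- t)" by (simp_all add: p_def q_def)
  qed
  have d: "p * cis t \<noteq> q * cis (- t)" for t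
  proof -
    define x where "x = Complex h t"
    have hx: "h0 < Re x" using h by (simp add: x_def)
    have "((\<lambda>x. c + \<alpha> * exp x + \<beta> * exp (- x)) has_field_derivative \<alpha> * exp x - \<beta> * exp (- x)) (at x)"
      by (auto intro!: derivative_eq_intros)
    then have "(A has_field_derivative \<alpha> * exp x - \<beta> * exp (- x)) (at x)"
      by (rule has_field_derivative_transform_within_open [OF _ open_right_half_plane [of h0]]) (use hx A in auto)
    then have "deriv A x = \<alpha> * exp x - \<beta> * exp (- x)" by (rule DERIV_imp_deriv)
    then have "p * cis t - q * cis (- t) \<noteq> 0" using dA [OF hx] unfolding x_def pq by metis
    then show ?thesis by simp
  qed
  show ?thesis
  proof (rule that [of p q])
    show "norm p \<noteq> norm q"
    proof
      assume eq: "norm p = norm q"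
      have p0: "p \<noteq> 0" using d [of 0] eq by auto
      then have n1: "norm (q / p) = 1" using eq by (simp add: norm_divide flip: eq)
      then have "q / p = cis (Arg (q / p))" by (subst cis_Arg) (auto simp: sgn_eq)
      then obtain s where s: "q / p = cis s" by blast
      have "q * cis (- (s / 2)) = p * (cis s * cis (- (s / 2)))" using s p0 by (simp add: field_simps)
      also have "\<dots> = p * cis (s / 2)" by (simp add: cis_mult)
      finally show False using d [of "s / 2"] by simp
    qed
    have "A (Complex h t) = c + p * cis t + q * cis (- t)" for t using A [of "Complex h t"] h pq by simp
    moreover have "{x. Re x = h} = range (Complex h)" by (auto simp: complex_eq_iff image_iff intro: exI [of _ "Im _"])
    ultimately show "A ` {x. Re x = h} = range (\<lambda>t::real. c + p * cis t + q * cis (- t))" by (simp add: image_image)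
  qed
qed

lemma curve_is_trigonometric_ellipse:
  assumes S: "C1_curve S" "compact S" "connected S" "S \<noteq> {}"
    and R: "m > 0" "R \<noteq> 0" "degree R \<le> m"
    and I0: "\<And>p T. unit_tangent S p T \<Longrightarrow> poly R p / T ^ m \<in> \<real>"
    and I1: "\<And>p T. unit_tangent S p T \<Longrightarrow> T\<^sup>2 * (poly R1 p - cnj p * poly (pderiv R) p) / T ^ m \<in> \<real>"
  obtains c p q where "norm p \<noteq> norm q" "S = range (\<lambda>t::real. c + p * cis t + q * cis (- t))"
proof -
  obtain c c' L where L: "L > 0" and us: "unit_speed S UNIV c c'" and per: "\<And>t. c (t + L) = c t" and inj: "inj_on c {0..<L}"
    by (rule closed_unit_speed_curve [OF S(1,2,4)]) (rule that)
  note cd = unit_speedD [OF us, simplified]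
  have real: "poly R (c t) / c' t ^ m \<in> \<real>" for t
  proof -
    have "unit_tangent S (c t) (c' t) \<or> unit_tangent S (c t) (- c' t)" by (rule unit_speed_tangent [OF S(1) us]) simp
    then show ?thesis
    proof
      assume "unit_tangent S (c t) (- c' t)"
      from I0 [OF this] show ?thesis by (cases "even m") auto
    qed (rule I0)
  qed
  have c'0: "c' t \<noteq> 0" for t using cd(4) [of t] by auto
  note enc = roots_enclosed [OF L cd(3,2) c'0 per inj R(2,3,1) real]
  define J where "J = c ` {0..L}"
  have J: "compact J" "J \<subseteq> S" unfolding J_def
    using cd(5,6) by (auto intro!: compact_continuous_image continuous_at_imp_continuous_on)
  define \<kappa> where "\<kappa> = lead_coeff R"
  have \<kappa>: "\<kappa> \<noteq> 0" using R(2) by (simp add: \<kappa>_def)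
  define Q where "Q = smult (1 / \<kappa>) R"
  have RQ: "R = smult \<kappa> Q" using \<kappa> by (simp add: Q_def)
  have Q: "degree Q = m" "lead_coeff Q = 1" using enc(1) \<kappa> by (auto simp: Q_def \<kappa>_def)
  have inJ: "z \<in> inside J" if "poly Q z = 0" for z using enc(2) [of z] that by (simp add: RQ J_def)
  have notS: "c 0 \<in> S" "c 0 \<in> J" using cd(5) L by (auto simp: J_def)
  \<comment> \<open>The first reality condition in the form that straightening requires, to be used
    with \<open>w = A'\<close>.\<close>
  have tan: "\<exists>r::real. T ^ m = of_real r * \<kappa> * w ^ m" if T: "unit_tangent S p T" and w: "w ^ m = poly Q p" "w \<noteq> 0" for T p w
  proof -
    obtain r :: real where r: "poly R p / T ^ m = of_real r" using I0 [OF T] by (auto elim: Reals_cases)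
    have T0: "T \<noteq> 0" using T smooth_arcD(4) unfolding unit_tangent_def by fastforce
    have e: "\<kappa> * w ^ m = of_real r * T ^ m" using r T0 w(1) by (simp add: RQ field_simps)
    then have "r \<noteq> 0" using \<kappa> w(2) by auto
    then have "T ^ m = of_real (1 / r) * \<kappa> * w ^ m" using e by (simp add: field_simps)
    then show ?thesis by blast
  qed
  have "\<not> constant (poly Q)" using Q R(1) by (simp add: constant_degree)
  then obtain z1 where z1: "poly Q z1 = 0" using fundamental_theorem_of_algebra by blast
  show ?thesis
  proof (cases "\<exists>z2. poly Q z2 = 0 \<and> z2 \<noteq> z1")
    case False
    have Qz: "poly Q x = (x - z1) ^ m" for x
    proof -
      have r: "{z. poly Q z = 0} = {z1}" using False z1 by blast
      have "Q \<noteq> 0" using Q R(1) by auto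
      from degree_eq_sum_order [OF this] have o: "order z1 Q = m" unfolding r Q(1) by simp
      have "smult 1 ([:- z1, 1:] ^ m) = Q" using complex_poly_decompose [of Q] unfolding r Q(2) by (simp add: o del: smult_1_left)
      then have "Q = [:- z1, 1:] ^ m" by simp
      then have "poly Q x = poly ([:- z1, 1:] ^ m) x" by (rule arg_cong)
      then show ?thesis by simp
    qed
    define A where "A x = z1 + exp x" for x
    have dA: "deriv A x = exp x" for x unfolding A_def by (intro DERIV_imp_deriv) (auto intro!: derivative_eq_intros)
    have "z1 \<noteq> c 0" using inJ [OF z1] notS(2) inside_no_overlap [of J] by blast
    then have w: "A (Ln (c 0 - z1)) = c 0" by (simp add: A_def exp_Ln)
    \<comment> \<open>Here the solution exists on the whole plane; 1 is an arbitrary margin to the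
      left of the boundary line.\<close>
    define h0 where "h0 = Re (Ln (c 0 - z1)) - 1"
    have "S = A ` {x. Re x = Re (Ln (c 0 - z1))}"
    proof (rule curve_eq_level_line [where n = m and \<kappa> = \<kappa>])
      show "A holomorphic_on {x. h0 < Re x}" unfolding A_def by (intro holomorphic_intros)
      show "A (x + 2 * of_real pi * \<i>) = A x" for x by (simp add: A_def exp_add)
      show "\<exists>h'. \<forall>x. h' < Re x \<longrightarrow> C < norm (A x)" for C
      proof (intro exI [of _ "\<bar>C\<bar> + norm z1"] allI impI)
        fix x assume x: "\<bar>C\<bar> + norm z1 < Re x"
        have "1 + Re x \<le> norm (exp x)" using exp_ge_add_one_self [of "Re x"] by simp
        also have "norm (exp x) \<le> norm (A x) + norm z1" using norm_triangle_ineq4 [of "A x" z1] by (simp add: A_def)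
        finally show "C < norm (A x)" using x by linarith
      qed
      show "\<exists>r::real. T ^ m = of_real r * \<kappa> * deriv A x ^ m" if "unit_tangent S (A x) T" for x T
        by (rule tan [OF that]) (simp_all add: Qz dA, simp add: A_def)
    qed (use S R(1) \<kappa> w notS in \<open>auto simp: dA h0_def\<close>)
    moreover obtain p q where "norm p \<noteq> norm q"
      "A ` {x. Re x = Re (Ln (c 0 - z1))} = range (\<lambda>t::real. z1 + p * cis t + q * cis (- t))"
      by (rule joukowski_image_of_line [of h0 A z1 1 0 "Re (Ln (c 0 - z1))"]) (auto simp: dA A_def h0_def intro: that)
    ultimately show ?thesis using that by metis
  next
    case True
    then obtain z2 where z2: "poly Q z2 = 0" "z1 \<noteq> z2" by blast
    obtain h0 A where hol: "A holomorphic_on {x. h0 < Re x}"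
      and per: "\<And>x. h0 < Re x \<Longrightarrow> A (x + 2 * of_real pi * \<i>) = A x"
      and ode: "\<And>x. h0 < Re x \<Longrightarrow> deriv A x ^ m = poly Q (A x) \<and> poly Q (A x) \<noteq> 0"
      and inf: "\<And>C. \<exists>h'. \<forall>x. h' < Re x \<longrightarrow> C < norm (A x)"
      and asym: "\<exists>h' C. \<forall>x. h' < Re x \<longrightarrow> norm (deriv (deriv A) x - A x) \<le> C"
      and lims: "\<And>w. Re w = h0 \<Longrightarrow> \<exists>z. (A \<longlongrightarrow> z) (at w within half_ball w 1)"
      and zero: "\<exists>w z. Re w = h0 \<and> (A \<longlongrightarrow> z) (at w within half_ball w 1) \<and> poly Q z = 0"
      by (rule exterior_solution [OF Q(1) R(1) Q(2) z1 z2]) (rule that)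
    have dA0: "deriv A x \<noteq> 0" if "h0 < Re x" for x using ode [OF that] R(1) by (auto simp: power_0_left)
    \<comment> \<open>Otherwise the connected image of the half-plane avoids \<open>J\<close>. Near
      the left edge it comes close to a root, which lies inside \<open>J\<close>, so all of it would
      lie inside and \<open>A\<close> would be bounded.\<close>
    have "\<exists>w. h0 < Re w \<and> A w \<in> J"
    proof (rule ccontr)
      assume out: "\<not> ?thesis"
      define H where "H = {x. h0 < Re x}"
      have conn: "connected (A ` H)"
        using hol connected_right_half_plane unfolding H_def by (intro connected_continuous_image holomorphic_on_imp_continuous_on)
      have sub: "A ` H \<subseteq> - J" using out by (auto simp: H_def)
      obtain w z where w: "Re w = h0" "(A \<longlongrightarrow> z) (at w within half_ball w 1)" "poly Q z = 0" using zero by blast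
      have "open (inside J)" using J(1) by (intro open_inside compact_imp_closed)
      then have "eventually (\<lambda>x. A x \<in> inside J) (at w within half_ball w 1)"
        using topological_tendstoD [OF w(2)] inJ [OF w(3)] by blast
      moreover have "eventually (\<lambda>x. x \<in> half_ball w 1) (at w within half_ball w 1)" by (simp add: eventually_at_filter)
      ultimately have "eventually (\<lambda>x. A x \<in> inside J \<and> x \<in> half_ball w 1) (at w within half_ball w 1)" by eventually_elim simp
      from eventually_happens' [OF at_within_half_ball_neq_bot [OF zero_less_one] this]
      obtain x where x: "A x \<in> inside J" "x \<in> half_ball w 1" by blast
      have xH: "x \<in> H" using x(2) w(1) by (simp add: half_ball_def H_def)
      have "A y \<in> inside J" if "y \<in> H" for y
      proof (rule inside_same_component [OF _ x(1)])
        show "connected_component (- J) (A x) (A y)" unfolding connected_component_def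
          using conn sub xH that by blast
      qed
      moreover have "bounded (inside J)" using J(1) by (intro bounded_inside compact_imp_bounded)
      then obtain C where "\<And>z. z \<in> inside J \<Longrightarrow> norm z \<le> C" unfolding bounded_iff by blast
      ultimately have bd: "norm (A y) \<le> C" if "h0 < Re y" for y using that by (auto simp: H_def)
      obtain h' where h': "\<And>x. h' < Re x \<Longrightarrow> C < norm (A x)" using inf by blast
      define y where "y = complex_of_real (max h0 h' + 1)"
      have "h0 < Re y" "h' < Re y" by (auto simp: y_def)
      then show False using bd [of y] h' [of y] by simp
    qed
    then obtain w where w: "h0 < Re w" "A w \<in> S" using J(2) by blast
    define h where "h = Re w"
    have S_eq: "S = A ` {x. Re x = h}"
      unfolding h_def
      by (rule curve_eq_level_line [OF hol dA0 per inf S(1,2,3) R(1) \<kappa> tan w]) (use ode dA0 in auto)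
    have hh: "h0 < h" using w by (simp add: h_def)
    \<comment> \<open>Two distinct roots require degree at least 2, so \<open>m - 2\<close> is a
      genuine difference.\<close>
    have m2: "m \<ge> 2"
    proof (rule ccontr)
      assume "\<not> m \<ge> 2"
      then have "card {z. poly Q z = 0} \<le> 1" using card_poly_roots_bound [of Q] Q R(1) by fastforce
      moreover have "card {z1, z2} \<le> card {z. poly Q z = 0}" using z1 z2 Q R(1) by (intro card_mono poly_roots_finite) auto
      ultimately show False using z2(2) by simp
    qed
    define Q1 where "Q1 = smult (1 / \<kappa>) R1"
    \<comment> \<open>Along the vertical line the tangent is a real multiple of
      \<open>\<i> * A'\<close>. The first condition then says that
      \<open>\<kappa> / \<i> ^ (m - 2)\<close> is real, and dividing the second one by it removes
      the constants.\<close>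
    have realh: "(poly Q1 (A x) - cnj (A x) * poly (pderiv Q) (A x)) / deriv A x ^ (m - 2) \<in> \<real>" if x: "Re x = h" for x
    proof -
      define D where "D t = \<i> * deriv A (Complex h t)" for t
      have dA: "(A has_field_derivative deriv A y) (at y)" if "h0 < Re y" for y
        using hol that open_right_half_plane holomorphic_derivI by blast
      have "\<exists>s::real. s \<noteq> 0 \<and> unit_tangent S (A (Complex h (Im x))) (of_real s * D (Im x))"
      proof (rule regular_curve_unit_tangent [OF S(1)])
        have "continuous_on {x. h0 < Re x} (deriv A)"
          by (intro holomorphic_on_imp_continuous_on holomorphic_deriv hol open_right_half_plane)
        moreover have "continuous_on UNIV (Complex h)" unfolding Complex_eq [abs_def] by (intro continuous_intros)
        ultimately have "continuous_on UNIV (\<lambda>t. deriv A (Complex h t))"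
          by (rule continuous_on_compose2) (use hh in auto)
        then show "continuous_on UNIV D" unfolding D_def by (rule continuous_on_mult_left)
        show "D t \<noteq> 0" for t using dA0 hh by (simp add: D_def)
        show "((\<lambda>t. A (Complex h t)) has_vector_derivative D t) (at t)" for t
        proof -
          have "(Complex h has_vector_derivative \<i>) (at t)" unfolding Complex_eq [abs_def] by (auto intro!: derivative_eq_intros)
          then have "((A \<circ> Complex h) has_vector_derivative \<i> * deriv A (Complex h t)) (at t)"
            by (intro field_vector_diff_chain_at) (use dA hh in auto)
          then show ?thesis by (simp add: o_def D_def)
        qed
        show "A (Complex h t) \<in> S" for t unfolding S_eq by auto
      qed
      moreover have "Complex h (Im x) = x" using x by (simp add: complex_eq_iff)
      ultimately obtain s :: real where s: "s \<noteq> 0" "unit_tangent S (A x) (of_real s * (\<i> * deriv A x))" by (auto simp: D_def)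
      define d where "d = deriv A x"
      have d: "d \<noteq> 0" "d ^ m = poly Q (A x)" using dA0 ode x hh by (auto simp: d_def)
      define k where "k = m - 2"
      have mk: "m = k + 2" using m2 by (simp add: k_def)
      define X where "X = poly Q1 (A x) - cnj (A x) * poly (pderiv Q) (A x)"
      have X: "poly R1 (A x) - cnj (A x) * poly (pderiv R) (A x) = \<kappa> * X"
        using \<kappa> by (simp add: X_def Q1_def RQ pderiv_smult algebra_simps)
      have "poly R (A x) / (of_real s * (\<i> * d)) ^ m \<in> \<real>" using I0 [OF s(2)] by (simp add: d_def)
      moreover have "poly R (A x) / (of_real s * (\<i> * d)) ^ m = \<kappa> / (of_real s ^ m * \<i> ^ m)"
        using d(1) by (simp add: RQ power_mult_distrib flip: d(2))
      ultimately have "\<kappa> / (of_real s ^ m * \<i> ^ m) * (- (of_real s ^ m)) \<in> \<real>"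
        by (simp only: Reals_mult Reals_minus Reals_power Reals_of_real)
      moreover have "\<kappa> / (of_real s ^ m * \<i> ^ m) * (- (of_real s ^ m)) = \<kappa> / \<i> ^ k" using s(1) by (simp add: mk power_add)
      ultimately have 1: "\<kappa> / \<i> ^ k \<in> \<real>" by (simp only:)
      have "(of_real s * (\<i> * d))\<^sup>2 * (\<kappa> * X) / (of_real s * (\<i> * d)) ^ m \<in> \<real>" using I1 [OF s(2)] by (simp add: d_def X)
      moreover have "(of_real s * (\<i> * d))\<^sup>2 * (\<kappa> * X) / (of_real s * (\<i> * d)) ^ m = (\<kappa> / \<i> ^ k) * (X / d ^ k) / of_real s ^ k"
        using d s(1) unfolding mk power_add by (simp add: power_mult_distrib)
      ultimately have "(\<kappa> / \<i> ^ k) * (X / d ^ k) / of_real s ^ k \<in> \<real>" by (simp only:)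
      then have "(\<kappa> / \<i> ^ k) * (X / d ^ k) / of_real s ^ k * of_real s ^ k / (\<kappa> / \<i> ^ k) \<in> \<real>"
        by (rule Reals_divide [OF Reals_mult [OF _ Reals_power [OF Reals_of_real]] 1])
      moreover have "(\<kappa> / \<i> ^ k) * (X / d ^ k) / of_real s ^ k * of_real s ^ k / (\<kappa> / \<i> ^ k) = X / d ^ k"
        using \<kappa> s(1) by simp
      ultimately have "X / d ^ k \<in> \<real>" by (simp only:)
      then show ?thesis by (simp add: X_def d_def k_def)
    qed
    obtain b \<alpha> \<beta> where A: "\<And>x. h0 < Re x \<Longrightarrow> A x = b + \<alpha> * exp x + \<beta> * exp (- x)"
      by (rule exterior_solution_joukowski [OF Q(1) R(1) z1 z2 hol per ode inf asym lims zero hh realh]) (assumption | rule that)+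
    obtain p q where "norm p \<noteq> norm q" "A ` {x. Re x = h} = range (\<lambda>t::real. b + p * cis t + q * cis (- t))"
      by (rule joukowski_image_of_line [OF A dA0 hh]) (assumption | rule that)+
    then show ?thesis using that S_eq by metis
  qed
qed

subsection \<open>Ellipses in the real plane\<close>

text \<open>The half axes are \<open>norm p + norm q\<close> and
  \<open>\<bar>norm p - norm q\<bar>\<close>. The mean \<mu> of the arguments of \<open>p\<close>
  and \<open>q\<close> gives the direction of the axes; half their difference, \<nu>, shifts the
  parameter.\<close>

lemma trigonometric_ellipse_equation:
  assumes pq: "norm p \<noteq> norm q"
  obtains w a b where "norm w = 1" "0 < a" "0 < b"
    "range (\<lambda>t::real. c + p * cis t + q * cis (- t)) = {z. (Re ((z - c) * cnj w) / a)\<^sup>2 + (Im ((z - c) * cnj w) / b)\<^sup>2 = 1}"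
proof -
  define \<phi> \<psi> where "\<phi> = Arg p" and "\<psi> = Arg q"
  define \<mu> \<nu> where "\<mu> = (\<phi> + \<psi>) / 2" and "\<nu> = (\<phi> - \<psi>) / 2"
  define a b where "a = norm p + norm q" and "b = norm p - norm q"
  have a: "a > 0" using pq norm_ge_zero [of p] norm_ge_zero [of q] unfolding a_def by linarith
  have b: "b \<noteq> 0" using pq by (simp add: b_def)
  have \<phi>: "\<phi> = \<nu> + \<mu>" "\<psi> = \<mu> - \<nu>" by (simp_all add: \<mu>_def \<nu>_def field_simps)
  have p: "p = of_real (norm p) * cis (\<nu> + \<mu>)" unfolding \<phi>(1) [symmetric] \<phi>_def by (metis rcis_cmod_Arg rcis_def)
  have q: "q = of_real (norm q) * cis (\<mu> - \<nu>)" unfolding \<phi>(2) [symmetric] \<psi>_def by (metis rcis_cmod_Arg rcis_def)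
  have param: "c + p * cis t + q * cis (- t) = c + Complex (a * cos (t + \<nu>)) (b * sin (t + \<nu>)) * cis \<mu>" for t
  proof -
    have "p * cis t + q * cis (- t) = of_real (norm p) * cis (t + \<nu>) * cis \<mu> + of_real (norm q) * cis (- (t + \<nu>)) * cis \<mu>"
    proof -
      have "cis (\<nu> + \<mu>) * cis t = cis (t + \<nu>) * cis \<mu>" "cis (\<mu> - \<nu>) * cis (- t) = cis (- (t + \<nu>)) * cis \<mu>"
        by (simp_all add: cis_mult algebra_simps)
      then show ?thesis by (subst p, subst q) (simp only: mult.assoc)
    qed
    also have "\<dots> = (of_real (norm p) * cis (t + \<nu>) + of_real (norm q) * cis (- (t + \<nu>))) * cis \<mu>"
      by (simp only: distrib_right)
    also have "of_real (norm p) * cis (t + \<nu>) + of_real (norm q) * cis (- (t + \<nu>)) = Complex (a * cos (t + \<nu>)) (b * sin (t + \<nu>))"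
      for t by (simp add: complex_eq_iff a_def b_def distrib_right left_diff_distrib del: minus_add_distrib)
    finally show ?thesis by simp
  qed
  have rot: "(z - c) * cnj (cis \<mu>) = w \<longleftrightarrow> z = c + w * cis \<mu>" for z w
  proof -
    have u: "cis \<mu> * cnj (cis \<mu>) = 1" by (simp add: cis_cnj cis_mult)
    have "(z - c) * cnj (cis \<mu>) * cis \<mu> = z - c" "w * cis \<mu> * cnj (cis \<mu>) = w"
      using u by (simp_all only: mult.assoc mult.commute [of "cnj (cis \<mu>)"] mult_1_right)
    then show ?thesis by (metis add.commute diff_add_cancel add_diff_cancel_left')
  qed
  show ?thesis
  proof (rule that [of "cis \<mu>" a "\<bar>b\<bar>"])
    show "range (\<lambda>t::real. c + p * cis t + q * cis (- t)) =
      {z. (Re ((z - c) * cnj (cis \<mu>)) / a)\<^sup>2 + (Im ((z - c) * cnj (cis \<mu>)) / \<bar>b\<bar>)\<^sup>2 = 1}"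
    proof (intro equalityI subsetI)
      fix z assume "z \<in> range (\<lambda>t::real. c + p * cis t + q * cis (- t))"
      then obtain t where "z = c + Complex (a * cos (t + \<nu>)) (b * sin (t + \<nu>)) * cis \<mu>" using param by auto
      then have e: "(z - c) * cnj (cis \<mu>) = Complex (a * cos (t + \<nu>)) (b * sin (t + \<nu>))" using rot by blast
      show "z \<in> {z. (Re ((z - c) * cnj (cis \<mu>)) / a)\<^sup>2 + (Im ((z - c) * cnj (cis \<mu>)) / \<bar>b\<bar>)\<^sup>2 = 1}"
        unfolding mem_Collect_eq e using a b by (simp add: power_divide power_mult_distrib)
    next
      fix z assume "z \<in> {z. (Re ((z - c) * cnj (cis \<mu>)) / a)\<^sup>2 + (Im ((z - c) * cnj (cis \<mu>)) / \<bar>b\<bar>)\<^sup>2 = 1}"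
      then have "(Re ((z - c) * cnj (cis \<mu>)) / a)\<^sup>2 + (Im ((z - c) * cnj (cis \<mu>)) / b)\<^sup>2 = 1" by (simp add: power_divide)
      then obtain s where "Re ((z - c) * cnj (cis \<mu>)) / a = cos s" "Im ((z - c) * cnj (cis \<mu>)) / b = sin s"
        using sincos_total_2pi by metis
      then have "(z - c) * cnj (cis \<mu>) = Complex (a * cos s) (b * sin s)" using a b by (simp add: complex_eq_iff field_simps)
      then have "z = c + p * cis (s - \<nu>) + q * cis (- (s - \<nu>))" unfolding rot param by simp
      then show "z \<in> range (\<lambda>t::real. c + p * cis t + q * cis (- t))" by blast
    qed
  qed (use a b in auto)
qed

section \<open>Transfer between \<open>real^2\<close> and the complex plane\<close>

definition complex_of_vec :: "real^2 \<Rightarrow> complex" where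
  "complex_of_vec v = Complex (v $ 1) (v $ 2)"

definition vec_of_complex :: "complex \<Rightarrow> real^2" where
  "vec_of_complex z = vector [Re z, Im z]"

lemma vec_of_complex_nth [simp]: "vec_of_complex z $ 1 = Re z" "vec_of_complex z $ 2 = Im z"
  by (simp_all add: vec_of_complex_def)

lemma complex_of_vec_sel [simp]: "Re (complex_of_vec v) = v $ 1" "Im (complex_of_vec v) = v $ 2"
  by (simp_all add: complex_of_vec_def)

lemma complex_of_vec_inverse [simp]: "vec_of_complex (complex_of_vec v) = v"
  and vec_of_complex_inverse [simp]: "complex_of_vec (vec_of_complex z) = z"
  by (simp_all add: vec_eq_iff forall_2 complex_eq_iff)

lemma linear_vec_of_complex: "linear vec_of_complex"
  and linear_complex_of_vec: "linear complex_of_vec"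
  by (auto intro!: linearI simp: vec_eq_iff forall_2 complex_eq_iff)

lemma bounded_linear_vec_of_complex: "bounded_linear vec_of_complex"
  and bounded_linear_complex_of_vec: "bounded_linear complex_of_vec"
  by (simp_all add: linear_conv_bounded_linear [symmetric] linear_vec_of_complex linear_complex_of_vec)

lemma inner_vec_of_complex: "v \<bullet> vec_of_complex w = Re (complex_of_vec v * cnj w)"
  by (simp add: inner_vec_def sum_2)

lemma norm_vec_of_complex [simp]: "norm (vec_of_complex w) = norm w"
  unfolding norm_eq_sqrt_inner [of "vec_of_complex w"] inner_vec_of_complex by (simp add: cmod_def power2_eq_square)

lemma bij_complex_of_vec: "bij complex_of_vec"
  by (metis bijI' complex_of_vec_inverse vec_of_complex_inverse)

lemma frontier_complex_of_vec: "frontier (complex_of_vec ` \<Omega>) = complex_of_vec ` frontier \<Omega>"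
proof -
  note cl = closure_injective_linear_image [OF linear_complex_of_vec bij_is_inj [OF bij_complex_of_vec]]
  have "frontier (complex_of_vec ` \<Omega>) = complex_of_vec ` closure \<Omega> \<inter> complex_of_vec ` closure (- \<Omega>)"
    unfolding frontier_closures cl bij_image_Compl_eq [OF bij_complex_of_vec, symmetric] by (rule refl)
  then show ?thesis unfolding frontier_closures image_Int [OF bij_is_inj [OF bij_complex_of_vec]] .
qed

lemma open_complex_of_vec: "open \<Omega> \<Longrightarrow> open (complex_of_vec ` \<Omega>)"
proof -
  assume "open \<Omega>"
  then have "open (vec_of_complex -` \<Omega>)"
    by (rule open_vimage) (intro linear_continuous_on bounded_linear_vec_of_complex)
  moreover have "vec_of_complex -` \<Omega> = complex_of_vec ` \<Omega>"
  proof (intro equalityI subsetI)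
    fix z assume "z \<in> vec_of_complex -` \<Omega>"
    then show "z \<in> complex_of_vec ` \<Omega>" by (intro image_eqI [of _ _ "vec_of_complex z"]) auto
  qed auto
  ultimately show ?thesis by simp
qed

lemma C2_smooth_curve_C1_curve:
  assumes "C2_smooth_curve S"
  shows "C1_curve (complex_of_vec ` S)"
  unfolding C1_curve_def
proof
  fix p assume "p \<in> complex_of_vec ` S"
  then obtain q where q: "q \<in> S" "p = complex_of_vec q" by blast
  then obtain U \<gamma> D g where U: "open U" "q \<in> U" and hom: "homeomorphism {-1<..<1::real} (S \<inter> U) \<gamma> g"
    and D: "\<And>t. t \<in> {-1<..<1} \<Longrightarrow> (\<gamma> has_vector_derivative D t) (at t) \<and> D t \<noteq> 0" "D C1_differentiable_on {-1<..<1}"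
    using assms unfolding C2_smooth_curve_def by metis
  have cont: "continuous_on A complex_of_vec" "continuous_on B vec_of_complex" for A B
    by (intro linear_continuous_on bounded_linear_complex_of_vec bounded_linear_vec_of_complex)+
  show "\<exists>\<sigma> \<sigma>' \<delta>. smooth_arc (complex_of_vec ` S) \<sigma> \<sigma>' \<delta> \<and> \<sigma> 0 = p"
  proof (rule regular_chart_smooth_arc)
    show "open (complex_of_vec ` U)" using U by (intro open_complex_of_vec)
    show "p \<in> complex_of_vec ` S" "p \<in> complex_of_vec ` U" using q U by auto
    have "homeomorphism (S \<inter> U) (complex_of_vec ` (S \<inter> U)) complex_of_vec vec_of_complex"
      by (intro homeomorphismI cont) auto
    then have "homeomorphism {-1<..<1} (complex_of_vec ` (S \<inter> U)) (complex_of_vec \<circ> \<gamma>) (g \<circ> vec_of_complex)"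
      using hom homeomorphism_compose by blast
    then show "homeomorphism {-1<..<1} (complex_of_vec ` S \<inter> complex_of_vec ` U) (complex_of_vec \<circ> \<gamma>) (g \<circ> vec_of_complex)"
      by (simp add: image_Int [OF bij_is_inj [OF bij_complex_of_vec]])
    show "continuous_on {-1<..<1} (\<lambda>t. complex_of_vec (D t))"
      by (rule continuous_on_compose2 [OF cont(1) C1_differentiable_imp_continuous_on [OF D(2)]]) auto
    fix t :: real assume t: "t \<in> {-1<..<1}"
    show "complex_of_vec (D t) \<noteq> 0"
    proof
      assume "complex_of_vec (D t) = 0"
      then have "D t = 0" by (simp add: complex_eq_iff vec_eq_iff forall_2)
      then show False using D(1) [OF t] by simp
    qed
    show "((complex_of_vec \<circ> \<gamma>) has_vector_derivative complex_of_vec (D t)) (at t)"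
      using bounded_linear.has_vector_derivative [OF bounded_linear_complex_of_vec] D(1) [OF t] by (simp add: o_def)
  qed
qed

lemma vec_of_complex_simps:
  "vec_of_complex (z + w) = vec_of_complex z + vec_of_complex w"
  "vec_of_complex (of_real s * z) = s *\<^sub>R vec_of_complex z"
  by (simp_all add: vec_eq_iff forall_2)

lemma line_reflection_vec_of_complex:
  assumes "norm T = 1"
  shows "line_reflection (vec_of_complex T) (vec_of_complex P) = vec_of_complex (T\<^sup>2 * cnj P)"
proof -
  have T: "(Re T)\<^sup>2 + (Im T)\<^sup>2 = 1" using assms by (simp add: cmod_def)
  have "vec_of_complex T \<bullet> vec_of_complex T = 1" using T by (simp add: inner_vec_of_complex power2_eq_square)
  moreover have "vec_of_complex P \<bullet> vec_of_complex T = Re P * Re T + Im P * Im T" by (simp add: inner_vec_of_complex)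
  moreover have "2 * (Re P * Re T + Im P * Im T) * Re T - Re P = Re (T\<^sup>2 * cnj P)"
  proof -
    have "2 * (Re P * Re T + Im P * Im T) * Re T - Re P * ((Re T)\<^sup>2 + (Im T)\<^sup>2) = Re (T\<^sup>2 * cnj P)"
      by (simp add: power2_eq_square algebra_simps)
    then show ?thesis unfolding T by simp
  qed
  moreover have "2 * (Re P * Re T + Im P * Im T) * Im T - Im P = Im (T\<^sup>2 * cnj P)"
  proof -
    have "2 * (Re P * Re T + Im P * Im T) * Im T - Im P * ((Re T)\<^sup>2 + (Im T)\<^sup>2) = Im (T\<^sup>2 * cnj P)"
      by (simp add: power2_eq_square algebra_simps)
    then show ?thesis unfolding T by simp
  qed
  ultimately show ?thesis by (simp add: line_reflection_def vec_eq_iff forall_2)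
qed

lemma unit_tangent_tangent_vector:
  assumes "unit_tangent (complex_of_vec ` S) p T"
  shows "tangent_vector S (vec_of_complex p) (vec_of_complex T)" "norm T = 1" "p \<in> complex_of_vec ` S"
proof -
  obtain \<sigma> \<sigma>' \<delta> t where \<sigma>: "smooth_arc (complex_of_vec ` S) \<sigma> \<sigma>' \<delta>" "t \<in> {-\<delta><..<\<delta>}" "\<sigma> t = p" "\<sigma>' t = T"
    using assms unfolding unit_tangent_def by blast
  note sh = smooth_arc_shift [OF \<sigma>(1,2)]
  note sd = smooth_arcD [OF sh]
  define \<gamma> where "\<gamma> u = vec_of_complex (\<sigma> (t + u))" for u
  have "eventually (\<lambda>u. u \<in> {- (\<delta> - \<bar>t\<bar>)<..<\<delta> - \<bar>t\<bar>}) (nhds 0)"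
    using sd(1) by (intro eventually_nhds_in_open) auto
  then have "eventually (\<lambda>u. \<gamma> u \<in> S) (nhds 0)"
  proof eventually_elim
    case (elim u)
    then show ?case using sd(5) [OF elim] by (auto simp: \<gamma>_def)
  qed
  moreover have "(\<gamma> has_vector_derivative vec_of_complex T) (at 0)"
    unfolding \<gamma>_def
    using bounded_linear.has_vector_derivative [OF bounded_linear_vec_of_complex sd(3) [of 0]] sd(1) \<sigma>(4) by simp
  moreover have "\<gamma> 0 = vec_of_complex p" using \<sigma>(3) by (simp add: \<gamma>_def)
  ultimately show "tangent_vector S (vec_of_complex p) (vec_of_complex T)" unfolding tangent_vector_def by blast
  show "norm T = 1" "p \<in> complex_of_vec ` S" using smooth_arcD(4,5) [OF \<sigma>(1,2)] \<sigma>(3,4) by auto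
qed

theorem corollary1p7:
  fixes \<Omega> :: "(real^2) set"
  assumes "billiard \<Omega>"
    and "bounded \<Omega>"
    and "C2_smooth_curve (frontier \<Omega>)"
    and "connected (frontier \<Omega>)"
    and "polynomially_integrable \<Omega>"
  shows "is_ellipse (frontier \<Omega>)"
proof -
  define W where "W = complex_of_vec ` \<Omega>"
  define S where "S = complex_of_vec ` frontier \<Omega>"
  have WS: "frontier W = S" by (simp add: W_def S_def frontier_complex_of_vec)
  have inW: "vec_of_complex Q \<in> \<Omega>" if "Q \<in> W" for Q using that by (auto simp: W_def)
  have cont: "continuous_on A complex_of_vec" for A by (intro linear_continuous_on bounded_linear_complex_of_vec)
  have W: "open W" "connected W" "W \<noteq> {}"
    using assms(1) unfolding billiard_def W_def by (auto intro!: open_complex_of_vec connected_continuous_image cont)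
  have bW: "bounded W" using assms(2) unfolding W_def by (rule bounded_linear_image [OF _ bounded_linear_complex_of_vec])
  have S: "C1_curve S" "compact S" "connected S" "S \<noteq> {}"
  proof -
    show "C1_curve S" unfolding S_def by (rule C2_smooth_curve_C1_curve [OF assms(3)])
    show "compact S" unfolding WS [symmetric] using bW by (rule compact_frontier_bounded)
    show "connected S" unfolding S_def by (intro connected_continuous_image cont assms(4))
    have "W \<noteq> UNIV" using bW by auto
    then show "S \<noteq> {}" unfolding WS [symmetric] using W(3) by (simp add: frontier_eq_empty)
  qed
  obtain \<Phi> where \<Phi>: "first_integral \<Omega> \<Phi>" "polynomial_in_velocity \<Omega> \<Phi>" "\<not> \<Phi> constant_on (\<Omega> \<times> sphere 0 1)"
    using assms(5) unfolding polynomially_integrable_def by blast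
  obtain n :: nat and a where a: "\<And>Q P. Q \<in> \<Omega> \<Longrightarrow> \<Phi> (Q, P) = (\<Sum>i\<le>n. \<Sum>j\<le>n - i. a i j Q * (P $ 1) ^ i * (P $ 2) ^ j)"
    using \<Phi>(2) unfolding polynomial_in_velocity_def by blast
  \<comment> \<open>The coefficients regrouped by total degree: \<open>f k\<close> is the component
    of \<Phi> that is homogeneous of degree \<open>k\<close> in the velocity.\<close>
  define b where "b k i Q = a (k - i) i (vec_of_complex Q)" for k i Q
  define f where "f k Q P = (\<Sum>i\<le>k. b k i Q * Re P ^ (k - i) * Im P ^ i)" for k Q P
  have expand: "\<Phi> (vec_of_complex Q, vec_of_complex (of_real l * P)) = (\<Sum>k\<le>n. f k Q P * l ^ k)" if "Q \<in> W" for Q P l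
  proof -
    have "\<Phi> (vec_of_complex Q, vec_of_complex (of_real l * P)) =
      (\<Sum>(i, j)\<in>Sigma {..n} (\<lambda>i. {..n - i}). a i j (vec_of_complex Q) * (l * Re P) ^ i * (l * Im P) ^ j)"
      unfolding a [OF inW [OF that]] by (subst sum.Sigma) auto
    also have "\<dots> = (\<Sum>(k, i)\<in>Sigma {..n} (\<lambda>k. {..k}). b k i Q * Re P ^ (k - i) * Im P ^ i * l ^ k)"
      by (rule sum.reindex_bij_witness [where i = "\<lambda>(k, i). (k - i, i)" and j = "\<lambda>(i, j). (i + j, j)"])
        (auto simp: b_def power_mult_distrib power_add)
    also have "\<dots> = (\<Sum>k\<le>n. f k Q P * l ^ k)"
      unfolding f_def sum_distrib_right by (subst sum.Sigma) auto
    finally show ?thesis .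
  qed
  \<comment> \<open>Multiplying the velocity by \<open>l > 0\<close> changes only the time of a
    motion, so \<Phi> is preserved for every \<open>l\<close>; comparing the coefficients of
    \<open>l ^ k\<close> shows that each homogeneous component is preserved separately.\<close>
  have component: "f k Q' P' = f k Q P"
    if Q: "Q \<in> W" "Q' \<in> W" and k: "k \<le> n"
      and flow: "\<And>l. l > 0 \<Longrightarrow> \<exists>t. billiard_flow \<Omega> t (vec_of_complex Q, vec_of_complex (of_real l * P)) (vec_of_complex Q', vec_of_complex (of_real l * P'))"
    for k Q Q' P P'
  proof -
    define p where "p = (\<Sum>k\<le>n. monom (f k Q P) k)"
    define p' where "p' = (\<Sum>k\<le>n. monom (f k Q' P') k)"
    have "p' = p"
    proof (rule poly_eqI_infinite)
      show "infinite {0::real<..}" by (rule infinite_Ioi)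
      fix l :: real assume "l \<in> {0<..}"
      then have "\<Phi> (vec_of_complex Q', vec_of_complex (of_real l * P')) = \<Phi> (vec_of_complex Q, vec_of_complex (of_real l * P))"
        using flow \<Phi>(1) unfolding first_integral_def by (metis greaterThan_iff)
      then show "poly p' l = poly p l" using Q by (simp add: expand p_def p'_def poly_sum poly_monom)
    qed
    moreover have "coeff p k = f k Q P" "coeff p' k = f k Q' P'" using k by (simp_all add: p_def p'_def coeff_sum)
    ultimately show ?thesis by simp
  qed
  \<comment> \<open>If every component were constant on unit velocities, so would be their sum
    \<Phi>.\<close>
  have "\<exists>k\<le>n. \<forall>c. \<exists>Q\<in>W. \<exists>P. norm P = 1 \<and> f k Q P \<noteq> c"
  proof (rule ccontr)
    assume "\<not> ?thesis"
    then obtain C where C: "\<And>k Q P. k \<le> n \<Longrightarrow> Q \<in> W \<Longrightarrow> norm P = 1 \<Longrightarrow> f k Q P = C k" by metis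
    have "\<Phi> x = (\<Sum>k\<le>n. C k)" if x: "x \<in> \<Omega> \<times> sphere 0 1" for x
    proof -
      obtain Q P where QP: "x = (Q, P)" "Q \<in> \<Omega>" "norm P = 1" using x by auto
      have "norm (complex_of_vec P) = 1" using norm_vec_of_complex [of "complex_of_vec P"] QP(3) by simp
      moreover have "complex_of_vec Q \<in> W" using QP(2) by (simp add: W_def)
      ultimately show ?thesis using expand [of "complex_of_vec Q" 1 "complex_of_vec P"] C QP(1) by simp
    qed
    then show False using \<Phi>(3) unfolding constant_on_def by blast
  qed
  then obtain k where k: "k \<le> n" "\<And>c. \<exists>Q\<in>W. \<exists>P. norm P = 1 \<and> f k Q P \<noteq> c" by blast
  have free: "f k (Q + P) P = f k Q P" if QP: "closed_segment Q (Q + P) \<subseteq> W" for Q P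
  proof (rule component [OF _ _ k(1)])
    show "Q \<in> W" "Q + P \<in> W" using QP by auto
    fix l :: real assume l: "l > 0"
    have "billiard_flow \<Omega> (1 / l) (vec_of_complex Q, vec_of_complex (of_real l * P))
      (vec_of_complex Q + (1 / l) *\<^sub>R vec_of_complex (of_real l * P), vec_of_complex (of_real l * P))"
    proof (rule billiard_flow.free)
      show "0 \<le> 1 / l" using l by simp
      show "\<forall>s\<in>{0..1 / l}. vec_of_complex Q + s *\<^sub>R vec_of_complex (of_real l * P) \<in> \<Omega>"
      proof
        fix s assume s: "s \<in> {0..1 / l}"
        have "Q + of_real (s * l) * P \<in> closed_segment Q (Q + P)"
          unfolding closed_segment_def
          by (rule CollectI, rule exI [of _ "s * l"]) (use s l in \<open>auto simp: field_simps scaleR_conv_of_real\<close>)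
        then have "vec_of_complex (Q + of_real (s * l) * P) \<in> \<Omega>" using QP inW by blast
        then show "vec_of_complex Q + s *\<^sub>R vec_of_complex (of_real l * P) \<in> \<Omega>" by (simp only: vec_of_complex_simps scaleR_scaleR)
      qed
    qed
    moreover have "vec_of_complex Q + (1 / l) *\<^sub>R vec_of_complex (of_real l * P) = vec_of_complex (Q + P)"
      using l by (simp add: vec_of_complex_simps)
    ultimately show "\<exists>t. billiard_flow \<Omega> t (vec_of_complex Q, vec_of_complex (of_real l * P)) (vec_of_complex (Q + P), vec_of_complex (of_real l * P))"
      by metis
  qed
  have bounce: "f k (p + of_real \<tau> * (T\<^sup>2 * cnj P)) (T\<^sup>2 * cnj P) = f k (p - of_real \<tau> * P) P"
    if T: "unit_tangent (frontier W) p T" and \<tau>: "\<tau> > 0"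
      and before: "\<And>s. 0 < s \<Longrightarrow> s \<le> \<tau> \<Longrightarrow> p - of_real s * P \<in> W"
      and after: "\<And>s. 0 < s \<Longrightarrow> s \<le> \<tau> \<Longrightarrow> p + of_real s * (T\<^sup>2 * cnj P) \<in> W"
    for p T P \<tau>
  proof (rule component [OF _ _ k(1)])
    show "p - of_real \<tau> * P \<in> W" "p + of_real \<tau> * (T\<^sup>2 * cnj P) \<in> W" using before after \<tau> by auto
    note tan = unit_tangent_tangent_vector [OF T [unfolded WS S_def]]
    fix l :: real assume l: "l > 0"
    define P' where "P' = T\<^sup>2 * cnj P"
    \<comment> \<open>At velocity \<open>l * P\<close> the impact comes after time
      \<open>\<tau> / l\<close>, and the motion continues for the same time.\<close>
    have "billiard_flow \<Omega> (\<tau> / l + \<tau> / l) (vec_of_complex (p - of_real \<tau> * P), vec_of_complex (of_real l * P))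
      (vec_of_complex p + (\<tau> / l) *\<^sub>R vec_of_complex (of_real l * P'), vec_of_complex (of_real l * P'))"
    proof (rule billiard_flow.bounce)
      show "0 < \<tau> / l" "0 < \<tau> / l" using l \<tau> by auto
      show "vec_of_complex p \<in> frontier \<Omega>" using tan(3) by auto
      show "vec_of_complex p = vec_of_complex (p - of_real \<tau> * P) + (\<tau> / l) *\<^sub>R vec_of_complex (of_real l * P)"
        using l by (simp add: vec_eq_iff forall_2)
      show "\<forall>s\<in>{0..<\<tau> / l}. vec_of_complex (p - of_real \<tau> * P) + s *\<^sub>R vec_of_complex (of_real l * P) \<in> \<Omega>"
      proof
        fix s assume "s \<in> {0..<\<tau> / l}"
        then have "0 < \<tau> - s * l" "\<tau> - s * l \<le> \<tau>" using l by (auto simp: field_simps)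
        then have "vec_of_complex (p - of_real (\<tau> - s * l) * P) \<in> \<Omega>" by (intro inW before)
        moreover have "vec_of_complex (p - of_real (\<tau> - s * l) * P) = vec_of_complex (p - of_real \<tau> * P) + s *\<^sub>R vec_of_complex (of_real l * P)"
          by (simp add: vec_eq_iff forall_2 algebra_simps)
        ultimately show "vec_of_complex (p - of_real \<tau> * P) + s *\<^sub>R vec_of_complex (of_real l * P) \<in> \<Omega>" by simp
      qed
      show "\<forall>s\<in>{0<..\<tau> / l}. vec_of_complex p + s *\<^sub>R vec_of_complex (of_real l * P') \<in> \<Omega>"
      proof
        fix s assume "s \<in> {0<..\<tau> / l}"
        then have "0 < s * l" "s * l \<le> \<tau>" using l by (auto simp: field_simps)
        then have "vec_of_complex (p + of_real (s * l) * P') \<in> \<Omega>" unfolding P'_def by (intro inW after)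
        then show "vec_of_complex p + s *\<^sub>R vec_of_complex (of_real l * P') \<in> \<Omega>" by (simp only: vec_of_complex_simps scaleR_scaleR)
      qed
      have "vec_of_complex T \<noteq> 0" using tan(2) norm_vec_of_complex [of T] by force
      moreover have "vec_of_complex (of_real l * P') = line_reflection (vec_of_complex T) (vec_of_complex (of_real l * P))"
        unfolding line_reflection_vec_of_complex [OF tan(2)] by (simp add: P'_def mult_ac)
      ultimately show "reflected_velocity (frontier \<Omega>) (vec_of_complex p) (vec_of_complex (of_real l * P)) (vec_of_complex (of_real l * P'))"
        using tan(1) unfolding reflected_velocity_def by blast
    qed
    moreover have "vec_of_complex p + (\<tau> / l) *\<^sub>R vec_of_complex (of_real l * P') = vec_of_complex (p + of_real \<tau> * P')"
      using l by (simp add: vec_eq_iff forall_2)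
    ultimately show "\<exists>t. billiard_flow \<Omega> t (vec_of_complex (p - of_real \<tau> * P), vec_of_complex (of_real l * P))
      (vec_of_complex (p + of_real \<tau> * (T\<^sup>2 * cnj P)), vec_of_complex (of_real l * (T\<^sup>2 * cnj P)))"
      unfolding P'_def by metis
  qed
  obtain m R R1 where R: "m > 0" "R \<noteq> 0" "degree R \<le> m"
    "\<And>p T. unit_tangent S p T \<Longrightarrow> poly R p / T ^ m \<in> \<real>"
    "\<And>p T. unit_tangent S p T \<Longrightarrow> T\<^sup>2 * (poly R1 p - cnj p * poly (pderiv R) p) / T ^ m \<in> \<real>"
    by (rule integrable_billiard_boundary [OF W f_def free bounce k(2), unfolded WS]) (assumption | rule that)+
  obtain c p q where pq: "norm p \<noteq> norm q" and Sr: "S = range (\<lambda>t::real. c + p * cis t + q * cis (- t))"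
    by (rule curve_is_trigonometric_ellipse [OF S R]) (assumption | rule that)+
  obtain w \<alpha> \<beta> where w: "norm w = 1" "0 < \<alpha>" "0 < \<beta>"
    "S = {z. (Re ((z - c) * cnj w) / \<alpha>)\<^sup>2 + (Im ((z - c) * cnj w) / \<beta>)\<^sup>2 = 1}"
    by (rule trigonometric_ellipse_equation [OF pq, of c, folded Sr]) (rule that)
  have in1: "(Q - vec_of_complex c) \<bullet> vec_of_complex w = Re ((complex_of_vec Q - c) * cnj w)"
    and in2: "(Q - vec_of_complex c) \<bullet> vec_of_complex (\<i> * w) = Im ((complex_of_vec Q - c) * cnj w)" for Q
    by (simp_all add: inner_vec_of_complex algebra_simps)
  have "frontier \<Omega> = {Q. (((Q - vec_of_complex c) \<bullet> vec_of_complex w) / \<alpha>)\<^sup>2 + (((Q - vec_of_complex c) \<bullet> vec_of_complex (\<i> * w)) / \<beta>)\<^sup>2 = 1}"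
  proof -
    have "Q \<in> frontier \<Omega> \<longleftrightarrow> complex_of_vec Q \<in> S" for Q
      unfolding S_def using bij_is_inj [OF bij_complex_of_vec] by (simp add: inj_image_mem_iff)
    then show ?thesis unfolding in1 in2 w(4) by blast
  qed
  moreover have "vec_of_complex w \<bullet> vec_of_complex (\<i> * w) = 0" by (simp add: inner_vec_of_complex)
  moreover have "norm (vec_of_complex w) = 1" "norm (vec_of_complex (\<i> * w)) = 1" using w(1) by (simp_all add: norm_mult)
  ultimately show ?thesis using w(2,3) unfolding is_ellipse_def by blast
qed

end
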